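(* Let $n\ge2$, let $\|\cdot\|$ be a strictly convex norm on $\mathbb R^n$, and let $H(p)=\|p\|$ for $p\in\mathbb R^n$. Then for every domain $\Omega\subset\mathbb R^n$, every $u\in AM_H(\Omega)$ has the linear approximation property in $\Omega$, and for every $x\in\Omega$, $$H(e)=\lim_{r\to 0}\|H(Du)\|_{L^\infty(B_r(x))}\qquad\text{for all } e\in\mathscr D u(x).$$ Moreover, if $n=2$, then: a) for every domain $\Omega\subset\mathbb R^2$, every $u\in AM_H(\Omega)$ is in $C^1(\Omega)$; and b) every $u\in AM_H(\mathbb R^2)$ for which there is a constant $C>0$ with $|u(x)|\le C(1+|x|)$ for all $x\in\mathbb R^2$ is a linear function.
   Context: A norm $\|\cdot\|$ is strictly convex if its unit sphere $\{p:\|p\|=1\}$ contains no line segment $[a,b]$ with $a\ne b$. For a domain $\Omega\subset\mathbb R^n$, a function $u\in W^{1,\infty}_{\rm loc}(\Omega)$ is an absolute minimizer for $H$ in $\Omega$, written $u\in AM_H(\Omega)$, if $\operatorname{ess\,sup}_{V}H(Du)\le \operatorname{ess\,sup}_{V}H(Dv)$ for every open $V\Subset\Omega$ and every $v\in W^{1,\infty}_{\rm loc}(V)\cap C(\overline V)$ with $v=u$ on $\partial V$. A function $u\in C^0(\Omega)$ has the linear approximation property if for every $x\in\Omega$ and every sequence of positive numbers $r_i\to0$ there exist a subsequence $(r_{i_k})$ and a vector $e\in\mathbb R^n$ such that $$\lim_{k\to\infty}\sup_{y\in B(0,1)}\Big|\frac{u(x+r_{i_k}y)-u(x)}{r_{i_k}}-e\cdot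 y\Big|=0.$$ $\mathscr D u(x)$ denotes the set of all vectors $e$ arising in this way at $x$ (over all sequences $r_i\to0$). "Linear function" means a function of the form $u(x)=a+p\cdot x$ with $a\in\mathbb R$ and $p$ a fixed vector. *)

theory Defs
  imports "HOL-Analysis.Analysis" "HOL-Probability.Essential_Supremum"
begin

definition is_norm :: "('a::real_vector \<Rightarrow> real) \<Rightarrow> bool" where
  "is_norm N \<longleftrightarrow>
     (\<forall>p. 0 \<le> N p) \<and> (\<forall>p. N p = 0 \<longleftrightarrow> p = 0) \<and>
     (\<forall>c p. N (c *\<^sub>R p) = \<bar>c\<bar> * N p) \<and> (\<forall>p q. N (p + q) \<le> N p + N q)"

definition strictly_convex_norm :: "('a::real_vector \<Rightarrow> real) \<Rightarrow> bool" where
  "strictly_convex_norm N \<longleftrightarrow>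
     is_norm N \<and> (\<nexists>a b. a \<noteq> b \<and> closed_segment a b \<subseteq> {p. N p = 1})"

definition domain_set :: "'a::topological_space set \<Rightarrow> bool" where
  "domain_set \<Omega> \<longleftrightarrow> open \<Omega> \<and> connected \<Omega> \<and> \<Omega> \<noteq> {}"

definition compactly_inside :: "'a::topological_space set \<Rightarrow> 'a set \<Rightarrow> bool" (infix "\<Subset>" 50) where
  "V \<Subset> \<Omega> \<longleftrightarrow> compact (closure V) \<and> closure V \<subseteq> \<Omega>"

definition partial_deriv :: "'n \<Rightarrow> (real ^ 'n::finite \<Rightarrow> real) \<Rightarrow> real ^ 'n \<Rightarrow> real" where
  "partial_deriv i f x = frechet_derivative f (at x) (axis i 1)"

text \<open>\<open>C_k_on k f S\<close>: \<open>f\<close> is of class \<open>C\<^sup>k\<close> on \<open>S\<close>. Only meant for open \<open>S\<close>.\<close>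

primrec C_k_on :: "nat \<Rightarrow> (real ^ 'n::finite \<Rightarrow> real) \<Rightarrow> (real ^ 'n) set \<Rightarrow> bool" where
  "C_k_on 0 f S \<longleftrightarrow> continuous_on S f"
| "C_k_on (Suc k) f S \<longleftrightarrow>
     (\<forall>x\<in>S. f differentiable (at x)) \<and> (\<forall>i. C_k_on k (partial_deriv i f) S)"

definition test_function :: "(real ^ 'n::finite) set \<Rightarrow> (real ^ 'n \<Rightarrow> real) \<Rightarrow> bool" where
  "test_function \<Omega> \<phi> \<longleftrightarrow> (\<forall>k. C_k_on k \<phi> UNIV) \<and> {x. \<phi> x \<noteq> 0} \<Subset> \<Omega>"

definition locally_integrable_on ::
    "('a::euclidean_space \<Rightarrow> 'b::euclidean_space) \<Rightarrow> 'a set \<Rightarrow> bool" where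
  "locally_integrable_on f \<Omega> \<longleftrightarrow> (\<forall>K. compact K \<and> K \<subseteq> \<Omega> \<longrightarrow> set_integrable lebesgue K f)"

definition is_weak_gradient ::
    "(real ^ 'n::finite) set \<Rightarrow> (real ^ 'n \<Rightarrow> real) \<Rightarrow> (real ^ 'n \<Rightarrow> real ^ 'n) \<Rightarrow> bool" where
  "is_weak_gradient \<Omega> u g \<longleftrightarrow>
     locally_integrable_on u \<Omega> \<and> locally_integrable_on g \<Omega> \<and>
     (\<forall>\<phi> i. test_function \<Omega> \<phi> \<longrightarrow>
        (LINT x:\<Omega>|lebesgue. u x * partial_deriv i \<phi> x) = - (LINT x:\<Omega>|lebesgue. g x $ i * \<phi> x))"

text \<open>The weak gradient is unique up to null sets; \<open>weak_gradient \<Omega> u\<close> is an arbitrary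
  representative, and is only used below through essential suprema over subsets of \<open>\<Omega>\<close>.\<close>

definition weak_gradient ::
    "(real ^ 'n::finite) set \<Rightarrow> (real ^ 'n \<Rightarrow> real) \<Rightarrow> real ^ 'n \<Rightarrow> real ^ 'n" where
  "weak_gradient \<Omega> u = (SOME g. is_weak_gradient \<Omega> u g)"

definition ess_sup_on :: "'a::euclidean_space set \<Rightarrow> ('a \<Rightarrow> real) \<Rightarrow> ereal" where
  "ess_sup_on S f = esssup (lebesgue_on S) (\<lambda>x. ereal (f x))"

definition Linf_norm :: "'a::euclidean_space set \<Rightarrow> ('a \<Rightarrow> 'b::real_normed_vector) \<Rightarrow> ereal" where
  "Linf_norm S f = ess_sup_on S (\<lambda>x. norm (f x))"

definition Linf_loc :: "'a::euclidean_space set \<Rightarrow> ('a \<Rightarrow> 'b::real_normed_vector) \<Rightarrow> bool" where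
  "Linf_loc \<Omega> f \<longleftrightarrow>
     f \<in> borel_measurable (lebesgue_on \<Omega>) \<and>
     (\<forall>K. compact K \<and> K \<subseteq> \<Omega> \<longrightarrow> Linf_norm K f < \<infinity>)"

definition W1inf_loc :: "(real ^ 'n::finite) set \<Rightarrow> (real ^ 'n \<Rightarrow> real) \<Rightarrow> bool" where
  "W1inf_loc \<Omega> u \<longleftrightarrow> Linf_loc \<Omega> u \<and> (\<exists>g. is_weak_gradient \<Omega> u g \<and> Linf_loc \<Omega> g)"

text \<open>Every class in \<open>W\<^sup>1\<^sup>,\<^sup>\<infinity>\<^sub>l\<^sub>o\<^sub>c(\<Omega>)\<close> has exactly one continuous representative. Since \<open>u\<close> is evaluated
  pointwise (on \<open>frontier V\<close> and in blow-ups), it is taken to be that representative.\<close>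

definition AM ::
    "(real ^ 'n::finite \<Rightarrow> real) \<Rightarrow> (real ^ 'n) set \<Rightarrow> (real ^ 'n \<Rightarrow> real) set" where
  "AM H \<Omega> = {u. W1inf_loc \<Omega> u \<and> continuous_on \<Omega> u \<and>
     (\<forall>V v. open V \<and> V \<Subset> \<Omega> \<and> W1inf_loc V v \<and> continuous_on (closure V) v \<and>
        (\<forall>x\<in>frontier V. v x = u x) \<longrightarrow>
        ess_sup_on V (\<lambda>x. H (weak_gradient \<Omega> u x)) \<le> ess_sup_on V (\<lambda>x. H (weak_gradient V v x)))}"

text \<open>The supremum is taken in \<open>ereal\<close>: for the finitely many \<open>k\<close> with \<open>ball x (r k)\<close> not inside
  the domain of \<open>u\<close> it may be infinite.\<close>

definition blow_up_limit ::
    "('a::euclidean_space \<Rightarrow> real) \<Rightarrow> 'a \<Rightarrow> (nat \<Rightarrow> real) \<Rightarrow> 'a \<Rightarrow> bool" where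
  "blow_up_limit u x r e \<longleftrightarrow>
     (\<lambda>k. SUP y\<in>ball 0 1. ereal \<bar>(u (x + r k *\<^sub>R y) - u x) / r k - e \<bullet> y\<bar>) \<longlonglongrightarrow> 0"

definition linear_approximation_property ::
    "('a::euclidean_space) set \<Rightarrow> ('a \<Rightarrow> real) \<Rightarrow> bool" where
  "linear_approximation_property \<Omega> u \<longleftrightarrow>
     continuous_on \<Omega> u \<and>
     (\<forall>x\<in>\<Omega>. \<forall>r. (\<forall>i. 0 < r i) \<and> r \<longlonglongrightarrow> 0 \<longrightarrow>
        (\<exists>s e. strict_mono (s :: nat \<Rightarrow> nat) \<and> blow_up_limit u x (r \<circ> s) e))"

definition blow_up_slopes :: "('a::euclidean_space \<Rightarrow> real) \<Rightarrow> 'a \<Rightarrow> 'a set" where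
  "blow_up_slopes u x =
     {e. \<exists>r s. (\<forall>i. 0 < r i) \<and> r \<longlonglongrightarrow> 0 \<and> strict_mono (s :: nat \<Rightarrow> nat) \<and>
           blow_up_limit u x (r \<circ> s) e}"

end

theory Submission
  imports Defs "HOL-Complex_Analysis.Complex_Analysis"
begin

text \<open>
  Let \<open>L\<close> be the norm dual to \<open>H\<close>, so that \<open>H p \<le> K\<close> says \<open>p \<bullet> w \<le> K * L w\<close> for all \<open>w\<close>. Strict convexity of
  \<open>H\<close> makes \<open>L\<close> continuously differentiable off the origin, with a gradient \<open>J\<close> on the unit \<open>H\<close>-sphere.
  Two facts connect essential suprema with pointwise statements: a weak gradient satisfies
  \<open>H \<le> K\<close> almost everywhere on an open set iff the function is locally \<open>K\<close>-Lipschitz there with respect to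
  \<open>L\<close> (\<open>weak_bound_imp_Lipschitz\<close>, \<open>Lipschitz_imp_weak_bound\<close>), and cones \<open>c + b * L (x - z)\<close> and affine functions
  are admissible competitors. If an absolute minimizer agrees with such a competitor on the boundary
  of \<open>V\<close>, then it inherits its Lipschitz constant, and since every point of \<open>V\<close> lies on a segment along which
  the competitor already has exactly that slope, the two agree in \<open>V\<close>. This is the locale
  \<open>comparison\<close> (\<open>AM_comparison\<close>), and all further properties of minimizers are derived from it.

  Let the slope \<open>S x\<close> be the infimum of the local Lipschitz constants at \<open>x\<close>. Comparison with cones shows that
  over every small sphere around \<open>x\<close> some increment quotient is at least \<open>S x\<close>, and that the slope at
  the point where it is found is at least as large (\<open>chain_step\<close>). Let \<open>y\<^sub>+\<close> and \<open>y\<^sub>-\<close> be points at \<open>L\<close>-distance \<open>M * r\<close> from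
  \<open>x\<close> where \<open>u\<close> has increased, respectively decreased, by at least \<open>S x * (M * r)\<close>. Near \<open>x\<close> at scale
  \<open>r\<close> the cones with vertices \<open>y\<^sub>+\<close> and \<open>y\<^sub>-\<close> bound \<open>u\<close> from below and from above; for large \<open>M\<close> these cones are
  almost affine by differentiability of \<open>L\<close>, and they agree at \<open>x\<close> up to a small error, so \<open>u\<close> is almost affine there
  with a slope of norm \<open>S x\<close> (\<open>near_linear\<close>). This gives the linear approximation property and
  \<open>H e = S x\<close>, while \<open>S x\<close> is the limit of the essential suprema by the equivalence above.

  In the plane the key is that flatness improves: if \<open>u\<close> is close to \<open>e \<bullet> z\<close> on a ball, then all difference
  quotients of \<open>u\<close> in a smaller ball are close to those of \<open>e \<bullet> z\<close>, at all smaller scales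
  (\<open>flatness_improves\<close>). Otherwise there are, after moving the origin and subtracting a constant,
  points \<open>z\<^sub>1 = - \<rho> f\<close> and \<open>z\<^sub>2 = \<rho> f\<close> such that
  \<open>p \<bullet> z\<^sub>1 < u z\<^sub>1\<close> and \<open>u z\<^sub>2 < p \<bullet> z\<^sub>2\<close> for every \<open>p\<close> with \<open>p \<bullet> f = m\<close>, where \<open>m\<close> is smaller than \<open>e \<bullet> f\<close> by \<open>\<epsilon>\<close>.
  All these \<open>p\<close> are at distance at least \<open>\<epsilon>\<close> from \<open>e\<close>. The component of \<open>{p \<bullet> z < u z}\<close> containing \<open>z\<^sub>1\<close> must
  leave the thin strip around the line where \<open>e \<bullet> z = p \<bullet> z\<close> and so can be connected to \<open>f / 2\<close>
  (\<open>reaches_large_side\<close>); the component of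
  \<open>{u z < p \<bullet> z}\<close> containing \<open>z\<^sub>2\<close> reaches the boundary by comparison with affine functions. Hence the
  winding number around \<open>z\<^sub>2\<close> of a path from \<open>z\<^sub>1\<close> to \<open>f / 2\<close> in the first set does not depend on the path, and
  is locally constant in \<open>p\<close>. But as \<open>p\<close> runs to either end of the line \<open>p \<bullet> f = m\<close>, paths passing \<open>z\<^sub>2\<close> on
  opposite sides are available, and their winding numbers differ (\<open>no_saddle_family\<close>).

  Improvement of flatness applied near a point to a blow-up slope gives strict differentiability, hence
  \<open>C\<^sup>1\<close>. For the Liouville theorem, linear growth bounds the slopes; at points of nearly maximal slope \<open>u\<close> is
  almost affine at all scales, and improvement of flatness at larger and larger scales makes \<open>u\<close> affine.
\<close>

section \<open>Strictly convex norms and their duals\<close>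

locale norm_fun =
  fixes N :: "'a::euclidean_space \<Rightarrow> real"
  assumes N: "is_norm N"
begin

lemma nonneg [simp]: "0 \<le> N p"
  and zero_iff [simp]: "N p = 0 \<longleftrightarrow> p = 0"
  and scale: "N (c *\<^sub>R p) = \<bar>c\<bar> * N p"
  and tri: "N (p + q) \<le> N p + N q"
  using N unfolding is_norm_def by blast+

lemma zero [simp]: "N 0 = 0"
  by simp

lemma pos [simp]: "0 < N p \<longleftrightarrow> p \<noteq> 0"
  using nonneg[of p] zero_iff[of p] by linarith

lemma minus [simp]: "N (- p) = N p"
  using scale[of "-1" p] by simp

lemma diff_comm: "N (x - y) = N (y - x)"
  using minus[of "x - y"] by simp

lemma divide: "N (p /\<^sub>R c) = N p / \<bar>c\<bar>" "N ((1 / c) *\<^sub>R p) = N p / \<bar>c\<bar>"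
  unfolding scale by (auto simp: field_simps)

lemma tri_diff: "\<bar>N p - N q\<bar> \<le> N (p - q)"
  using tri[of "p - q" q] tri[of "q - p" p] diff_comm[of p q] by simp

lemma tri3: "N (x - z) \<le> N (x - y) + N (y - z)"
  using tri[of "x - y" "y - z"] by simp

text \<open>
  Finite dimension enters here and in \<open>ge_norm\<close>: all norms are equivalent.
\<close>

lemma le_norm: "\<exists>C>0. \<forall>p. N p \<le> C * norm p"
proof (intro exI conjI allI)
  let ?C = "(\<Sum>b\<in>Basis. N b) + 1"
  show "?C > 0" by (intro add_nonneg_pos sum_nonneg) auto
  fix p
  have *: "N (\<Sum>b\<in>A. (p \<bullet> b) *\<^sub>R b) \<le> (\<Sum>b\<in>A. N b * norm p)" if "A \<subseteq> Basis" for A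
    using finite_subset[OF that finite_Basis] that
  proof (induction A)
    case (insert b A)
    have "N ((p \<bullet> b) *\<^sub>R b) \<le> N b * norm p"
      using insert.prems Basis_le_norm[of b p] mult_right_mono[of "\<bar>p \<bullet> b\<bar>" "norm p" "N b"]
      unfolding scale by (auto simp: ac_simps)
    then show ?case using insert tri[of "(p \<bullet> b) *\<^sub>R b" "\<Sum>b\<in>A. (p \<bullet> b) *\<^sub>R b"] by force
  qed simp
  have "N p \<le> (\<Sum>b\<in>Basis. N b * norm p)"
    using *[of Basis] by (simp add: euclidean_representation)
  also have "\<dots> \<le> ?C * norm p" by (simp add: sum_distrib_right distrib_right)
  finally show "N p \<le> ?C * norm p" .
qed

lemma continuous_on [continuous_intros]: "continuous_on S N"
proof -
  obtain C where C: "C > 0" "\<And>p. N p \<le> C * norm p" using le_norm by blast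
  have "C-lipschitz_on S N"
    using C order.trans[OF tri_diff C(2)]
    by (auto simp: lipschitz_on_def dist_norm)
  then show ?thesis by (rule lipschitz_on_continuous_on)
qed

lemma continuous_on_comp [continuous_intros]:
  "continuous_on S f \<Longrightarrow> continuous_on S (\<lambda>x. N (f x))"
  using continuous_on_compose2[OF continuous_on[of UNIV]] by blast

lemma ge_norm: "\<exists>c>0. \<forall>p. c * norm p \<le> N p"
proof -
  have "compact (sphere (0::'a) 1)" "sphere (0::'a) 1 \<noteq> {}" by auto
  then obtain x where x: "x \<in> sphere 0 1" "\<And>y. y \<in> sphere 0 1 \<Longrightarrow> N x \<le> N y"
    using continuous_attains_inf[OF _ _ continuous_on] by meson
  show ?thesis
  proof (intro exI conjI allI)
    show "N x > 0" using x(1) by auto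
    fix p show "N x * norm p \<le> N p"
    proof (cases "p = 0")
      case False
      then have "N x \<le> N (p /\<^sub>R norm p)" by (intro x(2)) auto
      then have "N x \<le> N p / norm p" using divide(1)[of "norm p" p] by simp
      then show ?thesis using False by (simp add: pos_le_divide_eq)
    qed simp
  qed
qed

end

definition dual_norm :: "('a::euclidean_space \<Rightarrow> real) \<Rightarrow> 'a \<Rightarrow> real" where
  "dual_norm H x = (SUP p\<in>{p. H p \<le> 1}. p \<bullet> x)"

locale strict_norm =
  fixes H :: "'a::euclidean_space \<Rightarrow> real"
  assumes strict: "strictly_convex_norm H"

sublocale strict_norm \<subseteq> H: norm_fun H
  using strict by unfold_locales (simp add: strictly_convex_norm_def)

context strict_norm
begin

definition L :: "'a \<Rightarrow> real" where "L = dual_norm H"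

lemma unit_ball: "compact {p. H p \<le> 1}" "convex {p. H p \<le> 1}" "{p. H p \<le> 1} \<noteq> {}"
proof -
  obtain c where c: "c > 0" "\<And>p. c * norm p \<le> H p" using H.ge_norm by blast
  have "bounded {p. H p \<le> 1}"
    unfolding bounded_iff using c by (metis mem_Collect_eq order.trans mult.commute pos_le_divide_eq)
  moreover have "closed {p. H p \<le> 1}"
    by (intro closed_Collect_le continuous_intros)
  ultimately show "compact {p. H p \<le> 1}" by (simp add: compact_eq_bounded_closed)
  show "convex {p. H p \<le> 1}"
  proof (rule convexI)
    fix x y and a b :: real assume "x \<in> {p. H p \<le> 1}" "y \<in> {p. H p \<le> 1}" "0 \<le> a" "0 \<le> b" "a + b = 1"
    then show "a *\<^sub>R x + b *\<^sub>R y \<in> {p. H p \<le> 1}"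
      using H.tri[of "a *\<^sub>R x" "b *\<^sub>R y"] mult_left_mono[of "H x" 1 a] mult_left_mono[of "H y" 1 b]
      by (simp add: H.scale)
  qed
  show "{p. H p \<le> 1} \<noteq> {}" using H.zero_iff[of 0] by (metis empty_iff mem_Collect_eq zero_less_one less_imp_le)
qed

lemma dual_attained: "\<exists>p. H p \<le> 1 \<and> p \<bullet> x = L x"
  and inner_le_unit: "H p \<le> 1 \<Longrightarrow> p \<bullet> x \<le> L x"
proof -
  have cont: "continuous_on {p. H p \<le> 1} (\<lambda>p. p \<bullet> x)" by (intro continuous_intros)
  obtain q where q: "H q \<le> 1" "\<And>p. H p \<le> 1 \<Longrightarrow> p \<bullet> x \<le> q \<bullet> x"
    using continuous_attains_sup[OF unit_ball(1,3) cont] by auto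
  have "L x = q \<bullet> x" unfolding L_def dual_norm_def
    by (rule cSup_eq_maximum) (use q in auto)
  then show "\<exists>p. H p \<le> 1 \<and> p \<bullet> x = L x" "H p \<le> 1 \<Longrightarrow> p \<bullet> x \<le> L x"
    using q by auto
qed

lemma inner_le: "p \<bullet> x \<le> H p * L x"
proof (cases "p = 0")
  case False
  then have "(p /\<^sub>R H p) \<bullet> x \<le> L x" by (intro inner_le_unit) (simp add: H.divide)
  then show ?thesis using False by (simp add: field_simps)
qed auto

lemma L_norm: "is_norm L"
  unfolding is_norm_def
proof (intro conjI allI)
  show nn: "0 \<le> L p" for p using inner_le_unit[of 0 p] by simp
  show "L p = 0 \<longleftrightarrow> p = 0" for p
  proof
    assume "L p = 0" 
    then have "p \<bullet> p \<le> 0" using inner_le[of p p] by auto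
    then show "p = 0" using inner_gt_zero_iff[of p] by linarith
  next
    assume "p = 0" then show "L p = 0" using dual_attained[of p] by auto
  qed
  have sc: "L (c *\<^sub>R p) = \<bar>c\<bar> * L p" for c p
  proof -
    have le: "L (c *\<^sub>R p) \<le> \<bar>c\<bar> * L p" for c p
    proof -
      obtain q where q: "H q \<le> 1" "q \<bullet> (c *\<^sub>R p) = L (c *\<^sub>R p)" using dual_attained by blast
      have "(sgn c *\<^sub>R q) \<bullet> p \<le> L p"
        by (rule inner_le_unit) (use q in \<open>auto simp: H.scale abs_sgn_eq\<close>)
      from mult_left_mono[OF this abs_ge_zero[of c]] show ?thesis
        using q(2) by (simp add: mult.assoc[symmetric] abs_mult_sgn)
    qed
    show ?thesis
    proof (cases "c = 0")
      case True then show ?thesis using le[of 0 p] nn[of 0] by simp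
    next
      case False
      have "L p \<le> \<bar>inverse c\<bar> * L (c *\<^sub>R p)" using le[of "inverse c" "c *\<^sub>R p"] False by simp
      then have "\<bar>c\<bar> * L p \<le> L (c *\<^sub>R p)" using False by (simp add: field_simps)
      then show ?thesis using le[of c p] by simp
    qed
  qed
  show "L (c *\<^sub>R p) = \<bar>c\<bar> * L p" for c p by (rule sc)
  show "L (p + q) \<le> L p + L q" for p q
  proof -
    obtain r where r: "H r \<le> 1" "r \<bullet> (p + q) = L (p + q)" using dual_attained by blast
    then show ?thesis using inner_le_unit[of r p] inner_le_unit[of r q] by (simp add: inner_add_right)
  qed
qed

end

sublocale strict_norm \<subseteq> L: norm_fun L
  by (rule norm_fun.intro[OF L_norm])

context strict_norm
begin

text \<open>
  The form in which strict convexity is used: otherwise the segment from \<open>a\<close> to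
  \<open>b\<close> would lie in the unit sphere.
\<close>

lemma midpoint_strict:
  assumes "H a \<le> 1" "H b \<le> 1" "1 \<le> H ((a + b) /\<^sub>R 2)"
  shows "a = b"
proof (rule ccontr)
  assume ne: "a \<noteq> b"
  have half: "H ((a + b) /\<^sub>R 2) = H (a + b) / 2" 
    using H.divide(1)[of 2 "a + b"] by simp
  have le1: "H ((1 - t) *\<^sub>R a + t *\<^sub>R b) \<le> 1" if "0 \<le> t" "t \<le> 1" for t
    using convexD[OF unit_ball(2), of a b "1-t" t] that assms by simp
  have "H ((1 - t) *\<^sub>R a + t *\<^sub>R b) = 1" if t: "0 \<le> t" "t \<le> 1" for t
  proof -
    have "(a + b) = ((1 - t) *\<^sub>R a + t *\<^sub>R b) + ((1 - (1 - t)) *\<^sub>R a + (1 - t) *\<^sub>R b)"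
      by (simp add: algebra_simps)
    then have "H (a + b) \<le> H ((1 - t) *\<^sub>R a + t *\<^sub>R b) + H ((1 - (1 - t)) *\<^sub>R a + (1 - t) *\<^sub>R b)"
      using H.tri by metis
    then show ?thesis using le1[of t] le1[of "1-t"] t assms(3) half by simp
  qed
  then have "closed_segment a b \<subseteq> {p. H p = 1}" by (auto simp: closed_segment_def)
  then show False using ne strict unfolding strictly_convex_norm_def by blast
qed

text \<open>
  If two unit vectors both attain the dual norm, so does their midpoint, which therefore has norm one as
  well.
\<close>

lemma dual_unique:
  assumes "x \<noteq> 0" "H p \<le> 1" "H q \<le> 1" "p \<bullet> x = L x" "q \<bullet> x = L x"
  shows "p = q"
proof (rule midpoint_strict)
  have "((p + q) /\<^sub>R 2) \<bullet> x = L x" using assms by (simp add: inner_add_left)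
  then have "L x \<le> H ((p + q) /\<^sub>R 2) * L x" using inner_le by metis
  then show "1 \<le> H ((p + q) /\<^sub>R 2)" using assms(1) by simp
qed fact+

text \<open>
  Off the origin \<open>J x\<close> is the gradient of the dual norm at \<open>x\<close>.
\<close>

definition J :: "'a \<Rightarrow> 'a" where "J x = (SOME p. H p \<le> 1 \<and> p \<bullet> x = L x)"

lemma J: "H (J x) \<le> 1" "J x \<bullet> x = L x"
  using someI_ex[OF dual_attained[of x]] by (auto simp: J_def)

lemma J_eq: "x \<noteq> 0 \<Longrightarrow> H p \<le> 1 \<Longrightarrow> p \<bullet> x = L x \<Longrightarrow> p = J x"
  using dual_unique J by blast

lemma J_le: "J x \<bullet> y \<le> L y"
  using inner_le_unit J by blast

lemma H_J: "x \<noteq> 0 \<Longrightarrow> H (J x) = 1"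
proof -
  assume "x \<noteq> 0"
  then have "0 < L x" "1 * L x \<le> H (J x) * L x" using inner_le[of "J x" x] J(2)[of x] L.pos by auto
  then have "1 \<le> H (J x)" using mult_le_cancel_right_pos by blast
  then show ?thesis using J(1)[of x] by simp
qed

lemma exists_unit: "\<exists>v. L v = 1"
proof -
  obtain b :: 'a where "b \<in> Basis" using nonempty_Basis by blast
  then have "b \<noteq> 0" by auto
  then have "L (b /\<^sub>R L b) = 1" by (simp add: L.divide)
  then show ?thesis by blast
qed

text \<open>
  The bidual of \<open>H\<close> is \<open>H\<close>: a hyperplane supporting the unit ball at \<open>p
  / H p\<close> yields the maximizing direction.
\<close>

lemma primal_attained: "\<exists>v. L v = 1 \<and> p \<bullet> v = H p"
proof (cases "p = 0")
  case True then show ?thesis using exists_unit by auto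
next
  case False
  define x where "x = p /\<^sub>R H p"
  let ?B = "{q. H q \<le> 1}"
  have Hx: "H x = 1" using False by (simp add: x_def H.scale)
  have px: "p = H p *\<^sub>R x" using False by (simp add: x_def)
  have "x \<in> closure ?B" using Hx closure_subset[of ?B] by auto
  moreover have "x \<notin> interior ?B"
  proof
    assume "x \<in> interior ?B"
    then obtain e where e: "e > 0" "ball x e \<subseteq> ?B" unfolding mem_interior by blast
    have nx: "x \<noteq> 0" using Hx H.zero by force
    define t where "t = e / (2 * norm x)"
    have t: "t > 0" "t * norm x < e" using e(1) nx by (simp_all add: t_def)
    define y where "y = (1 + t) *\<^sub>R x"
    have "dist x y < e" using t by (simp add: y_def dist_norm algebra_simps)
    then have "H y \<le> 1" using e(2) by auto
    moreover have "H y = 1 + t" using t(1) unfolding y_def H.scale Hx by simp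
    ultimately show False using t(1) by simp
  qed
  moreover have "rel_interior ?B = interior ?B"
  proof (rule rel_interior_nonempty_interior)
    have "open {q. H q < 1}" by (intro open_Collect_less continuous_intros)
    then have "{q. H q < 1} \<subseteq> interior ?B" by (intro interior_maximal) auto
    moreover have "0 \<in> {q. H q < 1}" by simp
    ultimately show "interior ?B \<noteq> {}" by blast
  qed
  ultimately obtain a where a: "a \<noteq> 0" "\<And>y. y \<in> closure ?B \<Longrightarrow> a \<bullet> x \<le> a \<bullet> y"
    using supporting_hyperplane_relative_frontier[OF unit_ball(2), of x] by metis
  define w where "w = - a"
  have w0: "w \<noteq> 0" using a(1) by (simp add: w_def)
  have Lw: "L w = x \<bullet> w"
  proof -
    obtain q where q: "H q \<le> 1" "q \<bullet> w = L w" using dual_attained by blast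
    have "q \<bullet> w \<le> x \<bullet> w" using a(2)[of q] q(1) closure_subset[of ?B] by (auto simp: w_def inner_commute)
    then show ?thesis using q inner_le_unit[of x w] Hx by linarith
  qed
  have nz: "L w > 0" using w0 by simp
  have "L (w /\<^sub>R L w) = 1" using nz L.divide(1)[of "L w" w] by simp
  moreover have "p \<bullet> (w /\<^sub>R L w) = H p"
  proof -
    have "p \<bullet> w = H p * L w" by (subst px) (simp add: Lw)
    then show ?thesis using nz by (simp add: field_simps)
  qed
  ultimately show ?thesis by blast
qed

lemma J_scale: "c > 0 \<Longrightarrow> J (c *\<^sub>R x) = J x"
proof (cases "x = 0")
  case False assume c: "c > 0"
  have "J x = J (c *\<^sub>R x)"
    by (rule J_eq) (use False c J in \<open>auto simp: L.scale\<close>)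
  then show ?thesis by simp
qed simp

text \<open>
  The graph of \<open>J\<close> is closed by uniqueness of the maximizer, and \<open>J\<close> takes
  values in a compact set.
\<close>

lemma continuous_on_J: "continuous_on (- {0}) J"
proof -
  let ?S = "- {0::'a}" and ?T = "{p. H p \<le> 1}"
  have "(\<lambda>x. (x, J x)) ` ?S = {z \<in> ?S \<times> ?T. snd z \<bullet> fst z - L (fst z) = 0}"
    using J J_eq by (auto simp: image_iff)
  moreover have "closedin (top_of_set (?S \<times> ?T)) {z \<in> ?S \<times> ?T. snd z \<bullet> fst z - L (fst z) = 0}"
    by (intro continuous_closedin_preimage_constant continuous_intros)
  ultimately show ?thesis
    using continuous_closed_graph_eq[OF unit_ball(1), of J ?S] J by auto
qed

text \<open>
  A convex function with a continuous selection of subgradients is differentiable.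
\<close>

lemma L_has_derivative:
  assumes "x \<noteq> 0"
  shows "(L has_derivative (\<lambda>h. J x \<bullet> h)) (at x)"
proof -
  have cont: "(J \<longlongrightarrow> J x) (at x)"
    using continuous_on_eq_continuous_at[of "- {0}" J] continuous_on_J assms
    by (simp add: isCont_def open_Compl)
  have "((\<lambda>y. norm (L y - L x - J x \<bullet> (y - x)) / norm (y - x)) \<longlongrightarrow> 0) (at x)"
  proof (rule Lim_null_comparison)
    show "((\<lambda>y. norm (J y - J x)) \<longlongrightarrow> 0) (at x)"
      using cont by (simp add: LIM_zero tendsto_norm_zero)
    have "norm (L y - L x - J x \<bullet> (y - x)) \<le> norm (J y - J x) * norm (y - x)" for y
    proof -
      have "0 \<le> L y - L x - J x \<bullet> (y - x)"
        using J_le[of x y] J[of x] by (simp add: inner_diff_right)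
      moreover have "L y - L x - J x \<bullet> (y - x) \<le> (J y - J x) \<bullet> (y - x)"
        using J_le[of y x] J[of y] J[of x] by (simp add: inner_diff_right inner_diff_left)
      moreover have "(J y - J x) \<bullet> (y - x) \<le> norm (J y - J x) * norm (y - x)"
        by (rule norm_cauchy_schwarz)
      ultimately show ?thesis by simp
    qed
    then show "\<forall>\<^sub>F y in at x. norm (norm (L y - L x - J x \<bullet> (y - x)) / norm (y - x)) \<le> norm (J y - J x)"
      by (auto simp: eventually_at_filter divide_simps intro!: always_eventually)
  qed
  then show ?thesis
    unfolding has_derivative_iff_norm by (simp add: bounded_linear_inner_right)
qed

text \<open>asymptotics\<close>
text \<open>
  Seen from far away, the dual norm is affine near the origin, uniformly in the direction of the
  viewpoint.
\<close>

lemma L_far: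
  assumes "\<delta> > 0"
  shows "\<exists>M0>0. \<forall>M\<ge>M0. \<forall>\<eta> y. L \<eta> = 1 \<and> L y \<le> 1 \<longrightarrow> L (M *\<^sub>R \<eta> - y) \<le> M - J \<eta> \<bullet> y + \<delta>"
proof -
  let ?A = "{x. 1/2 \<le> L x \<and> L x \<le> 2}"
  obtain c where c: "c > 0" "\<And>p. c * norm p \<le> L p" using L.ge_norm by blast
  have "bounded ?A"
    unfolding bounded_iff using c by (metis (no_types, lifting) mem_Collect_eq order.trans mult.commute pos_le_divide_eq)
  moreover have "closed ?A"
    by (intro closed_Collect_conj closed_Collect_le continuous_intros)
  ultimately have "compact ?A" by (simp add: compact_eq_bounded_closed)
  moreover have "continuous_on ?A J"
    by (rule continuous_on_subset[OF continuous_on_J]) auto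
  ultimately have "uniformly_continuous_on ?A J" by (intro compact_uniformly_continuous)
  moreover have "c * \<delta> > 0" using assms c(1) by simp
  ultimately obtain d where d: "d > 0" "\<And>x y. x \<in> ?A \<Longrightarrow> y \<in> ?A \<Longrightarrow> dist y x < d \<Longrightarrow> dist (J y) (J x) < c * \<delta>"
    unfolding uniformly_continuous_on_def by blast
  define M0 where "M0 = max 2 (2 / (c * d))"
  show ?thesis
  proof (intro exI[of _ M0] conjI allI impI)
    show "M0 > 0" by (simp add: M0_def)
    fix M \<eta> y assume M: "M \<ge> M0" and \<eta>: "L \<eta> = 1 \<and> L y \<le> 1"
    have M2: "M \<ge> 2" "M > 0" and Md: "M \<ge> 2 / (c * d)" using M by (auto simp: M0_def)
    let ?w = "\<eta> - y /\<^sub>R M"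
    have Ly: "L (y /\<^sub>R M) \<le> 1/2" using \<eta> M2 by (simp add: L.scale field_simps)
    have "\<bar>L ?w - L \<eta>\<bar> \<le> L (y /\<^sub>R M)"
      using L.tri_diff[of ?w \<eta>] by simp
    then have w: "?w \<in> ?A" "\<eta> \<in> ?A" using Ly \<eta> by auto
    have ny: "norm y \<le> 1 / c" using c(2)[of y] \<eta> c(1) by (simp add: field_simps)
    have "norm y / M \<le> (1 / c) / (2 / (c * d))"
      using ny Md c(1) d(1) M2 by (intro frac_le) auto
    also have "(1 / c) / (2 / (c * d)) = d / 2" using c(1) d(1) by simp
    finally have "norm y / M < d" using d(1) by linarith
    then have "dist ?w \<eta> < d" using M2 by (simp add: dist_norm divide_inverse mult.commute)
    then have JJ: "norm (J ?w - J \<eta>) < c * \<delta>" using d(2)[OF w(2,1)] by (simp add: dist_norm)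
    have "M *\<^sub>R \<eta> - y = M *\<^sub>R ?w" using M2 by (simp add: algebra_simps)
    then have "L (M *\<^sub>R \<eta> - y) = J ?w \<bullet> (M *\<^sub>R \<eta> - y)"
      using J(2)[of "M *\<^sub>R \<eta> - y"] J_scale[of M ?w] M2 by simp
    also have "\<dots> = M * (J ?w \<bullet> \<eta>) - J \<eta> \<bullet> y + (J \<eta> - J ?w) \<bullet> y" by (simp add: algebra_simps)
    also have "(J \<eta> - J ?w) \<bullet> y \<le> norm (J \<eta> - J ?w) * norm y" by (rule norm_cauchy_schwarz)
    also have "\<dots> \<le> (c * \<delta>) * (1 / c)"
      using JJ ny c assms by (intro mult_mono) (auto simp: norm_minus_commute)
    also have "\<dots> = \<delta>" using c by simp
    also have "M * (J ?w \<bullet> \<eta>) \<le> M * 1" using J_le[of ?w \<eta>] \<eta> M2 by (intro mult_left_mono) auto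
    finally show "L (M *\<^sub>R \<eta> - y) \<le> M - J \<eta> \<bullet> y + \<delta>" by simp
  qed
qed

text \<open>
  Strict convexity made quantitative by compactness: a slope that is not much steeper than
  \<open>e\<close>, and whose midpoint with \<open>e\<close> is not much flatter, is close to
  \<open>e\<close>.
\<close>

lemma near_extremal:
  assumes "H e > 0" "\<epsilon> > 0"
  shows "\<exists>\<nu>>0. \<forall>p. H p \<le> H e + \<nu> \<and> H e - \<nu> \<le> H ((p + e) /\<^sub>R 2) \<longrightarrow> norm (p - e) < \<epsilon>"
proof (rule ccontr)
  assume *: "\<not> ?thesis"
  have "\<exists>p. H p \<le> H e + \<nu> \<and> H e - \<nu> \<le> H ((p + e) /\<^sub>R 2) \<and> norm (p - e) \<ge> \<epsilon>" if "\<nu> > 0" for \<nu>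
  proof (rule ccontr)
    assume "\<not> (\<exists>p. H p \<le> H e + \<nu> \<and> H e - \<nu> \<le> H ((p + e) /\<^sub>R 2) \<and> norm (p - e) \<ge> \<epsilon>)"
    then have "\<forall>p. H p \<le> H e + \<nu> \<and> H e - \<nu> \<le> H ((p + e) /\<^sub>R 2) \<longrightarrow> norm (p - e) < \<epsilon>"
      using not_le by blast
    with * that show False by blast
  qed
  then have "\<forall>n::nat. \<exists>p. H p \<le> H e + 1 / Suc n \<and> H e - 1 / Suc n \<le> H ((p + e) /\<^sub>R 2) \<and> norm (p - e) \<ge> \<epsilon>"
    by (intro allI) simp
  then obtain p where p: "\<And>n. H (p n) \<le> H e + 1 / Suc n" "\<And>n. H e - 1 / Suc n \<le> H ((p n + e) /\<^sub>R 2)" "\<And>n. norm (p n - e) \<ge> \<epsilon>"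
    by metis
  obtain c where c: "c > 0" "\<And>p. c * norm p \<le> H p" using H.ge_norm by blast
  have "norm (p n) \<le> (H e + 1) / c" for n
  proof -
    have one_div: "1 / real (Suc n) \<le> 1" by (simp add: divide_le_eq)
    have "c * norm (p n) \<le> H e + 1" using c(2)[of "p n"] p(1)[of n] one_div by linarith
    then show ?thesis using c(1) by (simp add: field_simps)
  qed
  then have "bounded (range p)" by (auto simp: bounded_iff)
  then obtain q s where s: "strict_mono (s :: nat \<Rightarrow> nat)" "(p \<circ> s) \<longlonglongrightarrow> q"
    using bounded_imp_convergent_subsequence by blast
  have inv: "(\<lambda>n. 1 / real (Suc (s n))) \<longlonglongrightarrow> 0"
    using LIMSEQ_subseq_LIMSEQ[OF LIMSEQ_Suc[OF lim_1_over_n] s(1)] by (simp add: o_def)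
  have ps: "(\<lambda>n. p (s n)) \<longlonglongrightarrow> q" using s(2) by (simp add: o_def)
  have HH: "(\<lambda>n. H (f n)) \<longlonglongrightarrow> H l" if "f \<longlonglongrightarrow> l" for f l
    using continuous_on_tendsto_compose[OF H.continuous_on[of UNIV] that] by simp
  have "H q \<le> H e + 0"
    by (rule LIMSEQ_le[OF HH[OF ps] tendsto_add[OF tendsto_const inv]]) (use p(1) in auto)
  then have 1: "H q \<le> H e" by simp
  have "H e - 0 \<le> H ((q + e) /\<^sub>R 2)"
    by (rule LIMSEQ_le[OF tendsto_diff[OF tendsto_const inv] HH[OF tendsto_scaleR[OF tendsto_const tendsto_add[OF ps tendsto_const]]]])
      (use p(2) in auto)
  then have 2: "H e \<le> H ((q + e) /\<^sub>R 2)" by simp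
  have "\<epsilon> \<le> norm (q - e)"
    by (rule LIMSEQ_le_const[OF tendsto_norm[OF tendsto_diff[OF ps tendsto_const]]]) (use p(3) in auto)
  moreover have "q /\<^sub>R H e = e /\<^sub>R H e"
  proof (rule midpoint_strict)
    have "(q /\<^sub>R H e + e /\<^sub>R H e) /\<^sub>R 2 = ((q + e) /\<^sub>R 2) /\<^sub>R H e" by (simp add: algebra_simps)
    then show "1 \<le> H ((q /\<^sub>R H e + e /\<^sub>R H e) /\<^sub>R 2)"
      using 2 assms(1) H.divide(1)[of "H e" "(q + e) /\<^sub>R 2"] by simp
  qed (use 1 assms(1) in \<open>auto simp: H.divide\<close>)
  ultimately show False using assms by auto
qed

end

section \<open>Comparison and local slopes\<close>

text \<open>
  The local Lipschitz constant of \<open>u\<close> at \<open>x\<close> with respect to the norm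
  \<open>N\<close>.
\<close>

definition lslope :: "('a::euclidean_space \<Rightarrow> real) \<Rightarrow> 'a set \<Rightarrow> ('a \<Rightarrow> real) \<Rightarrow> 'a \<Rightarrow> real" where
  "lslope N \<Omega> u x = Inf {K. \<exists>\<delta>>0. ball x \<delta> \<subseteq> \<Omega> \<and> (\<forall>y\<in>ball x \<delta>. \<forall>z\<in>ball x \<delta>. u z - u y \<le> K * N (z - y))}"

lemma compactly_insideI:
  fixes V K \<Omega> :: "'a::t2_space set"
  assumes "V \<subseteq> K" "compact K" "K \<subseteq> \<Omega>"
  shows "V \<Subset> \<Omega>"
proof -
  have "closure V \<subseteq> K" by (rule closure_minimal[OF assms(1) compact_imp_closed[OF assms(2)]])
  then have "closure V = K \<inter> closure V" by blast
  then have "compact (closure V)" using compact_Int_closed[OF assms(2) closed_closure[of V]] by simp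
  with \<open>closure V \<subseteq> K\<close> assms(3) show ?thesis by (auto simp: compactly_inside_def)
qed

text \<open>
  Bolzano's bisection principle: increments along subdivided segments add up.
\<close>

lemma (in norm_fun) segment_increment:
  assumes "\<And>x. x \<in> closed_segment a b \<Longrightarrow> \<exists>\<delta>>0. \<forall>y\<in>ball x \<delta>. \<forall>z\<in>ball x \<delta>. u z - u y \<le> K * N (z - y)"
  shows "u b - u a \<le> K * N (b - a)"
proof -
  define g where "g t = a + t *\<^sub>R (b - a)" for t
  have Ng: "N (g t - g s) = (t - s) * N (b - a)" if "s \<le> t" for s t
  proof -
    have "g t - g s = (t - s) *\<^sub>R (b - a)" by (simp add: g_def algebra_simps)
    then show ?thesis using that by (simp add: scale)
  qed
  have "u (g 1) - u (g 0) \<le> K * ((1 - 0) * N (b - a))"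
  proof (rule Bolzano[where P = "\<lambda>s t. u (g t) - u (g s) \<le> K * ((t - s) * N (b - a))"])
    fix s t r assume "u (g t) - u (g s) \<le> K * ((t - s) * N (b - a))" "u (g r) - u (g t) \<le> K * ((r - t) * N (b - a))"
    then show "u (g r) - u (g s) \<le> K * ((r - s) * N (b - a))" by (simp add: algebra_simps)
  next
    fix t :: real assume t: "0 \<le> t" "t \<le> 1"
    have "g t \<in> closed_segment a b" using t unfolding closed_segment_def g_def
      by (auto simp: algebra_simps intro!: exI[of _ t])
    then obtain \<delta> where \<delta>: "\<delta> > 0" "\<And>y z. y\<in>ball (g t) \<delta> \<Longrightarrow> z\<in>ball (g t) \<delta> \<Longrightarrow> u z - u y \<le> K * N (z - y)"
      using assms by blast
    define d where "d = \<delta> / (norm (b - a) + 1)"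
    have d_aux: "norm (b - a) + 1 > 0" by (simp add: add_nonneg_pos)
    have d: "d > 0" "d * norm (b - a) < \<delta>"
      using \<delta>(1) d_aux by (auto simp: d_def field_simps)
    show "\<exists>d>0. \<forall>s r. s \<le> t \<and> t \<le> r \<and> r - s < d \<longrightarrow> u (g r) - u (g s) \<le> K * ((r - s) * N (b - a))"
    proof (intro exI conjI allI impI)
      fix s r assume sr: "s \<le> t \<and> t \<le> r \<and> r - s < d"
      have near: "g q \<in> ball (g t) \<delta>" if "\<bar>q - t\<bar> \<le> d" for q
      proof -
        have "dist (g t) (g q) = \<bar>q - t\<bar> * norm (b - a)"
          by (simp add: g_def dist_norm scaleR_left_diff_distrib[symmetric] abs_minus_commute)
        also have "\<dots> \<le> d * norm (b - a)" using that by (intro mult_right_mono) auto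
        finally show ?thesis using d by simp
      qed
      have "u (g r) - u (g s) \<le> K * N (g r - g s)" using sr by (intro \<delta>(2) near) auto
      then show "u (g r) - u (g s) \<le> K * ((r - s) * N (b - a))" using Ng[of s r] sr by simp
    qed (rule d)
  qed simp
  then show ?thesis by (simp add: g_def)
qed

lemma (in norm_fun) Lipschitz_const_nonneg:
  assumes "\<delta> > 0" "\<And>y z. y\<in>ball x \<delta> \<Longrightarrow> z\<in>ball x \<delta> \<Longrightarrow> u z - u y \<le> K * N (z - y)"
  shows "K \<ge> 0"
proof -
  obtain b :: 'a where b: "b \<in> Basis" using nonempty_Basis by blast
  define y where "y = x + (\<delta>/2) *\<^sub>R b"
  have y: "y \<in> ball x \<delta>" "y \<noteq> x" "x \<in> ball x \<delta>" using assms(1) b by (auto simp: y_def dist_norm)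
  have "u y - u x \<le> K * N (y - x)" "u x - u y \<le> K * N (y - x)"
    using assms(2)[OF y(1,3)] assms(2)[OF y(3,1)] diff_comm[of x y] by auto
  then have "0 \<le> K * N (y - x)" by linarith
  moreover have "N (y - x) > 0" using y by simp
  ultimately show ?thesis by (simp add: zero_le_mult_iff)
qed

lemma lslope_uminus: "norm_fun N \<Longrightarrow> lslope N \<Omega> (\<lambda>x. - u x) x = lslope N \<Omega> u x"
proof -
  assume "norm_fun N"
  then interpret norm_fun N .
  have "(\<forall>y\<in>ball x \<delta>. \<forall>z\<in>ball x \<delta>. - u z - - u y \<le> K * N (z - y)) \<longleftrightarrow>
        (\<forall>y\<in>ball x \<delta>. \<forall>z\<in>ball x \<delta>. u z - u y \<le> K * N (z - y))" for K \<delta>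
  proof -
    have "- u z - - u y = u y - u z" for y z by simp
    then show ?thesis using diff_comm by metis
  qed
  then show ?thesis unfolding lslope_def by presburger
qed

text \<open>
  What remains of the minimization property once measure theory has been eliminated. The vertex
  \<open>z\<close> must not lie in \<open>V\<close>, since a cone is not the solution with its own
  boundary values across its vertex.
\<close>

locale comparison = strict_norm H for H :: "'a::euclidean_space \<Rightarrow> real" +
  fixes \<Omega> :: "'a set" and u :: "'a \<Rightarrow> real"
  assumes open_\<Omega>: "open \<Omega>" and cont: "continuous_on \<Omega> u"
    and cone_eq: "\<And>V z b c x. open V \<Longrightarrow> V \<Subset> \<Omega> \<Longrightarrow> z \<notin> V \<Longrightarrow>
        (\<And>x. x \<in> frontier V \<Longrightarrow> u x = c + b * L (x - z)) \<Longrightarrow> x \<in> V \<Longrightarrow> u x = c + b * L (x - z)"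
    and plane_eq: "\<And>V p c x. open V \<Longrightarrow> V \<Subset> \<Omega> \<Longrightarrow>
        (\<And>x. x \<in> frontier V \<Longrightarrow> u x = c + p \<bullet> x) \<Longrightarrow> x \<in> V \<Longrightarrow> u x = c + p \<bullet> x"
begin

lemma uminus: "comparison H \<Omega> (\<lambda>x. - u x)"
proof unfold_locales
  show "open \<Omega>" by (rule open_\<Omega>)
  show "continuous_on \<Omega> (\<lambda>x. - u x)" using cont by (intro continuous_intros)
  fix V :: "'a set" and x c
  { fix z b assume V: "open V" "V \<Subset> \<Omega>" "z \<notin> V" "x \<in> V"
      and fr: "\<And>x. x \<in> frontier V \<Longrightarrow> - u x = c + b * L (x - z)"
    have "u y = (- c) + (- b) * L (y - z)" if "y \<in> frontier V" for y
      using fr[OF that] by simp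
    from cone_eq[OF V(1-3) this V(4)] show "- u x = c + b * L (x - z)" by simp }
  { fix p assume V: "open V" "V \<Subset> \<Omega>" "x \<in> V"
      and fr: "\<And>x. x \<in> frontier V \<Longrightarrow> - u x = c + p \<bullet> x"
    have "u y = (- c) + (- p) \<bullet> y" if "y \<in> frontier V" for y
      using fr[OF that] by simp
    from plane_eq[OF V(1,2) this V(3)] show "- u x = c + p \<bullet> x" by simp }
qed

text \<open>
  Turns comparison for equal boundary values into comparison for ordered boundary values, by restricting
  to the set where the inequality fails.
\<close>

lemma superlevel:
  assumes V: "open V" "V \<Subset> \<Omega>" and C: "continuous_on UNIV C"
    and fr: "\<And>y. y \<in> frontier V \<Longrightarrow> u y \<le> C y"
  defines "W \<equiv> {y \<in> V. C y < u y}"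
  shows "open W" "W \<Subset> \<Omega>" "\<And>y. y \<in> frontier W \<Longrightarrow> u y = C y"
proof -
  have clV: "closure V \<subseteq> \<Omega>" "compact (closure V)" using V by (auto simp: compactly_inside_def)
  have VO: "V \<subseteq> \<Omega>" using clV closure_subset by blast
  have contV: "continuous_on V (\<lambda>y. u y - C y)"
    using continuous_on_subset[OF cont VO] continuous_on_subset[OF C] by (intro continuous_intros) auto
  have "W = V \<inter> (\<lambda>y. u y - C y) -` {0<..}" by (auto simp: W_def)
  then show oW: "open W" using continuous_open_preimage[OF contV V(1)] by simp
  have WV: "closure W \<subseteq> closure V" by (rule closure_mono) (auto simp: W_def)
  show "W \<Subset> \<Omega>"
    by (rule compactly_insideI[OF _ clV(2,1)]) (use closure_subset[of V] in \<open>auto simp: W_def\<close>)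
  fix y assume y: "y \<in> frontier W"
  have yclW: "y \<in> closure W" "y \<notin> W" using y oW by (auto simp: frontier_def interior_open)
  have contcl: "continuous_on (closure V) (\<lambda>y. u y - C y)"
    using continuous_on_subset[OF cont clV(1)] continuous_on_subset[OF C] by (intro continuous_intros) auto
  have ge: "0 \<le> u y - C y"
  proof -
    let ?Z = "closure V \<inter> (\<lambda>y. u y - C y) -` {0..}"
    have "closed ?Z"
      by (rule continuous_closed_preimage[OF contcl closed_closure closed_atLeast])
    moreover have "W \<subseteq> ?Z" using closure_subset[of V] by (auto simp: W_def)
    ultimately have "closure W \<subseteq> ?Z" by (intro closure_minimal)
    then show ?thesis using yclW by auto
  qed
  show "u y = C y"
  proof (cases "y \<in> V")
    case True then show ?thesis using yclW ge by (auto simp: W_def)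
  next
    case False
    then have "y \<in> frontier V" using yclW WV V(1) by (auto simp: frontier_def interior_open)
    then show ?thesis using fr ge by force
  qed
qed

lemma below_cone:
  assumes "open V" "V \<Subset> \<Omega>" "z \<notin> V" "\<And>y. y \<in> frontier V \<Longrightarrow> u y \<le> c + b * L (y - z)" "x \<in> V"
  shows "u x \<le> c + b * L (x - z)"
proof (rule ccontr)
  let ?C = "\<lambda>y. c + b * L (y - z)" let ?W = "{y \<in> V. ?C y < u y}"
  assume "\<not> ?thesis"
  then have x: "x \<in> ?W" using assms by auto
  have C: "continuous_on UNIV ?C" by (intro continuous_intros)
  note W = superlevel[OF assms(1,2) C assms(4)]
  have "u x = ?C x" by (rule cone_eq[OF W(1,2) _ W(3) x]) (use assms(3) in auto)
  then show False using x by auto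
qed

lemma below_plane:
  assumes "open V" "V \<Subset> \<Omega>" "\<And>y. y \<in> frontier V \<Longrightarrow> u y \<le> c + p \<bullet> y" "x \<in> V"
  shows "u x \<le> c + p \<bullet> x"
proof (rule ccontr)
  let ?C = "\<lambda>y. c + p \<bullet> y" let ?W = "{y \<in> V. ?C y < u y}"
  assume "\<not> ?thesis"
  then have x: "x \<in> ?W" using assms by auto
  have C: "continuous_on UNIV ?C" by (intro continuous_intros)
  note W = superlevel[OF assms(1,2) C assms(3)]
  have "u x = ?C x" by (rule plane_eq[OF W(1,2) W(3) x]) auto
  then show False using x by auto
qed

end

context strict_norm
begin

definition LB :: "'a \<Rightarrow> real \<Rightarrow> 'a set" where "LB x r = {y. L (y - x) \<le> r}"

lemma norm_bounds: obtains a b where "a > 0" "b > 0" "\<And>p. L p \<le> b * norm p" "\<And>p. norm p \<le> a * L p"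
proof -
  obtain b where b: "b > 0" "\<And>p. L p \<le> b * norm p" using L.le_norm by blast
  obtain c where c: "c > 0" "\<And>p. c * norm p \<le> L p" using L.ge_norm by blast
  have "norm p \<le> (1 / c) * L p" for p using c(2)[of p] c(1) by (simp add: field_simps)
  with that[of "1 / c" b] b c show thesis by simp
qed

lemma compact_L: 
  assumes A: "closed A" "bounded A"
  shows "compact {y. L (y - x) \<in> A}"
proof -
  obtain a b where ab: "a > 0" "b > 0" "\<And>p. L p \<le> b * norm p" "\<And>p. norm p \<le> a * L p" using norm_bounds by blast
  obtain B where B: "\<And>t. t \<in> A \<Longrightarrow> norm t \<le> B" using A(2) by (auto simp: bounded_iff)
  have "bounded {y. L (y - x) \<in> A}"
    unfolding bounded_any_center[where a = x]
  proof (intro exI ballI)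
    fix y assume "y \<in> {y. L (y - x) \<in> A}"
    then have "L (y - x) \<le> B" using B by force
    then have "a * L (y - x) \<le> a * B" using ab(1) by simp
    then show "dist x y \<le> a * B" using ab(4)[of "y - x"] by (simp add: dist_norm norm_minus_commute)
  qed
  moreover have "closed {y. L (y - x) \<in> A}"
  proof -
    have "continuous_on UNIV (\<lambda>y. L (y - x))" by (intro continuous_intros)
    from continuous_closed_preimage[OF this closed_UNIV A(1)] show ?thesis by (simp add: vimage_def)
  qed
  ultimately show ?thesis by (simp add: compact_eq_bounded_closed)
qed

lemma compact_LB: "compact (LB x r)"
proof -
  have "LB x r = {y. L (y - x) \<in> {0..r}}" by (auto simp: LB_def)
  then show ?thesis using compact_L[of "{0..r}" x] by simp
qed

lemma LB_enlarge:
  assumes "open U" "LB x r \<subseteq> U" "r > 0"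
  shows "\<exists>\<rho>>0. LB x (r + \<rho>) \<subseteq> U"
proof (rule ccontr)
  assume neg: "\<not> ?thesis"
  have cpt: "compact (LB x (r + 1) - U)"
    using compact_LB assms(1) by (simp add: compact_diff)
  have "\<not> LB x (r + 1) \<subseteq> U" using neg zero_less_one by blast
  then have ne: "LB x (r + 1) - U \<noteq> {}" by blast
  have co: "continuous_on (LB x (r + 1) - U) (\<lambda>w. L (w - x))" by (intro continuous_intros)
  obtain y where y: "y \<in> LB x (r + 1) - U" "\<And>w. w \<in> LB x (r + 1) - U \<Longrightarrow> L (y - x) \<le> L (w - x)"
    using continuous_attains_inf[OF cpt ne co] by blast
  have gt: "L (y - x) > r" using y(1) assms(2) by (force simp: LB_def)
  define \<rho> where "\<rho> = min 1 ((L (y - x) - r) / 2)"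
  have "\<rho> > 0" using gt by (simp add: \<rho>_def)
  then obtain w where w: "w \<in> LB x (r + \<rho>)" "w \<notin> U" using neg by blast
  have "w \<in> LB x (r + 1) - U" using w by (auto simp: LB_def \<rho>_def)
  then have "L (y - x) \<le> r + \<rho>" using y(2)[of w] w(1) by (simp add: LB_def)
  moreover have "\<rho> \<le> (L (y - x) - r) / 2" unfolding \<rho>_def by (rule min.cobounded2)
  ultimately show False using gt by (simp add: field_simps)
qed

lemma L_on_segment:
  assumes "w \<in> closed_segment x y"
  shows "L (y - w) = L (y - x) - L (w - x)"
proof -
  obtain t where t: "0 \<le> t" "t \<le> 1" "w = (1 - t) *\<^sub>R x + t *\<^sub>R y" using assms by (auto simp: closed_segment_def)
  have e: "y - w = (1 - t) *\<^sub>R (y - x)" "w - x = t *\<^sub>R (y - x)" by (simp_all add: t algebra_simps)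
  have "L (y - w) = (1 - t) * L (y - x)" "L (w - x) = t * L (y - x)" unfolding e L.scale using t by auto
  then show ?thesis by (simp add: left_diff_distrib)
qed

end

context comparison
begin

abbreviation S :: "'a \<Rightarrow> real" where "S \<equiv> lslope L \<Omega> u"

text \<open>
  The punctured ball is the domain of comparison: its boundary consists of the sphere and the vertex.
\<close>

lemma below_cone_ball:
  assumes "r > 0" "LB x r \<subseteq> \<Omega>" "\<And>y. L (y - x) = r \<Longrightarrow> u y \<le> u x + \<sigma> * r" "L (y - x) \<le> r"
  shows "u y \<le> u x + \<sigma> * L (y - x)"
proof -
  let ?V = "{y. 0 < L (y - x) \<and> L (y - x) < r}"
  have c: "continuous_on UNIV (\<lambda>y. L (y - x))" by (intro continuous_intros)
  have oV: "open ?V" by (intro open_Collect_conj open_Collect_less c continuous_intros)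
  have "closed (LB x r)" using compact_LB compact_imp_closed by blast
  then have clV: "closure ?V \<subseteq> LB x r" by (intro closure_minimal) (auto simp: LB_def)
  have cV: "?V \<Subset> \<Omega>"
    by (rule compactly_insideI[OF _ compact_LB assms(2)]) (auto simp: LB_def)
  have fr: "u y \<le> u x + \<sigma> * L (y - x)" if "y \<in> frontier ?V" for y
  proof -
    have "y \<notin> ?V" "y \<in> LB x r" using that clV oV by (auto simp: frontier_def interior_open)
    then have "L (y - x) = r \<or> y = x" by (force simp: LB_def)
    then show ?thesis using assms(3) by auto
  qed
  show ?thesis
  proof (cases "y \<in> ?V")
    case True then show ?thesis using below_cone[OF oV cV _ fr] by simp
  next
    case False
    then have "L (y - x) = r \<or> y = x" using assms(4) by force
    then show ?thesis using assms(3) by auto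
  qed
qed

text \<open>
  The sphere inequality at \<open>x\<close> persists at all nearby centres \<open>y\<close> up to a
  small loss, by uniform continuity; each of them then gives a cone above \<open>u\<close>.
\<close>

lemma Lipschitz_near:
  assumes "r > 0" "LB x r \<subseteq> \<Omega>" "\<And>y. L (y - x) = r \<Longrightarrow> u y \<le> u x + \<sigma> * r" "\<eta> > 0"
  shows "\<exists>\<delta>>0. ball x \<delta> \<subseteq> \<Omega> \<and> (\<forall>y\<in>ball x \<delta>. \<forall>z\<in>ball x \<delta>. u z - u y \<le> (\<sigma> + \<eta>) * L (z - y))"
proof -
  obtain a b where ab: "a > 0" "b > 0" "\<And>p. L p \<le> b * norm p" "\<And>p. norm p \<le> a * L p" using norm_bounds by blast
  obtain \<rho> where \<rho>: "\<rho> > 0" "LB x (r + \<rho>) \<subseteq> \<Omega>" using LB_enlarge[OF open_\<Omega> assms(2,1)] by blast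
  have "uniformly_continuous_on (LB x (r + \<rho>)) u"
    using compact_uniformly_continuous[OF continuous_on_subset[OF cont \<rho>(2)] compact_LB] .
  moreover
  define h where "h = \<eta> * r / 2"
  have h: "h > 0" "h + h = \<eta> * r" using assms by (simp_all add: h_def)
  ultimately obtain d where d: "d > 0"
    "\<And>y z. y \<in> LB x (r + \<rho>) \<Longrightarrow> z \<in> LB x (r + \<rho>) \<Longrightarrow> dist z y < d \<Longrightarrow> dist (u z) (u y) < h"
    unfolding uniformly_continuous_on_def by blast
  define \<delta> where "\<delta> = min d (min (\<rho> / b) (r / (2 * b)))"
  have \<delta>: "\<delta> > 0" "\<delta> \<le> d" "b * \<delta> \<le> \<rho>" "2 * (b * \<delta>) \<le> r"
    using d(1) \<rho>(1) ab assms(1) by (auto simp: \<delta>_def min_def field_simps)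
  have Lb: "L (z - x) < b * \<delta>" if "z \<in> ball x \<delta>" for z
  proof -
    have "norm (z - x) < \<delta>" using that by (simp add: dist_norm norm_minus_commute)
    then have "b * norm (z - x) < b * \<delta>" using ab by simp
    then show ?thesis using ab(3)[of "z - x"] by linarith
  qed
  have bz: "L (z - y) \<le> r" if "z \<in> ball x \<delta>" "y \<in> ball x \<delta>" for y z
    using L.tri3[of z y x] Lb[OF that(1)] Lb[OF that(2)] L.diff_comm[of x y] \<delta>(4) by linarith
  show ?thesis
  proof (intro exI conjI ballI)
    show "\<delta> > 0" by (rule \<delta>)
    show "ball x \<delta> \<subseteq> \<Omega>"
    proof
      fix z assume "z \<in> ball x \<delta>"
      then show "z \<in> \<Omega>" using Lb[of z] \<delta>(3) assms(1) \<rho>(2) by (force simp: LB_def)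
    qed
    fix y z assume y: "y \<in> ball x \<delta>" and z: "z \<in> ball x \<delta>"
    have "u z \<le> u y + (\<sigma> + \<eta>) * L (z - y)"
    proof (rule below_cone_ball[OF assms(1) _ _ bz[OF z y]])
      show "LB y r \<subseteq> \<Omega>"
      proof
        fix w assume "w \<in> LB y r"
        then have "L (w - x) \<le> r + \<rho>" using L.tri3[of w x y] Lb[OF y] \<delta>(3) by (simp add: LB_def)
        then show "w \<in> \<Omega>" using \<rho>(2) by (auto simp: LB_def)
      qed
      fix w assume w: "L (w - y) = r"
      define w' where "w' = w - (y - x)"
      have L': "L (w' - x) = r" using w by (simp add: w'_def algebra_simps)
      have "L (w - x) \<le> r + \<rho>" using L.tri3[of w x y] Lb[OF y] \<delta>(3) w by simp
      then have m: "w \<in> LB x (r + \<rho>)" "w' \<in> LB x (r + \<rho>)" "y \<in> LB x (r + \<rho>)" "x \<in> LB x (r + \<rho>)"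
        using L' \<rho>(1) assms(1) Lb[OF y] \<delta>(3) by (auto simp: LB_def)
      have dd: "dist w w' < d" "dist y x < d" using y \<delta>(2) by (auto simp: w'_def dist_norm norm_minus_commute)
      have "u w - u w' < h" "u x - u y < h"
        using d(2)[OF m(2,1) dd(1)] d(2)[OF m(4,3) dd(2)] unfolding dist_real_def by linarith+
      moreover have "u w' \<le> u x + \<sigma> * r" using assms(3) L' by blast
      ultimately have "u w < u y + \<sigma> * r + (h + h)" by linarith
      then show "u w \<le> u y + (\<sigma> + \<eta>) * r" using h by (simp add: distrib_right)
    qed
    then show "u z - u y \<le> (\<sigma> + \<eta>) * L (z - y)" by simp
  qed
qed

lemma max_sphere:
  assumes "r > 0" "LB x r \<subseteq> \<Omega>"
  obtains y where "L (y - x) = r" "\<And>w. L (w - x) = r \<Longrightarrow> u w \<le> u y"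
proof -
  let ?A = "{y. L (y - x) \<in> {r}}"
  have "compact ?A" by (rule compact_L) auto
  moreover have "?A \<noteq> {}"
  proof -
    obtain v where "L v = 1" using exists_unit by blast
    then have "x + r *\<^sub>R v \<in> ?A" using assms(1) by (simp add: L.scale)
    then show ?thesis by blast
  qed
  moreover have "continuous_on ?A u"
    by (rule continuous_on_subset[OF cont]) (use assms in \<open>auto simp: LB_def\<close>)
  ultimately obtain y where "y \<in> ?A" "\<And>w. w \<in> ?A \<Longrightarrow> u w \<le> u y"
    using continuous_attains_sup[of ?A u] by blast
  then show thesis using that by auto
qed

lemma slope_le:
  assumes "\<delta> > 0" "ball x \<delta> \<subseteq> \<Omega>" "\<And>y z. y \<in> ball x \<delta> \<Longrightarrow> z \<in> ball x \<delta> \<Longrightarrow> u z - u y \<le> K * L (z - y)"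
  shows "S x \<le> K"
  unfolding lslope_def
proof (rule cInf_lower)
  show "bdd_below {K. \<exists>\<delta>>0. ball x \<delta> \<subseteq> \<Omega> \<and> (\<forall>y\<in>ball x \<delta>. \<forall>z\<in>ball x \<delta>. u z - u y \<le> K * L (z - y))}"
    by (rule bdd_belowI[of _ 0]) (use L.Lipschitz_const_nonneg in blast)
qed (use assms in blast)

lemma LB_mono: "r' \<le> r \<Longrightarrow> LB x r' \<subseteq> LB x r"
  by (auto simp: LB_def)

lemma exists_LB:
  assumes "x \<in> \<Omega>" shows "\<exists>r>0. LB x r \<subseteq> \<Omega>"
proof -
  obtain a b where ab: "a > 0" "b > 0" "\<And>p. L p \<le> b * norm p" "\<And>p. norm p \<le> a * L p" using norm_bounds by blast
  obtain e where e: "e > 0" "cball x e \<subseteq> \<Omega>" using open_\<Omega> assms open_contains_cball by blast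
  have "LB x (e / a) \<subseteq> cball x e"
  proof
    fix y assume "y \<in> LB x (e / a)"
    then have "a * L (y - x) \<le> e" using ab by (simp add: LB_def field_simps)
    then show "y \<in> cball x e" using ab(4)[of "y - x"] by (simp add: dist_norm norm_minus_commute)
  qed
  then show ?thesis using e ab(1) by (intro exI[of _ "e / a"]) auto
qed

lemma slope_Lipschitz:
  assumes "x \<in> \<Omega>" "\<eta> > 0"
  shows "\<exists>\<delta>>0. ball x \<delta> \<subseteq> \<Omega> \<and> (\<forall>y\<in>ball x \<delta>. \<forall>z\<in>ball x \<delta>. u z - u y \<le> (S x + \<eta>) * L (z - y))"
proof -
  let ?A = "{K. \<exists>\<delta>>0. ball x \<delta> \<subseteq> \<Omega> \<and> (\<forall>y\<in>ball x \<delta>. \<forall>z\<in>ball x \<delta>. u z - u y \<le> K * L (z - y))}"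
  obtain r where r: "r > 0" "LB x r \<subseteq> \<Omega>" using exists_LB[OF assms(1)] by blast
  obtain y where y: "L (y - x) = r" "\<And>w. L (w - x) = r \<Longrightarrow> u w \<le> u y" using max_sphere[OF r] by blast
  have "(u y - u x) / r + 1 \<in> ?A"
    using Lipschitz_near[OF r, of "(u y - u x) / r" 1] y r(1) by simp
  then have "?A \<noteq> {}" by (metis empty_iff)
  moreover have "Inf ?A < S x + \<eta>" using assms unfolding lslope_def by simp
  ultimately have "\<exists>K\<in>?A. K < S x + \<eta>" by (rule cInf_lessD)
  then obtain K where K: "K \<in> ?A" "K < S x + \<eta>" by (rule bexE)
  then obtain \<delta> where \<delta>: "\<delta> > 0" "ball x \<delta> \<subseteq> \<Omega>" "\<And>y z. y \<in> ball x \<delta> \<Longrightarrow> z \<in> ball x \<delta> \<Longrightarrow> u z - u y \<le> K * L (z - y)"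
    by blast
  have "u z - u y \<le> (S x + \<eta>) * L (z - y)" if "y \<in> ball x \<delta>" "z \<in> ball x \<delta>" for y z
    using \<delta>(3)[OF that] K(2) mult_right_mono[of K "S x + \<eta>" "L (z - y)"] by force
  then show ?thesis using \<delta>(1,2) by blast
qed

lemma slope_nonneg: "x \<in> \<Omega> \<Longrightarrow> 0 \<le> S x"
proof (rule field_le_epsilon)
  fix e :: real assume "x \<in> \<Omega>" "e > 0"
  then obtain \<delta> where "\<delta> > 0" "\<And>y z. y \<in> ball x \<delta> \<Longrightarrow> z \<in> ball x \<delta> \<Longrightarrow> u z - u y \<le> (S x + e) * L (z - y)"
    using slope_Lipschitz[of x e] by blast
  then show "0 \<le> S x + e" using L.Lipschitz_const_nonneg by blast
qed

lemma slope_le_sphere: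
  assumes "r > 0" "LB x r \<subseteq> \<Omega>" "\<And>y. L (y - x) = r \<Longrightarrow> u y \<le> u x + \<sigma> * r"
  shows "S x \<le> \<sigma>"
proof (rule field_le_epsilon)
  fix e :: real assume "e > 0"
  then show "S x \<le> \<sigma> + e" using Lipschitz_near[OF assms, of e] slope_le by blast
qed

text \<open>
  A one-sided bound along a single ray suffices, since the increment over a short piece of the ray is
  bounded by the local Lipschitz constant.
\<close>

lemma slope_ge:
  assumes "y \<in> \<Omega>" "v \<noteq> 0" "\<And>t. 0 < t \<Longrightarrow> t \<le> 1 \<Longrightarrow> u y - u (y - t *\<^sub>R v) \<ge> \<sigma> * (t * L v)"
  shows "\<sigma> \<le> S y"
proof (rule field_le_epsilon)
  fix e :: real assume "e > 0"
  then obtain \<delta> where \<delta>: "\<delta> > 0" "\<And>w z. w \<in> ball y \<delta> \<Longrightarrow> z \<in> ball y \<delta> \<Longrightarrow> u z - u w \<le> (S y + e) * L (z - w)"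
    using slope_Lipschitz[OF assms(1), of e] by blast
  define t where "t = min 1 (\<delta> / (2 * norm v))"
  have t: "0 < t" "t \<le> 1" "t * norm v < \<delta>"
    using \<delta>(1) assms(2) by (auto simp: t_def min_def field_simps split: if_splits)
  have A: "u y - u (y - t *\<^sub>R v) \<le> (S y + e) * L (t *\<^sub>R v)"
    using \<delta>(2)[of "y - t *\<^sub>R v" y] t \<delta>(1) by (simp add: dist_norm)
  have B: "L (t *\<^sub>R v) = t * L v" using t by (simp add: L.scale)
  have "\<sigma> * (t * L v) \<le> (S y + e) * (t * L v)" using assms(3)[OF t(1,2)] A[unfolded B] by linarith
  moreover have "0 < t * L v" using t assms(2) by simp
  ultimately show "\<sigma> \<le> S y + e" by (rule mult_right_le_imp_le)
qed

text \<open>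
  Increasing slope: the maximum point \<open>y\<close> on a sphere around \<open>x\<close> sees
  \<open>u\<close> below the cone with vertex \<open>x\<close>, which is attained at \<open>y\<close>.
  Going back from \<open>y\<close> towards \<open>x\<close> the function therefore drops at least at the
  rate of the cone.
\<close>

lemma chain_step:
  assumes r: "r > 0" "LB x r \<subseteq> \<Omega>"
  shows "\<exists>y. L (y - x) = r \<and> S x \<le> S y \<and> (\<forall>w\<in>closed_segment x y. S x * L (y - w) \<le> u y - u w)"
proof -
  obtain y where y: "L (y - x) = r" "\<And>w. L (w - x) = r \<Longrightarrow> u w \<le> u y" using max_sphere[OF r] by blast
  define \<sigma> where "\<sigma> = (u y - u x) / r"
  have uy: "u y = u x + \<sigma> * r" using r(1) by (simp add: \<sigma>_def)
  have sph: "\<And>w. L (w - x) = r \<Longrightarrow> u w \<le> u x + \<sigma> * r" using y uy by simp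
  have Sx: "S x \<le> \<sigma>" by (rule slope_le_sphere[OF r sph])
  have seg: "\<sigma> * L (y - w) \<le> u y - u w" if w: "w \<in> closed_segment x y" for w
  proof -
    have e: "L (y - w) = r - L (w - x)" using L_on_segment[OF w] y(1) by simp
    then have "L (w - x) \<le> r" using L.nonneg[of "y - w"] by linarith
    have "u w \<le> u x + \<sigma> * L (w - x)"
    proof (rule below_cone_ball[OF r])
      show "L (w - x) \<le> r" by fact
      show "\<And>y. L (y - x) = r \<Longrightarrow> u y \<le> u x + \<sigma> * r" by (rule sph)
    qed
    moreover have "\<sigma> * L (y - w) = \<sigma> * r - \<sigma> * L (w - x)" unfolding e by (rule right_diff_distrib)
    ultimately show ?thesis using uy by linarith
  qed
  have "\<sigma> \<le> S y"
  proof (rule slope_ge[of y "y - x"])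
    show "y \<in> \<Omega>" using y(1) r by (auto simp: LB_def)
    show "y - x \<noteq> 0" using y(1) r(1) L.zero by force
    fix t :: real assume t: "0 < t" "t \<le> 1"
    have "y - t *\<^sub>R (y - x) = (1 - (1 - t)) *\<^sub>R x + (1 - t) *\<^sub>R y" by (simp add: algebra_simps)
    then have "y - t *\<^sub>R (y - x) \<in> closed_segment x y" using t unfolding closed_segment_def by fastforce
    from seg[OF this] show "\<sigma> * (t * L (y - x)) \<le> u y - u (y - t *\<^sub>R (y - x))"
      using t by (simp add: L.scale)
  qed
  then have "S x \<le> S y" using Sx by simp
  moreover have "S x * L (y - w) \<le> u y - u w" if w: "w \<in> closed_segment x y" for w
    using seg[OF w] mult_right_mono[OF Sx L.nonneg[of "y - w"]] by linarith
  ultimately show ?thesis using y(1) by blast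
qed

text \<open>
  If all slopes on the segment were below \<open>\<sigma>\<close>, all sufficiently short increments
  would be too small, and by bisection so would their sum.
\<close>

lemma segment_slope:
  assumes "closed_segment a b \<subseteq> \<Omega>" "a \<noteq> b" "\<sigma> * L (b - a) \<le> u b - u a"
  shows "\<exists>x\<in>closed_segment a b. \<sigma> \<le> S x"
proof (rule ccontr)
  assume "\<not> ?thesis"
  then have lt: "\<And>x. x \<in> closed_segment a b \<Longrightarrow> S x < \<sigma>" by force
  define g where "g t = a + t *\<^sub>R (b - a)" for t
  have Lab: "L (b - a) > 0" using assms(2) by simp
  have Lg: "L (g t - g s) = (t - s) * L (b - a)" if "s \<le> t" for s t
  proof -
    have "g t - g s = (t - s) *\<^sub>R (b - a)" by (simp add: g_def algebra_simps)
    then show ?thesis using that by (simp add: L.scale)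
  qed
  have "0 < (1::real) \<longrightarrow> u (g 1) - u (g 0) < \<sigma> * ((1 - 0) * L (b - a))"
  proof (rule Bolzano[where P = "\<lambda>s t. s < t \<longrightarrow> u (g t) - u (g s) < \<sigma> * ((t - s) * L (b - a))"])
    fix s t r assume *: "s < t \<longrightarrow> u (g t) - u (g s) < \<sigma> * ((t - s) * L (b - a))"
      "t < r \<longrightarrow> u (g r) - u (g t) < \<sigma> * ((r - t) * L (b - a))" "s \<le> t" "t \<le> r"
    show "s < r \<longrightarrow> u (g r) - u (g s) < \<sigma> * ((r - s) * L (b - a))"
    proof (cases "s = t \<or> t = r")
      case True then show ?thesis using * by auto
    next
      case False
      then have "u (g t) - u (g s) + (u (g r) - u (g t)) < \<sigma> * ((t - s) * L (b - a)) + \<sigma> * ((r - t) * L (b - a))"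
        using * by (intro add_strict_mono) auto
      then show ?thesis by (simp add: algebra_simps)
    qed
  next
    fix t :: real assume t: "0 \<le> t" "t \<le> 1"
    have gt: "g t \<in> closed_segment a b" using t unfolding closed_segment_def g_def
      by (auto simp: algebra_simps intro!: exI[of _ t])
    then have gO: "g t \<in> \<Omega>" using assms(1) by blast
    define \<eta> where "\<eta> = (\<sigma> - S (g t)) / 2"
    have \<eta>: "\<eta> > 0" "S (g t) + \<eta> < \<sigma>" using lt[OF gt] by (simp_all add: \<eta>_def field_simps)
    obtain \<delta> where \<delta>: "\<delta> > 0" "\<And>y z. y\<in>ball (g t) \<delta> \<Longrightarrow> z\<in>ball (g t) \<delta> \<Longrightarrow> u z - u y \<le> (S (g t) + \<eta>) * L (z - y)"
      using slope_Lipschitz[OF gO \<eta>(1)] by blast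
    define d where "d = \<delta> / (norm (b - a) + 1)"
    have d_aux: "norm (b - a) + 1 > 0" by (simp add: add_nonneg_pos)
    have d: "d > 0" "d * norm (b - a) < \<delta>"
      using \<delta>(1) d_aux by (auto simp: d_def field_simps)
    show "\<exists>d>0. \<forall>s r. s \<le> t \<and> t \<le> r \<and> r - s < d \<longrightarrow> s < r \<longrightarrow> u (g r) - u (g s) < \<sigma> * ((r - s) * L (b - a))"
    proof (intro exI conjI allI impI)
      fix s r assume sr: "s \<le> t \<and> t \<le> r \<and> r - s < d" "s < r"
      have near: "g q \<in> ball (g t) \<delta>" if "\<bar>q - t\<bar> \<le> d" for q
      proof -
        have "dist (g t) (g q) = \<bar>q - t\<bar> * norm (b - a)"
          by (simp add: g_def dist_norm scaleR_left_diff_distrib[symmetric] abs_minus_commute)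
        also have "\<dots> \<le> d * norm (b - a)" using that by (intro mult_right_mono) auto
        finally show ?thesis using d by simp
      qed
      have "u (g r) - u (g s) \<le> (S (g t) + \<eta>) * L (g r - g s)" using sr by (intro \<delta>(2) near) auto
      moreover have "L (g r - g s) > 0" using Lg[of s r] sr(2) Lab by simp
      then have "(S (g t) + \<eta>) * L (g r - g s) < \<sigma> * L (g r - g s)" using \<eta>(2) by simp
      ultimately have "u (g r) - u (g s) < \<sigma> * L (g r - g s)" by linarith
      then show "u (g r) - u (g s) < \<sigma> * ((r - s) * L (b - a))" using Lg[of s r] sr by simp
    qed (rule d)
  qed simp
  then show False using assms(3) by (simp add: g_def)
qed

text \<open>
  Iterating the choice of a maximum point gives a discrete curve of steepest ascent.
\<close>

lemma chain:
  assumes "r > 0"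
  obtains X where "X 0 = x" "\<And>n. LB (X n) r \<subseteq> \<Omega> \<Longrightarrow> L (X (Suc n) - X n) = r \<and> S (X n) \<le> S (X (Suc n)) \<and>
      (\<forall>w\<in>closed_segment (X n) (X (Suc n)). S (X n) * L (X (Suc n) - w) \<le> u (X (Suc n)) - u w)"
proof -
  define f where "f x = (SOME y. L (y - x) = r \<and> S x \<le> S y \<and> (\<forall>w\<in>closed_segment x y. S x * L (y - w) \<le> u y - u w))" for x
  define X where "X n = (f ^^ n) x" for n
  have f: "L (f x - x) = r \<and> S x \<le> S (f x) \<and> (\<forall>w\<in>closed_segment x (f x). S x * L (f x - w) \<le> u (f x) - u w)"
    if "LB x r \<subseteq> \<Omega>" for x
    unfolding f_def by (rule someI_ex[OF chain_step[OF assms that]])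
  show thesis by (rule that[of X]) (use f in \<open>auto simp: X_def\<close>)
qed

end

section \<open>Linear approximation\<close>

context comparison
begin

text \<open>
  The Lipschitz bound puts \<open>u\<close> above the cone descending from \<open>yp\<close> and below
  the cone rising from \<open>ym\<close>. Both are nearly affine near \<open>x\<close> by
  \<open>L_far\<close>, with slopes \<open>K * J \<eta>\<close> and \<open>K * J \<zeta>\<close>. A
  linear function that lies above another one up to a constant on a symmetric set is close to it, so the
  two slopes nearly coincide and \<open>u\<close> is trapped between them.
\<close>

lemma near_linear:
  assumes r: "r > 0" "M > 0" "LB x (2 * (M * r)) \<subseteq> \<Omega>" "M \<ge> 1"
    and lip: "\<And>y z. y \<in> LB x (2 * (M * r)) \<Longrightarrow> z \<in> LB x (2 * (M * r)) \<Longrightarrow> u z - u y \<le> K * L (z - y)"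
    and K: "K \<ge> 0"
    and far: "\<And>\<eta> y. L \<eta> = 1 \<Longrightarrow> L y \<le> 1 \<Longrightarrow> L (M *\<^sub>R \<eta> - y) \<le> M - J \<eta> \<bullet> y + \<delta>"
    and yp: "L (yp - x) = M * r" "u yp - u x \<ge> \<sigma> * (M * r)"
    and ym: "L (ym - x) = M * r" "u ym - u x \<le> - \<sigma> * (M * r)"
  shows "\<exists>q. H q = K \<and> (\<forall>y. L y \<le> 1 \<longrightarrow> \<bar>u (x + r *\<^sub>R y) - u x - r * (q \<bullet> y)\<bar> \<le> 3 * r * (K * \<delta> + (K - \<sigma>) * M))"
proof -
  define E where "E = r * (K * \<delta> + (K - \<sigma>) * M)"
  define \<eta> where "\<eta> = (yp - x) /\<^sub>R (M * r)"
  define \<zeta> where "\<zeta> = (x - ym) /\<^sub>R (M * r)"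
  have Mr: "M * r > 0" using r by simp
  define R where "R = M * r"
  have R: "R > 0" "L (yp - x) = R" "L (x - ym) = R" using Mr yp(1) ym(1) L.diff_comm[of x ym] by (simp_all add: R_def)
  have eR: "\<eta> = (yp - x) /\<^sub>R R" "\<zeta> = (x - ym) /\<^sub>R R" by (simp_all only: \<eta>_def \<zeta>_def R_def)
  have eta: "L \<eta> = 1" "L \<zeta> = 1" unfolding eR L.divide using R by simp_all
  have "yp = x + R *\<^sub>R \<eta>" "ym = x - R *\<^sub>R \<zeta>" unfolding eR using R(1) by simp_all
  then have yp': "yp = x + (M * r) *\<^sub>R \<eta>" and ym': "ym = x - (M * r) *\<^sub>R \<zeta>" by (simp_all only: R_def)
  have nz: "\<eta> \<noteq> 0" "\<zeta> \<noteq> 0" using eta L.zero by force+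
  have inB: "x + r *\<^sub>R y \<in> LB x (2 * (M * r))" if "L y \<le> 1" for y
  proof -
    have "r * L y \<le> r * 1" using r(1) that by (intro mult_left_mono) auto
    also have "r * 1 \<le> 2 * (M * r)" using r(1,4) mult_right_mono[of 1 M r] by simp
    finally show ?thesis using r(1) by (simp add: LB_def L.scale)
  qed
  have ypB: "yp \<in> LB x (2 * (M * r))" "ym \<in> LB x (2 * (M * r))" using yp(1) ym(1) Mr by (auto simp: LB_def)
  have lower: "r * (K * (J \<eta> \<bullet> y)) - E \<le> u (x + r *\<^sub>R y) - u x" if y: "L y \<le> 1" for y
  proof -
    have "yp - (x + r *\<^sub>R y) = r *\<^sub>R (M *\<^sub>R \<eta> - y)" by (simp add: yp' algebra_simps)
    then have "u yp - u (x + r *\<^sub>R y) \<le> K * (r * L (M *\<^sub>R \<eta> - y))"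
      using lip[OF inB[OF y] ypB(1)] r(1) by (simp add: L.scale)
    also have "\<dots> \<le> K * (r * (M - J \<eta> \<bullet> y + \<delta>))"
      using far[OF eta(1) y] K r(1) by (intro mult_left_mono) auto
    finally have "\<sigma> * (M * r) - K * (r * (M - J \<eta> \<bullet> y + \<delta>)) \<le> u (x + r *\<^sub>R y) - u x"
      using yp(2) by linarith
    then show ?thesis by (simp add: E_def algebra_simps)
  qed
  have upper: "u (x + r *\<^sub>R y) - u x \<le> r * (K * (J \<zeta> \<bullet> y)) + E" if y: "L y \<le> 1" for y
  proof -
    have "(x + r *\<^sub>R y) - ym = r *\<^sub>R (M *\<^sub>R \<zeta> - (- y))" by (simp add: ym' algebra_simps)
    then have "u (x + r *\<^sub>R y) - u ym \<le> K * (r * L (M *\<^sub>R \<zeta> - (- y)))"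
      using lip[OF ypB(2) inB[OF y]] r(1) by (simp only: L.scale abs_of_pos)
    also have "\<dots> \<le> K * (r * (M - J \<zeta> \<bullet> (- y) + \<delta>))"
      using far[OF eta(2), of "- y"] y K r(1) by (intro mult_left_mono) auto
    finally have "u (x + r *\<^sub>R y) - u x \<le> K * (r * (M - J \<zeta> \<bullet> (- y) + \<delta>)) - \<sigma> * (M * r)"
      using ym(2) by linarith
    then show ?thesis by (simp add: E_def algebra_simps)
  qed
  let ?q = "K *\<^sub>R J \<eta>"
  have "\<bar>u (x + r *\<^sub>R y) - u x - r * (?q \<bullet> y)\<bar> \<le> 3 * E" if y: "L y \<le> 1" for y
  proof -
    have a: "r * (K * (J \<eta> \<bullet> y)) - E \<le> u (x + r *\<^sub>R y) - u x" by (rule lower[OF y])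
    have b: "u (x + r *\<^sub>R y) - u x \<le> r * (K * (J \<zeta> \<bullet> y)) + E" by (rule upper[OF y])
    have c: "r * (K * (J \<eta> \<bullet> (- y))) - E \<le> r * (K * (J \<zeta> \<bullet> (- y))) + E"
      using lower[of "- y"] upper[of "- y"] y by simp
    have "r * (K * (J \<zeta> \<bullet> y)) \<le> r * (K * (J \<eta> \<bullet> y)) + 2 * E" using c by simp
    moreover have "r * (?q \<bullet> y) = r * (K * (J \<eta> \<bullet> y))" by simp
    ultimately show ?thesis using a b by linarith
  qed
  moreover have "H ?q = K" using K H_J[OF nz(1)] by (simp add: H.scale)
  ultimately show ?thesis by (intro exI[of _ ?q]) (simp add: E_def mult.assoc)
qed

lemma sphere_increase:
  assumes "r > 0" "LB x r \<subseteq> \<Omega>"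
  shows "\<exists>y. L (y - x) = r \<and> S x * r \<le> u y - u x"
proof -
  obtain y where y: "L (y - x) = r" "\<forall>w\<in>closed_segment x y. S x * L (y - w) \<le> u y - u w"
    using chain_step[OF assms] by blast
  then have "S x * L (y - x) \<le> u y - u x" by (metis ends_in_segment(1))
  then show ?thesis using y(1) by auto
qed

lemma sphere_decrease:
  assumes "r > 0" "LB x r \<subseteq> \<Omega>"
  shows "\<exists>y. L (y - x) = r \<and> u y - u x \<le> - S x * r"
proof -
  interpret m: comparison H \<Omega> "\<lambda>x. - u x" by (rule uminus)
  have "lslope L \<Omega> (\<lambda>x. - u x) x = S x" by (rule lslope_uminus) unfold_locales
  then show ?thesis using m.sphere_increase[OF assms] by force
qed

text \<open>
  The error in \<open>near_linear\<close> is made small by first taking \<open>M\<close> large and then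
  the Lipschitz constant on a small ball close to the slope at the centre. The slope found there has
  norm slightly larger than \<open>S x\<close>, and is rescaled.
\<close>

lemma linear_at_scale:
  assumes x: "x \<in> \<Omega>" and \<epsilon>: "\<epsilon> > 0"
  shows "\<exists>r0>0. \<forall>r. 0 < r \<and> r < r0 \<longrightarrow> (\<exists>q. H q = S x \<and> (\<forall>y. L y \<le> 1 \<longrightarrow> \<bar>u (x + r *\<^sub>R y) - u x - r * (q \<bullet> y)\<bar> \<le> \<epsilon> * r))"
proof -
  have S0: "S x \<ge> 0" by (rule slope_nonneg[OF x])
  define B where "B = S x + 1"
  have B: "B > 0" "B \<ge> 1" "S x \<le> B" using S0 by (auto simp: B_def)
  define \<delta> where "\<delta> = \<epsilon> / (16 * B)"
  have \<delta>: "\<delta> > 0" "B * \<delta> = \<epsilon> / 16" using B \<epsilon> by (auto simp: \<delta>_def)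
  obtain M0 where M0: "M0 > 0" "\<And>M \<eta> y. M \<ge> M0 \<Longrightarrow> L \<eta> = 1 \<Longrightarrow> L y \<le> 1 \<Longrightarrow> L (M *\<^sub>R \<eta> - y) \<le> M - J \<eta> \<bullet> y + \<delta>"
    using L_far[OF \<delta>(1)] by blast
  define M where "M = max 1 M0"
  have M: "M \<ge> 1" "M \<ge> M0" "M > 0" by (auto simp: M_def)
  define \<tau> where "\<tau> = min 1 (\<epsilon> / (16 * M))"
  have \<tau>0: "\<tau> > 0" "\<tau> \<le> 1" using \<epsilon> M by (auto simp: \<tau>_def)
  have "\<tau> \<le> \<epsilon> / (16 * M)" unfolding \<tau>_def by (rule min.cobounded2)
  then have "\<tau> * M \<le> \<epsilon> / 16" using M(3) by (simp add: field_simps)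
  note \<tau> = \<tau>0 this
  obtain \<delta>1 where \<delta>1: "\<delta>1 > 0" "ball x \<delta>1 \<subseteq> \<Omega>" "\<And>y z. y \<in> ball x \<delta>1 \<Longrightarrow> z \<in> ball x \<delta>1 \<Longrightarrow> u z - u y \<le> (S x + \<tau>) * L (z - y)"
    using slope_Lipschitz[OF x \<tau>(1)] by blast
  obtain a b where ab: "a > 0" "b > 0" "\<And>p. L p \<le> b * norm p" "\<And>p. norm p \<le> a * L p" using norm_bounds by blast
  define r0 where "r0 = \<delta>1 / (2 * M * a)"
  have r0: "r0 > 0" using \<delta>1 M ab by (simp add: r0_def)
  have "\<exists>q. H q = S x \<and> (\<forall>y. L y \<le> 1 \<longrightarrow> \<bar>u (x + r *\<^sub>R y) - u x - r * (q \<bullet> y)\<bar> \<le> \<epsilon> * r)" if r: "0 < r" "r < r0" for r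
  proof -
    have LBb: "LB x (2 * (M * r)) \<subseteq> ball x \<delta>1"
    proof
      fix y assume "y \<in> LB x (2 * (M * r))"
      then have "a * L (y - x) \<le> a * (2 * (M * r))" using ab by (simp add: LB_def)
      also have "\<dots> = r * (2 * M * a)" by simp
      also have "\<dots> < r0 * (2 * M * a)" using r(2) M(3) ab(1) by simp
      also have "\<dots> = \<delta>1" using M(3) ab(1) by (simp add: r0_def)
      finally show "y \<in> ball x \<delta>1" using ab(4)[of "y - x"] by (simp add: dist_norm norm_minus_commute)
    qed
    have Mr: "M * r > 0" using M r by simp
    have LB1: "LB x (M * r) \<subseteq> \<Omega>" "LB x (2 * (M * r)) \<subseteq> \<Omega>"
      using LB_mono[of "M * r" "2 * (M * r)" x] Mr LBb \<delta>1(2) by auto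
    obtain yp where yp: "L (yp - x) = M * r" "S x * (M * r) \<le> u yp - u x" using sphere_increase[OF Mr LB1(1)] by blast
    obtain ym where ym: "L (ym - x) = M * r" "u ym - u x \<le> - S x * (M * r)" using sphere_decrease[OF Mr LB1(1)] by blast
    have Kn: "S x + \<tau> \<ge> 0" using S0 \<tau> by simp
    have lipB: "u z - u y \<le> (S x + \<tau>) * L (z - y)" if "y \<in> LB x (2 * (M * r))" "z \<in> LB x (2 * (M * r))" for y z
      using \<delta>1(3) that LBb by (simp add: subset_iff)
    obtain q where q: "H q = S x + \<tau>" "\<And>y. L y \<le> 1 \<Longrightarrow> \<bar>u (x + r *\<^sub>R y) - u x - r * (q \<bullet> y)\<bar> \<le> 3 * r * ((S x + \<tau>) * \<delta> + (S x + \<tau> - S x) * M)"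
      using near_linear[OF r(1) M(3) LB1(2) M(1) lipB Kn M0(2)[OF M(2)] yp ym] by blast
    have err1: "(S x + \<tau>) * \<delta> + (S x + \<tau> - S x) * M \<le> \<epsilon> / 8"
    proof -
      have "(S x + \<tau>) * \<delta> \<le> B * \<delta>" using \<tau>(2) \<delta>(1) by (intro mult_right_mono) (auto simp: B_def)
      then show ?thesis using \<delta>(2) \<tau>(3) by simp
    qed
    define q' where "q' = (S x / (S x + \<tau>)) *\<^sub>R q"
    have pos: "S x + \<tau> > 0" using S0 \<tau> by simp
    have Hq': "H q' = S x" using q(1) S0 pos by (simp add: q'_def H.scale)
    have "H (q - q') = \<tau>"
    proof -
      have "q - q' = (1 - S x / (S x + \<tau>)) *\<^sub>R q" by (simp add: q'_def scaleR_left_diff_distrib)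
      also have "1 - S x / (S x + \<tau>) = \<tau> / (S x + \<tau>)" using pos by (simp add: field_simps)
      finally show ?thesis using q(1) \<tau>(1) pos by (simp add: H.scale)
    qed
    then have dq: "\<bar>(q - q') \<bullet> y\<bar> \<le> \<epsilon> / 16" if "L y \<le> 1" for y
    proof -
      have "\<tau> * L y \<le> \<tau> * M" using that M(1) \<tau>(1) by (intro mult_left_mono) auto
      then have "(q - q') \<bullet> y \<le> \<epsilon> / 16" "(q - q') \<bullet> (- y) \<le> \<epsilon> / 16"
        using inner_le[of "q - q'" y] inner_le[of "q - q'" "- y"] \<open>H (q - q') = \<tau>\<close> \<tau>(3) by auto
      then show ?thesis by (simp add: abs_le_iff)
    qed
    have "\<bar>u (x + r *\<^sub>R y) - u x - r * (q' \<bullet> y)\<bar> \<le> \<epsilon> * r" if y: "L y \<le> 1" for y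
    proof -
      have "3 * r * ((S x + \<tau>) * \<delta> + (S x + \<tau> - S x) * M) \<le> 3 * r * (\<epsilon> / 8)"
        using err1 r by (intro mult_left_mono) auto
      then have 1: "\<bar>u (x + r *\<^sub>R y) - u x - r * (q \<bullet> y)\<bar> \<le> 3 * r * (\<epsilon> / 8)" using q(2)[OF y] by linarith
      have "\<bar>r * ((q - q') \<bullet> y)\<bar> \<le> r * (\<epsilon> / 16)" using dq[OF y] r by (simp add: abs_mult)
      moreover have "r * (q \<bullet> y) - r * (q' \<bullet> y) = r * ((q - q') \<bullet> y)" by (simp add: inner_diff_left algebra_simps)
      ultimately have "\<bar>u (x + r *\<^sub>R y) - u x - r * (q' \<bullet> y)\<bar> \<le> 3 * r * (\<epsilon> / 8) + r * (\<epsilon> / 16)" using 1 by linarith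
      also have "\<dots> \<le> \<epsilon> * r" using \<epsilon> r by (simp add: field_simps)
      finally show ?thesis .
    qed
    then show ?thesis using Hq' by blast
  qed
  then show ?thesis using r0 by blast
qed

text \<open>
  The supremum in the definition of a blow-up limit is taken in the extended reals; the next two lemmas
  restate it as a uniform estimate.
\<close>

lemma blow_up_limitI:
  assumes x: "x \<in> \<Omega>" and r: "\<And>i. 0 < (r i :: real)"
    and lim: "\<And>\<epsilon>. \<epsilon> > 0 \<Longrightarrow> \<forall>\<^sub>F i in sequentially. \<forall>y\<in>ball 0 1. \<bar>u (x + r i *\<^sub>R y) - u x - r i * (e \<bullet> y)\<bar> \<le> \<epsilon> * r i"
  shows "blow_up_limit u x r e"
  unfolding blow_up_limit_def
proof (rule order_tendstoI)
  let ?f = "\<lambda>k. SUP y\<in>ball 0 1. ereal \<bar>(u (x + r k *\<^sub>R y) - u x) / r k - e \<bullet> y\<bar>"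
  have ge: "0 \<le> ?f k" for k
    by (rule SUP_upper2[of 0]) auto
  fix c :: ereal
  { assume "c < 0" then show "\<forall>\<^sub>F k in sequentially. c < ?f k" using ge order.strict_trans2 by (blast intro: always_eventually) }
  assume "0 < c"
  then obtain \<epsilon> where \<epsilon>: "0 < ereal \<epsilon>" "ereal \<epsilon> < c" using ereal_dense2 by blast
  then have "\<epsilon> > 0" by simp
  from lim[OF this] show "\<forall>\<^sub>F k in sequentially. ?f k < c"
  proof (rule eventually_mono)
    fix i assume i: "\<forall>y\<in>ball 0 1. \<bar>u (x + r i *\<^sub>R y) - u x - r i * (e \<bullet> y)\<bar> \<le> \<epsilon> * r i"
    have "?f i \<le> ereal \<epsilon>"
    proof (rule SUP_least)
      fix y :: 'a assume "y \<in> ball 0 1"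
      then have "\<bar>u (x + r i *\<^sub>R y) - u x - r i * (e \<bullet> y)\<bar> / r i \<le> \<epsilon>" using i r[of i] by (simp add: pos_divide_le_eq)
      moreover have "\<bar>u (x + r i *\<^sub>R y) - u x - r i * (e \<bullet> y)\<bar> / r i = \<bar>(u (x + r i *\<^sub>R y) - u x) / r i - e \<bullet> y\<bar>"
      proof -
        have "(u (x + r i *\<^sub>R y) - u x) / r i - e \<bullet> y = (u (x + r i *\<^sub>R y) - u x - r i * (e \<bullet> y)) / r i"
          using r[of i] by (simp add: field_simps)
        then show ?thesis using r[of i] by simp
      qed
      ultimately show "ereal \<bar>(u (x + r i *\<^sub>R y) - u x) / r i - e \<bullet> y\<bar> \<le> ereal \<epsilon>" by simp
    qed
    then show "?f i < c" using \<epsilon>(2) by (rule order.strict_trans1)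
  qed
qed

lemma blow_up_limitD:
  assumes lim: "blow_up_limit u x r e" and r: "\<And>i. 0 < (r i :: real)" and \<epsilon>: "\<epsilon> > 0"
  shows "\<forall>\<^sub>F i in sequentially. \<forall>y\<in>ball 0 1. \<bar>u (x + r i *\<^sub>R y) - u x - r i * (e \<bullet> y)\<bar> \<le> \<epsilon> * r i"
proof -
  let ?f = "\<lambda>k. SUP y\<in>ball 0 1. ereal \<bar>(u (x + r k *\<^sub>R y) - u x) / r k - e \<bullet> y\<bar>"
  have "\<forall>\<^sub>F k in sequentially. ?f k < ereal \<epsilon>"
    using lim \<epsilon> unfolding blow_up_limit_def by (intro order_tendstoD(2)) auto
  then show ?thesis
  proof (rule eventually_mono)
    fix i assume i: "?f i < ereal \<epsilon>"
    show "\<forall>y\<in>ball 0 1. \<bar>u (x + r i *\<^sub>R y) - u x - r i * (e \<bullet> y)\<bar> \<le> \<epsilon> * r i"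
    proof
      fix y :: 'a assume "y \<in> ball 0 1"
      then have "ereal \<bar>(u (x + r i *\<^sub>R y) - u x) / r i - e \<bullet> y\<bar> \<le> ?f i" by (rule SUP_upper)
      then have "ereal \<bar>(u (x + r i *\<^sub>R y) - u x) / r i - e \<bullet> y\<bar> < ereal \<epsilon>" using i by (rule order.strict_trans1)
      then have "\<bar>(u (x + r i *\<^sub>R y) - u x) / r i - e \<bullet> y\<bar> * r i \<le> \<epsilon> * r i" using r[of i] by simp
      moreover have "\<bar>(u (x + r i *\<^sub>R y) - u x) / r i - e \<bullet> y\<bar> * r i = \<bar>u (x + r i *\<^sub>R y) - u x - r i * (e \<bullet> y)\<bar>"
      proof -
        have "((u (x + r i *\<^sub>R y) - u x) / r i - e \<bullet> y) * r i = u (x + r i *\<^sub>R y) - u x - r i * (e \<bullet> y)"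
          using r[of i] by (simp add: field_simps)
        then show ?thesis using r[of i] by (metis abs_mult abs_of_pos)
      qed
      ultimately show "\<bar>u (x + r i *\<^sub>R y) - u x - r i * (e \<bullet> y)\<bar> \<le> \<epsilon> * r i" by simp
    qed
  qed
qed

lemma linear_at_scale_ball:
  assumes x: "x \<in> \<Omega>" and \<epsilon>: "\<epsilon> > 0"
  shows "\<exists>r0>0. \<forall>r. 0 < r \<and> r < r0 \<longrightarrow> (\<exists>q. H q = S x \<and> (\<forall>y\<in>ball 0 1. \<bar>u (x + r *\<^sub>R y) - u x - r * (q \<bullet> y)\<bar> \<le> \<epsilon> * r))"
proof -
  obtain a b where ab: "a > 0" "b > 0" "\<And>p. L p \<le> b * norm p" "\<And>p. norm p \<le> a * L p" using norm_bounds by blast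
  have eb: "\<epsilon> / b > 0" using \<epsilon> ab by simp
  obtain r0 where r0: "r0 > 0" "\<And>r. 0 < r \<Longrightarrow> r < r0 \<Longrightarrow>
      \<exists>q. H q = S x \<and> (\<forall>y. L y \<le> 1 \<longrightarrow> \<bar>u (x + r *\<^sub>R y) - u x - r * (q \<bullet> y)\<bar> \<le> (\<epsilon> / b) * r)"
    using linear_at_scale[OF x eb] by blast
  have "\<exists>q. H q = S x \<and> (\<forall>y\<in>ball 0 1. \<bar>u (x + r *\<^sub>R y) - u x - r * (q \<bullet> y)\<bar> \<le> \<epsilon> * r)"
    if r: "0 < r" "r < r0 / b" for r
  proof -
    have rb: "0 < b * r" "b * r < r0" using r ab(2) by (auto simp: field_simps)
    obtain q where q: "H q = S x" "\<And>y. L y \<le> 1 \<Longrightarrow> \<bar>u (x + (b * r) *\<^sub>R y) - u x - (b * r) * (q \<bullet> y)\<bar> \<le> (\<epsilon> / b) * (b * r)"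
      using r0(2)[OF rb] by blast
    have "\<bar>u (x + r *\<^sub>R y) - u x - r * (q \<bullet> y)\<bar> \<le> \<epsilon> * r" if y: "y \<in> ball 0 1" for y
    proof -
      have "b * norm y \<le> b * 1" using y ab(2) by (intro mult_left_mono) auto
      then have "L y \<le> b * 1" using ab(3)[of y] by linarith
      then have "L (y /\<^sub>R b) \<le> 1" using ab(2) by (simp add: L.scale field_simps)
      note qq = q(2)[OF this]
      have bb: "b * r * inverse b = r" using ab(2) by (simp add: field_simps)
      have e1: "(b * r) *\<^sub>R (y /\<^sub>R b) = r *\<^sub>R y" unfolding scaleR_scaleR bb ..
      have e2: "(b * r) * (q \<bullet> (y /\<^sub>R b)) = r * (q \<bullet> y)" unfolding inner_scaleR_right mult.assoc[symmetric] bb ..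
      have e3: "(\<epsilon> / b) * (b * r) = \<epsilon> * r" using ab(2) by simp
      show ?thesis using qq unfolding e1 e2 e3 .
    qed
    then show ?thesis using q(1) by blast
  qed
  moreover have "r0 / b > 0" using r0 ab by simp
  ultimately show ?thesis by blast
qed

lemma bounded_H_level: "bounded {q. H q = c}"
proof -
  obtain k where k: "k > 0" "\<And>p. k * norm p \<le> H p" using H.ge_norm by blast
  have "norm q \<le> c / k" if "H q = c" for q using k(2)[of q] k(1) that by (simp add: field_simps)
  then show ?thesis by (auto simp: bounded_iff)
qed

lemma blow_up_exists:
  assumes x: "x \<in> \<Omega>" and r: "\<And>i. 0 < (r i :: real)" "r \<longlonglongrightarrow> 0"
  shows "\<exists>s e. strict_mono (s :: nat \<Rightarrow> nat) \<and> blow_up_limit u x (r \<circ> s) e"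
proof -
  let ?P = "\<lambda>\<epsilon> \<rho> q. H q = S x \<and> (\<forall>y\<in>ball 0 1. \<bar>u (x + \<rho> *\<^sub>R y) - u x - \<rho> * (q \<bullet> y)\<bar> \<le> \<epsilon> * \<rho>)"
  have "\<forall>n. \<exists>r0>0. \<forall>\<rho>. 0 < \<rho> \<and> \<rho> < r0 \<longrightarrow> (\<exists>q. ?P (1 / real (Suc n)) \<rho> q)"
    by (intro allI linear_at_scale_ball[OF x]) simp
  then obtain r0 where r0: "\<And>n. r0 n > 0" "\<And>n \<rho>. 0 < \<rho> \<Longrightarrow> \<rho> < r0 n \<Longrightarrow> \<exists>q. ?P (1 / real (Suc n)) \<rho> q"
    by (metis (no_types, lifting))
  have small: "\<exists>j>i. r j < r0 n" for i n
  proof -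
    have "\<forall>\<^sub>F j in sequentially. r j < r0 n" using r(2) r0(1)[of n] by (rule order_tendstoD(2))
    moreover have "\<forall>\<^sub>F j in sequentially. i < j" by (rule eventually_gt_at_top)
    ultimately have "\<forall>\<^sub>F j in sequentially. i < j \<and> r j < r0 n" by eventually_elim simp
    then show ?thesis using eventually_happens'[OF sequentially_bot] by blast
  qed
  obtain s where s: "\<And>n. r (s n) < r0 n" "\<And>n. s n < s (Suc n)"
    using dependent_nat_choice[of "\<lambda>n i. r i < r0 n" "\<lambda>n i j. i < j"] small by blast
  have sm: "strict_mono s" using s(2) by (simp add: strict_mono_Suc_iff)
  have "\<forall>n. \<exists>q. ?P (1 / real (Suc n)) (r (s n)) q" using r0(2) r(1) s(1) by blast
  then obtain q where q: "\<And>n. ?P (1 / real (Suc n)) (r (s n)) (q n)" by (metis (no_types, lifting))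
  have "bounded (range q)" by (rule bounded_subset[OF bounded_H_level[of "S x"]]) (use q in auto)
  then obtain e t where t: "strict_mono (t :: nat \<Rightarrow> nat)" "(q \<circ> t) \<longlonglongrightarrow> e"
    using bounded_imp_convergent_subsequence by blast
  have "blow_up_limit u x (r \<circ> (s \<circ> t)) e"
  proof (rule blow_up_limitI[OF x])
    show "0 < (r \<circ> (s \<circ> t)) i" for i using r by simp
    fix \<epsilon> :: real assume e: "\<epsilon> > 0"
    have "\<forall>\<^sub>F i in sequentially. dist ((q \<circ> t) i) e < \<epsilon> / 2" by (rule tendstoD[OF t(2)]) (use e in simp)
    moreover have "\<forall>\<^sub>F i in sequentially. 1 / real (Suc i) < \<epsilon> / 2"
      by (rule order_tendstoD(2)[OF LIMSEQ_Suc[OF lim_1_over_n]]) (use e in simp)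
    ultimately show "\<forall>\<^sub>F i in sequentially. \<forall>y\<in>ball 0 1. \<bar>u (x + (r \<circ> (s \<circ> t)) i *\<^sub>R y) - u x - (r \<circ> (s \<circ> t)) i * (e \<bullet> y)\<bar> \<le> \<epsilon> * (r \<circ> (s \<circ> t)) i"
    proof eventually_elim
      case (elim i)
      show ?case
      proof
        fix y :: 'a assume y: "y \<in> ball 0 1"
        let ?\<rho> = "r (s (t i))"
        have \<rho>: "?\<rho> > 0" by (rule r)
        have "1 / real (Suc (t i)) \<le> 1 / real (Suc i)" using seq_suble[OF t(1), of i] by (intro divide_left_mono) auto
        then have "1 / real (Suc (t i)) \<le> \<epsilon> / 2" using elim(2) by linarith
        then have "1 / real (Suc (t i)) * ?\<rho> \<le> \<epsilon> / 2 * ?\<rho>" using \<rho> by (intro mult_right_mono) auto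
        moreover have "\<bar>u (x + ?\<rho> *\<^sub>R y) - u x - ?\<rho> * (q (t i) \<bullet> y)\<bar> \<le> 1 / real (Suc (t i)) * ?\<rho>"
          using q[of "t i"] y by blast
        ultimately have 1: "\<bar>u (x + ?\<rho> *\<^sub>R y) - u x - ?\<rho> * (q (t i) \<bullet> y)\<bar> \<le> \<epsilon> / 2 * ?\<rho>" by linarith
        have "\<bar>(q (t i) - e) \<bullet> y\<bar> \<le> norm (q (t i) - e) * norm y" by (rule Cauchy_Schwarz_ineq2)
        also have "\<dots> \<le> (\<epsilon> / 2) * 1" using elim(1) y e by (intro mult_mono) (auto simp: dist_norm)
        finally have "?\<rho> * \<bar>(q (t i) - e) \<bullet> y\<bar> \<le> ?\<rho> * (\<epsilon> / 2)" using \<rho> by (intro mult_left_mono) auto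
        moreover have "?\<rho> * (q (t i) \<bullet> y) - ?\<rho> * (e \<bullet> y) = ?\<rho> * ((q (t i) - e) \<bullet> y)"
          by (simp add: inner_diff_left right_diff_distrib)
        ultimately have 2: "\<bar>?\<rho> * (q (t i) \<bullet> y) - ?\<rho> * (e \<bullet> y)\<bar> \<le> \<epsilon> / 2 * ?\<rho>"
          using \<rho> by (simp only: abs_mult abs_of_pos mult.commute[of "\<epsilon> / 2"])
        have "\<epsilon> / 2 * ?\<rho> + \<epsilon> / 2 * ?\<rho> = \<epsilon> * ?\<rho>" by (simp add: field_simps)
        then have "\<bar>u (x + ?\<rho> *\<^sub>R y) - u x - ?\<rho> * (e \<bullet> y)\<bar> \<le> \<epsilon> * ?\<rho>" using 1 2 by linarith
        then show "\<bar>u (x + (r \<circ> (s \<circ> t)) i *\<^sub>R y) - u x - (r \<circ> (s \<circ> t)) i * (e \<bullet> y)\<bar> \<le> \<epsilon> * (r \<circ> (s \<circ> t)) i"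
          by simp
      qed
    qed
  qed
  moreover have "strict_mono (s \<circ> t)" using sm t(1) by (rule strict_mono_o)
  ultimately show ?thesis by blast
qed

lemma has_lap: "linear_approximation_property \<Omega> u"
  unfolding linear_approximation_property_def using cont blow_up_exists by blast

lemma blow_up_slope_norm:
  assumes x: "x \<in> \<Omega>" and e: "e \<in> blow_up_slopes u x"
  shows "H e = S x"
proof -
  obtain r s where rs: "\<And>i. 0 < (r i :: real)" "r \<longlonglongrightarrow> 0" "strict_mono (s :: nat \<Rightarrow> nat)" "blow_up_limit u x (r \<circ> s) e"
    using e unfolding blow_up_slopes_def by blast
  obtain b where b: "b > 0" "\<And>p. H p \<le> b * norm p" using H.le_norm by blast
  have pos: "\<And>i. 0 < (r \<circ> s) i" using rs(1) by simp
  have lim0: "(r \<circ> s) \<longlonglongrightarrow> 0" using LIMSEQ_subseq_LIMSEQ[OF rs(2,3)] .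
  have close_e: "\<bar>H e - S x\<bar> \<le> \<epsilon>" if \<epsilon>: "\<epsilon> > 0" for \<epsilon>
  proof -
    define \<tau> where "\<tau> = \<epsilon> / (4 * b)"
    have \<tau>: "\<tau> > 0" "b * (4 * \<tau>) = \<epsilon>" using \<epsilon> b by (auto simp: \<tau>_def)
    obtain r0 where r0: "r0 > 0" "\<And>\<rho>. 0 < \<rho> \<Longrightarrow> \<rho> < r0 \<Longrightarrow>
        \<exists>q. H q = S x \<and> (\<forall>y\<in>ball 0 1. \<bar>u (x + \<rho> *\<^sub>R y) - u x - \<rho> * (q \<bullet> y)\<bar> \<le> \<tau> * \<rho>)"
      using linear_at_scale_ball[OF x \<tau>(1)] by blast
    have "\<forall>\<^sub>F i in sequentially. (r \<circ> s) i < r0" using lim0 r0(1) by (rule order_tendstoD(2))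
    moreover note blow_up_limitD[OF rs(4) pos \<tau>(1)]
    ultimately have "\<forall>\<^sub>F i in sequentially. (r \<circ> s) i < r0 \<and> (\<forall>y\<in>ball 0 1. \<bar>u (x + (r \<circ> s) i *\<^sub>R y) - u x - (r \<circ> s) i * (e \<bullet> y)\<bar> \<le> \<tau> * (r \<circ> s) i)"
      by eventually_elim blast
    then obtain i where i: "(r \<circ> s) i < r0" "\<And>y. y \<in> ball 0 1 \<Longrightarrow> \<bar>u (x + (r \<circ> s) i *\<^sub>R y) - u x - (r \<circ> s) i * (e \<bullet> y)\<bar> \<le> \<tau> * (r \<circ> s) i"
      using eventually_happens'[OF sequentially_bot] by blast
    define \<rho> where "\<rho> = (r \<circ> s) i"
    have \<rho>: "0 < \<rho>" "\<rho> < r0" using i(1) pos[of i] by (simp_all add: \<rho>_def)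
    obtain q where q: "H q = S x" "\<And>y. y \<in> ball 0 1 \<Longrightarrow> \<bar>u (x + \<rho> *\<^sub>R y) - u x - \<rho> * (q \<bullet> y)\<bar> \<le> \<tau> * \<rho>"
      using r0(2)[OF \<rho>] by blast
    have ey: "\<And>y. y \<in> ball 0 1 \<Longrightarrow> \<bar>u (x + \<rho> *\<^sub>R y) - u x - \<rho> * (e \<bullet> y)\<bar> \<le> \<tau> * \<rho>"
      using i(2) by (simp add: \<rho>_def)
    have "norm (e - q) \<le> 4 * \<tau>"
    proof (cases "e = q")
      case False
      define d where "d = e - q"
      have d: "norm d > 0" using False by (simp add: d_def)
      define y where "y = (1 / (2 * norm d)) *\<^sub>R d"
      have y: "y \<in> ball 0 1" using d by (simp add: y_def)
      have "d \<bullet> y = norm d / 2" using d by (simp add: y_def dot_square_norm power2_eq_square)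
      moreover have "\<bar>\<rho> * (e \<bullet> y) - \<rho> * (q \<bullet> y)\<bar> \<le> 2 * (\<tau> * \<rho>)" using q(2)[OF y] ey[OF y] by linarith
      then have "\<rho> * (d \<bullet> y) \<le> \<rho> * (2 * \<tau>)" by (simp add: d_def inner_diff_left algebra_simps)
      then have "d \<bullet> y \<le> 2 * \<tau>" using \<rho>(1) by simp
      ultimately show ?thesis by (simp add: d_def)
    qed (use \<tau> in simp)
    then have "b * norm (e - q) \<le> \<epsilon>" using b(1) \<tau>(2) mult_left_mono[of "norm (e - q)" "4 * \<tau>" b] by simp
    then have "H (e - q) \<le> \<epsilon>" using b(2)[of "e - q"] by linarith
    then show ?thesis using H.tri_diff[of e q] q(1) by linarith
  qed
  have "\<bar>H e - S x\<bar> \<le> 0"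
  proof (rule field_le_epsilon)
    fix \<epsilon> :: real assume "0 < \<epsilon>"
    from close_e[OF this] show "\<bar>H e - S x\<bar> \<le> 0 + \<epsilon>" by simp
  qed
  then show ?thesis by simp
qed

end

section \<open>Thin components: steep slopes\<close>

context comparison
begin

text \<open>
  Slopes increase along a chain, so as long as it stays in the domain its height grows at rate at least
  \<open>S x\<close>, both per step and relative to the distance covered.
\<close>

lemma chain_run:
  assumes "r > 0"
  obtains X where "X 0 = x" "\<And>n. (\<And>k. k < n \<Longrightarrow> LB (X k) r \<subseteq> \<Omega>) \<Longrightarrow> S x \<le> S (X n) \<and> S x * (n * r) \<le> u (X n) - u x \<and> L (X n - x) \<le> n * r"
    "\<And>n. LB (X n) r \<subseteq> \<Omega> \<Longrightarrow> L (X (Suc n) - X n) = r \<and> S (X n) \<le> S (X (Suc n)) \<and>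
      (\<forall>w\<in>closed_segment (X n) (X (Suc n)). S (X n) * L (X (Suc n) - w) \<le> u (X (Suc n)) - u w)"
proof -
  obtain X where X: "X 0 = x" "\<And>n. LB (X n) r \<subseteq> \<Omega> \<Longrightarrow> L (X (Suc n) - X n) = r \<and> S (X n) \<le> S (X (Suc n)) \<and>
      (\<forall>w\<in>closed_segment (X n) (X (Suc n)). S (X n) * L (X (Suc n) - w) \<le> u (X (Suc n)) - u w)"
    using chain[OF assms] by blast
  have "S x \<le> S (X n) \<and> S x * (n * r) \<le> u (X n) - u x \<and> L (X n - x) \<le> n * r" if "\<And>k. k < n \<Longrightarrow> LB (X k) r \<subseteq> \<Omega>" for n
    using that
  proof (induction n)
    case 0 then show ?case using X(1) by simp
  next
    case (Suc n)
    have IH: "S x \<le> S (X n)" "S x * (n * r) \<le> u (X n) - u x" "L (X n - x) \<le> n * r" using Suc by auto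
    have st: "L (X (Suc n) - X n) = r" "S (X n) \<le> S (X (Suc n))" "S (X n) * L (X (Suc n) - X n) \<le> u (X (Suc n)) - u (X n)"
      using X(2)[of n] Suc.prems[of n] by auto
    have "S x * r \<le> S (X n) * r" using IH(1) assms by (intro mult_right_mono) auto
    then have "S x * r \<le> u (X (Suc n)) - u (X n)" using st by simp
    moreover have "S x * (Suc n * r) = S x * (n * r) + S x * r" by (simp add: algebra_simps)
    moreover have "L (X (Suc n) - x) \<le> L (X (Suc n) - X n) + L (X n - x)" by (rule L.tri3)
    moreover have "Suc n * r = n * r + r" by (simp add: algebra_simps)
    ultimately show ?case using IH st by linarith
  qed
  then show thesis using that X by blast
qed

lemma LB_in_cball:
  assumes "a > 0" "\<And>p. norm p \<le> a * L p" "a * r \<le> 1/8" "norm x \<le> 3/4" "cball 0 1 \<subseteq> \<Omega>" "r > 0"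
  shows "LB x r \<subseteq> \<Omega>"
proof
  fix y assume "y \<in> LB x r"
  then have "L (y - x) \<le> r" by (simp add: LB_def)
  then have "a * L (y - x) \<le> a * r" using assms(1) by simp
  then have "norm (y - x) \<le> 1/8" using assms(2)[of "y - x"] assms(3) by linarith
  moreover have "norm y \<le> norm (y - x) + norm x" using norm_triangle_ineq[of "y - x" x] by simp
  ultimately have "norm y \<le> 1" using assms(4) by simp
  then show "y \<in> \<Omega>" using assms(5) by auto
qed

text \<open>
  A component inside a smaller concentric disc would have \<open>u \<le> p \<bullet> z\<close> on its
  boundary, hence inside by comparison.
\<close>

lemma component_reaches_boundary:
  assumes B: "cball 0 1 \<subseteq> \<Omega>" and z: "norm z < 1" "p \<bullet> z < u z" and r: "r < 1"
  shows "\<exists>q\<in>path_component_set {z \<in> ball 0 1. p \<bullet> z < u z} z. r < norm q"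
proof (rule ccontr)
  let ?W = "{z \<in> ball 0 1. p \<bullet> z < u z}" let ?C = "path_component_set ?W z"
  assume neg: "\<not> ?thesis"
  have zW: "z \<in> ?W" using z by simp
  have contu: "continuous_on (ball 0 1) (\<lambda>z. u z - p \<bullet> z)"
    using continuous_on_subset[OF cont] B by (intro continuous_intros) (meson ball_subset_cball order_trans)
  have "?W = ball 0 1 \<inter> (\<lambda>z. u z - p \<bullet> z) -` {0<..}" by auto
  then have oW: "open ?W" using continuous_open_preimage[OF contu open_ball open_greaterThan] by simp
  then have oC: "open ?C" by (rule open_path_component)
  have CW: "?C \<subseteq> ?W" by (rule path_component_subset)
  have zC: "z \<in> ?C" using zW by (simp add: path_component_refl)
  have Cr: "?C \<subseteq> cball 0 r" using neg by force
  have "cball 0 r \<subseteq> \<Omega>" using B r by (meson order.trans less_imp_le subset_cball)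
  then have cC: "?C \<Subset> \<Omega>" using compactly_insideI[OF Cr compact_cball] by blast
  have "u z \<le> 0 + p \<bullet> z"
  proof (rule below_plane[OF oC cC _ zC])
    fix y assume y: "y \<in> frontier ?C"
    have ycl: "y \<in> closure ?C" "y \<notin> ?C" using y oC by (auto simp: frontier_def interior_open)
    have yr: "y \<in> cball 0 r" using ycl(1) Cr closure_minimal[OF Cr closed_cball] by blast
    show "u y \<le> 0 + p \<bullet> y"
    proof (rule ccontr)
      assume "\<not> u y \<le> 0 + p \<bullet> y"
      then have yW: "y \<in> ?W" using yr r by auto
      then obtain e where e: "e > 0" "ball y e \<subseteq> ?W" using oW open_contains_ball by blast
      have "y \<in> ball y e" using e(1) by simp
      then obtain c where c: "c \<in> ?C" "c \<in> ball y e" using ycl(1) e(1) by (auto simp: closure_approachable dist_commute)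
      have "path_component ?W c y"
      proof (rule path_component_of_subset[OF e(2)])
        show "path_component (ball y e) c y"
          using convex_imp_path_connected[OF convex_ball] c(2) \<open>y \<in> ball y e\<close> unfolding path_connected_component by blast
      qed
      then have "y \<in> ?C" using c(1) path_component_trans by blast
      then show False using ycl(2) by simp
    qed
  qed
  then show False using z by simp
qed

end

text \<open>
  The function is \<open>lam\<close>-close to the linear function with slope \<open>e\<close> on the
  unit disc, and \<open>p\<close> is another slope at distance at least \<open>\<epsilon>\<close>. The
  parameter \<open>\<nu>\<close> quantifies strict convexity as in \<open>near_extremal\<close>; the
  smallness conditions on \<open>lam\<close> collect what the geometric constructions below consume.
\<close>

locale planar = comparison H \<Omega> u for H :: "complex \<Rightarrow> real" and \<Omega> u +
  fixes e p :: complex and lam \<nu> \<epsilon> a k :: real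
  assumes unit: "cball 0 1 \<subseteq> \<Omega>"
    and close: "\<And>z. z \<in> cball 0 1 \<Longrightarrow> \<bar>u z - e \<bullet> z\<bar> \<le> lam"
    and lam: "lam > 0" and \<nu>: "\<nu> > 0" "\<nu> < H e" and \<epsilon>: "\<epsilon> > 0"
    and sc: "\<And>q. H q \<le> H e + 2 * \<nu> \<Longrightarrow> H e - 2 * \<nu> \<le> H ((q + e) /\<^sub>R 2) \<Longrightarrow> norm (q - e) < \<epsilon>"
    and pe: "\<epsilon> \<le> norm (e - p)"
    and a: "a > 0" "\<And>p. norm p \<le> a * L p"
    and k: "k > 0" "\<And>p. norm p \<le> k * H p"
    and small1: "32 * a * lam \<le> \<nu>"
    and small2: "lam \<le> \<epsilon> / 4"
    and small3: "a * (6 * lam / \<nu> + 2 * ((2 * k * H e * a * (6 * lam / \<nu>)) + 4 * lam) / \<nu>) \<le> 1 / 16"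
begin

definition W where "W = {z \<in> ball 0 1. p \<bullet> z < u z}"

definition v where "v z = u z - p \<bullet> z"

lemma v_cont: "continuous_on (cball 0 1) v"
  unfolding v_def using continuous_on_subset[OF cont unit] by (intro continuous_intros)

lemma v_unif:
  assumes "m > 0" obtains d where "d > 0" "\<And>w w'. w \<in> cball 0 1 \<Longrightarrow> w' \<in> cball 0 1 \<Longrightarrow> norm (w - w') < d \<Longrightarrow> \<bar>v w - v w'\<bar> < m"
proof -
  have "uniformly_continuous_on (cball 0 1) v" by (rule compact_uniformly_continuous[OF v_cont compact_cball])
  then obtain d where "d > 0" "\<forall>x\<in>cball 0 1. \<forall>x'\<in>cball 0 1. dist x' x < d \<longrightarrow> dist (v x') (v x) < m"
    using assms unfolding uniformly_continuous_on_def by blast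
  then show thesis using that[of d] by (simp add: dist_norm)
qed

lemma segment_in_component:
  assumes "z \<in> path_component_set W z0" "closed_segment z y \<subseteq> W"
  shows "y \<in> path_component_set W z0"
proof -
  have "path_component W z y" unfolding path_component_def
    by (rule exI[of _ "linepath z y"]) (use assms(2) in auto)
  then show ?thesis using assms(1) path_component_trans by blast
qed

text \<open>
  Once a chain of slope at least \<open>H p\<close> has entered a component of \<open>{p \<bullet> z < u
  z}\<close> with margin \<open>m\<close>, it stays there: along the chain \<open>u\<close> increases at
  least as fast as \<open>p \<bullet> z\<close> can, and the steps are too short to lose the margin in
  between.
\<close>

lemma stays:
  assumes r: "r > 0" "a * r \<le> 1/8" "a * r < d"
    and d: "\<And>w w'. w \<in> cball 0 1 \<Longrightarrow> w' \<in> cball 0 1 \<Longrightarrow> norm (w - w') < d \<Longrightarrow> \<bar>v w - v w'\<bar> < m"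
    and X: "\<And>n. LB (X n) r \<subseteq> \<Omega> \<Longrightarrow> L (X (Suc n) - X n) = r \<and> S (X n) \<le> S (X (Suc n)) \<and>
      (\<forall>w\<in>closed_segment (X n) (X (Suc n)). S (X n) * L (X (Suc n) - w) \<le> u (X (Suc n)) - u w)"
    and j: "X j \<in> path_component_set W z0" "m \<le> v (X j)" "H p \<le> S (X j)"
    and n: "j \<le> n" "\<And>i. j \<le> i \<Longrightarrow> i < n \<Longrightarrow> norm (X i) \<le> 3/4"
  shows "X n \<in> path_component_set W z0 \<and> m \<le> v (X n) \<and> H p \<le> S (X n)"
  using n
proof (induction n rule: dec_induct)
  case base then show ?case using j by simp
next
  case (step n)
  have IH: "X n \<in> path_component_set W z0" "m \<le> v (X n)" "H p \<le> S (X n)" using step by auto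
  have nX: "norm (X n) \<le> 3/4" using step by simp
  have LBX: "LB (X n) r \<subseteq> \<Omega>" by (rule LB_in_cball[OF a r(2) nX unit r(1)])
  note st = X[OF LBX]
  have Ls: "L (X (Suc n) - X n) = r" using st by blast
  have "u (X (Suc n)) - u (X n) \<ge> S (X n) * r" using st by (metis ends_in_segment(1))
  moreover have "S (X n) * r \<ge> H p * r" using IH(3) r(1) by simp
  moreover have "p \<bullet> (X (Suc n) - X n) \<le> H p * r" using inner_le[of p "X (Suc n) - X n"] Ls by simp
  ultimately have v1: "m \<le> v (X (Suc n))" using IH(2) by (simp add: v_def inner_diff_right)
  have seg: "closed_segment (X n) (X (Suc n)) \<subseteq> W"
  proof
    fix w assume w: "w \<in> closed_segment (X n) (X (Suc n))"
    have nw: "norm (w - X n) \<le> a * r"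
    proof -
      have "norm (w - X n) \<le> norm (X (Suc n) - X n)" using w segment_bound(1)[of w "X n" "X (Suc n)"] by (simp add: norm_minus_commute)
      also have "\<dots> \<le> a * r" using a(2)[of "X (Suc n) - X n"] Ls by simp
      finally show ?thesis .
    qed
    have "norm w \<le> norm (w - X n) + norm (X n)" using norm_triangle_ineq[of "w - X n" "X n"] by simp
    then have wn: "norm w < 1" using nw r(2) nX by linarith
    have "\<bar>v w - v (X n)\<bar> < m" using wn nX nw r(3) by (intro d) auto
    then have "v w > 0" using IH(2) by linarith
    then show "w \<in> W" using wn by (simp add: W_def v_def)
  qed
  then have "X (Suc n) \<in> path_component_set W z0" by (rule segment_in_component[OF IH(1)])
  moreover have "H p \<le> S (X (Suc n))" using st IH(3) by linarith
  ultimately show ?case using v1 by simp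
qed

text \<open>
  If \<open>e\<close> and \<open>p\<close> both nearly attain the dual norm in a common direction
  \<open>w\<close>, so does their midpoint, which contradicts \<open>near_extremal\<close>.
\<close>

lemma contradiction_if_parallel:
  assumes h: "H e - \<nu> \<le> H p" and w: "1 / (8 * a) \<le> L w" "H p * L w - 4 * lam \<le> e \<bullet> w" "H p * L w - 4 * lam \<le> p \<bullet> w"
  shows False
proof -
  have a8: "1 / (8 * a) > 0" using a by simp
  then have Lw: "L w > 0" using w(1) by linarith
  have "4 * lam * (8 * a) \<le> \<nu>" using small1 by (simp add: mult.commute mult.left_commute)
  then have "4 * lam \<le> \<nu> * (1 / (8 * a))" using a(1) by (simp add: field_simps)
  also have "\<dots> \<le> \<nu> * L w" using w(1) \<nu> by (intro mult_left_mono) auto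
  finally have l4: "4 * lam \<le> \<nu> * L w" .
  have "H p * L w \<le> H e * L w + \<nu> * L w" using w(2) inner_le[of e w] l4 by linarith
  then have "H p * L w \<le> (H e + \<nu>) * L w" by (simp add: distrib_right)
  then have 1: "H p \<le> H e + \<nu>" using Lw by simp
  have "((p + e) /\<^sub>R 2) \<bullet> w = (p \<bullet> w + e \<bullet> w) / 2" by (simp add: inner_add_left)
  then have "H p * L w - 4 * lam \<le> ((p + e) /\<^sub>R 2) \<bullet> w" using w(2,3) by simp
  also have "\<dots> \<le> H ((p + e) /\<^sub>R 2) * L w" by (rule inner_le)
  finally have "(H p - \<nu>) * L w \<le> H ((p + e) /\<^sub>R 2) * L w" using l4 by (simp add: left_diff_distrib)
  then have "H p - \<nu> \<le> H ((p + e) /\<^sub>R 2)" using Lw by simp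
  then have "norm (p - e) < \<epsilon>" using 1 h \<nu> by (intro sc) auto
  then show False using pe by (simp add: norm_minus_commute)
qed

text \<open>
  Suppose the component of \<open>z1\<close> stays in the strip where \<open>e \<bullet> z\<close> and
  \<open>p \<bullet> z\<close> are nearly equal, and \<open>p\<close> is nearly as steep as
  \<open>e\<close>. Walk from \<open>z1\<close> against the direction \<open>d\<close> in which
  \<open>p\<close> attains its norm. Either the whole walk stays in the component, or \<open>u - p
  \<bullet> z\<close> drops by half along it, so that some point on the way has slope larger than
  \<open>H p\<close>, and an ascending chain from there stays in the component for a long distance. In
  both cases the component contains a long vector along which \<open>p\<close>, and by thinness also
  \<open>e\<close>, nearly attains its norm.
\<close>

lemma thin_impossible_large:
  assumes h: "H e - \<nu> \<le> H p" and z1: "norm z1 \<le> 1/8" "p \<bullet> z1 < u z1"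
    and thin: "\<And>q. q \<in> path_component_set W z1 \<Longrightarrow> (e - p) \<bullet> q \<le> lam"
  shows False
proof -
  let ?C = "path_component_set W z1"
  have z1W: "z1 \<in> W" using z1 by (simp add: W_def)
  have z1C: "z1 \<in> ?C" using z1W by (simp add: path_component_refl)
  have CW: "?C \<subseteq> W" by (rule path_component_subset)
  have strip: "\<bar>(e - p) \<bullet> q\<bar> \<le> lam" if "q \<in> ?C" for q
  proof -
    have "q \<in> W" using that CW by blast
    then have "p \<bullet> q < u q" "u q \<le> e \<bullet> q + lam" using close[of q] by (auto simp: W_def abs_le_iff)
    then show ?thesis using thin[OF that] by (simp add: inner_diff_left abs_le_iff)
  qed
  have strip2: "\<bar>(e - p) \<bullet> (q - q')\<bar> \<le> 2 * lam" if "q \<in> ?C" "q' \<in> ?C" for q q'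
    using strip[OF that(1)] strip[OF that(2)] by (simp add: inner_diff_right abs_le_iff)
  have hpos: "H p > 0" using h \<nu> by linarith
  obtain d where d: "L d = 1" "p \<bullet> d = H p" using primal_attained by blast
  have nd: "norm d \<le> a" using a(2)[of d] d by simp
  define t1 where "t1 = 3 / (8 * a)"
  have t1: "t1 > 0" "t1 * a = 3/8" "1 / (8 * a) \<le> t1" using a by (auto simp: t1_def field_simps)
  define c where "c t = z1 - t *\<^sub>R d" for t
  have cn: "norm (c t) \<le> 1/2" if "0 \<le> t" "t \<le> t1" for t
  proof -
    have "norm (t *\<^sub>R d) \<le> t1 * a" using that nd by (simp add: mult_mono)
    then show ?thesis using z1(1) t1(2) norm_triangle_ineq4[of z1 "t *\<^sub>R d"] by (simp add: c_def)
  qed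
  have contg: "continuous_on {0..t1} (\<lambda>t. v (c t))"
  proof (rule continuous_on_compose2[OF v_cont])
    show "continuous_on {0..t1} c" unfolding c_def by (intro continuous_intros)
    show "c ` {0..t1} \<subseteq> cball 0 1" using cn by fastforce
  qed
  have cW: "c t \<in> W" if "0 \<le> t" "t \<le> t1" "v (c t) > 0" for t
    using cn[OF that(1,2)] that(3) by (simp add: W_def v_def)
  have segC: "c t \<in> ?C" if "0 \<le> t" "\<And>s. 0 \<le> s \<Longrightarrow> s \<le> t \<Longrightarrow> c s \<in> W" for t
  proof (rule segment_in_component[OF z1C])
    show "closed_segment z1 (c t) \<subseteq> W"
    proof
      fix w assume "w \<in> closed_segment z1 (c t)"
      then obtain s where s: "0 \<le> s" "s \<le> 1" "w = (1 - s) *\<^sub>R z1 + s *\<^sub>R c t" by (auto simp: closed_segment_def)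
      have "w = c (s * t)" by (simp add: s c_def algebra_simps)
      moreover have "0 \<le> s * t" "s * t \<le> t" using s that(1) by (auto intro: mult_left_le_one_le)
      ultimately show "w \<in> W" using that(2) by simp
    qed
  qed
  show False
  proof (cases "\<forall>t\<in>{0..t1}. v (c t) > 0")
    case True
    then have cC: "c t1 \<in> ?C" using cW t1(1) by (intro segC) auto
    define w where "w = t1 *\<^sub>R d"
    have "z1 - c t1 = w" by (simp add: c_def w_def)
    then have s: "\<bar>(e - p) \<bullet> w\<bar> \<le> 2 * lam" using strip2[OF z1C cC] by simp
    have Lw: "L w = t1" using d t1(1) by (simp add: L.scale w_def)
    have pw: "p \<bullet> w = H p * L w" using d(2) Lw by (simp add: w_def)
    show False
    proof (rule contradiction_if_parallel[OF h])
      show "1 / (8 * a) \<le> L w" using Lw t1(3) by simp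
      show "H p * L w - 4 * lam \<le> p \<bullet> w" using pw lam by simp
      show "H p * L w - 4 * lam \<le> e \<bullet> w" using pw lam s by (simp add: inner_diff_left abs_le_iff)
    qed
  next
    case False
    \<comment> \<open>the first time at which \<open>u - p \<bullet> z\<close> has dropped to half of its initial value\<close>
    define g0 where "g0 = v z1"
    have g0: "g0 > 0" using z1 by (simp add: g0_def v_def)
    let ?A = "{t \<in> {0..t1}. v (c t) \<le> g0 / 2}"
    have neA: "?A \<noteq> {}" using False g0 by force
    have "closed ?A" using continuous_closed_preimage[OF contg closed_atLeastAtMost closed_atMost[of "g0/2"]]
      by (simp add: vimage_def Int_def)
    moreover have "{0..t1} \<inter> ?A = ?A" by blast
    ultimately have cA: "compact ?A" using compact_Int_closed[OF compact_Icc[of 0 t1], of ?A] by simp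
    obtain t0 where t0: "t0 \<in> ?A" "\<And>t. t \<in> ?A \<Longrightarrow> t0 \<le> t" using compact_attains_inf[OF cA neA] by blast
    have t0r: "0 \<le> t0" "t0 \<le> t1" "v (c t0) \<le> g0 / 2" using t0(1) by auto
    have c0: "v (c 0) = g0" by (simp add: c_def g0_def)
    have before: "v (c t) > g0 / 2" if "0 \<le> t" "t < t0" for t
      using t0(2)[of t] that t0r by force
    have ge: "v (c t0) \<ge> g0 / 2"
    proof (rule ccontr)
      assume lt: "\<not> ?thesis"
      then have "v (c t0) \<le> g0 / 2" "g0 / 2 \<le> v (c 0)" using c0 g0 by auto
      then obtain t where t: "0 \<le> t" "t \<le> t0" "v (c t) = g0 / 2"
        using IVT2'[of "\<lambda>t. v (c t)" t0 "g0/2" 0] continuous_on_subset[OF contg, of "{0..t0}"] t0r by auto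
      then have "t0 \<le> t" using t0(2)[of t] t0r by auto
      then show False using t lt by auto
    qed
    have t0pos: "t0 > 0" using t0r c0 g0 by (cases "t0 = 0") auto
    have inW: "c t \<in> W" if "0 \<le> t" "t \<le> t0" for t
    proof (rule cW)
      show "v (c t) > 0" using before[of t] ge g0 that by (cases "t = t0") auto
    qed (use that t0r in auto)
    have diff: "z1 - c t0 = t0 *\<^sub>R d" by (simp add: c_def)
    have Ld: "L (z1 - c t0) = t0" using diff d t0pos by (simp add: L.scale)
    define \<sigma> where "\<sigma> = (u z1 - u (c t0)) / t0"
    have "u z1 - u (c t0) = (v z1 - v (c t0)) + p \<bullet> (z1 - c t0)" by (simp add: v_def inner_diff_right)
    also have "p \<bullet> (z1 - c t0) = H p * t0" using diff d(2) by simp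
    finally have "u z1 - u (c t0) > H p * t0" using t0r(3) g0 by (simp add: g0_def)
    then have \<sigma>: "\<sigma> > H p" using t0pos by (simp add: \<sigma>_def field_simps)
    have segW: "closed_segment (c t0) z1 \<subseteq> W"
    proof
      fix w assume "w \<in> closed_segment (c t0) z1"
      then obtain s where s: "0 \<le> s" "s \<le> 1" "w = (1 - s) *\<^sub>R c t0 + s *\<^sub>R z1" by (auto simp: closed_segment_def)
      have "w = c ((1 - s) * t0)" by (simp add: s c_def algebra_simps)
      moreover have "0 \<le> (1 - s) * t0" "(1 - s) * t0 \<le> t0" using s t0pos by (auto intro: mult_left_le_one_le)
      ultimately show "w \<in> W" using inW by simp
    qed
    have W\<Omega>: "W \<subseteq> \<Omega>" using unit by (force simp: W_def)
    have "\<exists>y\<in>closed_segment (c t0) z1. \<sigma> \<le> S y"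
    proof (rule segment_slope)
      show "closed_segment (c t0) z1 \<subseteq> \<Omega>" using segW W\<Omega> by blast
      show "c t0 \<noteq> z1" using Ld t0pos by force
      show "\<sigma> * L (z1 - c t0) \<le> u z1 - u (c t0)" using Ld t0pos by (simp add: \<sigma>_def)
    qed
    then obtain y where y: "y \<in> closed_segment (c t0) z1" "\<sigma> \<le> S y" by blast
    have yC: "y \<in> ?C"
    proof (rule segment_in_component[OF z1C])
      have "closed_segment z1 y \<subseteq> closed_segment (c t0) z1" using y(1) by (simp add: subset_closed_segment)
      then show "closed_segment z1 y \<subseteq> W" using segW by blast
    qed
    have ny: "norm y \<le> 1/2"
    proof -
      have "closed_segment (c t0) z1 \<subseteq> cball 0 (1/2)"
        using cn[of t0] t0r z1(1) by (intro closed_segment_subset) auto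
      then show ?thesis using y(1) by auto
    qed
    define m where "m = v y"
    have m: "m > 0" using yC CW by (force simp: m_def v_def W_def)
    obtain dd where dd: "dd > 0" "\<And>w w'. w \<in> cball 0 1 \<Longrightarrow> w' \<in> cball 0 1 \<Longrightarrow> norm (w - w') < dd \<Longrightarrow> \<bar>v w - v w'\<bar> < m"
      using v_unif[OF m] by blast
    define r where "r = min (1 / (8 * a)) (dd / (2 * a))"
    have r: "r > 0" "a * r \<le> 1/8" "a * r < dd"
    proof -
      show "r > 0" using a dd by (simp add: r_def)
      have "r \<le> 1 / (8 * a)" "r \<le> dd / (2 * a)" unfolding r_def by (rule min.cobounded1, rule min.cobounded2)
      then have "a * r \<le> 1/8" "a * r \<le> dd / 2" using a(1) by (auto simp: field_simps)
      then show "a * r \<le> 1/8" "a * r < dd" using dd(1) by auto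
    qed
    obtain X where X: "X 0 = y" "\<And>n. (\<And>k. k < n \<Longrightarrow> LB (X k) r \<subseteq> \<Omega>) \<Longrightarrow> S y \<le> S (X n) \<and> S y * (n * r) \<le> u (X n) - u y \<and> L (X n - y) \<le> n * r"
      "\<And>n. LB (X n) r \<subseteq> \<Omega> \<Longrightarrow> L (X (Suc n) - X n) = r \<and> S (X n) \<le> S (X (Suc n)) \<and>
      (\<forall>w\<in>closed_segment (X n) (X (Suc n)). S (X n) * L (X (Suc n) - w) \<le> u (X (Suc n)) - u w)"
      using chain_run[OF r(1), of y] by blast
    have Sy: "S y > 0" using \<sigma> y(2) hpos by linarith
    \<comment> \<open>the chain cannot stay in a small disc, since its height is unbounded\<close>
    have "\<exists>n. norm (X n) > 5/8"
    proof (rule ccontr)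
      assume "\<not> ?thesis"
      then have all: "norm (X n) \<le> 5/8" for n by (auto simp: not_less)
      have LBX: "LB (X k) r \<subseteq> \<Omega>" for k by (rule LB_in_cball[OF a r(2) _ unit r(1)]) (use all[of k] in simp)
      have bd: "u (X n) - u y \<le> 2 * norm e + 2 * lam" for n
      proof -
        have "\<bar>u (X n) - e \<bullet> X n\<bar> \<le> lam" "\<bar>u y - e \<bullet> y\<bar> \<le> lam" using all[of n] ny by (auto intro!: close)
        moreover have "norm e * norm (X n) \<le> norm e * 1" "norm e * norm y \<le> norm e * 1"
          using all[of n] ny by (intro mult_left_mono; simp)+
        moreover note Cauchy_Schwarz_ineq2[of e "X n"] Cauchy_Schwarz_ineq2[of e y]
        ultimately show ?thesis by linarith
      qed
      obtain n :: nat where n: "(2 * norm e + 2 * lam) / (S y * r) < n" using reals_Archimedean2 by blast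
      have "S y * (n * r) \<le> 2 * norm e + 2 * lam" using X(2)[of n] LBX bd[of n] by force
      moreover have "2 * norm e + 2 * lam < n * (S y * r)" using n Sy r(1) by (simp add: pos_divide_less_eq)
      ultimately show False by (simp add: mult.commute mult.left_commute)
    qed
    define N where "N = (LEAST n. norm (X n) > 5/8)"
    have N: "norm (X N) > 5/8" unfolding N_def using \<open>\<exists>n. norm (X n) > 5/8\<close> by (rule LeastI_ex)
    have less: "norm (X i) \<le> 5/8" if "i < N" for i using not_less_Least that unfolding N_def by force
    have LBX: "LB (X i) r \<subseteq> \<Omega>" if "i < N" for i
      by (rule LB_in_cball[OF a r(2) _ unit r(1)]) (use less[OF that] in simp)
    have "X N \<in> ?C \<and> m \<le> v (X N) \<and> H p \<le> S (X N)"
    proof (rule stays[where X = X and d = dd and m = m and r = r and j = 0 and n = N])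
      show "0 < r" "a * r \<le> 1/8" "a * r < dd" by (fact r)+
      show "X 0 \<in> ?C" "m \<le> v (X 0)" "H p \<le> S (X 0)" using X(1) yC y(2) \<sigma> by (simp_all add: m_def)
      show "norm (X i) \<le> 3/4" if "i < N" for i using less[OF that] by simp
    qed (use dd(2) X(3) in auto)
    then have XN: "X N \<in> ?C" by blast
    have run: "S y * (N * r) \<le> u (X N) - u y" "L (X N - y) \<le> N * r" using X(2)[of N] LBX by auto
    let ?w = "X N - y"
    have "1/8 \<le> norm ?w" using N ny norm_triangle_ineq2[of "X N" y] by linarith
    then have "1/8 \<le> a * L ?w" using a(2)[of ?w] by linarith
    then have w1: "1 / (8 * a) \<le> L ?w" using a(1) by (simp add: field_simps)
    have "H p * L ?w \<le> S y * (N * r)" using run(2) y(2) \<sigma> hpos Sy by (intro mult_mono) auto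
    then have up: "H p * L ?w \<le> u (X N) - u y" using run(1) by linarith
    have "norm (X N) < 1" using XN CW by (auto simp: W_def)
    then have "\<bar>u (X N) - e \<bullet> X N\<bar> \<le> lam" "\<bar>u y - e \<bullet> y\<bar> \<le> lam" using ny by (auto intro!: close)
    then have ew: "H p * L ?w - 2 * lam \<le> e \<bullet> ?w" using up by (simp add: inner_diff_right abs_le_iff)
    have pw: "H p * L ?w - 4 * lam \<le> p \<bullet> ?w" using ew strip2[OF XN yC] by (simp add: inner_diff_left abs_le_iff)
    show False by (rule contradiction_if_parallel[OF h w1 _ pw]) (use ew lam in linarith)
  qed
qed

end

section \<open>Thin components: flat slopes\<close>

text \<open>
  The image is contained in, not equal to, the union of the edges together with \<open>X 0\<close>,
  which covers the case without edges.
\<close>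

lemma polygon_path:
  fixes X :: "nat \<Rightarrow> 'a::real_normed_vector"
  shows "\<exists>g. path g \<and> pathstart g = X 0 \<and> pathfinish g = X N \<and> path_image g \<subseteq> insert (X 0) (\<Union>i<N. closed_segment (X i) (X (Suc i)))"
proof (induction N)
  case 0
  show ?case
    by (rule exI[of _ "\<lambda>_. X 0"]) (auto simp: path_def pathstart_def pathfinish_def path_image_def)
next
  case (Suc N)
  then obtain g where g: "path g" "pathstart g = X 0" "pathfinish g = X N"
    "path_image g \<subseteq> insert (X 0) (\<Union>i<N. closed_segment (X i) (X (Suc i)))" by blast
  let ?h = "g +++ linepath (X N) (X (Suc N))"
  have "path ?h" "pathstart ?h = X 0" "pathfinish ?h = X (Suc N)" using g by auto
  moreover have "path_image ?h \<subseteq> insert (X 0) (\<Union>i<Suc N. closed_segment (X i) (X (Suc i)))"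
    using g by (auto simp: path_image_join lessThan_Suc)
  ultimately show ?case by blast
qed

text \<open>
  In the coordinates \<open>k \<bullet> z\<close> and \<open>d \<bullet> z\<close>, a path along a strip
  and a path across it meet inside a rectangle, by Fashoda's theorem.
\<close>

lemma paths_cross_strip:
  fixes \<gamma> g :: "real \<Rightarrow> complex" and k d :: complex
  assumes \<gamma>: "path \<gamma>" "k \<bullet> pathstart \<gamma> \<le> 1/4" "3/4 \<le> k \<bullet> pathfinish \<gamma>" "\<And>z. z \<in> path_image \<gamma> \<Longrightarrow> \<bar>d \<bullet> z\<bar> \<le> l"
    and g: "path g" "\<And>z. z \<in> path_image g \<Longrightarrow> 1/4 < k \<bullet> z \<and> k \<bullet> z < 3/4" "d \<bullet> pathstart g \<le> - 2 * l" "2 * l \<le> d \<bullet> pathfinish g"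
    and l: "l > 0" and eq: "\<And>z w. k \<bullet> z = k \<bullet> w \<Longrightarrow> d \<bullet> z = d \<bullet> w \<Longrightarrow> z = w"
  shows "\<exists>z. z \<in> path_image \<gamma> \<and> z \<in> path_image g"
proof -
  define \<Phi> :: "complex \<Rightarrow> real^2" where "\<Phi> z = vector [max (1/4) (min (3/4) (k \<bullet> z)), max (- 2 * l) (min (2 * l) (d \<bullet> z))]" for z
  have \<Phi>1: "\<Phi> z $ 1 = max (1/4) (min (3/4) (k \<bullet> z))" and \<Phi>2: "\<Phi> z $ 2 = max (- 2 * l) (min (2 * l) (d \<bullet> z))" for z
    by (simp_all add: \<Phi>_def)
  have cont: "continuous_on UNIV \<Phi>"
  proof -
    have "continuous_on UNIV (\<lambda>z. \<Phi> z $ i)" for i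
    proof -
      have "i = 1 \<or> i = 2" by (rule exhaust_2)
      then show ?thesis
        by (elim disjE) (simp_all only: \<Phi>1 \<Phi>2, (intro continuous_intros)+)
    qed
    then have "continuous_on UNIV (\<lambda>z. \<chi> i. \<Phi> z $ i)" by (rule continuous_on_vec_lambda)
    then show ?thesis by (simp only: vec_nth_inverse)
  qed
  let ?a = "vector [1/4, - 2 * l] :: real^2" and ?b = "vector [3/4, 2 * l] :: real^2"
  have box: "\<Phi> z \<in> cbox ?a ?b" for z
    using l by (auto simp: mem_box_cart forall_2 \<Phi>1 \<Phi>2)
  have p1: "path (\<Phi> \<circ> \<gamma>)" "path (\<Phi> \<circ> g)"
    using \<gamma>(1) g(1) continuous_on_subset[OF cont] by (auto intro!: path_continuous_image)
  obtain w where w: "w \<in> path_image (\<Phi> \<circ> \<gamma>)" "w \<in> path_image (\<Phi> \<circ> g)"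
  proof (rule fashoda[OF p1, of ?a ?b])
    show "path_image (\<Phi> \<circ> \<gamma>) \<subseteq> cbox ?a ?b" "path_image (\<Phi> \<circ> g) \<subseteq> cbox ?a ?b"
      using box by (auto simp: path_image_def)
    show "pathstart (\<Phi> \<circ> \<gamma>) $ 1 = ?a $ 1" "pathfinish (\<Phi> \<circ> \<gamma>) $ 1 = ?b $ 1"
      using \<gamma>(2,3) by (auto simp: pathstart_compose pathfinish_compose \<Phi>1)
    show "pathstart (\<Phi> \<circ> g) $ 2 = ?a $ 2" "pathfinish (\<Phi> \<circ> g) $ 2 = ?b $ 2"
      using g(3,4) l by (auto simp: pathstart_compose pathfinish_compose \<Phi>2)
  qed blast
  obtain z z' where z: "z \<in> path_image \<gamma>" "z' \<in> path_image g" "\<Phi> z = w" "\<Phi> z' = w"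
    using w by (auto simp: path_image_compose)
  have "\<Phi> z $ 1 = \<Phi> z' $ 1" "\<Phi> z $ 2 = \<Phi> z' $ 2" using z by simp_all
  then have "max (1/4) (min (3/4) (k \<bullet> z)) = max (1/4) (min (3/4) (k \<bullet> z'))"
    "max (- 2 * l) (min (2 * l) (d \<bullet> z)) = max (- 2 * l) (min (2 * l) (d \<bullet> z'))" unfolding \<Phi>1 \<Phi>2 .
  then have "k \<bullet> z = k \<bullet> z'" "d \<bullet> z = d \<bullet> z'"
    using g(2)[OF z(2)] \<gamma>(4)[OF z(1)] l by (auto simp: max_def min_def abs_le_iff split: if_splits)
  then have "z = z'" by (rule eq)
  then show ?thesis using z by blast
qed

text \<open>
  Orthogonal coordinates adapted to the line \<open>d \<bullet> z = 0\<close>, which has direction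
  \<open>k\<close>.
\<close>

lemma complex_decomp:
  fixes d z :: complex
  assumes "d \<noteq> 0"
  defines "k \<equiv> \<i> * d / of_real (norm d)"
  shows "(norm z)\<^sup>2 = (d \<bullet> z)\<^sup>2 / (norm d)\<^sup>2 + (k \<bullet> z)\<^sup>2" "norm k = 1" "d \<bullet> k = 0"
    "\<And>z w. k \<bullet> z = k \<bullet> w \<Longrightarrow> d \<bullet> z = d \<bullet> w \<Longrightarrow> z = w"
proof -
  have nd: "norm d > 0" using assms by simp
  have *: "(norm z)\<^sup>2 = (d \<bullet> z)\<^sup>2 / (norm d)\<^sup>2 + (k \<bullet> z)\<^sup>2" for z
  proof -
    have Rek: "Re k = - Im d / norm d" and Imk: "Im k = Re d / norm d" by (simp_all add: k_def)
    have kz: "k \<bullet> z = (Re d * Im z - Im d * Re z) / norm d"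
      unfolding inner_complex_def Rek Imk by (simp add: diff_divide_distrib)
    have "(norm d)\<^sup>2 * (norm z)\<^sup>2 = (d \<bullet> z)\<^sup>2 + (Re d * Im z - Im d * Re z)\<^sup>2"
      unfolding cmod_power2 inner_complex_def by (simp add: power2_eq_square algebra_simps)
    then have "(norm z)\<^sup>2 = ((d \<bullet> z)\<^sup>2 + (Re d * Im z - Im d * Re z)\<^sup>2) / (norm d)\<^sup>2" using nd by (simp add: field_simps)
    then show ?thesis by (simp add: kz power_divide add_divide_distrib)
  qed
  show "(norm z)\<^sup>2 = (d \<bullet> z)\<^sup>2 / (norm d)\<^sup>2 + (k \<bullet> z)\<^sup>2" by (rule *)
  show "norm k = 1" using nd by (simp add: k_def norm_mult norm_divide)
  show "d \<bullet> k = 0" unfolding k_def inner_complex_def by (simp add: field_simps)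
  fix z w assume "k \<bullet> z = k \<bullet> w" "d \<bullet> z = d \<bullet> w"
  then have "(norm (z - w))\<^sup>2 = 0" using *[of "z - w"] by (simp add: inner_diff_right)
  then show "z = w" by simp
qed

context planar
begin

text \<open>
  If \<open>p\<close> is flatter than \<open>e\<close>, ascending chains of slope close to \<open>H
  e\<close> overtake \<open>p \<bullet> z\<close>. By \<open>component_reaches_boundary\<close> a
  component confined to the strip runs along it to nearly the boundary of the disc. Near a point
  \<open>P0\<close> halfway along the strip there is a point of slope at least \<open>H e - \<nu> /
  2\<close> on the side of the strip where \<open>e \<bullet> z < p \<bullet> z\<close>, and an
  ascending chain from there crosses the strip, because \<open>u\<close> gains on \<open>p \<bullet>
  z\<close> at rate at least \<open>\<nu> / 2\<close>. It meets the component in the crossing and, by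
  \<open>stays\<close>, remains in it until it has left the strip on the other side.
\<close>

lemma thin_impossible_small:
  assumes h: "H p < H e - \<nu>" and z1: "norm z1 \<le> 1/8" "p \<bullet> z1 < u z1"
    and thin: "\<And>q. q \<in> path_component_set W z1 \<Longrightarrow> (e - p) \<bullet> q \<le> lam"
  shows False
proof -
  let ?C = "path_component_set W z1"
  have z1W: "z1 \<in> W" using z1 by (simp add: W_def)
  have CW: "?C \<subseteq> W" by (rule path_component_subset)
  have strip: "\<bar>(e - p) \<bullet> q\<bar> \<le> lam" if "q \<in> ?C" for q
  proof -
    have "q \<in> W" using that CW by blast
    then have "p \<bullet> q < u q" "u q \<le> e \<bullet> q + lam" using close[of q] by (auto simp: W_def abs_le_iff)
    then show ?thesis using thin[OF that] by (simp add: inner_diff_left abs_le_iff)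
  qed
  obtain q where q: "q \<in> ?C" "7/8 < norm q"
    using component_reaches_boundary[OF unit, of z1 p "7/8"] z1 unfolding W_def by force
  define d where "d = e - p"
  have nd: "norm d \<ge> \<epsilon>" using pe by (simp add: d_def)
  have d0: "d \<noteq> 0" using nd \<epsilon> by force
  define k0 where "k0 = \<i> * d / of_real (norm d)"
  note dec = complex_decomp[OF d0, folded k0_def]
  have kq: "\<bar>k0 \<bullet> q\<bar> \<ge> 3/4"
  proof (rule ccontr)
    assume "\<not> ?thesis"
    then have "(k0 \<bullet> q)\<^sup>2 \<le> (3/4)\<^sup>2" by (intro abs_le_square_iff[THEN iffD1]) simp
    moreover have "(d \<bullet> q)\<^sup>2 / (norm d)\<^sup>2 \<le> (1/4)\<^sup>2"
    proof -
      have "\<bar>d \<bullet> q\<bar> \<le> \<epsilon> / 4" using strip[OF q(1)] small2 by (simp add: d_def)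
      then have "\<bar>d \<bullet> q\<bar> \<le> norm d * (1/4)" using nd by simp
      then have "\<bar>d \<bullet> q\<bar> / norm d \<le> 1/4" using d0 by (simp add: field_simps)
      then have "(\<bar>d \<bullet> q\<bar> / norm d)\<^sup>2 \<le> (1/4)\<^sup>2" by (intro power_mono) auto
      then show ?thesis by (simp add: power_divide)
    qed
    moreover have "(7/8)\<^sup>2 < (norm q)\<^sup>2" using q(2) by (intro power_strict_mono) auto
    ultimately show False using dec(1)[of q] by (simp add: power2_eq_square)
  qed
  define kk where "kk = (if k0 \<bullet> q \<ge> 0 then k0 else - k0)"
  have kk: "norm kk = 1" "d \<bullet> kk = 0" "3/4 \<le> kk \<bullet> q" "\<And>z w. kk \<bullet> z = kk \<bullet> w \<Longrightarrow> d \<bullet> z = d \<bullet> w \<Longrightarrow> z = w"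
  proof -
    show "norm kk = 1" "d \<bullet> kk = 0" "3/4 \<le> kk \<bullet> q" using dec(2,3) kq by (auto simp: kk_def)
    show "z = w" if "kk \<bullet> z = kk \<bullet> w" "d \<bullet> z = d \<bullet> w" for z w
      using that dec(4)[of z w] by (auto simp: kk_def split: if_splits)
  qed
  have kkz: "\<bar>kk \<bullet> z\<bar> \<le> norm z" for z using Cauchy_Schwarz_ineq2[of kk z] kk(1) by simp
  obtain \<gamma> where \<gamma>: "path \<gamma>" "path_image \<gamma> \<subseteq> W" "pathstart \<gamma> = z1" "pathfinish \<gamma> = q"
    using q(1) unfolding mem_Collect_eq path_component_def by blast
  have \<gamma>C: "path_image \<gamma> \<subseteq> ?C"
  proof (rule path_component_maximal)
    show "z1 \<in> path_image \<gamma>" using pathstart_in_path_image[of \<gamma>] \<gamma>(3) by simp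
    show "path_connected (path_image \<gamma>)" by (rule path_connected_path_image[OF \<gamma>(1)])
  qed (rule \<gamma>(2))
  obtain m where m: "m > 0" "\<And>z. z \<in> path_image \<gamma> \<Longrightarrow> m \<le> v z"
  proof -
    have "path_image \<gamma> \<subseteq> cball 0 1" using \<gamma>(2) by (force simp: W_def)
    then have "continuous_on (path_image \<gamma>) v" using continuous_on_subset[OF v_cont] by blast
    then obtain z where z: "z \<in> path_image \<gamma>" "\<forall>y\<in>path_image \<gamma>. v z \<le> v y"
      using continuous_attains_inf[OF compact_path_image[OF \<gamma>(1)] path_image_nonempty] by blast
    have "v z > 0" using z(1) \<gamma>(2) by (force simp: W_def v_def)
    then show thesis using that z(2) by blast
  qed
  obtain dd where dd: "dd > 0" "\<And>w w'. w \<in> cball 0 1 \<Longrightarrow> w' \<in> cball 0 1 \<Longrightarrow> norm (w - w') < dd \<Longrightarrow> \<bar>v w - v w'\<bar> < m"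
    using v_unif[OF m(1)] by blast
  obtain ve where ve: "L ve = 1" "e \<bullet> ve = H e" using primal_attained by blast
  have nve: "norm ve \<le> a" using a(2)[of ve] ve by simp
  have dve: "d \<bullet> ve \<ge> \<nu>" using inner_le[of p ve] ve h by (simp add: d_def inner_diff_left)
  define P0 where "P0 = kk /\<^sub>R 2"
  have P0: "norm P0 = 1/2" "d \<bullet> P0 = 0" using kk by (auto simp: P0_def)
  have kkP0: "kk \<bullet> P0 = 1/2" using kk(1) by (simp add: P0_def dot_square_norm)
  define t1 where "t1 = 2 * lam / \<nu>"
  define t2 where "t2 = 6 * lam / \<nu>"
  have t12: "0 < t1" "t1 < t2" "t2 - t1 = 4 * lam / \<nu>" "t1 * \<nu> = 2 * lam"
    using lam \<nu> by (auto simp: t1_def t2_def field_simps)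
  define T where "T = 2 * ((2 * k * H e * a * t2) + 4 * lam) / \<nu>"
  have Tpos: "T > 0" using k(1) a(1) lam \<nu> t12 by (auto simp: T_def intro!: divide_pos_pos add_nonneg_pos mult_nonneg_nonneg)
  have smallT: "a * (t2 + T) \<le> 1/16" using small3 by (simp add: T_def t2_def)
  define yy where "yy t = P0 - t *\<^sub>R ve" for t
  have nyy: "norm (yy t - P0) \<le> a * t2" if "0 \<le> t" "t \<le> t2" for t
  proof -
    have "t * norm ve \<le> t2 * a" using that nve by (intro mult_mono) auto
    then show ?thesis using that by (simp add: yy_def mult.commute)
  qed
  have at2: "a * t2 \<le> 1/16" "a * T \<le> 1/16"
  proof -
    have "a * t2 > 0" "a * T > 0" using a(1) t12 Tpos by auto
    moreover have "a * (t2 + T) = a * t2 + a * T" by (rule distrib_left)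
    ultimately show "a * t2 \<le> 1/16" "a * T \<le> 1/16" using smallT by linarith+
  qed
  have nyy1: "norm (yy t) \<le> 5/8" if "0 \<le> t" "t \<le> t2" for t
    using nyy[OF that] at2 P0(1) norm_triangle_ineq[of "yy t - P0" P0] by simp
  have "\<exists>x\<in>closed_segment (yy t2) (yy t1). H e - \<nu> / 2 \<le> S x"
  proof (rule segment_slope)
    have "closed_segment (yy t2) (yy t1) \<subseteq> cball 0 1"
      using nyy1[of t1] nyy1[of t2] t12 by (intro closed_segment_subset) auto
    then show "closed_segment (yy t2) (yy t1) \<subseteq> \<Omega>" using unit by blast
    have df: "yy t1 - yy t2 = (t2 - t1) *\<^sub>R ve" by (simp add: yy_def algebra_simps)
    have Ldf: "L (yy t1 - yy t2) = t2 - t1" unfolding df L.scale using ve(1) t12(1,2) by simp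
    show "yy t2 \<noteq> yy t1" using Ldf t12 by force
    have "\<bar>u (yy t1) - e \<bullet> yy t1\<bar> \<le> lam" "\<bar>u (yy t2) - e \<bullet> yy t2\<bar> \<le> lam"
      using nyy1[of t1] nyy1[of t2] t12 by (auto intro!: close)
    then have "u (yy t1) - u (yy t2) \<ge> e \<bullet> (yy t1 - yy t2) - 2 * lam" by (simp add: inner_diff_right abs_le_iff)
    moreover have "e \<bullet> (yy t1 - yy t2) = (t2 - t1) * H e" unfolding df using ve by simp
    moreover have "(H e - \<nu> / 2) * (t2 - t1) = (t2 - t1) * H e - 2 * lam"
      using t12(3) \<nu> by (simp add: field_simps)
    ultimately show "(H e - \<nu> / 2) * L (yy t1 - yy t2) \<le> u (yy t1) - u (yy t2)" using Ldf by simp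
  qed
  then obtain x0 where x0: "x0 \<in> closed_segment (yy t2) (yy t1)" "H e - \<nu> / 2 \<le> S x0" by blast
  obtain s where s: "0 \<le> s" "s \<le> 1" "x0 = (1 - s) *\<^sub>R yy t2 + s *\<^sub>R yy t1" using x0(1) by (auto simp: closed_segment_def)
  define t where "t = (1 - s) * t2 + s * t1"
  have x0t: "x0 = yy t" by (simp add: s yy_def t_def algebra_simps)
  have tr: "t1 \<le> t" "t \<le> t2"
  proof -
    have "(1 - s) * t1 \<le> (1 - s) * t2" "s * t1 \<le> s * t2" using s t12 by (auto intro!: mult_left_mono)
    then show "t1 \<le> t" "t \<le> t2" unfolding t_def by (simp_all add: algebra_simps)
  qed
  have dx0: "d \<bullet> x0 \<le> - 2 * lam"
  proof -
    have "t1 * \<nu> \<le> t * (d \<bullet> ve)" using tr t12 dve \<nu> by (intro mult_mono) auto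
    then show ?thesis using t12(4) P0(2) by (simp add: x0t yy_def inner_diff_right)
  qed
  have nd2: "norm d \<le> 2 * k * H e"
  proof -
    have "norm d \<le> norm e + norm p" unfolding d_def by (rule norm_triangle_ineq4)
    also have "\<dots> \<le> k * H e + k * H p" using k(2)[of e] k(2)[of p] by simp
    also have "\<dots> \<le> k * H e + k * H e" using k(1) h \<nu> by simp
    finally show ?thesis by simp
  qed
  have x0n: "norm (x0 - P0) \<le> a * t2" "norm x0 \<le> 5/8" using nyy[of t] nyy1[of t] tr t12 by (auto simp: x0t)
  have vx0: "v x0 \<ge> - (2 * k * H e * a * t2) - lam"
  proof -
    have "d \<bullet> x0 = d \<bullet> (x0 - P0)" using P0 by (simp add: inner_diff_right)
    then have "\<bar>d \<bullet> x0\<bar> \<le> norm d * norm (x0 - P0)" using Cauchy_Schwarz_ineq2[of d "x0 - P0"] by simp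
    also have "\<dots> \<le> (2 * k * H e) * (a * t2)" using nd2 x0n k(1) by (intro mult_mono) auto
    finally have 1: "\<bar>d \<bullet> x0\<bar> \<le> 2 * k * H e * a * t2" by (simp add: mult.assoc)
    have "\<bar>u x0 - e \<bullet> x0\<bar> \<le> lam" using x0n by (intro close) auto
    then show ?thesis using 1 by (simp add: v_def d_def inner_diff_left abs_le_iff)
  qed
  define r where "r = min (1 / (16 * a)) (dd / (2 * a))"
  have r: "r > 0" "a * r \<le> 1/16" "a * r < dd"
  proof -
    show "r > 0" using a dd by (simp add: r_def)
    have "r \<le> 1 / (16 * a)" "r \<le> dd / (2 * a)" unfolding r_def by (rule min.cobounded1, rule min.cobounded2)
    then have "a * r \<le> 1/16" "a * r \<le> dd / 2" using a(1) by (auto simp: field_simps)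
    then show "a * r \<le> 1/16" "a * r < dd" using dd(1) by auto
  qed
  have r8: "a * r \<le> 1/8" using r by simp
  obtain X where X: "X 0 = x0" "\<And>n. (\<And>k. k < n \<Longrightarrow> LB (X k) r \<subseteq> \<Omega>) \<Longrightarrow> S x0 \<le> S (X n) \<and> S x0 * (n * r) \<le> u (X n) - u x0 \<and> L (X n - x0) \<le> n * r"
    "\<And>n. LB (X n) r \<subseteq> \<Omega> \<Longrightarrow> L (X (Suc n) - X n) = r \<and> S (X n) \<le> S (X (Suc n)) \<and>
    (\<forall>w\<in>closed_segment (X n) (X (Suc n)). S (X n) * L (X (Suc n) - w) \<le> u (X (Suc n)) - u w)"
    using chain_run[OF r(1), of x0] by blast
  \<comment> \<open>after length \<open>T\<close> the gain on \<open>p \<bullet> z\<close> has made up the deficit at \<open>x0\<close>, with \<open>3 * lam\<close> to spare\<close>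
  define N where "N = nat \<lceil>T / r\<rceil>"
  have Nr: "T \<le> N * r" "N * r \<le> T + r"
  proof -
    have "T / r \<le> N" unfolding N_def by (rule real_nat_ceiling_ge)
    then show "T \<le> N * r" using r(1) by (simp add: field_simps)
    have "real N \<le> T / r + 1" unfolding N_def using Tpos r(1) by (simp add: of_nat_nat)
    then have "N * r \<le> (T / r + 1) * r" using r(1) by (intro mult_right_mono) auto
    then show "N * r \<le> T + r" using r(1) by (simp add: distrib_right)
  qed
  have near0: "norm (X n - P0) \<le> a * t2 + a * (n * r)" "LB (X n) r \<subseteq> \<Omega>" if "n \<le> N" for n
  proof -
    have "norm (X n - P0) \<le> a * t2 + a * (n * r) \<and> LB (X n) r \<subseteq> \<Omega>" if "n \<le> N" for n
      using that
    proof (induction n rule: less_induct)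
      case (less n)
      then have "LB (X i) r \<subseteq> \<Omega>" if "i < n" for i using that by simp
      then have "L (X n - x0) \<le> n * r" using X(2)[of n] by blast
      then have "a * L (X n - x0) \<le> a * (n * r)" using a(1) by simp
      then have 1: "norm (X n - P0) \<le> a * t2 + a * (n * r)"
        using a(2)[of "X n - x0"] x0n(1) norm_triangle_ineq[of "X n - x0" "x0 - P0"] by simp
      have "real n * r \<le> N * r" using less.prems r(1) by simp
      then have "a * (n * r) \<le> a * (T + r)" using Nr(2) a(1) by simp
      then have "norm (X n - P0) \<le> a * (t2 + T) + a * r" using 1 by (simp add: distrib_left)
      then have "norm (X n) \<le> 3/4" using smallT r(2) P0(1) norm_triangle_ineq[of "X n - P0" P0] by simp
      then show ?case using 1 LB_in_cball[OF a r8 _ unit r(1)] by blast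
    qed
    then show "norm (X n - P0) \<le> a * t2 + a * (n * r)" "LB (X n) r \<subseteq> \<Omega>" using that by auto
  qed
  have near: "norm (X n - P0) \<le> 1/8" if "n \<le> N" for n
  proof -
    have "real n * r \<le> N * r" using that r(1) by simp
    then have "a * (n * r) \<le> a * (T + r)" using Nr(2) a(1) by simp
    then show ?thesis using near0(1)[OF that] smallT r(2) by (simp add: distrib_left)
  qed
  have nX: "norm (X n) \<le> 3/4" if "n \<le> N" for n
    using near[OF that] P0(1) norm_triangle_ineq[of "X n - P0" P0] by simp
  have runN: "S x0 * (N * r) \<le> u (X N) - u x0" "L (X N - x0) \<le> N * r" using X(2)[of N] near0(2) by auto
  have vXN: "v (X N) \<ge> 3 * lam"
  proof -
    have "p \<bullet> (X N - x0) \<le> H p * L (X N - x0)" by (rule inner_le)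
    also have "\<dots> \<le> H p * (N * r)" using runN(2) by (intro mult_left_mono) auto
    finally have "v (X N) - v x0 \<ge> (S x0 - H p) * (N * r)"
      using runN(1) by (simp add: v_def inner_diff_right left_diff_distrib)
    moreover have "(\<nu> / 2) * T \<le> (S x0 - H p) * (N * r)" using x0(2) h \<nu> Nr(1) Tpos by (intro mult_mono) auto
    moreover have "(\<nu> / 2) * T = 2 * k * H e * a * t2 + 4 * lam" using \<nu> by (simp add: T_def)
    ultimately show ?thesis using vx0 by linarith
  qed
  have dXN: "2 * lam \<le> d \<bullet> X N"
  proof -
    have "\<bar>u (X N) - e \<bullet> X N\<bar> \<le> lam" using nX[of N] by (intro close) auto
    then show ?thesis using vXN by (simp add: v_def d_def inner_diff_left abs_le_iff)
  qed
  obtain g where g: "path g" "pathstart g = X 0" "pathfinish g = X N"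
    "path_image g \<subseteq> insert (X 0) (\<Union>i<N. closed_segment (X i) (X (Suc i)))"
    using polygon_path[of X N] by blast
  have gnear: "norm (z - P0) \<le> 1/8" if "z \<in> path_image g" for z
  proof -
    have "z = X 0 \<or> (\<exists>i<N. z \<in> closed_segment (X i) (X (Suc i)))" using that g(4) by blast
    then show ?thesis
    proof
      assume "z = X 0" then show ?thesis using near[of 0] by simp
    next
      assume "\<exists>i<N. z \<in> closed_segment (X i) (X (Suc i))"
      then obtain i where i: "i < N" "z \<in> closed_segment (X i) (X (Suc i))" by blast
      have "closed_segment (X i) (X (Suc i)) \<subseteq> cball P0 (1/8)"
        using near[of i] near[of "Suc i"] i(1) by (intro closed_segment_subset) (auto simp: dist_norm norm_minus_commute)
      then show ?thesis using i(2) by (auto simp: dist_norm norm_minus_commute)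
    qed
  qed
  have "\<exists>z. z \<in> path_image \<gamma> \<and> z \<in> path_image g"
  proof (rule paths_cross_strip[where k = kk and d = d and l = lam])
    show "path \<gamma>" "path g" by fact+
    show "kk \<bullet> pathstart \<gamma> \<le> 1/4" using kkz[of z1] z1(1) \<gamma>(3) by simp
    show "3/4 \<le> kk \<bullet> pathfinish \<gamma>" using kk(3) \<gamma>(4) by simp
    show "\<bar>d \<bullet> z\<bar> \<le> lam" if "z \<in> path_image \<gamma>" for z using strip[of z] that \<gamma>C by (auto simp: d_def)
    show "1/4 < kk \<bullet> z \<and> kk \<bullet> z < 3/4" if "z \<in> path_image g" for z
    proof -
      have "kk \<bullet> z = 1/2 + kk \<bullet> (z - P0)" using kkP0 by (simp add: inner_diff_right)
      then show ?thesis using kkz[of "z - P0"] gnear[OF that] by (simp add: abs_le_iff)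
    qed
    show "d \<bullet> pathstart g \<le> - 2 * lam" using dx0 g(2) X(1) by simp
    show "2 * lam \<le> d \<bullet> pathfinish g" using dXN g(3) by simp
    show "lam > 0" by (rule lam)
    show "z = w" if "kk \<bullet> z = kk \<bullet> w" "d \<bullet> z = d \<bullet> w" for z w by (rule kk(4)[OF that])
  qed
  then obtain y where y: "y \<in> path_image \<gamma>" "y \<in> path_image g" by blast
  have yC: "y \<in> ?C" using y(1) \<gamma>C by blast
  \<comment> \<open>the crossing point lies on an edge of the chain; the end of this edge is still in the component\<close>
  have "\<exists>j\<le>N. X j \<in> ?C \<and> m \<le> v (X j)"
  proof (cases "y = X 0")
    case True then show ?thesis using yC m(2)[OF y(1)] by blast
  next
    case False
    then obtain i where i: "i < N" "y \<in> closed_segment (X i) (X (Suc i))" using y(2) g(4) by blast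
    have LBi: "LB (X i) r \<subseteq> \<Omega>" using near0(2)[of i] i by simp
    note st = X(3)[OF LBi]
    have Si: "S x0 \<le> S (X i)" using X(2)[of i] near0(2) i by force
    have "S (X i) * L (X (Suc i) - y) \<le> u (X (Suc i)) - u y" using st i(2) by blast
    moreover have "H p * L (X (Suc i) - y) \<le> S (X i) * L (X (Suc i) - y)"
      using Si x0(2) h \<nu> by (intro mult_right_mono) auto
    moreover have "p \<bullet> (X (Suc i) - y) \<le> H p * L (X (Suc i) - y)" by (rule inner_le)
    ultimately have vS: "m \<le> v (X (Suc i))" using m(2)[OF y(1)] by (simp add: v_def inner_diff_right)
    have "closed_segment y (X (Suc i)) \<subseteq> W"
    proof
      fix w assume w: "w \<in> closed_segment y (X (Suc i))"
      have "w \<in> closed_segment (X i) (X (Suc i))"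
        using w i(2) subset_closed_segment[of y "X (Suc i)" "X i" "X (Suc i)"] by auto
      then have wg: "norm w \<le> 3/4"
      proof -
        assume "w \<in> closed_segment (X i) (X (Suc i))"
        moreover have "closed_segment (X i) (X (Suc i)) \<subseteq> cball 0 (3/4)"
          using nX[of i] nX[of "Suc i"] i(1) by (intro closed_segment_subset) auto
        ultimately show ?thesis by auto
      qed
      have "norm (w - X (Suc i)) \<le> norm (X (Suc i) - X i)"
        using \<open>w \<in> closed_segment (X i) (X (Suc i))\<close> segment_bound(2)[of w "X i" "X (Suc i)"] by (simp add: norm_minus_commute)
      also have "\<dots> \<le> a * r" using a(2)[of "X (Suc i) - X i"] st by simp
      finally have "\<bar>v w - v (X (Suc i))\<bar> < m" using wg nX[of "Suc i"] i(1) r(3) by (intro dd(2)) auto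
      then have "v w > 0" using vS by linarith
      then show "w \<in> W" using wg by (simp add: W_def v_def)
    qed
    then have "X (Suc i) \<in> ?C" by (rule segment_in_component[OF yC])
    then show ?thesis using vS i(1) by (intro exI[of _ "Suc i"]) auto
  qed
  then obtain j where j: "j \<le> N" "X j \<in> ?C" "m \<le> v (X j)" by blast
  have Sj: "S x0 \<le> S (X j)" using X(2)[of j] near0(2) j(1) by force
  have "X N \<in> ?C \<and> m \<le> v (X N) \<and> H p \<le> S (X N)"
  proof (rule stays[where X = X and d = dd and m = m and r = r and j = j and n = N])
    show "0 < r" "a * r \<le> 1/8" "a * r < dd" by (fact r(1) r8 r(3))+
    show "X j \<in> ?C" "m \<le> v (X j)" "j \<le> N" by fact+
    show "H p \<le> S (X j)" using Sj x0(2) h \<nu> by linarith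
    show "norm (X i) \<le> 3/4" if "i < N" for i using nX[of i] that by simp
  qed (use dd(2) X(3) in auto)
  then have "X N \<in> ?C" by blast
  then show False using thin dXN lam by (force simp: d_def)
qed

lemma reaches_large_side:
  assumes z1: "norm z1 \<le> 1/8" "p \<bullet> z1 < u z1"
  shows "\<exists>q\<in>path_component_set W z1. lam < (e - p) \<bullet> q"
  using thin_impossible_small[OF _ z1] thin_impossible_large[OF _ z1] by (meson not_le)

end

section \<open>A winding number argument\<close>

text \<open>
  On the compact set where \<open>A \<le> 0\<close>, the function \<open>B\<close> is bounded away from
  zero.
\<close>

lemma compact_dominate:
  fixes A B :: "'a::topological_space \<Rightarrow> real"
  assumes "compact K" "continuous_on K A" "continuous_on K B" "\<And>z. z \<in> K \<Longrightarrow> 0 \<le> B z"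
    and pos: "\<And>z. z \<in> K \<Longrightarrow> B z = 0 \<Longrightarrow> 0 < A z"
  shows "\<exists>s>0. \<forall>z\<in>K. 0 < A z + s * B z"
proof (cases "{z \<in> K. A z \<le> 0} = {}")
  case True
  then have "\<forall>z\<in>K. 0 < A z + 1 * B z" using assms(4) by (force simp: not_le intro: add_pos_nonneg)
  then show ?thesis by (intro exI[of _ 1]) simp
next
  case False
  let ?Z = "{z \<in> K. A z \<le> 0}"
  have "closedin (top_of_set K) (K \<inter> A -` {..0})" by (rule continuous_closedin_preimage[OF assms(2) closed_atMost])
  moreover have "K \<inter> A -` {..0} = ?Z" by auto
  ultimately have cZ: "compact ?Z" using closedin_compact[OF assms(1)] by simp
  have cA: "continuous_on ?Z A" and cB: "continuous_on ?Z B" using assms(2,3) by (auto intro: continuous_on_subset)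
  obtain z1 where z1: "z1 \<in> ?Z" "\<And>y. y \<in> ?Z \<Longrightarrow> B z1 \<le> B y" using continuous_attains_inf[OF cZ False cB] by blast
  obtain z2 where z2: "z2 \<in> ?Z" "\<And>y. y \<in> ?Z \<Longrightarrow> A z2 \<le> A y" using continuous_attains_inf[OF cZ False cA] by blast
  have b: "B z1 > 0" using z1(1) pos[of z1] assms(4)[of z1] by force
  define s where "s = (1 - A z2) / B z1"
  have s: "s > 0" using z2(1) b by (auto simp: s_def intro!: divide_pos_pos)
  have "0 < A z + s * B z" if "z \<in> K" for z
  proof (cases "A z \<le> 0")
    case True
    then have z: "z \<in> ?Z" using that by simp
    have "s * B z1 \<le> s * B z" using z1(2)[OF z] s by (intro mult_left_mono) auto
    moreover have "s * B z1 = 1 - A z2" using b by (simp add: s_def)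
    ultimately show ?thesis using z2(2)[OF z] by linarith
  next
    case False
    then show ?thesis using s assms(4)[OF that] by (intro add_pos_nonneg) auto
  qed
  then show ?thesis using s by blast
qed

text \<open>
  Passing the point \<open>\<rho> f\<close> on one side or the other. The real part is the turning angle
  divided by \<open>2 \<pi>\<close>, and each linear piece turns in a fixed direction.
\<close>

lemma Re_winding_detour:
  fixes f :: complex and \<rho> :: real
  assumes f: "norm f = 1" and \<rho>: "0 < \<rho>" "\<rho> < 1/2"
  defines "low \<equiv> linepath (- (of_real \<rho> * f)) (- (\<i> * f / 2)) +++ linepath (- (\<i> * f / 2)) (f / 2)"
    and "up \<equiv> linepath (- (of_real \<rho> * f)) (\<i> * f / 2) +++ linepath (\<i> * f / 2) (f / 2)"
  shows "Re (winding_number low (of_real \<rho> * f)) > 0" "Re (winding_number up (of_real \<rho> * f)) < 0"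
    "of_real \<rho> * f \<notin> path_image low" "of_real \<rho> * f \<notin> path_image up"
proof -
  define z where "z = of_real \<rho> * f"
  have ff: "f * cnj f = 1" using f by (simp add: complex_norm_square[symmetric] del: complex_norm_square)
  have Imf: "Im ((x * f) * cnj (y * f)) = Im (x * cnj y)" for x y
  proof -
    have *: "(x * f) * cnj (y * f) = (x * cnj y) * (f * cnj f)" by simp
    show ?thesis unfolding * ff by simp
  qed
  have e1: "0 < Im ((- (\<i> * f / 2) - - z) * cnj (- (\<i> * f / 2) - z))"
  proof -
    have "- (\<i> * f / 2) - - z = (- \<i> / 2 + of_real \<rho>) * f" "- (\<i> * f / 2) - z = (- \<i> / 2 - of_real \<rho>) * f"
      by (simp_all add: z_def algebra_simps)
    then show ?thesis unfolding Imf using \<rho> by (simp only: Imf) simp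
  qed
  have e2: "0 < Im ((f / 2 - - (\<i> * f / 2)) * cnj (f / 2 - z))"
  proof -
    have "f / 2 - - (\<i> * f / 2) = (1 / 2 + \<i> / 2) * f" "f / 2 - z = (1 / 2 - of_real \<rho>) * f"
      by (simp_all add: z_def algebra_simps)
    then show ?thesis using \<rho> by (simp only: Imf) simp
  qed
  have e3: "0 < Im ((\<i> * f / 2 - f / 2) * cnj (\<i> * f / 2 - z))"
  proof -
    have "\<i> * f / 2 - f / 2 = (\<i> / 2 - 1 / 2) * f" "\<i> * f / 2 - z = (\<i> / 2 - of_real \<rho>) * f"
      by (simp_all add: z_def algebra_simps)
    then show ?thesis using \<rho> by (simp only: Imf) simp
  qed
  have e4: "0 < Im ((- z - \<i> * f / 2) * cnj (- z - z))"
  proof -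
    have "- z - \<i> * f / 2 = (- of_real \<rho> - \<i> / 2) * f" "- z - z = (- 2 * of_real \<rho>) * f"
      by (simp_all add: z_def algebra_simps)
    then show ?thesis using \<rho> by (simp only: Imf) simp
  qed
  have notin: "z \<notin> closed_segment a b" if "0 < Im ((b - a) * cnj (b - z))" for a b
  proof
    assume "z \<in> closed_segment a b"
    then obtain t where "z = (1 - t) *\<^sub>R a + t *\<^sub>R b" by (auto simp: closed_segment_def)
    then have "b - z = (1 - t) *\<^sub>R (b - a)" by (simp add: algebra_simps)
    then have "(b - a) * cnj (b - z) = of_real (1 - t) * ((b - a) * cnj (b - a))"
      by (simp add: scaleR_conv_of_real mult.left_commute)
    also have "\<dots> = of_real ((1 - t) * ((Re (b - a))\<^sup>2 + (Im (b - a))\<^sup>2))"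
      by (simp only: complex_mult_cnj of_real_mult)
    finally have "Im ((b - a) * cnj (b - z)) = 0" by (simp only: Im_complex_of_real)
    then show False using that by simp
  qed
  note n1 = notin[OF e1] and n2 = notin[OF e2] and n3 = notin[OF e3] and n4 = notin[OF e4]
  note w1 = winding_number_linepath_pos_lt[OF e1] and w2 = winding_number_linepath_pos_lt[OF e2]
    and w3 = winding_number_linepath_pos_lt[OF e3] and w4 = winding_number_linepath_pos_lt[OF e4]
  have "winding_number low z = winding_number (linepath (- z) (- (\<i> * f / 2))) z + winding_number (linepath (- (\<i> * f / 2)) (f / 2)) z"
    unfolding low_def z_def[symmetric] by (rule winding_number_join) (use n1 n2 in auto)
  then show "Re (winding_number low (of_real \<rho> * f)) > 0" using w1 w2 by (simp add: z_def)
  have n3': "z \<notin> closed_segment (\<i> * f / 2) (f / 2)" using n3 by (simp add: closed_segment_commute)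
  have n4': "z \<notin> closed_segment (- z) (\<i> * f / 2)" using n4 by (simp add: closed_segment_commute)
  have "winding_number up z = winding_number (linepath (- z) (\<i> * f / 2)) z + winding_number (linepath (\<i> * f / 2) (f / 2)) z"
    unfolding up_def z_def[symmetric] by (rule winding_number_join) (use n3' n4' in auto)
  moreover have "winding_number (linepath (- z) (\<i> * f / 2)) z = - winding_number (linepath (\<i> * f / 2) (- z)) z"
    using winding_number_reversepath[of "linepath (\<i> * f / 2) (- z)" z] n4 by simp
  moreover have "winding_number (linepath (\<i> * f / 2) (f / 2)) z = - winding_number (linepath (f / 2) (\<i> * f / 2)) z"
    using winding_number_reversepath[of "linepath (f / 2) (\<i> * f / 2)" z] n3 by simp
  ultimately show "Re (winding_number up (of_real \<rho> * f)) < 0" using w3 w4 by (simp add: z_def)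
  show "of_real \<rho> * f \<notin> path_image low" "of_real \<rho> * f \<notin> path_image up"
    unfolding low_def up_def z_def[symmetric] using n1 n2 n3' n4' by (auto simp: path_image_join)
qed

text \<open>
  The winding number around \<open>\<rho> f\<close> of a path from \<open>- \<rho> f\<close> to \<open>f
  / 2\<close> inside \<open>{P s z < U z}\<close> is independent of the path, because the component of
  \<open>{U z < P s z}\<close> containing \<open>\<rho> f\<close> escapes towards the circle without
  meeting any of these paths. A path admissible for \<open>s\<close> is admissible for nearby
  parameters, so its sign is locally constant in \<open>s\<close>, hence constant. For large positive
  and large negative \<open>s\<close>, however, the two detours of \<open>Re_winding_detour\<close> are
  admissible.
\<close>

lemma no_saddle_family:
  fixes U :: "complex \<Rightarrow> real" and f :: complex and m \<rho> :: real
  assumes contU: "continuous_on (cball 0 1) U" and f: "norm f = 1" and \<rho>: "0 < \<rho>" "\<rho> < 1/2"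
  defines "P \<equiv> \<lambda>s z. m * (f \<bullet> z) + s * ((\<i> * f) \<bullet> z)"
  assumes start: "P 0 (- (of_real \<rho> * f)) < U (- (of_real \<rho> * f))" and fin: "P 0 (f / 2) < U (f / 2)"
    and path: "\<And>s. \<exists>\<gamma>. path \<gamma> \<and> path_image \<gamma> \<subseteq> {z \<in> ball 0 1. P s z < U z} \<and> pathstart \<gamma> = - (of_real \<rho> * f) \<and> pathfinish \<gamma> = f / 2"
    and escape: "\<And>s r. r < 1 \<Longrightarrow> \<exists>q\<in>path_component_set {z \<in> ball 0 1. U z < P s z} (of_real \<rho> * f). r < norm q"
  shows False
proof -
  define z1 where "z1 = - (of_real \<rho> * f)"
  define z2 where "z2 = of_real \<rho> * f"
  define R where "R = f / 2"
  define G where "G s = {\<gamma>. path \<gamma> \<and> path_image \<gamma> \<subseteq> {z \<in> ball 0 1. P s z < U z} \<and> pathstart \<gamma> = z1 \<and> pathfinish \<gamma> = R}" for s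
  have ff: "f \<bullet> f = 1" using f by (simp add: dot_square_norm)
  have fi: "(\<i> * f) \<bullet> f = 0" "f \<bullet> (\<i> * f) = 0" by (simp_all add: inner_complex_def)
  have ii: "(\<i> * f) \<bullet> (\<i> * f) = 1" using f by (simp add: dot_square_norm norm_mult)
  have inner1: "f \<bullet> (of_real c * f) = c" "(\<i> * f) \<bullet> (of_real c * f) = 0" for c
    using ff fi by (simp_all add: scaleR_conv_of_real[symmetric])
  have z2N: "U z2 < P s z2" for s
  proof -
    obtain q where "q \<in> path_component_set {z \<in> ball 0 1. U z < P s z} z2" using escape[of 0 s] unfolding z2_def by auto
    then have "z2 \<in> {z \<in> ball 0 1. U z < P s z}" by (metis (mono_tags, lifting) mem_Collect_eq path_component_mem(1))
    then show ?thesis by simp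
  qed
  have contP: "continuous_on A (P s)" for A s unfolding P_def by (intro continuous_intros)
  \<comment> \<open>two admissible paths form a loop that the component of \<open>z2\<close> avoids on its way out of the disc\<close>
  have unique: "winding_number \<gamma> z2 = winding_number \<gamma>' z2" "z2 \<notin> path_image \<gamma>" if g: "\<gamma> \<in> G s" "\<gamma>' \<in> G s" for s \<gamma> \<gamma>'
  proof -
    have p: "path \<gamma>" "path \<gamma>'" "pathstart \<gamma> = z1" "pathfinish \<gamma> = R" "pathstart \<gamma>' = z1" "pathfinish \<gamma>' = R"
      and im: "path_image \<gamma> \<subseteq> {z \<in> ball 0 1. P s z < U z}" "path_image \<gamma>' \<subseteq> {z \<in> ball 0 1. P s z < U z}"
      using g by (auto simp: G_def)
    show zn: "z2 \<notin> path_image \<gamma>" using im z2N[of s] by force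
    have zn': "z2 \<notin> path_image \<gamma>'" using im z2N[of s] by force
    let ?l = "\<gamma> +++ reversepath \<gamma>'"
    have l: "path ?l" "pathfinish ?l = pathstart ?l" "path_image ?l = path_image \<gamma> \<union> path_image \<gamma>'"
      using p by (auto simp: path_image_join)
    have lW: "path_image ?l \<subseteq> {z \<in> ball 0 1. P s z < U z}" using im l(3) by blast
    have cl: "compact (path_image ?l)" "path_image ?l \<noteq> {}" by (rule compact_path_image[OF l(1)]) (rule path_image_nonempty)
    obtain y where y: "y \<in> path_image ?l" "\<And>x. x \<in> path_image ?l \<Longrightarrow> norm x \<le> norm y"
      using continuous_attains_sup[OF cl, of norm] continuous_on_norm_id by blast
    have ny: "norm y < 1" using y(1) lW by auto
    obtain q where q: "q \<in> path_component_set {z \<in> ball 0 1. U z < P s z} z2" "norm y < norm q"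
      using escape[OF ny, of s] unfolding z2_def by blast
    let ?S = "path_component_set {z \<in> ball 0 1. U z < P s z} z2"
    have z2S: "z2 \<in> ?S" using q(1) by (metis (mono_tags, lifting) mem_Collect_eq path_component_mem(1) path_component_refl)
    have "?S \<inter> path_image ?l = {}"
    proof -
      have "?S \<subseteq> {z \<in> ball 0 1. U z < P s z}" by (rule path_component_subset)
      then show ?thesis using lW by force
    qed
    then have "winding_number ?l z2 = winding_number ?l q"
      by (intro winding_number_eq[OF l(1,2) z2S q(1)] path_connected_imp_connected path_connected_path_component)
    also have "\<dots> = 0"
      by (rule winding_number_zero_outside[OF l(1) convex_cball[of 0 "norm y"] l(2)]) (use q(2) y(2) in auto)
    finally have "winding_number \<gamma> z2 + winding_number (reversepath \<gamma>') z2 = 0"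
      using winding_number_join[of \<gamma> z2 "reversepath \<gamma>'"] p zn zn' by simp
    then show "winding_number \<gamma> z2 = winding_number \<gamma>' z2"
      using winding_number_reversepath[of \<gamma>' z2] p zn' by simp
  qed
  have nonempty: "\<exists>\<gamma>. \<gamma> \<in> G s" for s using path[of s] unfolding G_def z1_def R_def by blast
  \<comment> \<open>a path compactly inside the open set remains admissible for nearby parameters\<close>
  have stable: "\<exists>\<delta>>0. \<forall>s'. \<bar>s' - s\<bar> < \<delta> \<longrightarrow> \<gamma> \<in> G s'" if g: "\<gamma> \<in> G s" for \<gamma> s
  proof -
    have p: "path \<gamma>" "path_image \<gamma> \<subseteq> {z \<in> ball 0 1. P s z < U z}" "pathstart \<gamma> = z1" "pathfinish \<gamma> = R" using g by (auto simp: G_def)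
    have cont: "continuous_on (path_image \<gamma>) (\<lambda>z. U z - P s z)"
    proof (intro continuous_on_diff contP)
      show "continuous_on (path_image \<gamma>) U" using p(2) by (intro continuous_on_subset[OF contU]) force
    qed
    obtain y where y: "y \<in> path_image \<gamma>" "\<And>x. x \<in> path_image \<gamma> \<Longrightarrow> U y - P s y \<le> U x - P s x"
      using continuous_attains_inf[OF compact_path_image[OF p(1)] path_image_nonempty cont] by blast
    define \<delta> where "\<delta> = U y - P s y"
    have \<delta>: "\<delta> > 0" using y(1) p(2) by (auto simp: \<delta>_def)
    have "\<gamma> \<in> G s'" if s': "\<bar>s' - s\<bar> < \<delta>" for s'
    proof -
      have "P s' z < U z" "z \<in> ball 0 1" if z: "z \<in> path_image \<gamma>" for z
      proof -
        show zb: "z \<in> ball 0 1" using z p(2) by blast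
        have "P s' z - P s z = (s' - s) * ((\<i> * f) \<bullet> z)" by (simp add: P_def algebra_simps)
        also have "\<dots> \<le> \<bar>s' - s\<bar> * \<bar>(\<i> * f) \<bullet> z\<bar>" by (simp add: abs_mult[symmetric])
        also have "\<dots> \<le> \<bar>s' - s\<bar> * 1"
        proof (intro mult_left_mono)
          have "\<bar>(\<i> * f) \<bullet> z\<bar> \<le> norm (\<i> * f) * norm z" by (rule Cauchy_Schwarz_ineq2)
          also have "\<dots> \<le> 1" using f zb by (simp add: norm_mult)
          finally show "\<bar>(\<i> * f) \<bullet> z\<bar> \<le> 1" .
        qed simp
        finally have "P s' z - P s z < \<delta>" using s' by simp
        then show "P s' z < U z" using y(2)[OF z] by (simp add: \<delta>_def)
      qed
      then show ?thesis using p by (auto simp: G_def)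
    qed
    then show ?thesis using \<delta> by blast
  qed
  let ?low = "linepath z1 (- (\<i> * f / 2)) +++ linepath (- (\<i> * f / 2)) R"
  let ?up = "linepath z1 (\<i> * f / 2) +++ linepath (\<i> * f / 2) R"
  \<comment> \<open>on the detour the weight \<open>?B\<close> of \<open>s\<close> is positive except at the two ends, where \<open>?A\<close> is positive by assumption\<close>
  have detour: "\<exists>s>0. linepath z1 c +++ linepath c R \<in> G (\<tau> * s)" if c: "c = \<tau> *\<^sub>R (- (\<i> * f / 2))" and \<tau>: "\<tau> = 1 \<or> \<tau> = -1" for c \<tau>
  proof -
    let ?K = "closed_segment z1 c \<union> closed_segment c R"
    let ?B = "\<lambda>z. - \<tau> * ((\<i> * f) \<bullet> z)" let ?A = "\<lambda>z. U z - P 0 z"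
    have ends: "norm z1 < 1" "norm c < 1" "norm R < 1" using \<rho> f \<tau> by (auto simp: z1_def c R_def norm_mult)
    have "closed_segment z1 c \<subseteq> ball 0 1" "closed_segment c R \<subseteq> ball 0 1"
      using ends by (intro closed_segment_subset convex_ball; simp)+
    then have Kb: "?K \<subseteq> ball 0 1" by blast
    have Bz1: "?B z1 = 0" and BR: "?B R = 0"
      using inner1(2)[of "-\<rho>"] inner1(2)[of "1/2"] by (simp_all add: z1_def R_def)
    have half: "\<i> * f / 2 = (1/2) *\<^sub>R (\<i> * f)" by (simp add: scaleR_conv_of_real)
    have "(\<i> * f) \<bullet> (\<i> * f / 2) = 1/2" unfolding half inner_scaleR_right ii by simp
    then have Bc: "?B c = 1/2" using \<tau> by (auto simp: c)
    have Bseg: "0 \<le> ?B z \<and> (?B z = 0 \<longrightarrow> z = w)" if z: "z \<in> closed_segment w c" and w: "?B w = 0" for z w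
    proof -
      obtain t where t: "0 \<le> t" "t \<le> 1" "z = (1 - t) *\<^sub>R w + t *\<^sub>R c" using z by (auto simp: closed_segment_def)
      have "?B z = (1 - t) * ?B w + t * ?B c" by (simp add: t inner_add_right algebra_simps)
      then have "?B z = t / 2" unfolding w Bc by simp
      then show ?thesis using t by auto
    qed
    have "\<exists>s>0. \<forall>z\<in>?K. 0 < ?A z + s * ?B z"
    proof (rule compact_dominate)
      show "compact ?K" by (intro compact_Un compact_segment)
      show "continuous_on ?K ?A"
      proof (intro continuous_on_diff contP)
        show "continuous_on ?K U" using Kb by (intro continuous_on_subset[OF contU]) force
      qed
      show "continuous_on ?K ?B" by (intro continuous_intros)
      fix z assume z: "z \<in> ?K"
      have zz: "z \<in> closed_segment z1 c \<or> z \<in> closed_segment R c" using z by (auto simp: closed_segment_commute)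
      show "0 \<le> ?B z" using Bseg[OF _ Bz1] Bseg[OF _ BR] zz by blast
      assume "?B z = 0"
      then have "z = z1 \<or> z = R" using Bseg[OF _ Bz1] Bseg[OF _ BR] zz by blast
      then show "0 < ?A z" using start fin by (auto simp: z1_def R_def)
    qed
    then obtain s where s: "s > 0" "\<And>z. z \<in> ?K \<Longrightarrow> 0 < ?A z + s * ?B z" by blast
    have "P (\<tau> * s) z < U z" if "z \<in> ?K" for z
      using s(2)[OF that] by (simp add: P_def algebra_simps)
    then have "linepath z1 c +++ linepath c R \<in> G (\<tau> * s)"
      using Kb by (auto simp: G_def path_image_join)
    then show ?thesis using s(1) by blast
  qed
  obtain s1 where s1: "?low \<in> G s1" using detour[of "- (\<i> * f / 2)" 1] by auto
  obtain s2 where s2: "?up \<in> G s2" using detour[of "\<i> * f / 2" "-1"] by auto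
  note wn = Re_winding_detour[OF f \<rho>]
  have low: "Re (winding_number ?low z2) > 0" and up: "Re (winding_number ?up z2) < 0"
    using wn(1,2) by (simp_all add: z1_def z2_def R_def)
  let ?Pos = "{s. \<exists>\<gamma>\<in>G s. Re (winding_number \<gamma> z2) > 0}" and ?Neg = "{s. \<exists>\<gamma>\<in>G s. \<not> Re (winding_number \<gamma> z2) > 0}"
  have op: "open {s. \<exists>\<gamma>\<in>G s. Q \<gamma>}" for Q
  proof (unfold open_dist, intro ballI)
    fix s assume "s \<in> {s. \<exists>\<gamma>\<in>G s. Q \<gamma>}"
    then obtain \<gamma> where "\<gamma> \<in> G s" "Q \<gamma>" by blast
    then show "\<exists>e>0. \<forall>y. dist y s < e \<longrightarrow> y \<in> {s. \<exists>\<gamma>\<in>G s. Q \<gamma>}"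
      using stable[of \<gamma> s] unfolding dist_real_def by blast
  qed
  have "False" if sPN: "s \<in> ?Pos" "s \<in> ?Neg" for s
  proof -
    obtain \<gamma> \<gamma>' where "\<gamma> \<in> G s" "\<gamma>' \<in> G s" and *: "Re (winding_number \<gamma> z2) > 0" "\<not> Re (winding_number \<gamma>' z2) > 0"
      using sPN by blast
    then have "winding_number \<gamma> z2 = winding_number \<gamma>' z2" by (intro unique(1))
    then show False using * by simp
  qed
  then have dj: "?Pos \<inter> ?Neg \<inter> UNIV = {}" by blast
  have cov: "UNIV \<subseteq> ?Pos \<union> ?Neg" using nonempty by blast
  have inPos: "s1 \<in> ?Pos" using s1 low by blast
  have "\<not> Re (winding_number ?up z2) > 0" using up by linarith
  then have inNeg: "s2 \<in> ?Neg" using s2 by blast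
  have "?Pos \<inter> UNIV = {} \<or> ?Neg \<inter> UNIV = {}"
    by (rule connectedD[OF connected_UNIV op op dj cov])
  then show False
  proof
    assume "?Pos \<inter> UNIV = {}"
    then have "s1 \<notin> ?Pos" by (simp only: Int_UNIV_right empty_iff not_False_eq_True)
    then show False using inPos by (rule notE)
  next
    assume "?Neg \<inter> UNIV = {}"
    then have "s2 \<notin> ?Neg" by (simp only: Int_UNIV_right empty_iff not_False_eq_True)
    then show False using inNeg by (rule notE)
  qed
qed

section \<open>Improvement of flatness\<close>

text \<open>
  The case of two points symmetric about the origin, in directional form: knowing \<open>u\<close> at
  one of them bounds it at the other. If it failed, then \<open>u\<close> at \<open>- \<rho> f\<close>
  would lie above, and at \<open>\<rho> f\<close> below, every linear function of slope \<open>p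
  s\<close> with \<open>p s \<bullet> f = m\<close>, which \<open>no_saddle_family\<close> excludes.
\<close>

lemma planar_flatness:
  fixes H :: "complex \<Rightarrow> real" and e :: complex
  assumes sn: "strict_norm H" and e: "e \<noteq> 0" and \<epsilon>: "\<epsilon> > 0"
  shows "\<exists>lam>0. \<forall>\<Omega> u f \<rho>. comparison H \<Omega> u \<longrightarrow> cball 0 1 \<subseteq> \<Omega> \<longrightarrow> (\<forall>z\<in>cball 0 1. \<bar>u z - e \<bullet> z\<bar> \<le> lam) \<longrightarrow>
     norm f = 1 \<longrightarrow> 0 < \<rho> \<longrightarrow> \<rho> \<le> 1/8 \<longrightarrow> - ((e \<bullet> f - \<epsilon>) * \<rho>) < u (- (of_real \<rho> * f)) \<longrightarrow> (e \<bullet> f - \<epsilon>) * \<rho> \<le> u (of_real \<rho> * f)"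
proof -
  interpret strict_norm H by (rule sn)
  have E: "H e > 0" using H.pos[of e] e by blast
  obtain \<nu>0 where \<nu>0: "\<nu>0 > 0" "\<And>q. H q \<le> H e + \<nu>0 \<Longrightarrow> H e - \<nu>0 \<le> H ((q + e) /\<^sub>R 2) \<Longrightarrow> norm (q - e) < \<epsilon>"
    using near_extremal[OF E \<epsilon>] by blast
  define \<nu> where "\<nu> = min (\<nu>0 / 2) (H e / 2)"
  have "\<nu> \<le> H e / 2" unfolding \<nu>_def by (rule min.cobounded2)
  moreover have "\<nu> > 0" using \<nu>0(1) E unfolding \<nu>_def by simp
  ultimately have \<nu>: "\<nu> > 0" "\<nu> < H e" using E by linarith+
  have "\<nu> \<le> \<nu>0 / 2" unfolding \<nu>_def by (rule min.cobounded1)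
  then have \<nu>2: "2 * \<nu> \<le> \<nu>0" by simp
  have sc: "norm (q - e) < \<epsilon>" if "H q \<le> H e + 2 * \<nu>" "H e - 2 * \<nu> \<le> H ((q + e) /\<^sub>R 2)" for q
    using that \<nu>2 by (intro \<nu>0(2)) linarith+
  obtain a b where ab: "a > 0" "b > 0" "\<And>p. L p \<le> b * norm p" "\<And>p. norm p \<le> a * L p" using norm_bounds by blast
  obtain k0 where k0: "k0 > 0" "\<And>p. k0 * norm p \<le> H p" using H.ge_norm by blast
  define k where "k = 1 / k0"
  have k: "k > 0" "\<And>p. norm p \<le> k * H p" using k0 by (auto simp: k_def field_simps)
  define Q where "Q = a * (6 / \<nu> + 2 * ((2 * k * H e * a * (6 / \<nu>)) + 4) / \<nu>)"
  have Q: "Q > 0" using ab k E \<nu> by (auto simp: Q_def intro!: mult_pos_pos add_pos_pos divide_pos_pos)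
  define lam where "lam = min (\<nu> / (32 * a)) (min (\<epsilon> / 4) (1 / (16 * Q)))"
  have lam: "lam > 0" using \<nu> ab \<epsilon> Q by (simp add: lam_def)
  have "lam \<le> \<nu> / (32 * a)" "lam \<le> \<epsilon> / 4" "lam \<le> 1 / (16 * Q)" by (simp_all add: lam_def)
  then have small: "32 * a * lam \<le> \<nu>" "lam \<le> \<epsilon> / 4" "lam * Q \<le> 1 / 16"
    using ab(1) Q by (auto simp: field_simps)
  have "a * (6 * lam / \<nu> + 2 * ((2 * k * H e * a * (6 * lam / \<nu>)) + 4 * lam) / \<nu>) = lam * Q"
    using \<nu>(1) by (simp add: Q_def field_simps)
  with small(3) have small3: "a * (6 * lam / \<nu> + 2 * ((2 * k * H e * a * (6 * lam / \<nu>)) + 4 * lam) / \<nu>) \<le> 1 / 16" by simp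
  have main: "(e \<bullet> f - \<epsilon>) * \<rho> \<le> u (of_real \<rho> * f)"
    if cm: "comparison H \<Omega> u" and unit: "cball 0 1 \<subseteq> \<Omega>" and close: "\<And>z. z \<in> cball 0 1 \<Longrightarrow> \<bar>u z - e \<bullet> z\<bar> \<le> lam"
      and f: "norm f = 1" and \<rho>: "0 < \<rho>" "\<rho> \<le> 1/8" and start: "- ((e \<bullet> f - \<epsilon>) * \<rho>) < u (- (of_real \<rho> * f))" for \<Omega> u f \<rho>
  proof (rule ccontr)
    assume "\<not> ?thesis"
    then have stop: "u (of_real \<rho> * f) < (e \<bullet> f - \<epsilon>) * \<rho>" by simp
    interpret c: comparison H \<Omega> u by (rule cm)
    interpret c': comparison H \<Omega> "\<lambda>x. - u x" by (rule c.uminus)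
    define m where "m = e \<bullet> f - \<epsilon>"
    \<comment> \<open>the line of slopes \<open>p s\<close>, at distance \<open>\<epsilon>\<close> from \<open>e\<close>\<close>
    define p where "p s = m *\<^sub>R f + s *\<^sub>R (\<i> * f)" for s
    have ff: "f \<bullet> f = 1" using f by (simp add: dot_square_norm)
    have fi: "(\<i> * f) \<bullet> f = 0" by (simp add: inner_complex_def)
    have pz: "p s \<bullet> z = m * (f \<bullet> z) + s * ((\<i> * f) \<bullet> z)" for s z by (simp add: p_def inner_add_left)
    have pf: "p s \<bullet> f = m" for s using ff fi by (simp add: pz)
    have rf: "of_real x * f = x *\<^sub>R f" for x by (simp add: scaleR_conv_of_real)
    have ep: "\<epsilon> \<le> norm (e - p s)" for s
    proof -
      have "(e - p s) \<bullet> f = \<epsilon>" by (simp add: inner_diff_left pf m_def)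
      then show ?thesis using norm_cauchy_schwarz[of "e - p s" f] f by simp
    qed
    let ?z1 = "- (of_real \<rho> * f)"
    have nz1: "norm ?z1 \<le> 1/8" using f \<rho> by (simp add: norm_mult)
    have e1: "p s \<bullet> ?z1 = - ((e \<bullet> f - \<epsilon>) * \<rho>)" and e2: "p s \<bullet> (of_real \<rho> * f) = (e \<bullet> f - \<epsilon>) * \<rho>" for s
      unfolding rf by (simp_all add: pf m_def mult.commute)
    have pz1: "p s \<bullet> ?z1 < u ?z1" for s unfolding e1 by (rule start)
    have pz2: "u (of_real \<rho> * f) < p s \<bullet> (of_real \<rho> * f)" for s unfolding e2 by (rule stop)
    have nf2: "norm (f / 2) = 1/2" using f by (simp add: norm_divide)
    have f2: "f / 2 = (1/2) *\<^sub>R f" by (simp add: scaleR_conv_of_real)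
    have epf2: "(e - p s) \<bullet> (f / 2) = \<epsilon> / 2" for s unfolding f2 by (simp add: inner_diff_left pf m_def)
    show False
    proof (rule no_saddle_family[where U = u and f = f and m = m and \<rho> = \<rho>])
      show "continuous_on (cball 0 1) u" by (rule continuous_on_subset[OF c.cont unit])
      show "norm f = 1" "0 < \<rho>" "\<rho> < 1/2" using f \<rho> by auto
      show "m * (f \<bullet> - (of_real \<rho> * f)) + 0 * ((\<i> * f) \<bullet> - (of_real \<rho> * f)) < u (- (of_real \<rho> * f))"
        using pz1[of 0] unfolding pz .
      have "\<bar>u (f / 2) - e \<bullet> (f / 2)\<bar> \<le> lam" using nf2 by (intro close) auto
      then have "p 0 \<bullet> (f / 2) < u (f / 2)" using epf2[of 0] small(2) \<epsilon> by (simp add: inner_diff_left abs_le_iff)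
      then show "m * (f \<bullet> (f / 2)) + 0 * ((\<i> * f) \<bullet> (f / 2)) < u (f / 2)" unfolding pz .
    next
      fix s
      interpret pl: planar H \<Omega> u e "p s" lam \<nu> \<epsilon> a k
        by unfold_locales (fact unit close lam \<nu> \<epsilon> sc ep ab(1,4) k small(1,2) small3)+
      obtain q where q: "q \<in> path_component_set pl.W ?z1" "lam < (e - p s) \<bullet> q"
        using pl.reaches_large_side[OF nz1 pz1] by blast
      obtain g where g: "path g" "path_image g \<subseteq> pl.W" "pathstart g = ?z1" "pathfinish g = q"
        using q(1) unfolding mem_Collect_eq path_component_def by blast
      have qn: "norm q < 1" using g pathfinish_in_path_image[of g] by (auto simp: pl.W_def)
      have seg: "closed_segment q (f / 2) \<subseteq> pl.W"
      proof
        fix w assume w: "w \<in> closed_segment q (f / 2)"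
        have "closed_segment q (f / 2) \<subseteq> ball 0 1 \<inter> {w. lam < (e - p s) \<bullet> w}"
        proof (rule closed_segment_subset)
          show "convex (ball 0 1 \<inter> {w. lam < (e - p s) \<bullet> w})" by (intro convex_Int convex_ball convex_halfspace_gt)
          show "q \<in> ball 0 1 \<inter> {w. lam < (e - p s) \<bullet> w}" using qn q(2) by simp
          have "lam < \<epsilon> / 2" using small(2) \<epsilon> by simp
          then show "f / 2 \<in> ball 0 1 \<inter> {w. lam < (e - p s) \<bullet> w}" using nf2 epf2[of s] by simp
        qed
        then have wb: "norm w < 1" "lam < (e - p s) \<bullet> w" using w by auto
        then have "\<bar>u w - e \<bullet> w\<bar> \<le> lam" by (intro close) auto
        then show "w \<in> pl.W" using wb by (simp add: pl.W_def inner_diff_left abs_le_iff)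
      qed
      have "path (g +++ linepath q (f / 2)) \<and> path_image (g +++ linepath q (f / 2)) \<subseteq> pl.W \<and>
          pathstart (g +++ linepath q (f / 2)) = ?z1 \<and> pathfinish (g +++ linepath q (f / 2)) = f / 2"
        using g seg by (auto simp: path_image_join)
      then show "\<exists>\<gamma>. path \<gamma> \<and> path_image \<gamma> \<subseteq> {z \<in> ball 0 1. m * (f \<bullet> z) + s * ((\<i> * f) \<bullet> z) < u z} \<and>
          pathstart \<gamma> = ?z1 \<and> pathfinish \<gamma> = f / 2" unfolding pl.W_def pz by blast
    next
      fix s r :: real assume r: "r < 1"
      have z2: "norm (of_real \<rho> * f) < 1" using f \<rho> by (simp add: norm_mult)
      have "(- p s) \<bullet> (of_real \<rho> * f) < - u (of_real \<rho> * f)" using pz2[of s] by simp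
      have "{z \<in> ball 0 1. (- p s) \<bullet> z < - u z} = {z \<in> ball 0 1. u z < m * (f \<bullet> z) + s * ((\<i> * f) \<bullet> z)}"
        by (simp only: inner_minus_left neg_less_iff_less pz)
      note eq = this
      from c'.component_reaches_boundary[OF unit z2 \<open>(- p s) \<bullet> (of_real \<rho> * f) < - u (of_real \<rho> * f)\<close> r]
      show "\<exists>q\<in>path_component_set {z \<in> ball 0 1. u z < m * (f \<bullet> z) + s * ((\<i> * f) \<bullet> z)} (of_real \<rho> * f). r < norm q"
        unfolding eq .
    qed
  qed
  show ?thesis using lam main by blast
qed

lemma linear_isometry_inner:
  assumes "linear f" "\<And>x. norm (f x) = norm x"
  shows "f x \<bullet> f y = x \<bullet> y"
  using assms linear_add[OF assms(1), of x y] by (simp add: dot_norm flip: linear_add)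

text \<open>
  Comparison is invariant under isometric changes of coordinates and under the rescaling used in
  blow-ups. It allows an abstract plane to be replaced by the complex numbers, where winding numbers are
  available.
\<close>

lemma comparison_transport:
  fixes \<phi> :: "'b::euclidean_space \<Rightarrow> 'a::euclidean_space" and \<psi> :: "'a \<Rightarrow> 'b"
  assumes cm: "comparison H \<Omega> u"
    and lin: "linear \<phi>" "linear \<psi>" and iso: "\<And>x. norm (\<phi> x) = norm x" and inv: "\<And>x. \<psi> (\<phi> x) = x" "\<And>y. \<phi> (\<psi> y) = y"
    and r: "r > 0"
  shows "comparison (\<lambda>z. H (\<phi> z)) {z. x0 + r *\<^sub>R \<phi> z \<in> \<Omega>} (\<lambda>z. (u (x0 + r *\<^sub>R \<phi> z) - c) / r)"
proof -
  interpret c: comparison H \<Omega> u by (rule cm)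
  note linear_simps = linear_add[OF lin(1)] linear_scale[OF lin(1)] linear_0[OF lin(1)] linear_diff[OF lin(1)]
  have phi0: "\<phi> p = 0 \<longleftrightarrow> p = 0" for p using iso[of p] by (metis norm_eq_zero)
  have inn: "\<phi> x \<bullet> \<phi> y = x \<bullet> y" for x y by (rule linear_isometry_inner[OF lin(1) iso])
  have sn: "strict_norm (\<lambda>z. H (\<phi> z))"
  proof
    have "is_norm (\<lambda>z. H (\<phi> z))"
      unfolding is_norm_def linear_simps using phi0 by (simp add: c.H.scale c.H.tri)
    moreover have "\<not> (\<exists>a b. a \<noteq> b \<and> closed_segment a b \<subseteq> {p. H (\<phi> p) = 1})"
    proof
      assume "\<exists>a b. a \<noteq> b \<and> closed_segment a b \<subseteq> {p. H (\<phi> p) = 1}"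
      then obtain a b where ab: "a \<noteq> b" "closed_segment a b \<subseteq> {p. H (\<phi> p) = 1}" by blast
      have "closed_segment (\<phi> a) (\<phi> b) = \<phi> ` closed_segment a b" by (rule closed_segment_linear_image[OF lin(1)])
      then have "closed_segment (\<phi> a) (\<phi> b) \<subseteq> {p. H p = 1}" using ab(2) by auto
      moreover have "\<phi> a \<noteq> \<phi> b" using ab(1) inv(1) by metis
      ultimately show False using c.strict unfolding strictly_convex_norm_def by blast
    qed
    ultimately show "strictly_convex_norm (\<lambda>z. H (\<phi> z))" unfolding strictly_convex_norm_def by blast
  qed
  interpret s: strict_norm "\<lambda>z. H (\<phi> z)" by (rule sn)
  have LL: "s.L z = c.L (\<phi> z)" for z
  proof -
    have "(\<lambda>p. p \<bullet> z) ` {p. H (\<phi> p) \<le> 1} = (\<lambda>p. p \<bullet> \<phi> z) ` {p. H p \<le> 1}"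
    proof (intro equalityI subsetI)
      fix t assume "t \<in> (\<lambda>p. p \<bullet> z) ` {p. H (\<phi> p) \<le> 1}"
      then obtain p where p: "H (\<phi> p) \<le> 1" "t = p \<bullet> z" by auto
      then show "t \<in> (\<lambda>p. p \<bullet> \<phi> z) ` {p. H p \<le> 1}" by (intro image_eqI[of _ _ "\<phi> p"]) (simp_all add: inn)
    next
      fix t assume "t \<in> (\<lambda>p. p \<bullet> \<phi> z) ` {p. H p \<le> 1}"
      then obtain p where p: "H p \<le> 1" "t = p \<bullet> \<phi> z" by auto
      then show "t \<in> (\<lambda>p. p \<bullet> z) ` {p. H (\<phi> p) \<le> 1}"
        using inn[of "\<psi> p" z] by (intro image_eqI[of _ _ "\<psi> p"]) (simp_all add: inv)
    qed
    then show ?thesis unfolding s.L_def c.L_def dual_norm_def by simp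
  qed
  define T where "T z = x0 + r *\<^sub>R \<phi> z" for z
  define T' where "T' y = \<psi> ((y - x0) /\<^sub>R r)" for y
  have TT: "T' (T z) = z" "T (T' y) = y" for z y using r by (simp_all add: T_def T'_def inv)
  have clin: "continuous_on A \<phi>" "continuous_on B \<psi>" for A B
    using lin by (simp_all add: linear_continuous_on linear_conv_bounded_linear)
  have cT: "continuous_on A T" for A unfolding T_def by (intro continuous_intros clin)
  have cT': "continuous_on A T'" for A unfolding T'_def
    by (rule continuous_on_compose2[OF clin(2)[of UNIV]]) (auto intro!: continuous_intros)
  have image_T: "T ` V = T' -` V" for V using TT by (auto simp: image_iff) (metis TT(2))
  have open_T: "open (T ` V)" if "open V" for V
    unfolding image_T by (rule open_vimage[OF that cT'])
  have set_eq: "{z. x0 + r *\<^sub>R \<phi> z \<in> \<Omega>} = T -` \<Omega>" by (auto simp: T_def)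
  have V_T: "T ` V \<Subset> \<Omega> \<and> frontier (T ` V) \<subseteq> T ` frontier V" if V: "open V" "V \<Subset> T -` \<Omega>" for V
  proof -
    have cpt: "compact (T ` closure V)" "T ` closure V \<subseteq> \<Omega>"
      using V(2) compact_continuous_image[OF cT] by (auto simp: compactly_inside_def)
    have sub: "T ` V \<subseteq> T ` closure V" by (intro image_mono closure_subset)
    have "closure (T ` V) \<subseteq> T ` closure V" by (rule closure_minimal[OF sub compact_imp_closed[OF cpt(1)]])
    moreover have "frontier (T ` V) = closure (T ` V) - T ` V" using open_T[OF V(1)] by (simp add: frontier_def interior_open)
    moreover have "frontier V = closure V - V" using V(1) by (simp add: frontier_def interior_open)
    ultimately show ?thesis using compactly_insideI[OF sub cpt] by blast
  qed
  show ?thesis unfolding set_eq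
  proof (unfold_locales)
    show "open (T -` \<Omega>)" by (rule open_vimage[OF c.open_\<Omega> cT])
    have "continuous_on (T -` \<Omega>) (\<lambda>z. u (T z))"
      by (rule continuous_on_compose2[OF c.cont cT]) auto
    then show "continuous_on (T -` \<Omega>) (\<lambda>z. (u (x0 + r *\<^sub>R \<phi> z) - c) / r)"
      unfolding T_def using r by (intro continuous_intros) auto
    fix V z0 b c' x and p :: 'b
    assume V: "open V" "V \<Subset> T -` \<Omega>" and x: "x \<in> V"
    note VT = V_T[OF V] open_T[OF V(1)]
    have Tx: "T x \<in> T ` V" using x by blast
    { assume z0: "z0 \<notin> V" and fr: "\<And>x. x \<in> frontier V \<Longrightarrow> (u (x0 + r *\<^sub>R \<phi> x) - c) / r = c' + b * s.L (x - z0)"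
      have Lr: "r * s.L (x - z0) = c.L (T x - T z0)" for x
      proof -
        have "T x - T z0 = r *\<^sub>R \<phi> (x - z0)" by (simp add: T_def linear_simps scaleR_diff_right)
        then show ?thesis using r by (simp add: LL c.L.scale)
      qed
      have *: "(u (T x) - c) / r = c' + b * s.L (x - z0) \<longleftrightarrow> u (T x) = (r * c' + c) + b * c.L (T x - T z0)" for x
        using r by (simp add: Lr[symmetric] field_simps)
      have "u y = (r * c' + c) + b * c.L (y - T z0)" if yf: "y \<in> frontier (T ` V)" for y
      proof -
        obtain x where x: "x \<in> frontier V" "y = T x" using yf VT(1) by blast
        show ?thesis using fr[OF x(1)] *[of x] x(2) by (simp add: T_def)
      qed
      moreover have "T z0 \<notin> T ` V" using z0 TT(1) by (metis imageE)
      ultimately have "u (T x) = (r * c' + c) + b * c.L (T x - T z0)"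
        using c.cone_eq[OF VT(2) _ _ _ Tx] VT(1) by blast
      then show "(u (x0 + r *\<^sub>R \<phi> x) - c) / r = c' + b * s.L (x - z0)" using *[of x] by (simp add: T_def) }
    { assume fr: "\<And>x. x \<in> frontier V \<Longrightarrow> (u (x0 + r *\<^sub>R \<phi> x) - c) / r = c' + p \<bullet> x"
      have pr: "r * (p \<bullet> x) = \<phi> p \<bullet> T x - \<phi> p \<bullet> x0" for x
        by (simp add: T_def inner_add_right inn)
      have *: "(u (T x) - c) / r = c' + p \<bullet> x \<longleftrightarrow> u (T x) = (r * c' + c - \<phi> p \<bullet> x0) + \<phi> p \<bullet> T x" for x
      proof -
        have "(u (T x) - c) / r = c' + p \<bullet> x \<longleftrightarrow> u (T x) - c = r * c' + r * (p \<bullet> x)" using r by (simp add: field_simps)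
        then show ?thesis unfolding pr by auto
      qed
      have "u y = (r * c' + c - \<phi> p \<bullet> x0) + \<phi> p \<bullet> y" if yf: "y \<in> frontier (T ` V)" for y
      proof -
        obtain x where x: "x \<in> frontier V" "y = T x" using yf VT(1) by blast
        show ?thesis using fr[OF x(1)] *[of x] x(2) by (simp add: T_def)
      qed
      then have "u (T x) = (r * c' + c - \<phi> p \<bullet> x0) + \<phi> p \<bullet> T x"
        using c.plane_eq[OF VT(2) _ _ Tx] VT(1) by blast
      then show "(u (x0 + r *\<^sub>R \<phi> x) - c) / r = c' + p \<bullet> x" using *[of x] by (simp add: T_def) }
  qed
qed

text \<open>
  Move the midpoint of \<open>z1\<close> and \<open>z2\<close> to the origin, rescale by
  \<open>r\<close>, and subtract the mean of \<open>u z1\<close> and \<open>u z2\<close>. The values at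
  the two points are then opposite, so that a failure of the estimate at one of them is the hypothesis
  of \<open>planar_flatness\<close> at the other.
\<close>

lemma flatness_improves:
  fixes H :: "'a::euclidean_space \<Rightarrow> real" and e :: 'a
  assumes dim: "DIM('a) = 2" and sn: "strict_norm H" and e: "e \<noteq> 0" and \<epsilon>: "\<epsilon> > 0"
  shows "\<exists>lam>0. \<forall>\<Omega> u x0 r. comparison H \<Omega> u \<longrightarrow> r > 0 \<longrightarrow> cball x0 (2 * r) \<subseteq> \<Omega> \<longrightarrow>
    (\<forall>y\<in>cball x0 (2 * r). \<bar>u y - u x0 - e \<bullet> (y - x0)\<bar> \<le> lam * r) \<longrightarrow>
    (\<forall>z1\<in>cball x0 (r / 8). \<forall>z2\<in>cball x0 (r / 8). \<bar>u z2 - u z1 - e \<bullet> (z2 - z1)\<bar> \<le> \<epsilon> * norm (z2 - z1))"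
proof -
  have dim': "DIM(complex) = DIM('a)" using dim by simp
  obtain \<phi> :: "complex \<Rightarrow> 'a" and \<psi> where iso': "linear \<phi>" "linear \<psi>" "\<And>x. norm (\<phi> x) = norm x"
    "\<And>y. norm (\<psi> y) = norm y" "\<And>x. \<psi> (\<phi> x) = x" "\<And>y. \<phi> (\<psi> y) = y"
    by (rule isomorphisms_UNIV_UNIV[OF dim']) (rule that; assumption)
  note iso = iso'(1-3,5,6)
  have inn: "\<phi> x \<bullet> \<phi> y = x \<bullet> y" for x y by (rule linear_isometry_inner[OF iso(1,3)])
  let ?H = "\<lambda>z. H (\<phi> z)" and ?e = "\<psi> e"
  have snH: "comparison H \<Omega> u \<Longrightarrow> strict_norm ?H" for \<Omega> u
    using comparison_transport[OF _ iso(1,2,3,4,5), of H \<Omega> u 1 0 0] comparison_def by force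
  have "\<exists>lam>0. strict_norm ?H \<longrightarrow> (\<forall>\<Omega> u f \<rho>. comparison ?H \<Omega> u \<longrightarrow> cball 0 1 \<subseteq> \<Omega> \<longrightarrow> (\<forall>z\<in>cball 0 1. \<bar>u z - ?e \<bullet> z\<bar> \<le> lam) \<longrightarrow>
     norm f = 1 \<longrightarrow> 0 < \<rho> \<longrightarrow> \<rho> \<le> 1/8 \<longrightarrow> - ((?e \<bullet> f - \<epsilon>) * \<rho>) < u (- (of_real \<rho> * f)) \<longrightarrow> (?e \<bullet> f - \<epsilon>) * \<rho> \<le> u (of_real \<rho> * f))"
  proof (cases "strict_norm ?H")
    case True
    have "?e \<noteq> 0" using e iso(5)[of e] linear_0[OF iso(1)] by metis
    then show ?thesis using planar_flatness[OF True _ \<epsilon>] by blast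
  qed (auto intro: exI[of _ 1])
  then obtain lam where lam: "lam > 0" and flat: "\<And>\<Omega> u f \<rho>. strict_norm ?H \<Longrightarrow> comparison ?H \<Omega> u \<Longrightarrow> cball 0 1 \<subseteq> \<Omega> \<Longrightarrow> (\<forall>z\<in>cball 0 1. \<bar>u z - ?e \<bullet> z\<bar> \<le> lam) \<Longrightarrow>
     norm f = 1 \<Longrightarrow> 0 < \<rho> \<Longrightarrow> \<rho> \<le> 1/8 \<Longrightarrow> - ((?e \<bullet> f - \<epsilon>) * \<rho>) < u (- (of_real \<rho> * f)) \<Longrightarrow> (?e \<bullet> f - \<epsilon>) * \<rho> \<le> u (of_real \<rho> * f)"
    by blast
  have main: "(e \<bullet> (z2 - z1)) - \<epsilon> * norm (z2 - z1) \<le> u z2 - u z1"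
    if cm: "comparison H \<Omega> u" and r: "r > 0" and sub: "cball x0 (2 * r) \<subseteq> \<Omega>"
      and close: "\<And>y. y \<in> cball x0 (2 * r) \<Longrightarrow> \<bar>u y - u x0 - e \<bullet> (y - x0)\<bar> \<le> (lam / 2) * r"
      and z: "z1 \<in> cball x0 (r / 8)" "z2 \<in> cball x0 (r / 8)" for \<Omega> u x0 r z1 z2
  proof (cases "z1 = z2")
    case False
    define d where "d = norm (z2 - z1)"
    have d: "d > 0" using False by (simp add: d_def)
    define w where "w = (z2 - z1) /\<^sub>R d"
    have w: "norm w = 1" "z2 - z1 = d *\<^sub>R w" using d by (simp_all add: w_def d_def)
    define mid where "mid = (1/2) *\<^sub>R (z1 + z2)"
    define \<rho> where "\<rho> = d / (2 * r)"
    define c where "c = (u z1 + u z2) / 2"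
    define f where "f = \<psi> w"
    have f: "norm f = 1" "\<phi> f = w" using iso(3)[of f] iso(5)[of w] w by (auto simp: f_def)
    have \<rho>0: "\<rho> > 0" using d r by (simp add: \<rho>_def)
    have "d \<le> r / 4" using z norm_triangle_ineq4[of "z2 - x0" "z1 - x0"] by (simp add: d_def dist_norm norm_minus_commute)
    then have \<rho>8: "\<rho> \<le> 1/8" using r by (simp add: \<rho>_def field_simps)
    have midx: "norm (mid - x0) \<le> r / 8"
    proof -
      have "mid \<in> cball x0 (r / 8)" unfolding mid_def scaleR_add_right
        by (rule convexD[OF convex_cball z]) auto
      then show ?thesis by (simp add: dist_norm norm_minus_commute)
    qed
    have rr: "\<phi> (of_real t * f) = t *\<^sub>R w" for t
      using f(2) linear_scale[OF iso(1), of t f] by (simp add: scaleR_conv_of_real)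
    have half: "r * \<rho> = d / 2" using r by (simp add: \<rho>_def)
    have Tz2: "mid + r *\<^sub>R \<phi> (of_real \<rho> * f) = z2"
    proof -
      have "mid + r *\<^sub>R \<phi> (of_real \<rho> * f) = mid + (1/2) *\<^sub>R (z2 - z1)" by (simp add: rr half w(2))
      then show ?thesis by (simp add: mid_def scaleR_add_right scaleR_diff_right flip: scaleR_add_left)
    qed
    have Tz1: "mid + r *\<^sub>R \<phi> (- (of_real \<rho> * f)) = z1"
    proof -
      have "mid + r *\<^sub>R \<phi> (- (of_real \<rho> * f)) = mid - (1/2) *\<^sub>R (z2 - z1)"
        using linear_neg[OF iso(1)] by (simp add: rr half w(2))
      then show ?thesis by (simp add: mid_def scaleR_add_right scaleR_diff_right flip: scaleR_add_left)
    qed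
    let ?u = "\<lambda>z. (u (mid + r *\<^sub>R \<phi> z) - c) / r" and ?\<Omega> = "{z. mid + r *\<^sub>R \<phi> z \<in> \<Omega>}"
    have cm': "comparison ?H ?\<Omega> ?u" by (rule comparison_transport[OF cm iso r])
    have inb: "mid + r *\<^sub>R \<phi> z \<in> cball x0 (2 * r)" if "z \<in> cball 0 1" for z
    proof -
      have "norm (mid + r *\<^sub>R \<phi> z - x0) \<le> norm (mid - x0) + norm (r *\<^sub>R \<phi> z)"
        using norm_triangle_ineq[of "mid - x0" "r *\<^sub>R \<phi> z"] by (simp add: algebra_simps)
      also have "norm (r *\<^sub>R \<phi> z) \<le> r * 1" using that iso(3)[of z] r by simp
      finally show ?thesis using midx r by (simp add: dist_norm norm_minus_commute)
    qed
    have closeu: "\<bar>?u z - ?e \<bullet> z\<bar> \<le> lam" if zc: "z \<in> cball 0 1" for z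
    proof -
      let ?y = "mid + r *\<^sub>R \<phi> z"
      have zz: "z1 \<in> cball x0 (2 * r)" "z2 \<in> cball x0 (2 * r)" using z r by (auto intro: order.trans)
      have "e \<bullet> (mid - x0) = (e \<bullet> (z1 - x0) + e \<bullet> (z2 - x0)) / 2"
        by (simp add: mid_def inner_add_right inner_diff_right)
      moreover have "e \<bullet> (?y - mid) = e \<bullet> (?y - x0) - e \<bullet> (mid - x0)"
        unfolding inner_diff_right by simp
      ultimately have em: "e \<bullet> (?y - mid) = e \<bullet> (?y - x0) - (e \<bullet> (z1 - x0) + e \<bullet> (z2 - x0)) / 2" by simp
      have arith: "\<bar>A - (b1 + b2) / 2 - (Y - (P1 + P2) / 2)\<bar> \<le> 2 * K"
        if "\<bar>A - B - Y\<bar> \<le> K" "\<bar>b1 - B - P1\<bar> \<le> K" "\<bar>b2 - B - P2\<bar> \<le> K" for A B Y K b1 b2 P1 P2 :: real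
        using that by (simp add: abs_le_iff field_simps)
      have "\<bar>u ?y - c - e \<bullet> (?y - mid)\<bar> \<le> 2 * ((lam / 2) * r)"
        unfolding em c_def by (rule arith[OF close[OF inb[OF zc]] close[OF zz(1)] close[OF zz(2)]])
      then have "\<bar>u ?y - c - e \<bullet> (?y - mid)\<bar> \<le> lam * r" by simp
      moreover have "e \<bullet> (?y - mid) = r * (?e \<bullet> z)" using inn[of ?e z] iso(5)[of e] by simp
      ultimately have "\<bar>u ?y - c - r * (?e \<bullet> z)\<bar> / r \<le> lam" using r by (simp add: pos_divide_le_eq)
      moreover have "\<bar>u ?y - c - r * (?e \<bullet> z)\<bar> / r = \<bar>?u z - ?e \<bullet> z\<bar>"
      proof -
        have "?u z - ?e \<bullet> z = (u ?y - c - r * (?e \<bullet> z)) / r" using r by (simp add: field_simps)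
        then show ?thesis using r by simp
      qed
      ultimately show ?thesis by simp
    qed
    have ef: "?e \<bullet> f = e \<bullet> w" using inn[of ?e f] iso(5)[of e] f(2) by simp
    have um: "?u (- (of_real \<rho> * f)) = - ((u z2 - u z1) / (2 * r))" and up: "?u (of_real \<rho> * f) = (u z2 - u z1) / (2 * r)"
      unfolding Tz1 Tz2 using r by (simp_all add: c_def field_simps)
    show ?thesis
    proof (rule ccontr)
      assume nt: "\<not> ?thesis"
      have ew: "e \<bullet> (z2 - z1) = d * (e \<bullet> w)" unfolding w(2) by simp
      have "u z2 - u z1 < d * (e \<bullet> w) - \<epsilon> * d" using nt unfolding ew d_def[symmetric] by linarith
      then have "u z2 - u z1 < d * (e \<bullet> w - \<epsilon>)" by (simp only: right_diff_distrib mult.commute[of \<epsilon> d])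
      then have lt: "(u z2 - u z1) / (2 * r) < (?e \<bullet> f - \<epsilon>) * \<rho>" using r by (simp add: ef \<rho>_def divide_strict_right_mono mult.commute)
      have "(?e \<bullet> f - \<epsilon>) * \<rho> \<le> ?u (of_real \<rho> * f)"
      proof (rule flat[OF snH[OF cm] cm' _ _ f(1) \<rho>0 \<rho>8])
        show "cball 0 1 \<subseteq> ?\<Omega>" using inb sub by blast
        show "\<forall>z\<in>cball 0 1. \<bar>?u z - ?e \<bullet> z\<bar> \<le> lam" using closeu by blast
        show "- ((?e \<bullet> f - \<epsilon>) * \<rho>) < ?u (- (of_real \<rho> * f))" unfolding um using lt by simp
      qed
      then show False unfolding up using lt by simp
    qed
  qed simp
  show ?thesis
  proof (intro exI[of _ "lam / 2"] conjI allI impI ballI)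
    show "lam / 2 > 0" using lam by simp
    fix \<Omega> u x0 r z1 z2
    assume *: "comparison H \<Omega> u" "r > 0" "cball x0 (2 * r) \<subseteq> \<Omega>"
      "\<forall>y\<in>cball x0 (2 * r). \<bar>u y - u x0 - e \<bullet> (y - x0)\<bar> \<le> (lam / 2) * r"
      "z1 \<in> cball x0 (r / 8)" "z2 \<in> cball x0 (r / 8)"
    have 1: "e \<bullet> (z2 - z1) - \<epsilon> * norm (z2 - z1) \<le> u z2 - u z1" using * by (intro main[of \<Omega> u r x0]) auto
    have 2: "e \<bullet> (z1 - z2) - \<epsilon> * norm (z1 - z2) \<le> u z1 - u z2" using * by (intro main[of \<Omega> u r x0]) auto
    show "\<bar>u z2 - u z1 - e \<bullet> (z2 - z1)\<bar> \<le> \<epsilon> * norm (z2 - z1)"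
      using 1 2 by (simp add: abs_le_iff norm_minus_commute inner_diff_right)
  qed
qed

section \<open>Consequences in the plane\<close>

context comparison
begin

text \<open>
  A blow-up slope \<open>e\<close> makes \<open>u\<close> flat at one small scale. For \<open>e \<noteq>
  0\<close>, flatness then improves to all smaller scales and all nearby base points; for \<open>e =
  0\<close> the local Lipschitz constant vanishes.
\<close>

lemma strictly_differentiable:
  assumes dim: "DIM('a) = 2" and x: "x \<in> \<Omega>"
  shows "\<exists>e. \<forall>\<epsilon>>0. \<exists>\<delta>>0. ball x \<delta> \<subseteq> \<Omega> \<and> (\<forall>z1\<in>ball x \<delta>. \<forall>z2\<in>ball x \<delta>. \<bar>u z2 - u z1 - e \<bullet> (z2 - z1)\<bar> \<le> \<epsilon> * norm (z2 - z1))"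
proof -
  have rpos: "0 < 1 / real (Suc i)" for i by simp
  have rlim: "(\<lambda>i. 1 / real (Suc i)) \<longlonglongrightarrow> 0" by (rule LIMSEQ_Suc[OF lim_1_over_n])
  obtain s e where s: "strict_mono (s :: nat \<Rightarrow> nat)" "blow_up_limit u x ((\<lambda>i. 1 / real (Suc i)) \<circ> s) e"
    using blow_up_exists[OF x rpos rlim] by blast
  have "e \<in> blow_up_slopes u x" unfolding blow_up_slopes_def using s rpos rlim by (intro CollectI exI[of _ "\<lambda>i. 1 / real (Suc i)"] exI[of _ s] conjI allI)
  then have He: "H e = S x" by (rule blow_up_slope_norm[OF x])
  obtain a b where ab: "a > 0" "b > 0" "\<And>p. L p \<le> b * norm p" "\<And>p. norm p \<le> a * L p" using norm_bounds by blast
  have "\<exists>\<delta>>0. ball x \<delta> \<subseteq> \<Omega> \<and> (\<forall>z1\<in>ball x \<delta>. \<forall>z2\<in>ball x \<delta>. \<bar>u z2 - u z1 - e \<bullet> (z2 - z1)\<bar> \<le> \<epsilon> * norm (z2 - z1))"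
    if \<epsilon>: "\<epsilon> > 0" for \<epsilon>
  proof (cases "e = 0")
    case True
    then have S0: "S x = 0" using He by simp
    have eb: "\<epsilon> / b > 0" using \<epsilon> ab by simp
    obtain \<delta> where \<delta>: "\<delta> > 0" "ball x \<delta> \<subseteq> \<Omega>" "\<And>y z. y \<in> ball x \<delta> \<Longrightarrow> z \<in> ball x \<delta> \<Longrightarrow> u z - u y \<le> (S x + \<epsilon> / b) * L (z - y)"
      using slope_Lipschitz[OF x eb] by blast
    have one: "u z2 - u z1 \<le> \<epsilon> * norm (z2 - z1)" if z: "z1 \<in> ball x \<delta>" "z2 \<in> ball x \<delta>" for z1 z2
    proof -
      have "u z2 - u z1 \<le> (\<epsilon> / b) * L (z2 - z1)" using \<delta>(3)[OF z] S0 by simp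
      also have "\<dots> \<le> (\<epsilon> / b) * (b * norm (z2 - z1))" using ab(3) eb by (intro mult_left_mono) auto
      finally show ?thesis using ab(2) by simp
    qed
    have "\<bar>u z2 - u z1 - e \<bullet> (z2 - z1)\<bar> \<le> \<epsilon> * norm (z2 - z1)" if z: "z1 \<in> ball x \<delta>" "z2 \<in> ball x \<delta>" for z1 z2
      using one[OF z] one[OF z(2,1)] True by (simp add: abs_le_iff norm_minus_commute)
    then show ?thesis using \<delta>(1,2) by blast
  next
    case False
    have sn: "strict_norm H" by unfold_locales
    have cm: "comparison H \<Omega> u" by unfold_locales
    obtain lam where lam: "lam > 0" and flat: "\<And>x0 r. r > 0 \<Longrightarrow> cball x0 (2 * r) \<subseteq> \<Omega> \<Longrightarrow>
      (\<forall>y\<in>cball x0 (2 * r). \<bar>u y - u x0 - e \<bullet> (y - x0)\<bar> \<le> lam * r) \<Longrightarrow>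
      (\<forall>z1\<in>cball x0 (r / 8). \<forall>z2\<in>cball x0 (r / 8). \<bar>u z2 - u z1 - e \<bullet> (z2 - z1)\<bar> \<le> \<epsilon> * norm (z2 - z1))"
      using flatness_improves[OF dim sn False \<epsilon>] cm by metis
    obtain R where R: "R > 0" "ball x R \<subseteq> \<Omega>" using open_\<Omega> x open_contains_ball by blast
    let ?r = "(\<lambda>i. 1 / real (Suc i)) \<circ> s"
    have "?r \<longlonglongrightarrow> 0" by (rule LIMSEQ_subseq_LIMSEQ[OF rlim s(1)])
    then have ev1: "\<forall>\<^sub>F i in sequentially. ?r i < R" using R(1) by (rule order_tendstoD(2))
    have rpos': "0 < ?r i" for i by simp
    have "lam / 4 > 0" using lam by simp
    note ev2 = blow_up_limitD[OF s(2) rpos' this]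
    have "\<forall>\<^sub>F i in sequentially. ?r i < R \<and> (\<forall>y\<in>ball 0 1. \<bar>u (x + ?r i *\<^sub>R y) - u x - ?r i * (e \<bullet> y)\<bar> \<le> lam / 4 * ?r i)"
      using ev1 ev2 by (rule eventually_conj)
    then obtain i where i: "?r i < R" "\<forall>y\<in>ball 0 1. \<bar>u (x + ?r i *\<^sub>R y) - u x - ?r i * (e \<bullet> y)\<bar> \<le> lam / 4 * ?r i"
      using eventually_happens'[OF sequentially_bot] by blast
    define \<rho> where "\<rho> = ?r i"
    have \<rho>: "\<rho> > 0" "\<rho> < R" "\<And>y. y \<in> ball 0 1 \<Longrightarrow> \<bar>u (x + \<rho> *\<^sub>R y) - u x - \<rho> * (e \<bullet> y)\<bar> \<le> lam / 4 * \<rho>"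
      using i rpos'[of i] unfolding \<rho>_def by blast+
    define r where "r = \<rho> / 4"
    have r: "r > 0" "2 * r = \<rho> / 2" using \<rho>(1) by (simp_all add: r_def)
    have sub: "cball x (2 * r) \<subseteq> \<Omega>"
    proof -
      have "cball x (2 * r) \<subseteq> ball x R" using r \<rho> by auto
      then show ?thesis using R(2) by blast
    qed
    have est: "\<forall>y\<in>cball x (2 * r). \<bar>u y - u x - e \<bullet> (y - x)\<bar> \<le> lam * r"
    proof
      fix y assume y: "y \<in> cball x (2 * r)"
      define w where "w = (1 / \<rho>) *\<^sub>R (y - x)"
      have "norm (y - x) \<le> \<rho> / 2" using y r by (simp add: dist_norm norm_minus_commute)
      then have "(1 / \<rho>) * norm (y - x) \<le> (1 / \<rho>) * (\<rho> / 2)" using \<rho>(1) by (intro mult_left_mono) auto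
      also have "(1 / \<rho>) * (\<rho> / 2) = 1 / 2" using \<rho>(1) by simp
      finally have w1: "w \<in> ball 0 1" using \<rho>(1) unfolding w_def mem_ball_0 norm_scaleR by simp
      have w2: "\<rho> *\<^sub>R w = y - x" using \<rho>(1) by (simp add: w_def)
      have w3: "\<rho> * (e \<bullet> w) = e \<bullet> (y - x)" unfolding w2[symmetric] by simp
      show "\<bar>u y - u x - e \<bullet> (y - x)\<bar> \<le> lam * r" using \<rho>(3)[OF w1] unfolding w2 w3 by (simp add: r_def)
    qed
    have "ball x (r / 8) \<subseteq> cball x (r / 8)" by (rule ball_subset_cball)
    moreover have "ball x (r / 8) \<subseteq> \<Omega>" using sub r(1) by (intro order_trans[OF _ sub]) auto
    ultimately show ?thesis using flat[OF r(1) sub est] r(1) by (intro exI[of _ "r / 8"]) auto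
  qed
  then show ?thesis by blast
qed

end

text \<open>
  Strict differentiability at every point makes the gradient continuous.
\<close>

lemma planar_C1:
  fixes H :: "real ^ 'n::finite \<Rightarrow> real"
  assumes cm: "comparison H \<Omega> u" and card: "CARD('n) = 2"
  shows "C_k_on 1 u \<Omega>"
proof -
  interpret comparison H \<Omega> u by (rule cm)
  have dim: "DIM(real ^ 'n) = 2" using card by simp
  have "\<exists>D. \<forall>x\<in>\<Omega>. \<forall>\<epsilon>>0. \<exists>\<delta>>0. ball x \<delta> \<subseteq> \<Omega> \<and> (\<forall>z1\<in>ball x \<delta>. \<forall>z2\<in>ball x \<delta>. \<bar>u z2 - u z1 - D x \<bullet> (z2 - z1)\<bar> \<le> \<epsilon> * norm (z2 - z1))"
    by (rule bchoice) (use strictly_differentiable[OF dim] in blast)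
  then obtain D where D: "\<And>x \<epsilon>. x \<in> \<Omega> \<Longrightarrow> \<epsilon> > 0 \<Longrightarrow> \<exists>\<delta>>0. ball x \<delta> \<subseteq> \<Omega> \<and> (\<forall>z1\<in>ball x \<delta>. \<forall>z2\<in>ball x \<delta>. \<bar>u z2 - u z1 - D x \<bullet> (z2 - z1)\<bar> \<le> \<epsilon> * norm (z2 - z1))"
    by blast
  have der: "(u has_derivative (\<lambda>h. D x \<bullet> h)) (at x)" if x: "x \<in> \<Omega>" for x
    unfolding has_derivative_at_alt
  proof (intro conjI allI impI bounded_linear_inner_right)
    fix \<epsilon> :: real assume "\<epsilon> > 0"
    then obtain \<delta> where \<delta>: "\<delta> > 0" "\<forall>z1\<in>ball x \<delta>. \<forall>z2\<in>ball x \<delta>. \<bar>u z2 - u z1 - D x \<bullet> (z2 - z1)\<bar> \<le> \<epsilon> * norm (z2 - z1)"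
      using D[OF x] by blast
    have "norm (u y - u x - D x \<bullet> (y - x)) \<le> \<epsilon> * norm (y - x)" if y: "norm (y - x) < \<delta>" for y
    proof -
      have "x \<in> ball x \<delta>" "y \<in> ball x \<delta>" using \<delta>(1) y by (auto simp: dist_norm norm_minus_commute)
      then show ?thesis using \<delta>(2) by simp
    qed
    then show "\<exists>d>0. \<forall>y. norm (y - x) < d \<longrightarrow> norm (u y - u x - D x \<bullet> (y - x)) \<le> \<epsilon> * norm (y - x)"
      using \<delta>(1) by blast
  qed
  have part: "partial_deriv i u x = D x $ i" if x: "x \<in> \<Omega>" for x i
    unfolding partial_deriv_def frechet_derivative_at[OF der[OF x], symmetric] by (simp add: inner_axis)
  have contD: "continuous_on \<Omega> D"
    unfolding continuous_on_iff
  proof (intro ballI allI impI)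
    fix x and \<epsilon> :: real assume x: "x \<in> \<Omega>" and \<epsilon>: "\<epsilon> > 0"
    have e2: "\<epsilon> / 2 > 0" "\<epsilon> / 4 > 0" using \<epsilon> by auto
    obtain \<delta> where \<delta>: "\<delta> > 0" "\<forall>z1\<in>ball x \<delta>. \<forall>z2\<in>ball x \<delta>. \<bar>u z2 - u z1 - D x \<bullet> (z2 - z1)\<bar> \<le> \<epsilon> / 2 * norm (z2 - z1)"
      using D[OF x e2(1)] by blast
    have "norm (D x' - D x) < \<epsilon>" if x': "x' \<in> \<Omega>" "dist x' x < \<delta>" for x'
    proof (cases "D x' = D x")
      case False
      define d where "d = D x' - D x"
      have d: "norm d > 0" using False by (simp add: d_def)
      obtain \<delta>' where \<delta>': "\<delta>' > 0" "\<forall>z1\<in>ball x' \<delta>'. \<forall>z2\<in>ball x' \<delta>'. \<bar>u z2 - u z1 - D x' \<bullet> (z2 - z1)\<bar> \<le> \<epsilon> / 4 * norm (z2 - z1)"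
        using D[OF x'(1) e2(2)] by blast
      define m where "m = min \<delta>' (\<delta> - dist x' x)"
      have m: "m > 0" "m \<le> \<delta>'" "m \<le> \<delta> - dist x' x" using \<delta>'(1) x'(2) by (auto simp: m_def)
      define t where "t = m / (2 * norm d)"
      have t: "t > 0" "t * norm d < m" using m(1) d by (auto simp: t_def)
      define h where "h = t *\<^sub>R d"
      have nh: "norm h = t * norm d" "norm h < m" using t by (simp_all add: h_def)
      have in1: "x' \<in> ball x' \<delta>'" "x' + h \<in> ball x' \<delta>'" using \<delta>'(1) nh m by (auto simp: dist_norm)
      have "dist x (x' + h) \<le> dist x x' + norm h" using dist_triangle[of x "x' + h" x'] by (simp add: dist_norm)
      then have in2: "x' \<in> ball x \<delta>" "x' + h \<in> ball x \<delta>" using nh m x'(2) by (auto simp: dist_commute)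
      have 1: "\<bar>u (x' + h) - u x' - D x' \<bullet> h\<bar> \<le> \<epsilon> / 4 * norm h" using \<delta>'(2)[rule_format, OF in1] by simp
      have 2: "\<bar>u (x' + h) - u x' - D x \<bullet> h\<bar> \<le> \<epsilon> / 2 * norm h" using \<delta>(2)[rule_format, OF in2] by simp
      have "d \<bullet> h \<le> \<epsilon> / 4 * norm h + \<epsilon> / 2 * norm h" unfolding d_def inner_diff_left using abs_le_D1[OF 2] abs_le_D2[OF 1] by linarith
      also have "\<dots> = (3 / 4 * \<epsilon>) * norm h" by (simp add: field_simps)
      finally have "t * (norm d * norm d) \<le> (3 / 4 * \<epsilon>) * (t * norm d)" unfolding nh(1) by (simp add: h_def dot_square_norm power2_eq_square)
      then have "(t * norm d) * norm d \<le> (t * norm d) * (3 / 4 * \<epsilon>)" by (simp add: mult_ac)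
      then have "norm d \<le> 3 / 4 * \<epsilon>" using t(1) d by (simp add: mult_le_cancel_left_pos)
      then show ?thesis using \<epsilon> by (simp add: d_def)
    qed (use \<epsilon> in simp)
    then show "\<exists>d>0. \<forall>x'\<in>\<Omega>. dist x' x < d \<longrightarrow> dist (D x') (D x) < \<epsilon>" using \<delta>(1) by (auto simp: dist_norm)
  qed
  have "continuous_on \<Omega> (partial_deriv i u)" for i
  proof -
    have "continuous_on \<Omega> (\<lambda>x. D x $ i)" using contD by (intro continuous_intros)
    then show ?thesis using part by (simp cong: continuous_on_cong)
  qed
  moreover have "u differentiable (at x)" if "x \<in> \<Omega>" for x using der[OF that] unfolding differentiable_def by blast
  ultimately show ?thesis by simp
qed

text \<open>
  Let \<open>K\<close> be the supremum of the slopes. Where the slope is nearly \<open>K\<close>, the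
  global Lipschitz constant and the increments over spheres match at every scale, so \<open>u\<close> is
  nearly affine on arbitrarily large balls around that point. Taking radii that are large compared with
  the distance to the origin, and passing to a convergent subsequence of the slopes,
  \<open>flatness_improves\<close> applies on balls that contain any two given points.
\<close>

lemma planar_Liouville:
  fixes H :: "'a::euclidean_space \<Rightarrow> real"
  assumes cm: "comparison H UNIV u" and dim: "DIM('a) = 2" and C: "C > 0" "\<And>x. \<bar>u x\<bar> \<le> C * (1 + norm x)"
  shows "\<exists>a p. \<forall>x. u x = a + p \<bullet> x"
proof -
  interpret comparison H UNIV u by (rule cm)
  have sn: "strict_norm H" by unfold_locales
  obtain a b where ab: "a > 0" "b > 0" "\<And>p. L p \<le> b * norm p" "\<And>p. norm p \<le> a * L p" using norm_bounds by blast
  have Sb: "S x \<le> 1 + C * a" for x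
  proof (rule slope_le_sphere)
    let ?r = "2 * C * (1 + norm x)"
    have "1 + norm x > 0" by (simp add: add_pos_nonneg)
    then show r: "?r > 0" using C(1) by simp
    show "LB x ?r \<subseteq> UNIV" by simp
    fix y assume y: "L (y - x) = ?r"
    have "norm y \<le> norm x + norm (y - x)" using norm_triangle_ineq[of x "y - x"] by simp
    also have "norm (y - x) \<le> a * ?r" using ab(4)[of "y - x"] y by simp
    finally have "C * norm y \<le> C * (norm x + a * ?r)" using C(1) by simp
    then have "C * (1 + norm y) \<le> C * (1 + norm x) + C * a * ?r" by (simp add: algebra_simps)
    then have "u y \<le> C * (1 + norm x) + C * a * ?r" using C(2)[of y] by linarith
    moreover have "- (C * (1 + norm x)) \<le> u x" using C(2)[of x] by linarith
    moreover have "(1 + C * a) * ?r = C * (1 + norm x) + C * (1 + norm x) + C * a * ?r" by (simp add: algebra_simps)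
    ultimately show "u y \<le> u x + (1 + C * a) * ?r" by linarith
  qed
  define K where "K = Sup (range S)"
  have bdd: "bdd_above (range S)" by (rule bdd_aboveI2[of _ _ "1 + C * a"]) (rule Sb)
  have SK: "S x \<le> K" for x unfolding K_def using bdd by (intro cSup_upper) auto
  have K0: "K \<ge> 0" using slope_nonneg[of 0] SK[of 0] by simp
  have near: "\<exists>x. S x > K - \<tau>" if "\<tau> > 0" for \<tau>
  proof -
    have "K - \<tau> < Sup (range S)" using that by (simp add: K_def)
    then show ?thesis using less_cSup_iff[of "range S" "K - \<tau>"] bdd by auto
  qed
  have lip: "u z - u y \<le> K * L (z - y)" for y z
  proof (rule field_le_epsilon)
    fix \<epsilon> :: real assume \<epsilon>: "\<epsilon> > 0"
    define \<eta> where "\<eta> = \<epsilon> / (L (z - y) + 1)"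
    have Lp: "L (z - y) + 1 > 0" by (simp add: add_nonneg_pos)
    have \<eta>: "\<eta> > 0" using \<epsilon> Lp by (simp add: \<eta>_def)
    have "u z - u y \<le> (K + \<eta>) * L (z - y)"
    proof (rule L.segment_increment)
      fix x
      obtain \<delta> where \<delta>: "\<delta> > 0" "\<forall>y\<in>ball x \<delta>. \<forall>z\<in>ball x \<delta>. u z - u y \<le> (S x + \<eta>) * L (z - y)"
        using slope_Lipschitz[of x \<eta>] \<eta> by blast
      have "(S x + \<eta>) * L w \<le> (K + \<eta>) * L w" for w using SK[of x] by (intro mult_right_mono) auto
      then show "\<exists>\<delta>>0. \<forall>y\<in>ball x \<delta>. \<forall>z\<in>ball x \<delta>. u z - u y \<le> (K + \<eta>) * L (z - y)"
        using \<delta> by (meson order.trans)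
    qed
    also have "\<dots> = K * L (z - y) + \<eta> * L (z - y)" by (simp add: distrib_right)
    also have "\<eta> * L (z - y) \<le> \<eta> * (L (z - y) + 1)" using \<eta> by simp
    also have "\<eta> * (L (z - y) + 1) = \<epsilon>" using Lp by (simp add: \<eta>_def)
    finally show "u z - u y \<le> K * L (z - y) + \<epsilon>" by simp
  qed
  show ?thesis
  proof (cases "K = 0")
    case True
    have "u x = u 0" for x using lip[of x 0] lip[of 0 x] True by simp
    then show ?thesis by (intro exI[of _ "u 0"] exI[of _ 0]) simp
  next
    case False
    then have Kp: "K > 0" using K0 by simp
    have flat: "\<exists>x. \<forall>r>0. \<exists>q. H q = K \<and> (\<forall>y. L y \<le> 1 \<longrightarrow> \<bar>u (x + r *\<^sub>R y) - u x - r * (q \<bullet> y)\<bar> \<le> \<epsilon> * r)" if \<epsilon>: "\<epsilon> > 0" for \<epsilon>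
    proof -
      define \<delta> where "\<delta> = \<epsilon> / (6 * K)"
      have \<delta>: "\<delta> > 0" "K * \<delta> = \<epsilon> / 6" using \<epsilon> Kp by (auto simp: \<delta>_def)
      obtain M0 where M0: "M0 > 0" "\<And>M \<eta> y. M \<ge> M0 \<Longrightarrow> L \<eta> = 1 \<Longrightarrow> L y \<le> 1 \<Longrightarrow> L (M *\<^sub>R \<eta> - y) \<le> M - J \<eta> \<bullet> y + \<delta>"
        using L_far[OF \<delta>(1)] by blast
      define M where "M = max 1 M0"
      have M: "M \<ge> 1" "M \<ge> M0" "M > 0" by (auto simp: M_def)
      have "\<epsilon> / (6 * M) > 0" using \<epsilon> M by simp
      then obtain x where x: "S x > K - \<epsilon> / (6 * M)" using near by blast
      have KM: "(K - S x) * M \<le> \<epsilon> / 6"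
      proof -
        have "(K - S x) * M \<le> (\<epsilon> / (6 * M)) * M" using x M(3) by (intro mult_right_mono) auto
        then show ?thesis using M(3) by simp
      qed
      have "\<exists>q. H q = K \<and> (\<forall>y. L y \<le> 1 \<longrightarrow> \<bar>u (x + r *\<^sub>R y) - u x - r * (q \<bullet> y)\<bar> \<le> \<epsilon> * r)" if r: "r > 0" for r
      proof -
        have Mr: "M * r > 0" using M r by simp
        obtain yp where yp: "L (yp - x) = M * r" "S x * (M * r) \<le> u yp - u x" using sphere_increase[OF Mr] by blast
        obtain ym where ym: "L (ym - x) = M * r" "u ym - u x \<le> - S x * (M * r)" using sphere_decrease[OF Mr] by blast
        obtain q where q: "H q = K" "\<And>y. L y \<le> 1 \<Longrightarrow> \<bar>u (x + r *\<^sub>R y) - u x - r * (q \<bullet> y)\<bar> \<le> 3 * r * (K * \<delta> + (K - S x) * M)"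
          using near_linear[OF r M(3) _ M(1) lip K0 M0(2)[OF M(2)] yp ym] by blast
        have "3 * r * (K * \<delta> + (K - S x) * M) \<le> 3 * r * (\<epsilon> / 6 + \<epsilon> / 6)"
          using \<delta>(2) KM r by (intro mult_left_mono add_mono) auto
        also have "\<dots> = \<epsilon> * r" by simp
        finally show ?thesis using q order.trans by blast
      qed
      then show ?thesis by blast
    qed
    have "\<forall>n. \<exists>x. \<forall>r>0. \<exists>q. H q = K \<and> (\<forall>y. L y \<le> 1 \<longrightarrow> \<bar>u (x + r *\<^sub>R y) - u x - r * (q \<bullet> y)\<bar> \<le> 1 / real (Suc n) * r)"
      by (intro allI flat) simp
    then obtain X where X: "\<And>n r. r > 0 \<Longrightarrow> \<exists>q. H q = K \<and> (\<forall>y. L y \<le> 1 \<longrightarrow> \<bar>u (X n + r *\<^sub>R y) - u (X n) - r * (q \<bullet> y)\<bar> \<le> 1 / real (Suc n) * r)"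
      using choice[of "\<lambda>n x. \<forall>r>0. \<exists>q. H q = K \<and> (\<forall>y. L y \<le> 1 \<longrightarrow> \<bar>u (x + r *\<^sub>R y) - u x - r * (q \<bullet> y)\<bar> \<le> 1 / real (Suc n) * r)"] by blast
    \<comment> \<open>large compared with the distance of \<open>X n\<close> from the origin, so that any two given points lie in the ball where flatness is improved\<close>
    define rr where "rr n = real (Suc n) * (1 + norm (X n))" for n
    have rr: "rr n > 0" for n by (simp add: rr_def add_pos_nonneg)
    have "\<forall>n. \<exists>q. H q = K \<and> (\<forall>y. L y \<le> 1 \<longrightarrow> \<bar>u (X n + rr n *\<^sub>R y) - u (X n) - rr n * (q \<bullet> y)\<bar> \<le> 1 / real (Suc n) * rr n)"
      using X rr by blast
    then obtain q where q: "\<And>n. H (q n) = K" "\<And>n y. L y \<le> 1 \<Longrightarrow> \<bar>u (X n + rr n *\<^sub>R y) - u (X n) - rr n * (q n \<bullet> y)\<bar> \<le> 1 / real (Suc n) * rr n"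
      using choice[of "\<lambda>n q. H q = K \<and> (\<forall>y. L y \<le> 1 \<longrightarrow> \<bar>u (X n + rr n *\<^sub>R y) - u (X n) - rr n * (q \<bullet> y)\<bar> \<le> 1 / real (Suc n) * rr n)"] by blast
    have "bounded (range q)" by (rule bounded_subset[OF bounded_H_level[of K]]) (use q(1) in auto)
    then obtain e t where t: "strict_mono (t :: nat \<Rightarrow> nat)" "(q \<circ> t) \<longlonglongrightarrow> e"
      using bounded_imp_convergent_subsequence by blast
    have "(\<lambda>n. H ((q \<circ> t) n)) \<longlonglongrightarrow> H e"
      using continuous_on_tendsto_compose[OF H.continuous_on[of UNIV] t(2)] by simp
    then have "(\<lambda>n. K) \<longlonglongrightarrow> H e" using q(1) by simp
    then have "H e = K" by (simp add: LIMSEQ_const_iff)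
    then have e0: "e \<noteq> 0" using Kp by auto
    have lin: "\<bar>u z2 - u z1 - e \<bullet> (z2 - z1)\<bar> \<le> \<epsilon> * norm (z2 - z1)" if \<epsilon>: "\<epsilon> > 0" for \<epsilon> z1 z2
    proof -
      obtain lam where lam: "lam > 0" and improve: "\<And>x0 r. r > 0 \<Longrightarrow>
        (\<forall>y\<in>cball x0 (2 * r). \<bar>u y - u x0 - e \<bullet> (y - x0)\<bar> \<le> lam * r) \<Longrightarrow>
        (\<forall>z1\<in>cball x0 (r / 8). \<forall>z2\<in>cball x0 (r / 8). \<bar>u z2 - u z1 - e \<bullet> (z2 - z1)\<bar> \<le> \<epsilon> * norm (z2 - z1))"
        using flatness_improves[OF dim sn e0 \<epsilon>] cm subset_UNIV by metis
      define B where "B = 16 * b * (1 + norm z1 + norm z2)"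
      have "\<forall>\<^sub>F n in sequentially. dist ((q \<circ> t) n) e < lam / 4" by (rule tendstoD[OF t(2)]) (use lam in simp)
      moreover have "\<forall>\<^sub>F n in sequentially. 1 / real (Suc n) < lam / (4 * b)"
        by (rule order_tendstoD(2)[OF LIMSEQ_Suc[OF lim_1_over_n]]) (use lam ab in simp)
      moreover have "\<forall>\<^sub>F n in sequentially. B \<le> real n"
        using filterlim_real_sequentially unfolding filterlim_at_top by blast
      ultimately have "\<forall>\<^sub>F n in sequentially. dist ((q \<circ> t) n) e < lam / 4 \<and> 1 / real (Suc n) < lam / (4 * b) \<and> B \<le> real n"
        by eventually_elim blast
      then obtain n where n: "dist ((q \<circ> t) n) e < lam / 4" "1 / real (Suc n) < lam / (4 * b)" "B \<le> real n"
        using eventually_happens'[OF sequentially_bot] by blast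
      define m where "m = t n"
      have nm: "n \<le> m" unfolding m_def by (rule seq_suble[OF t(1)])
      have qe: "norm (q m - e) \<le> lam / 4" using n(1) by (simp add: m_def dist_norm)
      have "1 / real (Suc m) \<le> 1 / real (Suc n)" using nm by (intro divide_left_mono) auto
      then have em: "1 / real (Suc m) \<le> lam / (4 * b)" using n(2) by linarith
      define R where "R = rr m"
      have R: "R > 0" using rr by (simp add: R_def)
      define r where "r = R / (2 * b)"
      have r: "r > 0" "2 * r = R / b" "R = 2 * b * r" using R ab by (simp_all add: r_def field_simps)
      have est: "\<forall>y\<in>cball (X m) (2 * r). \<bar>u y - u (X m) - e \<bullet> (y - X m)\<bar> \<le> lam * r"
      proof
        fix y assume y: "y \<in> cball (X m) (2 * r)"
        have ny: "norm (y - X m) \<le> 2 * r" using y by (simp add: dist_norm norm_minus_commute)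
        define w where "w = (1 / R) *\<^sub>R (y - X m)"
        have w2: "R *\<^sub>R w = y - X m" using R by (simp add: w_def)
        have w3: "R * (q m \<bullet> w) = q m \<bullet> (y - X m)" unfolding w2[symmetric] by simp
        have "L (y - X m) \<le> b * (2 * r)" using ab(3)[of "y - X m"] ny ab(2) mult_left_mono[OF ny, of b] by linarith
        then have "L (y - X m) \<le> R" using r(3) by simp
        then have "L w \<le> 1" using R by (simp add: w_def L.scale)
        from q(2)[OF this, of m] have 1: "\<bar>u y - u (X m) - q m \<bullet> (y - X m)\<bar> \<le> 1 / real (Suc m) * R"
          unfolding R_def[symmetric] w2 w3 by simp
        have "1 / real (Suc m) * R \<le> lam / (4 * b) * (2 * b * r)" unfolding r(3)[symmetric] using em R by (intro mult_right_mono) auto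
        also have "\<dots> = lam / 2 * r" using ab(2) by simp
        finally have 2: "1 / real (Suc m) * R \<le> lam / 2 * r" .
        have "\<bar>(q m - e) \<bullet> (y - X m)\<bar> \<le> norm (q m - e) * norm (y - X m)" by (rule Cauchy_Schwarz_ineq2)
        also have "\<dots> \<le> (lam / 4) * (2 * r)" using qe ny lam by (intro mult_mono) auto
        finally have 3: "\<bar>q m \<bullet> (y - X m) - e \<bullet> (y - X m)\<bar> \<le> lam / 2 * r" by (simp add: inner_diff_left)
        have "lam / 2 * r + lam / 2 * r = lam * r" by simp
        then show "\<bar>u y - u (X m) - e \<bullet> (y - X m)\<bar> \<le> lam * r" using 1 2 3 by linarith
      qed
      have inb: "z \<in> cball (X m) (r / 8)" if z: "norm z \<le> norm z1 + norm z2" for z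
      proof -
        have "B \<le> real (Suc m)" using n(3) nm by linarith
        then have "B * (1 + norm (X m)) \<le> R" unfolding R_def rr_def by (intro mult_right_mono) (auto simp: add_nonneg_nonneg)
        then have "16 * b * ((1 + norm z1 + norm z2) * (1 + norm (X m))) \<le> 16 * b * (r / 8)" using r(3) by (simp add: B_def mult.assoc)
        then have "(1 + norm z1 + norm z2) * (1 + norm (X m)) \<le> r / 8" using ab(2) by (subst (asm) mult_le_cancel_left_pos) auto
        moreover have "norm z + norm (X m) \<le> (1 + norm z1 + norm z2) * (1 + norm (X m))"
        proof -
          have "0 \<le> (norm z1 + norm z2) * norm (X m)" by simp
          moreover have "(1 + norm z1 + norm z2) * (1 + norm (X m)) = 1 + norm (X m) + (norm z1 + norm z2) + (norm z1 + norm z2) * norm (X m)"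
            by (simp add: algebra_simps)
          ultimately show ?thesis using z by linarith
        qed
        moreover have "norm (X m - z) \<le> norm z + norm (X m)" using norm_triangle_ineq4[of "X m" z] by simp
        ultimately show ?thesis by (simp add: dist_norm)
      qed
      show ?thesis using improve[OF r(1) est] inb[of z1] inb[of z2] by simp
    qed
    have "u z = u 0 + e \<bullet> z" for z
    proof -
      have "\<bar>u z - u 0 - e \<bullet> z\<bar> \<le> 0"
      proof (rule field_le_epsilon)
        fix \<epsilon> :: real assume \<epsilon>: "\<epsilon> > 0"
        define \<eta> where "\<eta> = \<epsilon> / (norm z + 1)"
        have np: "norm z + 1 > 0" by (simp add: add_nonneg_pos)
        have \<eta>: "\<eta> > 0" using \<epsilon> np by (simp add: \<eta>_def)
        have "\<bar>u z - u 0 - e \<bullet> (z - 0)\<bar> \<le> \<eta> * norm (z - 0)" by (rule lin[OF \<eta>])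
        also have "\<dots> \<le> \<eta> * (norm z + 1)" using \<eta> by simp
        also have "\<dots> = \<epsilon>" using np by (simp add: \<eta>_def)
        finally show "\<bar>u z - u 0 - e \<bullet> z\<bar> \<le> 0 + \<epsilon>" by simp
      qed
      then show ?thesis by simp
    qed
    then show ?thesis by blast
  qed
qed

section \<open>Smooth bumps\<close>

text \<open>
  A recursive notion that avoids iterated derivative operators, which suits closure under products.
\<close>

primrec differentiable_times :: "nat \<Rightarrow> (real \<Rightarrow> real) \<Rightarrow> bool" where
  "differentiable_times 0 f \<longleftrightarrow> True"
| "differentiable_times (Suc k) f \<longleftrightarrow> (\<exists>f'. (\<forall>t. (f has_real_derivative f' t) (at t)) \<and> differentiable_times k f')"

definition smooth_real :: "(real \<Rightarrow> real) \<Rightarrow> bool" where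
  "smooth_real f \<longleftrightarrow> (\<forall>k. differentiable_times k f)"

lemma differentiable_times_mono: "differentiable_times (Suc k) f \<Longrightarrow> differentiable_times k f"
proof (induction k arbitrary: f)
  case (Suc k)
  then obtain f' where f': "\<forall>t. (f has_real_derivative f' t) (at t)" "differentiable_times (Suc k) f'" by auto
  then have "differentiable_times k f'" using Suc.IH by blast
  then show ?case using f'(1) by auto
qed simp

lemma smooth_realD:
  assumes "smooth_real f"
  shows "\<exists>f'. (\<forall>t. (f has_real_derivative f' t) (at t)) \<and> smooth_real f'"
proof -
  have "differentiable_times (Suc 0) f" using assms unfolding smooth_real_def by blast
  then obtain f' where f': "\<forall>t. (f has_real_derivative f' t) (at t)" by auto
  have "differentiable_times k f'" for k
  proof -
    have "differentiable_times (Suc k) f" using assms unfolding smooth_real_def by blast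
    then obtain g where g: "\<forall>t. (f has_real_derivative g t) (at t)" "differentiable_times k g" by auto
    have "g = f'" using g(1) f' DERIV_unique by blast
    then show ?thesis using g(2) by simp
  qed
  then show ?thesis using f' unfolding smooth_real_def by blast
qed

lemma differentiable_times_add:
  "differentiable_times k f \<Longrightarrow> differentiable_times k g \<Longrightarrow> differentiable_times k (\<lambda>t. f t + g t)"
proof (induction k arbitrary: f g)
  case (Suc k)
  obtain f' where f': "\<forall>t. (f has_real_derivative f' t) (at t)" "differentiable_times k f'" using Suc.prems(1) by auto
  obtain g' where g': "\<forall>t. (g has_real_derivative g' t) (at t)" "differentiable_times k g'" using Suc.prems(2) by auto
  have "\<forall>t. ((\<lambda>t. f t + g t) has_real_derivative f' t + g' t) (at t)" using f'(1) g'(1) by (auto intro: DERIV_add)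
  moreover have "differentiable_times k (\<lambda>t. f' t + g' t)" using Suc.IH f'(2) g'(2) by blast
  ultimately show ?case unfolding differentiable_times.simps by (intro exI[of _ "\<lambda>t. f' t + g' t"] conjI)
qed simp

lemma differentiable_times_mult:
  "differentiable_times k f \<Longrightarrow> differentiable_times k g \<Longrightarrow> differentiable_times k (\<lambda>t. f t * g t)"
proof (induction k arbitrary: f g)
  case (Suc k)
  obtain f' where f': "\<forall>t. (f has_real_derivative f' t) (at t)" "differentiable_times k f'" using Suc.prems(1) by auto
  obtain g' where g': "\<forall>t. (g has_real_derivative g' t) (at t)" "differentiable_times k g'" using Suc.prems(2) by auto
  have "\<forall>t. ((\<lambda>t. f t * g t) has_real_derivative f' t * g t + g' t * f t) (at t)" using f'(1) g'(1) by (auto intro: DERIV_mult)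
  moreover have "differentiable_times k (\<lambda>t. f' t * g t + g' t * f t)"
    using Suc.IH f'(2) g'(2) differentiable_times_mono[OF Suc.prems(1)] differentiable_times_mono[OF Suc.prems(2)]
    by (intro differentiable_times_add) auto
  ultimately show ?case unfolding differentiable_times.simps by (intro exI[of _ "\<lambda>t. f' t * g t + g' t * f t"] conjI)
qed simp

lemma differentiable_times_affine:
  "differentiable_times k f \<Longrightarrow> differentiable_times k (\<lambda>t. c * f (m * t + b))"
proof (induction k arbitrary: f c)
  case (Suc k)
  obtain f' where f': "\<forall>t. (f has_real_derivative f' t) (at t)" "differentiable_times k f'" using Suc.prems by auto
  have "((\<lambda>t. c * f (m * t + b)) has_real_derivative (c * m) * f' (m * t + b)) (at t)" for t
  proof -
    have "((\<lambda>t. f (m * t + b)) has_real_derivative f' (m * t + b) * m) (at t)"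
      by (rule DERIV_chain2[OF f'(1)[rule_format]]) (auto intro!: derivative_eq_intros)
    from DERIV_cmult[OF this, of c] show ?thesis by (simp add: mult_ac)
  qed
  moreover have "differentiable_times k (\<lambda>t. (c * m) * f' (m * t + b))" by (rule Suc.IH[OF f'(2)])
  ultimately show ?case unfolding differentiable_times.simps by (intro exI[of _ "\<lambda>t. (c * m) * f' (m * t + b)"] conjI allI)
qed simp

text \<open>
  The functions \<open>p (1/t) exp (- c/t)\<close>, extended by zero: a family closed under
  differentiation.
\<close>

definition flat_exp :: "real poly \<Rightarrow> real \<Rightarrow> real \<Rightarrow> real" where
  "flat_exp p c t = (if 0 < t then poly p (1 / t) * exp (- c / t) else 0)"

lemma poly_times_exp_tendsto_0:
  fixes p :: "real poly"
  assumes c: "c > 0"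
  shows "((\<lambda>x. poly p x * exp (- c * x)) \<longlongrightarrow> 0) at_top"
proof -
  have mon: "((\<lambda>x. x ^ i * exp (- c * x)) \<longlongrightarrow> 0) at_top" for i
  proof -
    have "filterlim (\<lambda>x. c * x) at_top at_top" using c by (intro filterlim_tendsto_pos_mult_at_top[OF tendsto_const]) (auto intro: filterlim_ident)
    then have "((\<lambda>x. (c * x) ^ i / exp (c * x)) \<longlongrightarrow> 0) at_top"
      using filterlim_compose[OF tendsto_power_div_exp_0[of i]] by blast
    then have "((\<lambda>x. (1 / c ^ i) * ((c * x) ^ i / exp (c * x))) \<longlongrightarrow> (1 / c ^ i) * 0) at_top" by (intro tendsto_intros)
    moreover have "(1 / c ^ i) * ((c * x) ^ i / exp (c * x)) = x ^ i * exp (- c * x)" for x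
      using c by (simp add: power_mult_distrib exp_minus field_simps)
    ultimately show ?thesis by simp
  qed
  have "((\<lambda>x. \<Sum>i\<le>degree p. coeff p i * (x ^ i * exp (- c * x))) \<longlongrightarrow> (\<Sum>i\<le>degree p. coeff p i * 0)) at_top"
    by (intro tendsto_sum tendsto_mult tendsto_const mon)
  moreover have "(\<Sum>i\<le>degree p. coeff p i * (x ^ i * exp (- c * x))) = poly p x * exp (- c * x)" for x
    by (simp add: poly_altdef sum_distrib_right mult.assoc)
  ultimately show ?thesis by simp
qed

lemma flat_exp_deriv:
  assumes c: "c > 0"
  shows "(flat_exp p c has_real_derivative flat_exp ([:0, 0, 1:] * (smult c p - pderiv p)) c t) (at t)"
proof -
  let ?q = "[:0, 0, 1:] * (smult c p - pderiv p)"
  consider "t > 0" | "t < 0" | "t = 0" by linarith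
  then show ?thesis
  proof cases
    case 1
    have "((\<lambda>t. poly p (1 / t) * exp (- c / t)) has_real_derivative
        (poly (pderiv p) (1 / t) * (- 1 / t\<^sup>2)) * exp (- c / t) + (exp (- c / t) * (c / t\<^sup>2)) * poly p (1 / t)) (at t)"
    proof (rule DERIV_mult)
      have d: "((\<lambda>t. 1 / t) has_real_derivative (- 1 / t\<^sup>2)) (at t)"
        using 1 by (auto intro!: derivative_eq_intros simp: power2_eq_square)
      show "((\<lambda>t. poly p (1 / t)) has_real_derivative poly (pderiv p) (1 / t) * (- 1 / t\<^sup>2)) (at t)"
        by (rule DERIV_chain2[OF poly_DERIV d])
      show "((\<lambda>t. exp (- c / t)) has_real_derivative exp (- c / t) * (c / t\<^sup>2)) (at t)"
        using 1 by (auto intro!: derivative_eq_intros simp: power2_eq_square)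
    qed
    moreover have "(poly (pderiv p) (1 / t) * (- 1 / t\<^sup>2)) * exp (- c / t) + (exp (- c / t) * (c / t\<^sup>2)) * poly p (1 / t) = flat_exp ?q c t"
      using 1 by (simp add: flat_exp_def power2_eq_square field_simps)
    ultimately have "((\<lambda>t. poly p (1 / t) * exp (- c / t)) has_real_derivative flat_exp ?q c t) (at t)" by simp
    then show ?thesis
      by (rule has_field_derivative_transform_within_open[of _ _ _ "{0<..}"]) (use 1 in \<open>auto simp: flat_exp_def\<close>)
  next
    case 2
    have "((\<lambda>t. 0) has_real_derivative flat_exp ?q c t) (at t)" using 2 by (simp add: flat_exp_def)
    then show ?thesis
      by (rule has_field_derivative_transform_within_open[of _ _ _ "{..<0}"]) (use 2 in \<open>auto simp: flat_exp_def\<close>)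
  next
    case 3
    have "((\<lambda>h. (flat_exp p c (0 + h) - flat_exp p c 0) / h) \<longlongrightarrow> 0) (at 0)"
    proof (subst filterlim_at_split, intro conjI)
      have "\<forall>\<^sub>F h in at_left 0. (flat_exp p c (0 + h) - flat_exp p c 0) / h = (0::real)"
        by (auto simp: eventually_at_left_field flat_exp_def intro!: exI[of _ "-1"])
      then show "((\<lambda>h. (flat_exp p c (0 + h) - flat_exp p c 0) / h) \<longlongrightarrow> 0) (at_left 0)"
        by (rule tendsto_eventually)
      have "((\<lambda>h. poly ([:0, 1:] * p) (inverse h) * exp (- c * inverse h)) \<longlongrightarrow> 0) (at_right 0)"
        using filterlim_compose[OF poly_times_exp_tendsto_0[OF c] filterlim_inverse_at_top_right] by blast
      moreover have "\<forall>\<^sub>F h in at_right 0. poly ([:0, 1:] * p) (inverse h) * exp (- c * inverse h) = (flat_exp p c (0 + h) - flat_exp p c 0) / h"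
        by (auto simp: eventually_at_right_field flat_exp_def field_simps intro!: exI[of _ 1])
      ultimately show "((\<lambda>h. (flat_exp p c (0 + h) - flat_exp p c 0) / h) \<longlongrightarrow> 0) (at_right 0)"
        by (rule Lim_transform_eventually)
    qed
    then show ?thesis using 3 by (simp add: DERIV_def flat_exp_def)
  qed
qed

lemma smooth_flat_exp: "c > 0 \<Longrightarrow> differentiable_times k (flat_exp p c)"
proof (induction k arbitrary: p)
  case (Suc k)
  have "\<forall>t. (flat_exp p c has_real_derivative flat_exp ([:0, 0, 1:] * (smult c p - pderiv p)) c t) (at t)"
    using flat_exp_deriv[OF Suc.prems] by blast
  then show ?case using Suc.IH[OF Suc.prems] unfolding differentiable_times.simps
    by (intro exI[of _ "flat_exp ([:0, 0, 1:] * (smult c p - pderiv p)) c"] conjI)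
qed simp

definition bump1 :: "real \<Rightarrow> real \<Rightarrow> real \<Rightarrow> real \<Rightarrow> real" where
  "bump1 c a b t = flat_exp 1 c (t - a) * flat_exp 1 c (b - t)"

lemma bump1_smooth: "c > 0 \<Longrightarrow> smooth_real (bump1 c a b)"
proof -
  assume c: "c > 0"
  have "differentiable_times k (\<lambda>t. (1 * flat_exp 1 c (1 * t + (- a))) * (1 * flat_exp 1 c ((- 1) * t + b)))" for k
    by (intro differentiable_times_mult differentiable_times_affine smooth_flat_exp c)
  then show ?thesis unfolding smooth_real_def by (simp add: bump1_def[abs_def])
qed

lemma bump1_pos: "a < t \<Longrightarrow> t < b \<Longrightarrow> bump1 c a b t > 0"
  and bump1_zero: "\<not> (a < t \<and> t < b) \<Longrightarrow> bump1 c a b t = 0"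
  and bump1_nonneg: "bump1 c a b t \<ge> 0"
  by (auto simp: bump1_def flat_exp_def)

lemma bump1_le_1: "c > 0 \<Longrightarrow> bump1 c a b t \<le> 1"
  unfolding bump1_def flat_exp_def by (auto intro!: mult_le_one)

lemma bump1_shift: "bump1 c a b (t - s) = bump1 c (a + s) (b + s) t"
  by (simp add: bump1_def algebra_simps)

lemma bump1_tendsto: "a < t \<Longrightarrow> t < b \<Longrightarrow> (\<lambda>n. bump1 (1 / Suc n) a b t) \<longlonglongrightarrow> 1"
proof -
  assume t: "a < t" "t < b"
  have "(\<lambda>n. exp (- (1 / Suc n) / (t - a)) * exp (- (1 / Suc n) / (b - t))) \<longlonglongrightarrow> exp (- 0 / (t - a)) * exp (- 0 / (b - t))"
    by (intro tendsto_intros LIMSEQ_Suc[OF lim_1_over_n]) (use t in auto)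
  then show ?thesis using t by (simp add: bump1_def flat_exp_def)
qed

text \<open>
  A product of one-dimensional bumps. As \<open>c\<close> tends to zero it tends to the indicator
  function of the box, which replaces the usual rescaled mollifiers.
\<close>

definition bump :: "real \<Rightarrow> real ^ 'n::finite \<Rightarrow> real ^ 'n \<Rightarrow> real ^ 'n \<Rightarrow> real" where
  "bump c a b x = (\<Prod>i\<in>UNIV. bump1 c (a $ i) (b $ i) (x $ i))"

lemma prod_coordinate_has_derivative:
  fixes \<beta> \<beta>' :: "'n::finite \<Rightarrow> real \<Rightarrow> real"
  assumes "\<And>i t. (\<beta> i has_real_derivative \<beta>' i t) (at t)"
  shows "((\<lambda>x :: real ^ 'n. \<Prod>i\<in>UNIV. \<beta> i (x $ i)) has_derivative
     (\<lambda>h. \<Sum>i\<in>UNIV. (\<beta>' i (x $ i) * h $ i) * (\<Prod>j\<in>UNIV - {i}. \<beta> j (x $ j)))) (at x)"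
proof (rule has_derivative_prod)
  fix i :: 'n
  have "((\<lambda>x :: real ^ 'n. x $ i) has_derivative (\<lambda>h. h $ i)) (at x)"
    by (intro bounded_linear_imp_has_derivative bounded_linear_vec_nth)
  moreover have "(\<beta> i has_derivative (\<lambda>h. \<beta>' i (x $ i) * h)) (at (x $ i))"
    using assms[of i "x $ i"] by (simp add: has_field_derivative_def)
  ultimately show "((\<lambda>x :: real ^ 'n. \<beta> i (x $ i)) has_derivative (\<lambda>h. \<beta>' i (x $ i) * h $ i)) (at x)"
    using has_derivative_compose by blast
qed

lemma prod_coordinate_partial:
  fixes \<beta> \<beta>' :: "'n::finite \<Rightarrow> real \<Rightarrow> real"
  assumes "\<And>i t. (\<beta> i has_real_derivative \<beta>' i t) (at t)"
  shows "partial_deriv k (\<lambda>x. \<Prod>i\<in>UNIV. \<beta> i (x $ i)) = (\<lambda>x. \<Prod>i\<in>UNIV. (\<beta>(k := \<beta>' k)) i (x $ i))"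
proof
  fix x :: "real ^ 'n"
  have "partial_deriv k (\<lambda>x. \<Prod>i\<in>UNIV. \<beta> i (x $ i)) x =
      (\<Sum>i\<in>UNIV. (\<beta>' i (x $ i) * axis k 1 $ i) * (\<Prod>j\<in>UNIV - {i}. \<beta> j (x $ j)))"
    unfolding partial_deriv_def frechet_derivative_at[OF prod_coordinate_has_derivative[OF assms], symmetric] ..
  also have "\<dots> = (\<Sum>i\<in>UNIV. if i = k then \<beta>' k (x $ k) * (\<Prod>j\<in>UNIV - {k}. \<beta> j (x $ j)) else 0)"
    by (intro sum.cong) (auto simp: axis_def)
  also have "\<dots> = \<beta>' k (x $ k) * (\<Prod>j\<in>UNIV - {k}. \<beta> j (x $ j))" by simp
  also have "\<dots> = (\<Prod>i\<in>UNIV. (\<beta>(k := \<beta>' k)) i (x $ i))"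
    by (subst (2) prod.remove[of _ k]) (auto intro!: prod.cong)
  finally show "partial_deriv k (\<lambda>x. \<Prod>i\<in>UNIV. \<beta> i (x $ i)) x = (\<Prod>i\<in>UNIV. (\<beta>(k := \<beta>' k)) i (x $ i))" .
qed

text \<open>
  The partial derivatives of a product of one-dimensional functions are of the same form, which makes
  the induction over the order of differentiability possible.
\<close>

lemma prod_coordinate_smooth:
  fixes \<beta> :: "'n::finite \<Rightarrow> real \<Rightarrow> real"
  assumes "\<And>i. smooth_real (\<beta> i)"
  shows "C_k_on k (\<lambda>x. \<Prod>i\<in>UNIV. \<beta> i (x $ i)) S"
  using assms
proof (induction k arbitrary: \<beta>)
  case 0
  obtain \<beta>' where \<beta>': "\<And>i t. (\<beta> i has_real_derivative \<beta>' i t) (at t)" using smooth_realD[OF 0] by metis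
  have "continuous_on S (\<lambda>x :: real ^ 'n. \<Prod>i\<in>UNIV. \<beta> i (x $ i))"
    by (intro continuous_at_imp_continuous_on ballI has_derivative_continuous[OF prod_coordinate_has_derivative[of \<beta> \<beta>', OF \<beta>']])
  then show ?case by simp
next
  case (Suc k)
  have "\<forall>i. \<exists>f'. (\<forall>t. (\<beta> i has_real_derivative f' t) (at t)) \<and> smooth_real f'" using smooth_realD[OF Suc.prems] by blast
  then obtain \<beta>' where \<beta>': "\<And>i t. (\<beta> i has_real_derivative \<beta>' i t) (at t)" "\<And>i. smooth_real (\<beta>' i)" by metis
  have "C_k_on k (\<lambda>x. \<Prod>i\<in>UNIV. (\<beta>(j := \<beta>' j)) i (x $ i)) S" for j
    using Suc.prems \<beta>'(2) by (intro Suc.IH) auto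
  moreover have "(\<lambda>x :: real ^ 'n. \<Prod>i\<in>UNIV. \<beta> i (x $ i)) differentiable (at x)" for x
    using prod_coordinate_has_derivative[of \<beta> \<beta>', OF \<beta>'(1)] unfolding differentiable_def by blast
  ultimately show ?case by (simp add: prod_coordinate_partial[of \<beta> \<beta>', OF \<beta>'(1)])
qed

lemma bump_smooth: "c > 0 \<Longrightarrow> C_k_on k (bump c a b) S"
  unfolding bump_def[abs_def] by (rule prod_coordinate_smooth[OF bump1_smooth])

lemma bump_nonneg: "0 \<le> bump c a b x"
  unfolding bump_def by (intro prod_nonneg bump1_nonneg ballI)

lemma bump_le_1: "c > 0 \<Longrightarrow> bump c a b x \<le> 1"
  unfolding bump_def by (intro prod_le_1) (auto simp: bump1_nonneg bump1_le_1)

lemma bump_pos: "x \<in> box a b \<Longrightarrow> 0 < bump c a b x"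
  unfolding bump_def by (intro prod_pos) (auto simp: mem_box_cart bump1_pos)

lemma bump_zero: "x \<notin> box a b \<Longrightarrow> bump c a b x = 0"
  unfolding bump_def mem_box_cart by (auto intro: prod_zero bump1_zero)

lemma bump_shift: "bump c a b (x - s) = bump c (a + s) (b + s) x"
  by (simp add: bump_def bump1_shift)

lemma bump_tendsto:
  fixes a b x :: "real ^ 'n::finite"
  shows "(\<lambda>n. bump (1 / Suc n) a b x) \<longlonglongrightarrow> indicator (box a b) x"
proof (cases "x \<in> box a b")
  case True
  have "(\<lambda>n. bump1 (1 / Suc n) (a $ i) (b $ i) (x $ i)) \<longlonglongrightarrow> (\<lambda>_. 1) i" for i
    by (rule bump1_tendsto) (use True in \<open>auto simp: mem_box_cart\<close>)
  then have "(\<lambda>n. bump (1 / Suc n) a b x) \<longlonglongrightarrow> (\<Prod>i\<in>(UNIV::'n set). (\<lambda>_. 1) i)"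
    unfolding bump_def by (rule tendsto_prod)
  then show ?thesis using True by simp
qed (simp add: bump_zero)

lemma bump_test:
  assumes "c > 0" "cbox a b \<subseteq> V"
  shows "test_function V (bump c a b)"
proof -
  have "{x. bump c a b x \<noteq> 0} \<subseteq> cbox a b" using bump_zero box_subset_cbox by blast
  then have cl: "closure {x. bump c a b x \<noteq> 0} \<subseteq> cbox a b" by (intro closure_minimal closed_cbox)
  then have "closure {x. bump c a b x \<noteq> 0} = cbox a b \<inter> closure {x. bump c a b x \<noteq> 0}" by blast
  then have "compact (closure {x. bump c a b x \<noteq> 0})"
    using compact_Int_closed[OF compact_cbox closed_closure, of a b] by metis
  then show ?thesis unfolding test_function_def compactly_inside_def using bump_smooth[OF assms(1)] cl assms(2) by blast
qed

section \<open>A density lemma\<close>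

text \<open>
  A substitute for Lebesgue's differentiation theorem. On \<open>{1 / n < f}\<close> a fine cover by
  boxes, tagged at points of this set, has Riemann sums at least \<open>1 / n\<close> times its volume,
  while the integrals over the boxes are not positive; Henstock's lemma bounds the difference.
\<close>

lemma AE_le_of_box_integrals:
  fixes f :: "'a::euclidean_space \<Rightarrow> real"
  assumes int: "f integrable_on cbox a b"
    and le: "\<And>c d. cbox c d \<subseteq> cbox a b \<Longrightarrow> integral (cbox c d) f \<le> 0"
  shows "negligible {x \<in> cbox a b. 0 < f x}"
proof (cases "box a b = {}")
  case True
  then have "negligible (cbox a b)" by (simp add: negligible_interval)
  then show ?thesis by (rule negligible_subset) auto
next
  case False
  have "negligible {x \<in> cbox a b. 1 / Suc n < f x}" for n
    unfolding negligible_outer_le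
  proof (intro allI impI)
    fix e :: real assume e: "e > 0"
    let ?\<delta> = "1 / real (Suc n)"
    have \<delta>: "?\<delta> > 0" by simp
    have e\<delta>: "e * ?\<delta> > 0" using e by simp
    obtain \<gamma> where \<gamma>: "gauge \<gamma>" and hen: "\<And>p. p tagged_partial_division_of (cbox a b) \<Longrightarrow> \<gamma> fine p \<Longrightarrow>
        (\<Sum>(x,k)\<in>p. norm (measure lborel k *\<^sub>R f x - integral k f)) < e * ?\<delta>"
      using Henstock_lemma[OF int e\<delta>] by blast
    let ?E = "{x \<in> cbox a b. ?\<delta> < f x}"
    have sub: "?E \<subseteq> cbox a b" by blast
    obtain \<D> where \<D>: "countable \<D>" "\<Union>\<D> \<subseteq> cbox a b" "\<And>K. K \<in> \<D> \<Longrightarrow> interior K \<noteq> {} \<and> (\<exists>c d. K = cbox c d)"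
      "pairwise (\<lambda>A B. interior A \<inter> interior B = {}) \<D>" "\<And>K. K \<in> \<D> \<Longrightarrow> \<exists>x \<in> ?E \<inter> K. K \<subseteq> \<gamma> x"
      "\<And>u v. cbox u v \<in> \<D> \<Longrightarrow> \<exists>n. \<forall>i \<in> Basis. v \<bullet> i - u \<bullet> i = (b \<bullet> i - a \<bullet> i) / 2^n" "?E \<subseteq> \<Union>\<D>"
      by (rule covering_lemma[OF sub False \<gamma>]) (rule that; assumption)
    have "\<exists>t. \<forall>K\<in>\<D>. t K \<in> ?E \<inter> K \<and> K \<subseteq> \<gamma> (t K)"
      by (rule bchoice) (use \<D>(5) in blast)
    then obtain t where t: "\<And>K. K \<in> \<D> \<Longrightarrow> t K \<in> ?E \<inter> K \<and> K \<subseteq> \<gamma> (t K)" by blast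
    have Dm: "K \<in> lmeasurable" if "K \<in> \<D>" for K using \<D>(3)[OF that] by auto
    have bound: "measure lebesgue (\<Union>\<F>) \<le> e" if F: "\<F> \<subseteq> \<D>" "finite \<F>" for \<F>
    proof -
      let ?p = "(\<lambda>K. (t K, K)) ` \<F>"
      have inj: "inj_on (\<lambda>K. (t K, K)) \<F>" by (auto simp: inj_on_def)
      have tp: "?p tagged_partial_division_of (cbox a b)"
      proof -
        have A: "x \<in> K \<and> K \<subseteq> cbox a b \<and> (\<exists>a b. K = cbox a b)" if xK: "(x, K) \<in> ?p" for x K
        proof -
          have K: "K \<in> \<D>" "x = t K" using F xK by auto
          show ?thesis using t[OF K(1)] K \<D>(2) \<D>(3)[OF K(1)] by blast
        qed
        have B: "interior K \<inter> interior M = {}" if xK: "(x, K) \<in> ?p" "(y, M) \<in> ?p" "(x, K) \<noteq> (y, M)" for x K y M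
        proof -
          have "K \<in> \<D>" "M \<in> \<D>" "M \<noteq> K" using F xK by auto
          then show ?thesis using \<D>(4) unfolding pairwise_def by metis
        qed
        show ?thesis unfolding tagged_partial_division_of_def
        proof (intro conjI)
          show "finite ?p" using F by simp
          show "\<forall>x K. (x, K) \<in> ?p \<longrightarrow> x \<in> K \<and> K \<subseteq> cbox a b \<and> (\<exists>a b. K = cbox a b)" using A by blast
          show "\<forall>x K y M. (x, K) \<in> ?p \<and> (y, M) \<in> ?p \<and> (x, K) \<noteq> (y, M) \<longrightarrow> interior K \<inter> interior M = {}" using B by blast
        qed
      qed
      have fine: "\<gamma> fine ?p" using t F by (auto simp: fine_def)
      have "(\<Sum>K\<in>\<F>. measure lborel K * ?\<delta>) \<le> (\<Sum>K\<in>\<F>. norm (measure lborel K *\<^sub>R f (t K) - integral K f))"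
      proof (rule sum_mono)
        fix K assume K: "K \<in> \<F>"
        then have KD: "K \<in> \<D>" using F by blast
        obtain c d where cd: "K = cbox c d" using \<D>(3)[OF KD] by blast
        have "integral K f \<le> 0" using le[of c d] cd KD \<D>(2) by blast
        moreover have "measure lborel K * ?\<delta> \<le> measure lborel K * f (t K)"
          using t[OF KD] by (intro mult_left_mono) (auto simp: less_imp_le)
        ultimately show "measure lborel K * ?\<delta> \<le> norm (measure lborel K *\<^sub>R f (t K) - integral K f)" by simp
      qed
      also have "\<dots> = (\<Sum>(x,k)\<in>?p. norm (measure lborel k *\<^sub>R f x - integral k f))"
        by (subst sum.reindex[OF inj]) simp
      also have "\<dots> < e * ?\<delta>" by (rule hen[OF tp fine])
      finally have "(\<Sum>K\<in>\<F>. measure lborel K) * ?\<delta> < e * ?\<delta>" by (simp only: sum_distrib_right)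
      then have "(\<Sum>K\<in>\<F>. measure lborel K) < e" using \<delta> mult_less_cancel_right_pos by blast
      moreover have "measure lebesgue (\<Union>\<F>) \<le> (\<Sum>K\<in>\<F>. measure lebesgue K)"
        using F Dm by (intro measure_Union_le) auto
      moreover have "(\<Sum>K\<in>\<F>. measure lebesgue K) = (\<Sum>K\<in>\<F>. measure lborel K)"
      proof (rule sum.cong)
        fix K assume "K \<in> \<F>"
        then obtain c d where "K = cbox c d" using F \<D>(3) by blast
        then show "measure lebesgue K = measure lborel K" by (simp add: measure_completion)
      qed simp
      ultimately show ?thesis by linarith
    qed
    have "\<Union>\<D> \<in> lmeasurable \<and> measure lebesgue (\<Union>\<D>) \<le> e"
      using fmeasurable_Union_bound[OF \<D>(1) Dm bound] measure_Union_bound[OF \<D>(1) Dm bound] by blast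
    then show "\<exists>T. ?E \<subseteq> T \<and> T \<in> lmeasurable \<and> measure lebesgue T \<le> e" using \<D>(7) by blast
  qed
  then have "negligible (\<Union>n. {x \<in> cbox a b. 1 / Suc n < f x})" by (intro negligible_countable_Union) auto
  moreover have "{x \<in> cbox a b. 0 < f x} \<subseteq> (\<Union>n. {x \<in> cbox a b. 1 / Suc n < f x})"
    using reals_Archimedean by (force simp: inverse_eq_divide)
  ultimately show ?thesis by (rule negligible_subset)
qed

section \<open>Weak gradients\<close>

text \<open>
  Measurability is local, as open sets are countable unions of boxes.
\<close>

lemma locally_integrable_measurable:
  fixes g :: "'a::euclidean_space \<Rightarrow> 'b::euclidean_space"
  assumes "open \<Omega>" "locally_integrable_on g \<Omega>"
  shows "g \<in> borel_measurable (lebesgue_on \<Omega>)"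
proof -
  obtain \<D> where \<D>: "countable \<D>" "\<D> \<subseteq> Pow \<Omega>" "\<And>X. X \<in> \<D> \<Longrightarrow> \<exists>a b. X = cbox a b" "\<Union>\<D> = \<Omega>"
    using open_countable_Union_open_cbox[OF assms(1)] by metis
  have \<Omega>s: "\<Omega> \<in> sets lebesgue" using assms(1) by simp
  show ?thesis
  proof (rule measurable_piecewise_restrict[OF \<D>(1)])
    show "space (lebesgue_on \<Omega>) \<subseteq> \<Union>\<D>" using \<D>(4) by simp
    fix X assume X: "X \<in> \<D>"
    obtain a b where ab: "X = cbox a b" using \<D>(3)[OF X] by blast
    have XO: "X \<subseteq> \<Omega>" using X \<D>(2) by blast
    have Xs: "X \<in> sets lebesgue" by (simp add: ab)
    show "X \<inter> space (lebesgue_on \<Omega>) \<in> sets (lebesgue_on \<Omega>)"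
      using XO Xs \<Omega>s by (simp add: sets_restrict_space_iff Int_absorb2)
    have "set_integrable lebesgue X g" using assms(2) XO ab compact_cbox unfolding locally_integrable_on_def by blast
    then have "(\<lambda>x. indicator X x *\<^sub>R g x) \<in> borel_measurable lebesgue"
      unfolding set_integrable_def by (rule borel_measurable_integrable)
    then have "g \<in> borel_measurable (lebesgue_on X)"
      using borel_measurable_restrict_space_iff[of X lebesgue g] Xs by simp
    moreover have "restrict_space (lebesgue_on \<Omega>) X = lebesgue_on X"
      using restrict_restrict_space[of \<Omega> lebesgue X] XO Xs \<Omega>s by (simp add: Int_absorb1)
    ultimately show "g \<in> borel_measurable (restrict_space (lebesgue_on \<Omega>) X)" by simp
  qed
qed

lemma set_integral_support:
  assumes "Q \<subseteq> \<Omega>" "\<And>x. x \<in> \<Omega> \<Longrightarrow> x \<notin> Q \<Longrightarrow> f x = 0"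
  shows "(LINT x:\<Omega>|M. f x) = (LINT x:Q|M. f x)"
  unfolding set_lebesgue_integral_def
proof (rule arg_cong[where f = "integral\<^sup>L M"])
  show "(\<lambda>x. indicator \<Omega> x *\<^sub>R f x) = (\<lambda>x. indicator Q x *\<^sub>R f x)"
    using assms by (auto simp: fun_eq_iff indicator_def)
qed

lemma set_integrable_compact:
  fixes f :: "'a::euclidean_space \<Rightarrow> 'b::euclidean_space"
  assumes "compact K" "continuous_on K f"
  shows "set_integrable lebesgue K f"
proof -
  have "integrable lborel (\<lambda>x. indicator K x *\<^sub>R f x)"
    using borel_integrable_compact[OF assms] by (simp add: if_distrib[of "\<lambda>c. c *\<^sub>R _"] indicator_def cong: if_cong)
  then show ?thesis unfolding set_integrable_def using integrable_completion[of "\<lambda>x. indicator K x *\<^sub>R f x" lborel]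
    by (simp add: borel_measurable_integrable)
qed

lemma set_integral_eq_HK:
  fixes f :: "'a::euclidean_space \<Rightarrow> real"
  assumes "cbox a b \<subseteq> \<Omega>" "\<And>x. x \<notin> cbox a b \<Longrightarrow> f x = 0" "continuous_on (cbox a b) f"
  shows "(LINT x:\<Omega>|lebesgue. f x) = integral (cbox a b) f"
proof -
  have "(LINT x:\<Omega>|lebesgue. f x) = (LINT x:cbox a b|lebesgue. f x)"
    by (rule set_integral_support[OF assms(1)]) (use assms(2) in blast)
  also have "\<dots> = integral (cbox a b) f"
    by (rule set_lebesgue_integral_eq_integral(2)[OF set_integrable_compact[OF compact_cbox assms(3)]])
  finally show ?thesis .
qed

definition grad :: "(real ^ 'n::finite \<Rightarrow> real) \<Rightarrow> real ^ 'n \<Rightarrow> real ^ 'n" where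
  "grad f x = (\<chi> i. partial_deriv i f x)"

lemma grad_has_derivative:
  assumes "f differentiable (at x)"
  shows "(f has_derivative (\<lambda>h. grad f x \<bullet> h)) (at x)"
proof -
  have d: "(f has_derivative frechet_derivative f (at x)) (at x)" using assms by (simp add: frechet_derivative_works)
  then have lin: "linear (frechet_derivative f (at x))" by (rule has_derivative_linear)
  have "frechet_derivative f (at x) h = grad f x \<bullet> h" for h
  proof -
    have "frechet_derivative f (at x) h = frechet_derivative f (at x) (\<Sum>i\<in>UNIV. (h $ i) *\<^sub>R axis i 1)"
      using basis_expansion[of h] by (simp add: scalar_mult_eq_scaleR)
    also have "\<dots> = (\<Sum>i\<in>UNIV. (h $ i) * partial_deriv i f x)"
      using lin by (simp add: linear_sum linear_scale partial_deriv_def)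
    finally show ?thesis by (simp add: grad_def inner_vec_def mult.commute)
  qed
  then have "frechet_derivative f (at x) = (\<lambda>h. grad f x \<bullet> h)" by blast
  then show ?thesis using d by simp
qed

lemma partial_deriv_eqI:
  assumes "(f has_derivative (\<lambda>h. D \<bullet> h)) (at x)"
  shows "partial_deriv i f x = D $ i"
  unfolding partial_deriv_def frechet_derivative_at[OF assms, symmetric] by (simp add: inner_axis)

lemma bump_gradient:
  fixes a b :: "real ^ 'n::finite"
  assumes "c > 0"
  shows "(bump c a b has_derivative (\<lambda>h. grad (bump c a b) x \<bullet> h)) (at x)" "continuous_on UNIV (grad (bump c a b))"
    "continuous_on S (bump c a b)"
proof -
  have C1: "C_k_on (Suc 0) (bump c a b) UNIV" by (rule bump_smooth[OF assms])
  then show "(bump c a b has_derivative (\<lambda>h. grad (bump c a b) x \<bullet> h)) (at x)" by (intro grad_has_derivative) simp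
  have "continuous_on UNIV (\<lambda>x. \<chi> i. partial_deriv i (bump c a b) x)"
    using C1 by (intro continuous_on_vec_lambda) simp
  then show "continuous_on UNIV (grad (bump c a b))" by (simp add: grad_def[abs_def])
  show "continuous_on S (bump c a b)" using bump_smooth[OF assms, of 0 a b S] by simp
qed

lemma bump_grad_shift:
  fixes a b :: "real ^ 'n::finite"
  assumes "c > 0"
  shows "partial_deriv i (bump c (a + s) (b + s)) x = grad (bump c a b) (x - s) $ i"
proof (rule partial_deriv_eqI)
  have "((\<lambda>x. bump c a b (x - s)) has_derivative (\<lambda>h. grad (bump c a b) (x - s) \<bullet> h)) (at x)"
  proof (rule has_derivative_compose[of "\<lambda>x. x - s" "\<lambda>h. h", OF _ bump_gradient(1)[OF assms]])
    show "((\<lambda>x. x - s) has_derivative (\<lambda>h. h)) (at x)" by (auto intro!: derivative_eq_intros)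
  qed
  then show "(bump c (a + s) (b + s) has_derivative (\<lambda>h. grad (bump c a b) (x - s) \<bullet> h)) (at x)"
    by (simp add: bump_shift)
qed

lemma bump_grad_zero:
  fixes a b :: "real ^ 'n::finite"
  assumes "x \<notin> cbox a b"
  shows "partial_deriv i (bump c a b) x = 0"
proof -
  have "((\<lambda>x. 0) has_derivative (\<lambda>h. 0 \<bullet> h)) (at x)" by simp
  then have "(bump c a b has_derivative (\<lambda>h. 0 \<bullet> h)) (at x)"
    by (rule has_derivative_transform_within_open[of _ _ _ _ "- cbox a b"])
      (use assms bump_zero box_subset_cbox in \<open>force simp: open_Compl\<close>)+
  from partial_deriv_eqI[OF this] show ?thesis by simp
qed

lemma set_integrable_times_bounded:
  fixes f \<phi> :: "'a::euclidean_space \<Rightarrow> real"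
  assumes f: "set_integrable lebesgue Q f" and \<phi>: "continuous_on UNIV \<phi>" "\<And>x. \<bar>\<phi> x\<bar> \<le> 1"
  shows "set_integrable lebesgue Q (\<lambda>x. f x * \<phi> x)"
proof -
  have \<phi>m: "\<phi> \<in> borel_measurable lebesgue" using borel_measurable_continuous_onI[OF \<phi>(1)] by (simp add: measurable_completion)
  show ?thesis unfolding set_integrable_def
  proof (rule Bochner_Integration.integrable_bound[OF f[unfolded set_integrable_def]])
    have "(\<lambda>x. (indicator Q x *\<^sub>R f x) * \<phi> x) \<in> borel_measurable lebesgue"
      using borel_measurable_integrable[OF f[unfolded set_integrable_def]] \<phi>m by (rule borel_measurable_times)
    then show "(\<lambda>x. indicator Q x *\<^sub>R (f x * \<phi> x)) \<in> borel_measurable lebesgue" by (simp add: mult.assoc)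
    show "AE x in lebesgue. norm (indicator Q x *\<^sub>R (f x * \<phi> x)) \<le> norm (indicator Q x *\<^sub>R f x)"
      using \<phi>(2) by (intro always_eventually allI) (simp add: abs_mult indicator_def mult_left_le)
  qed
qed

lemma set_integrable_inner:
  fixes g :: "_ \<Rightarrow> _::euclidean_space"
  assumes "set_integrable M Q g"
  shows "set_integrable M Q (\<lambda>x. g x \<bullet> w)"
proof -
  have "integrable M (\<lambda>x. (indicator Q x *\<^sub>R g x) \<bullet> w)"
    using assms unfolding set_integrable_def by (intro integrable_inner_left)
  then show ?thesis by (simp add: set_integrable_def)
qed

lemma weak_gradientD:
  assumes "is_weak_gradient \<Omega> u g"
  shows "\<And>K. compact K \<Longrightarrow> K \<subseteq> \<Omega> \<Longrightarrow> set_integrable lebesgue K g" "locally_integrable_on g \<Omega>"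
    "\<And>\<phi> i. test_function \<Omega> \<phi> \<Longrightarrow>
      (LINT x:\<Omega>|lebesgue. u x * partial_deriv i \<phi> x) = - (LINT x:\<Omega>|lebesgue. g x $ i * \<phi> x)"
  using assms by (simp_all add: is_weak_gradient_def locally_integrable_on_def)

text \<open>
  Moving the bump through \<open>Q\<close> with velocity \<open>w\<close>: differentiate under the
  integral sign, and shift the derivative from the bump to \<open>u\<close> by the definition of the
  weak gradient.
\<close>

lemma mollified_derivative:
  fixes u :: "real ^ 'n::finite \<Rightarrow> real" and a b w :: "real ^ 'n"
  assumes weak: "is_weak_gradient \<Omega> u g" and Q: "cbox a' b' \<subseteq> \<Omega>" and cu: "continuous_on (cbox a' b') u"
    and c: "c > 0" and box: "\<And>t. t \<in> {0..1} \<Longrightarrow> cbox (a + t *\<^sub>R w) (b + t *\<^sub>R w) \<subseteq> cbox a' b'"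
    and t: "t \<in> {0..1}"
  shows "((\<lambda>t. integral (cbox a' b') (\<lambda>z. u z * bump c (a + t *\<^sub>R w) (b + t *\<^sub>R w) z)) has_real_derivative
      (LINT z:cbox a' b'|lebesgue. (g z \<bullet> w) * bump c (a + t *\<^sub>R w) (b + t *\<^sub>R w) z)) (at t within {0..1})"
proof -
  let ?Q = "cbox a' b'" and ?\<phi> = "bump c a b" and ?\<phi>t = "bump c (a + t *\<^sub>R w) (b + t *\<^sub>R w)"
  note D = bump_gradient[OF c, where a = a and b = b]
  have eq: "bump c (a + t *\<^sub>R w) (b + t *\<^sub>R w) z = ?\<phi> (z - t *\<^sub>R w)" for t z by (simp add: bump_shift)
  have leib: "((\<lambda>t. integral ?Q (\<lambda>z. u z * ?\<phi> (z - t *\<^sub>R w))) has_real_derivative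
      integral ?Q (\<lambda>z. u z * (grad ?\<phi> (z - t *\<^sub>R w) \<bullet> (- w)))) (at t within {0..1})"
  proof (rule leibniz_rule_field_derivative[of "{0..1}" a' b' "\<lambda>t z. u z * ?\<phi> (z - t *\<^sub>R w)" "\<lambda>t z. u z * (grad ?\<phi> (z - t *\<^sub>R w) \<bullet> (- w))"])
    fix t :: real and z assume "t \<in> {0..1}"
    have "((\<lambda>t. ?\<phi> (z - t *\<^sub>R w)) has_derivative (\<lambda>h. grad ?\<phi> (z - t *\<^sub>R w) \<bullet> (- h *\<^sub>R w))) (at t within {0..1})"
    proof (rule has_derivative_compose[of "\<lambda>t. z - t *\<^sub>R w" "\<lambda>h. - h *\<^sub>R w", OF _ D(1)])
      show "((\<lambda>t. z - t *\<^sub>R w) has_derivative (\<lambda>h. - h *\<^sub>R w)) (at t within {0..1})" by (auto intro!: derivative_eq_intros)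
    qed
    then have "((\<lambda>t. ?\<phi> (z - t *\<^sub>R w)) has_real_derivative grad ?\<phi> (z - t *\<^sub>R w) \<bullet> (- w)) (at t within {0..1})"
      by (rule has_derivative_imp_has_field_derivative) simp
    from DERIV_cmult[OF this, of "u z"]
    show "((\<lambda>t. u z * ?\<phi> (z - t *\<^sub>R w)) has_field_derivative u z * (grad ?\<phi> (z - t *\<^sub>R w) \<bullet> (- w))) (at t within {0..1})" .
  next
    fix t :: real
    show "(\<lambda>z. u z * ?\<phi> (z - t *\<^sub>R w)) integrable_on ?Q"
      by (intro integrable_continuous continuous_on_mult cu continuous_on_compose2[OF D(3)[of UNIV]] continuous_intros) auto
  next
    have "continuous_on ({0..1} \<times> ?Q) (\<lambda>p. u (snd p) * (grad ?\<phi> (snd p - fst p *\<^sub>R w) \<bullet> (- w)))"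
      by (intro continuous_on_mult continuous_on_inner continuous_on_compose2[OF cu] continuous_on_compose2[OF D(2)] continuous_intros) auto
    then show "continuous_on ({0..1} \<times> ?Q) (\<lambda>(t, z). u z * (grad ?\<phi> (z - t *\<^sub>R w) \<bullet> (- w)))"
      by (simp add: split_beta)
  qed (use t in auto)
  have test: "test_function \<Omega> ?\<phi>t" using box[OF t] Q by (intro bump_test[OF c]) blast
  have gint: "set_integrable lebesgue ?Q g" by (rule weak_gradientD(1)[OF weak compact_cbox Q])
  have \<phi>c: "continuous_on UNIV ?\<phi>t" "\<bar>?\<phi>t x\<bar> \<le> 1" for x
    by (rule bump_gradient(3)[OF c]) (simp add: abs_of_nonneg[OF bump_nonneg] bump_le_1[OF c])
  have pc: "continuous_on UNIV (partial_deriv i ?\<phi>t)" for i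
    using bump_smooth[OF c, of "Suc 0" "a + t *\<^sub>R w" "b + t *\<^sub>R w" UNIV] by simp
  have part: "integral ?Q (\<lambda>z. u z * partial_deriv i ?\<phi>t z) = - (LINT z:?Q|lebesgue. (g z \<bullet> axis i 1) * ?\<phi>t z)" for i
  proof -
    have "(LINT x:\<Omega>|lebesgue. u x * partial_deriv i ?\<phi>t x) = integral ?Q (\<lambda>z. u z * partial_deriv i ?\<phi>t z)"
    proof (rule set_integral_eq_HK[OF Q])
      show "u x * partial_deriv i ?\<phi>t x = 0" if "x \<notin> ?Q" for x
      proof -
        have "x \<notin> cbox (a + t *\<^sub>R w) (b + t *\<^sub>R w)" using that box[OF t] by blast
        then show ?thesis by (simp add: bump_grad_zero)
      qed
      show "continuous_on ?Q (\<lambda>z. u z * partial_deriv i ?\<phi>t z)"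
        by (intro continuous_on_mult cu continuous_on_subset[OF pc]) auto
    qed
    moreover have "(LINT x:\<Omega>|lebesgue. g x $ i * ?\<phi>t x) = (LINT x:?Q|lebesgue. g x $ i * ?\<phi>t x)"
    proof (rule set_integral_support[OF Q])
      fix x assume "x \<notin> ?Q"
      then have "?\<phi>t x = 0" using box[OF t] bump_zero box_subset_cbox by blast
      then show "g x $ i * ?\<phi>t x = 0" by simp
    qed
    moreover have "(LINT x:\<Omega>|lebesgue. u x * partial_deriv i ?\<phi>t x) = - (LINT x:\<Omega>|lebesgue. g x $ i * ?\<phi>t x)"
      by (rule weak_gradientD(3)[OF weak test])
    ultimately show ?thesis by (simp add: inner_axis)
  qed
  have "integral ?Q (\<lambda>z. u z * (grad ?\<phi> (z - t *\<^sub>R w) \<bullet> (- w))) = integral ?Q (\<lambda>z. \<Sum>i\<in>UNIV. (- (w $ i)) * (u z * partial_deriv i ?\<phi>t z))"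
  proof (rule arg_cong[where f = "integral ?Q"], rule ext)
    fix z
    have "grad ?\<phi> (z - t *\<^sub>R w) $ i = partial_deriv i ?\<phi>t z" for i by (rule bump_grad_shift[OF c, symmetric])
    then show "u z * (grad ?\<phi> (z - t *\<^sub>R w) \<bullet> (- w)) = (\<Sum>i\<in>UNIV. (- (w $ i)) * (u z * partial_deriv i ?\<phi>t z))"
      by (simp add: inner_vec_def sum_distrib_left sum_negf mult_ac)
  qed
  also have "\<dots> = (\<Sum>i\<in>UNIV. integral ?Q (\<lambda>z. (- (w $ i)) * (u z * partial_deriv i ?\<phi>t z)))"
    by (intro integral_sum integrable_continuous continuous_on_mult cu continuous_on_const continuous_on_subset[OF pc]) auto
  also have "\<dots> = (\<Sum>i\<in>UNIV. (w $ i) * (LINT z:?Q|lebesgue. (g z \<bullet> axis i 1) * ?\<phi>t z))"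
    by (intro sum.cong) (simp_all add: part)
  also have "\<dots> = (\<Sum>i\<in>UNIV. LINT z:?Q|lebesgue. (w $ i) * ((g z \<bullet> axis i 1) * ?\<phi>t z))" by simp
  also have "\<dots> = (LINT z:?Q|lebesgue. \<Sum>i\<in>UNIV. (w $ i) * ((g z \<bullet> axis i 1) * ?\<phi>t z))"
  proof -
    have "set_integrable lebesgue ?Q (\<lambda>z. (w $ i) * ((g z \<bullet> axis i 1) * ?\<phi>t z))" for i
      using set_integrable_times_bounded[OF set_integrable_inner[OF gint] \<phi>c, of "axis i 1"] by (intro set_integrable_mult_right) auto
    then show ?thesis unfolding set_lebesgue_integral_def set_integrable_def scaleR_sum_right
      by (intro Bochner_Integration.integral_sum[symmetric])
  qed
  also have "\<dots> = (LINT z:?Q|lebesgue. (g z \<bullet> w) * ?\<phi>t z)"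
  proof -
    have "(\<Sum>i\<in>UNIV. (w $ i) * ((g z \<bullet> axis i 1) * ?\<phi>t z)) = (g z \<bullet> w) * ?\<phi>t z" for z
    proof -
      have "g z \<bullet> axis i 1 = g z $ i" for i by (simp add: inner_axis)
      then show ?thesis unfolding inner_vec_def[of "g z" w] by (simp add: sum_distrib_right mult_ac)
    qed
    then show ?thesis by simp
  qed
  finally show ?thesis using leib by (simp add: eq)
qed

lemma bump_integral_shift:
  fixes a b :: "real ^ 'n::finite"
  assumes "cbox (a + s) (b + s) \<subseteq> cbox a' b'"
  shows "integral (cbox a' b') (\<lambda>z. f z * bump c (a + s) (b + s) z) = integral (cbox a b) (\<lambda>z. f (z + s) * bump c a b z)"
proof -
  let ?h = "\<lambda>z. f z * bump c (a + s) (b + s) z"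
  have "?h z = 0" if "z \<notin> cbox (a + s) (b + s)" for z using that bump_zero box_subset_cbox by force
  then have "(\<lambda>z. if z \<in> cbox (a + s) (b + s) then ?h z else 0) = ?h" by auto
  then have "integral (cbox a' b') ?h = integral (cbox (a + s) (b + s)) ?h"
    using Henstock_Kurzweil_Integration.integral_restrict_Int[of "cbox a' b'" "cbox (a + s) (b + s)" ?h] assms by (simp add: Int_absorb2)
  also have "\<dots> = integral (cbox a b) (?h \<circ> (+) s)" by (rule integral_shift_cbox_plus[symmetric])
  also have "?h \<circ> (+) s = (\<lambda>z. f (z + s) * bump c a b z)"
    by (simp add: fun_eq_iff add.commute[of s] bump_shift[symmetric])
  finally show ?thesis .
qed

lemma bump_integral_pos:
  fixes a b :: "real ^ 'n::finite"
  assumes "c > 0" "box a b \<noteq> {}"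
  shows "integral (cbox a b) (bump c a b) > 0"
proof -
  have ni: "integral (cbox a b) (bump c a b) \<ge> 0" by (rule integral_nonneg) (auto simp: bump_nonneg intro!: integrable_continuous bump_gradient(3)[OF assms(1)])
  have "integral (cbox a b) (bump c a b) \<noteq> 0"
  proof
    assume 0: "integral (cbox a b) (bump c a b) = 0"
    obtain x where x: "x \<in> box a b" using assms(2) by blast
    have "(bump c a b has_integral 0) (cbox a b)"
      using 0 integrable_integral[OF integrable_continuous[OF bump_gradient(3)[OF assms(1)]]] by metis
    then have "bump c a b x = 0"
      by (rule has_integral_0_cbox_imp_0[OF bump_gradient(3)[OF assms(1)] bump_nonneg]) (use x assms(2) box_subset_cbox in auto)
    then show False using bump_pos[OF x, of c] by simp
  qed
  then show ?thesis using ni by simp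
qed

section \<open>Weak gradient bounds are Lipschitz bounds\<close>

lemma bump_bounded: "c > 0 \<Longrightarrow> \<bar>bump c a b x\<bar> \<le> 1"
  by (simp add: bump_nonneg bump_le_1)

text \<open>
  The averages of \<open>u\<close> over a moving box change by at most \<open>k\<close> per unit of
  time. If the box is so small that \<open>u\<close> is nearly constant on it at the start and at the
  end, then these averages are nearly the values of \<open>u\<close>.
\<close>

lemma weak_directional_bound:
  fixes u :: "real ^ 'n::finite \<Rightarrow> real" and y w :: "real ^ 'n"
  assumes weak: "is_weak_gradient \<Omega> u g" and Q: "cbox a' b' \<subseteq> \<Omega>" and cu: "continuous_on (cbox a' b') u"
    and AE: "AE x in lebesgue. x \<in> cbox a' b' \<longrightarrow> g x \<bullet> w \<le> k"
    and y: "y \<in> box a' b'" "y + w \<in> box a' b'"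
  shows "u (y + w) - u y \<le> k"
proof (rule ccontr)
  assume neg: "\<not> ?thesis"
  let ?Q = "cbox a' b'"
  define \<eta> where "\<eta> = (u (y + w) - u y - k) / 3"
  have \<eta>: "\<eta> > 0" "u (y + w) - u y - k = 3 * \<eta>" using neg by (auto simp: \<eta>_def)
  have cub: "continuous_on (box a' b') u" using continuous_on_subset[OF cu box_subset_cbox] .
  \<comment> \<open>a single neighbourhood of \<open>y\<close> controls both ends of the motion\<close>
  define U where "U = (box a' b' \<inter> u -` {..<u y + \<eta>}) \<inter> (\<lambda>z. z + w) -` (box a' b' \<inter> u -` {u (y + w) - \<eta><..})"
  have o1: "open (box a' b' \<inter> u -` {..<u y + \<eta>})" by (rule continuous_open_preimage[OF cub open_box open_lessThan])
  have o2: "open (box a' b' \<inter> u -` {u (y + w) - \<eta><..})" by (rule continuous_open_preimage[OF cub open_box open_greaterThan])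
  have "continuous_on UNIV (\<lambda>z. z + w)" by (intro continuous_intros)
  from open_Int[OF o1 open_vimage[OF o2 this]] have "open U" unfolding U_def .
  moreover have "y \<in> U" using y \<eta>(1) by (simp add: U_def)
  ultimately obtain a b where ab: "y \<in> box a b" "cbox a b \<subseteq> U" using open_contains_cbox by metis
  have inQ: "z \<in> ?Q" "z + w \<in> ?Q" "u z \<le> u y + \<eta>" "u (z + w) \<ge> u (y + w) - \<eta>" if "z \<in> cbox a b" for z
  proof -
    have zU: "z \<in> U" using that ab(2) by blast
    then show "z \<in> ?Q" "z + w \<in> ?Q" using box_subset_cbox unfolding U_def by blast+
    show "u z \<le> u y + \<eta>" "u (z + w) \<ge> u (y + w) - \<eta>" using zU by (auto simp: U_def)
  qed
  have box: "cbox (a + t *\<^sub>R w) (b + t *\<^sub>R w) \<subseteq> ?Q" if t: "t \<in> {0..1}" for t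
  proof
    fix z assume z: "z \<in> cbox (a + t *\<^sub>R w) (b + t *\<^sub>R w)"
    define z0 where "z0 = z - t *\<^sub>R w"
    have "z0 \<in> cbox a b" using z by (auto simp: z0_def mem_box algebra_simps)
    note i = inQ(1,2)[OF this]
    have "(1 - t) *\<^sub>R z0 + t *\<^sub>R (z0 + w) \<in> ?Q"
      using convexD[OF convex_box(1) i, of "1 - t" t] t by simp
    moreover have "(1 - t) *\<^sub>R z0 + t *\<^sub>R (z0 + w) = z" by (simp add: z0_def algebra_simps)
    ultimately show "z \<in> ?Q" by simp
  qed
  let ?F = "\<lambda>t. integral ?Q (\<lambda>z. u z * bump 1 (a + t *\<^sub>R w) (b + t *\<^sub>R w) z)"
  define I where "I = integral (cbox a b) (bump 1 a b)"
  have I0: "I > 0" unfolding I_def by (rule bump_integral_pos) (use ab(1) in auto)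
  have It: "integral ?Q (\<lambda>z. bump 1 (a + t *\<^sub>R w) (b + t *\<^sub>R w) z) = I" if "t \<in> {0..1}" for t
    using bump_integral_shift[OF box[OF that], where f = "\<lambda>_. 1" and c = 1] by (simp add: I_def)
  have gint: "set_integrable lebesgue ?Q g" by (rule weak_gradientD(1)[OF weak compact_cbox Q])
  have der: "(LINT z:?Q|lebesgue. (g z \<bullet> w) * bump 1 (a + t *\<^sub>R w) (b + t *\<^sub>R w) z) \<le> k * I" if t: "t \<in> {0..1}" for t
  proof -
    let ?\<phi> = "bump 1 (a + t *\<^sub>R w) (b + t *\<^sub>R w)"
    have \<phi>c: "continuous_on UNIV ?\<phi>" by (rule bump_gradient(3)) simp
    have kint: "set_integrable lebesgue ?Q (\<lambda>z. k * ?\<phi> z)"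
      by (rule set_integrable_compact[OF compact_cbox]) (intro continuous_intros continuous_on_subset[OF \<phi>c]; simp)
    have "(LINT z:?Q|lebesgue. (g z \<bullet> w) * ?\<phi> z) \<le> (LINT z:?Q|lebesgue. k * ?\<phi> z)"
      unfolding set_lebesgue_integral_def
    proof (rule integral_mono_AE)
      show "integrable lebesgue (\<lambda>z. indicat_real ?Q z *\<^sub>R ((g z \<bullet> w) * ?\<phi> z))"
        using set_integrable_times_bounded[OF set_integrable_inner[OF gint] \<phi>c bump_bounded[OF zero_less_one]] unfolding set_integrable_def .
      show "integrable lebesgue (\<lambda>z. indicat_real ?Q z *\<^sub>R (k * ?\<phi> z))" using kint unfolding set_integrable_def .
      show "AE z in lebesgue. indicat_real ?Q z *\<^sub>R ((g z \<bullet> w) * ?\<phi> z) \<le> indicat_real ?Q z *\<^sub>R (k * ?\<phi> z)"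
        using AE by eventually_elim (auto simp: indicator_def intro!: mult_right_mono bump_nonneg)
    qed
    also have "\<dots> = integral ?Q (\<lambda>z. k * ?\<phi> z)" by (rule set_lebesgue_integral_eq_integral(2)[OF kint])
    also have "\<dots> = k * I" using It[OF t] by simp
    finally show ?thesis .
  qed
  have "\<exists>t\<in>{0<..<1}. ?F 1 - ?F 0 = (LINT z:?Q|lebesgue. (g z \<bullet> w) * bump 1 (a + t *\<^sub>R w) (b + t *\<^sub>R w) z) * (1 - 0)"
    by (rule mvt_simple[OF zero_less_one])
      (use mollified_derivative[OF weak Q cu zero_less_one box] in \<open>auto simp: has_field_derivative_def\<close>)
  then obtain t where t: "t \<in> {0<..<1}" "?F 1 - ?F 0 = (LINT z:?Q|lebesgue. (g z \<bullet> w) * bump 1 (a + t *\<^sub>R w) (b + t *\<^sub>R w) z)"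
    by auto
  have "t \<in> {0..1}" using t(1) by simp
  then have up: "?F 1 - ?F 0 \<le> k * I" unfolding t(2) by (rule der)
  have ui: "(\<lambda>z. u (z + s) * bump 1 a b z) integrable_on cbox a b" if "\<And>z. z \<in> cbox a b \<Longrightarrow> z + s \<in> ?Q" for s
  proof (rule integrable_continuous)
    have "continuous_on (cbox a b) (\<lambda>z. u (z + s))"
      by (rule continuous_on_compose2[OF cu]) (use that in \<open>auto intro!: continuous_intros\<close>)
    then show "continuous_on (cbox a b) (\<lambda>z. u (z + s) * bump 1 a b z)"
      by (intro continuous_on_mult bump_gradient(3)) auto
  qed
  have ci: "(\<lambda>z. c * bump 1 a b z) integrable_on cbox a b" for c
    by (intro integrable_continuous continuous_on_mult continuous_on_const bump_gradient(3)) simp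
  have "?F 1 = integral (cbox a b) (\<lambda>z. u (z + w) * bump 1 a b z)"
  proof -
    have "cbox (a + w) (b + w) \<subseteq> ?Q" using box[of 1] by simp
    from bump_integral_shift[OF this, of u 1] show ?thesis by (simp only: scaleR_one)
  qed
  also have "\<dots> \<ge> integral (cbox a b) (\<lambda>z. (u (y + w) - \<eta>) * bump 1 a b z)"
    by (rule integral_le[OF ci ui[OF inQ(2)]]) (assumption | intro mult_right_mono bump_nonneg inQ(4))+
  finally have F1: "?F 1 \<ge> (u (y + w) - \<eta>) * I" by (simp add: I_def)
  have "?F 0 = integral (cbox a b) (\<lambda>z. u (z + 0) * bump 1 a b z)"
  proof -
    have "cbox (a + 0) (b + 0) \<subseteq> ?Q" using box[of 0] by simp
    from bump_integral_shift[OF this, of u 1] show ?thesis by (simp only: scaleR_zero_left)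
  qed
  also have "\<dots> \<le> integral (cbox a b) (\<lambda>z. (u y + \<eta>) * bump 1 a b z)"
    by (rule integral_le[OF ui ci]) (simp_all add: inQ(1,3) mult_right_mono bump_nonneg)
  finally have F0: "?F 0 \<le> (u y + \<eta>) * I" by (simp add: I_def)
  have "(u (y + w) - \<eta>) * I - (u y + \<eta>) * I \<le> k * I" using up F1 F0 by linarith
  moreover have "(u (y + w) - \<eta>) * I - (u y + \<eta>) * I - k * I = (u (y + w) - u y - k - 2 * \<eta>) * I" by (simp add: algebra_simps)
  ultimately have "(u (y + w) - u y - k - 2 * \<eta>) * I \<le> 0" by linarith
  then have "\<eta> * I \<le> 0" using \<eta>(2) by simp
  moreover have "\<eta> * I > 0" using \<eta>(1) I0 by simp
  ultimately show False by simp
qed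

text \<open>
  The derivative of the average at time zero is bounded by the increments of \<open>u\<close>; letting
  the bump tend to the indicator function of the box turns this into a bound for the integral of the
  directional weak derivative.
\<close>

lemma weak_directional_bound_converse:
  fixes u :: "real ^ 'n::finite \<Rightarrow> real" and w :: "real ^ 'n"
  assumes weak: "is_weak_gradient \<Omega> u g" and Q: "cbox a' b' \<subseteq> \<Omega>" and cu: "continuous_on (cbox a' b') u"
    and inc: "\<And>y t. t \<ge> 0 \<Longrightarrow> y \<in> cbox a' b' \<Longrightarrow> y + t *\<^sub>R w \<in> cbox a' b' \<Longrightarrow> u (y + t *\<^sub>R w) - u y \<le> t * k"
    and cd: "cbox c d \<subseteq> box a' b'"
  shows "integral (cbox c d) (\<lambda>x. g x \<bullet> w - k) \<le> 0"
proof -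
  let ?Q = "cbox a' b'"
  obtain e where e: "e > 0" "(\<Union>x\<in>cbox c d. ball x e) \<subseteq> box a' b'"
    using compact_subset_open_imp_ball_epsilon_subset[OF compact_cbox open_box cd] by blast
  \<comment> \<open>a multiple of \<open>w\<close> so short that the moving box stays in \<open>Q\<close>\<close>
  define s where "s = e / (norm w + 1)"
  have nw: "norm w + 1 > 0" by (simp add: add_nonneg_pos)
  have s: "s > 0" "s * norm w < e" using e(1) nw by (auto simp: s_def field_simps)
  define v where "v = s *\<^sub>R w"
  have near: "z + t *\<^sub>R v \<in> ?Q" if z: "z \<in> cbox c d" and t: "t \<in> {0..1}" for z t
  proof -
    have "norm (t *\<^sub>R v) = t * (s * norm w)" using t s by (simp add: v_def)
    also have "\<dots> \<le> 1 * (s * norm w)" using t s by (intro mult_right_mono) auto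
    finally have "z + t *\<^sub>R v \<in> ball z e" using s by (simp add: dist_norm)
    then show ?thesis using e(2) z box_subset_cbox by blast
  qed
  have box: "cbox (c + t *\<^sub>R v) (d + t *\<^sub>R v) \<subseteq> ?Q" if t: "t \<in> {0..1}" for t
  proof
    fix z assume z: "z \<in> cbox (c + t *\<^sub>R v) (d + t *\<^sub>R v)"
    have "z - t *\<^sub>R v \<in> cbox c d" using z by (auto simp: mem_box algebra_simps)
    from near[OF this t] show "z \<in> ?Q" by simp
  qed
  have cdQ: "cbox c d \<subseteq> ?Q" using cd box_subset_cbox by blast
  have gint: "set_integrable lebesgue ?Q g" by (rule weak_gradientD(1)[OF weak compact_cbox Q])
  let ?f = "\<lambda>x. g x \<bullet> w - k"
  have kint: "set_integrable lebesgue ?Q (\<lambda>x. k)" by (rule set_integrable_compact) auto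
  have fint: "set_integrable lebesgue ?Q ?f"
    by (rule set_integral_diff(1)[OF set_integrable_inner[OF gint] kint])
  have moll: "(LINT z:?Q|lebesgue. ?f z * bump \<epsilon> c d z) \<le> 0" if \<epsilon>: "\<epsilon> > 0" for \<epsilon>
  proof -
    let ?\<phi> = "bump \<epsilon> c d"
    have \<phi>c: "continuous_on A ?\<phi>" for A by (rule bump_gradient(3)[OF \<epsilon>])
    let ?F = "\<lambda>t. integral ?Q (\<lambda>z. u z * bump \<epsilon> (c + t *\<^sub>R v) (d + t *\<^sub>R v) z)"
    define I where "I = integral (cbox c d) ?\<phi>"
    define A where "A = (LINT z:?Q|lebesgue. (g z \<bullet> w) * ?\<phi> z)"
    have "(?F has_real_derivative (LINT z:?Q|lebesgue. (g z \<bullet> v) * bump \<epsilon> (c + 0 *\<^sub>R v) (d + 0 *\<^sub>R v) z)) (at 0 within {0..1})"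
      by (rule mollified_derivative[OF weak Q cu \<epsilon> box]) auto
    moreover have "(LINT z:?Q|lebesgue. (g z \<bullet> v) * bump \<epsilon> (c + 0 *\<^sub>R v) (d + 0 *\<^sub>R v) z) = s * A"
      by (simp add: A_def v_def mult.assoc)
    ultimately have "(?F has_real_derivative s * A) (at 0 within {0..1})" by simp
    then have lim: "((\<lambda>t. (?F t - ?F 0) / (t - 0)) \<longlongrightarrow> s * A) (at 0 within {0..1})"
      by (simp add: has_field_derivative_iff)
    have quot: "(?F t - ?F 0) / (t - 0) \<le> s * (k * I)" if t: "t \<in> {0..1}" "t \<noteq> 0" for t
    proof -
      have tp: "t > 0" using t by auto
      have ui: "(\<lambda>z. u (z + r *\<^sub>R v) * ?\<phi> z) integrable_on cbox c d" if r: "r \<in> {0..1}" for r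
      proof (rule integrable_continuous)
        have "continuous_on (cbox c d) (\<lambda>z. u (z + r *\<^sub>R v))"
          by (rule continuous_on_compose2[OF cu]) (use near[OF _ r] in \<open>auto intro!: continuous_intros\<close>)
        then show "continuous_on (cbox c d) (\<lambda>z. u (z + r *\<^sub>R v) * ?\<phi> z)" by (intro continuous_on_mult \<phi>c)
      qed
      have Ft: "?F r = integral (cbox c d) (\<lambda>z. u (z + r *\<^sub>R v) * ?\<phi> z)" if r: "r \<in> {0..1}" for r
        by (rule bump_integral_shift[OF box[OF r]])
      have Ii: "(\<lambda>z. (t * s * k) * ?\<phi> z) integrable_on cbox c d"
        by (intro integrable_continuous continuous_on_mult continuous_on_const \<phi>c)
      have t0: "(0::real) \<in> {0..1}" by simp
      have "?F t - ?F 0 = integral (cbox c d) (\<lambda>z. u (z + t *\<^sub>R v) * ?\<phi> z - u (z + 0 *\<^sub>R v) * ?\<phi> z)"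
        unfolding Ft[OF t(1)] Ft[OF t0] by (rule Henstock_Kurzweil_Integration.integral_diff[OF ui[OF t(1)] ui[OF t0], symmetric])
      also have "\<dots> \<le> integral (cbox c d) (\<lambda>z. (t * s * k) * ?\<phi> z)"
      proof (rule integral_le[OF integrable_diff[OF ui[OF t(1)] ui[OF t0]] Ii])
        fix z assume z: "z \<in> cbox c d"
        have "z \<in> ?Q" "z + (t * s) *\<^sub>R w \<in> ?Q" using near[OF z t(1)] z cdQ by (auto simp: v_def)
        then have "u (z + (t * s) *\<^sub>R w) - u z \<le> t * s * k" using tp s by (intro inc) auto
        then have "(u (z + t *\<^sub>R v) - u z) * ?\<phi> z \<le> (t * s * k) * ?\<phi> z"
          unfolding v_def scaleR_scaleR by (intro mult_right_mono bump_nonneg)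
        then show "u (z + t *\<^sub>R v) * ?\<phi> z - u (z + 0 *\<^sub>R v) * ?\<phi> z \<le> (t * s * k) * ?\<phi> z" by (simp add: left_diff_distrib)
      qed
      also have "\<dots> = (s * (k * I)) * t" by (simp add: I_def)
      finally show ?thesis using tp by (simp add: pos_divide_le_eq)
    qed
    have "s * A \<le> s * (k * I)"
    proof (rule tendsto_upperbound[OF lim])
      show "\<forall>\<^sub>F t in at 0 within {0..1}. (?F t - ?F 0) / (t - 0) \<le> s * (k * I)"
        unfolding eventually_at_filter by (intro always_eventually allI impI quot)
      show "at (0::real) within {0..1} \<noteq> bot" by (simp add: at_within_Icc_at_right)
    qed
    then have Ak: "A \<le> k * I" using s(1) by simp
    have k\<phi>: "set_integrable lebesgue ?Q (\<lambda>z. k * ?\<phi> z)"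
      by (rule set_integrable_compact[OF compact_cbox]) (intro continuous_on_mult continuous_on_const \<phi>c)
    have "(LINT z:?Q|lebesgue. ?f z * ?\<phi> z) = (LINT z:?Q|lebesgue. (g z \<bullet> w) * ?\<phi> z - k * ?\<phi> z)"
      by (simp add: left_diff_distrib)
    also have "\<dots> = A - (LINT z:?Q|lebesgue. k * ?\<phi> z)" unfolding A_def
      by (rule set_integral_diff(2)[OF set_integrable_times_bounded[OF set_integrable_inner[OF gint] \<phi>c bump_bounded[OF \<epsilon>]] k\<phi>])
    also have "(LINT z:?Q|lebesgue. k * ?\<phi> z) = integral ?Q (\<lambda>z. k * ?\<phi> z)" by (rule set_lebesgue_integral_eq_integral(2)[OF k\<phi>])
    also have "\<dots> = k * I"
    proof -
      have "cbox (c + 0) (d + 0) \<subseteq> ?Q" using cdQ by simp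
      from bump_integral_shift[OF this, of "\<lambda>_. 1" \<epsilon>] show ?thesis by (simp add: I_def)
    qed
    finally show ?thesis using Ak by simp
  qed
  have fm: "set_integrable lebesgue ?Q (\<lambda>x. ?f x * bump (1 / Suc n) c d x)" for n
    by (rule set_integrable_times_bounded[OF fint bump_gradient(3) bump_bounded]) auto
  have sub: "box c d \<subseteq> ?Q" using cdQ box_subset_cbox by blast
  have fb: "set_integrable lebesgue (box c d) ?f" by (rule set_integrable_subset[OF fint _ sub]) simp
  have ind: "indicat_real ?Q x *\<^sub>R (?f x * indicat_real (box c d) x) = indicat_real (box c d) x *\<^sub>R ?f x" for x
    using sub by (auto simp: indicator_def)
  have "(\<lambda>n. LINT x|lebesgue. indicat_real ?Q x *\<^sub>R (?f x * bump (1 / Suc n) c d x)) \<longlonglongrightarrow>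
      (LINT x|lebesgue. indicat_real (box c d) x *\<^sub>R ?f x)"
  proof (rule integral_dominated_convergence[where w = "\<lambda>x. norm (indicat_real ?Q x *\<^sub>R ?f x)"])
    show "(\<lambda>x. indicat_real (box c d) x *\<^sub>R ?f x) \<in> borel_measurable lebesgue"
      using fb unfolding set_integrable_def by (rule borel_measurable_integrable)
    show "(\<lambda>x. indicat_real ?Q x *\<^sub>R (?f x * bump (1 / Suc n) c d x)) \<in> borel_measurable lebesgue" for n
      using fm unfolding set_integrable_def by (rule borel_measurable_integrable)
    show "integrable lebesgue (\<lambda>x. norm (indicat_real ?Q x *\<^sub>R ?f x))"
      using fint unfolding set_integrable_def by (rule integrable_norm)
    show "AE x in lebesgue. (\<lambda>n. indicat_real ?Q x *\<^sub>R (?f x * bump (1 / Suc n) c d x)) \<longlonglongrightarrow> indicat_real (box c d) x *\<^sub>R ?f x"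
      unfolding ind[symmetric] by (intro always_eventually allI tendsto_intros bump_tendsto)
    show "AE x in lebesgue. norm (indicat_real ?Q x *\<^sub>R (?f x * bump (1 / Suc n) c d x)) \<le> norm (indicat_real ?Q x *\<^sub>R ?f x)" for n
      using bump_bounded[of "1 / Suc n" c d] by (intro always_eventually allI) (simp add: abs_mult indicator_def mult_left_le)
  qed
  then have "(LINT x|lebesgue. indicat_real (box c d) x *\<^sub>R ?f x) \<le> 0"
    by (rule tendsto_upperbound) (use moll in \<open>auto simp: set_lebesgue_integral_def\<close>)
  also have "(LINT x|lebesgue. indicat_real (box c d) x *\<^sub>R ?f x) = integral (box c d) ?f"
    using set_lebesgue_integral_eq_integral(2)[OF fb] by (simp add: set_lebesgue_integral_def)
  also have "\<dots> = integral (cbox c d) ?f" by (rule integral_open_interval)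
  finally show ?thesis .
qed

lemma weak_bound_imp_Lipschitz:
  fixes u N :: "real ^ 'n::finite \<Rightarrow> real"
  assumes weak: "is_weak_gradient \<Omega> u g" and V: "open V" "V \<subseteq> \<Omega>" and cu: "continuous_on V u"
    and AE: "AE x in lebesgue. x \<in> V \<longrightarrow> (\<forall>w. g x \<bullet> w \<le> K * N w)" and x: "x \<in> V"
  shows "\<exists>\<delta>>0. ball x \<delta> \<subseteq> V \<and> (\<forall>y\<in>ball x \<delta>. \<forall>z\<in>ball x \<delta>. u z - u y \<le> K * N (z - y))"
proof -
  obtain a b where ab: "x \<in> box a b" "cbox a b \<subseteq> V" using open_contains_cbox[OF V(1) x] by metis
  obtain \<delta> where \<delta>: "\<delta> > 0" "ball x \<delta> \<subseteq> box a b" using ab(1) open_box open_contains_ball by blast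
  have "u z - u y \<le> K * N (z - y)" if yz: "y \<in> ball x \<delta>" "z \<in> ball x \<delta>" for y z
  proof -
    have "u (y + (z - y)) - u y \<le> K * N (z - y)"
    proof (rule weak_directional_bound[OF weak _ continuous_on_subset[OF cu ab(2)]])
      show "cbox a b \<subseteq> \<Omega>" using ab V by blast
      show "AE x in lebesgue. x \<in> cbox a b \<longrightarrow> g x \<bullet> (z - y) \<le> K * N (z - y)"
        using AE by eventually_elim (use ab(2) in blast)
    qed (use yz \<delta>(2) in auto)
    then show ?thesis by simp
  qed
  moreover have "ball x \<delta> \<subseteq> V" using \<delta>(2) ab(2) box_subset_cbox by blast
  ultimately show ?thesis using \<delta>(1) by blast
qed

text \<open>
  For each direction the bound holds off a null set. A countable dense set of directions gives a common
  null set, and continuity does the rest.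
\<close>

lemma Lipschitz_imp_weak_bound:
  fixes u N :: "real ^ 'n::finite \<Rightarrow> real"
  assumes weak: "is_weak_gradient \<Omega> u g" and V: "open V" "V \<subseteq> \<Omega>" and cu: "continuous_on V u" and N: "norm_fun N"
    and lip: "\<And>x. x \<in> V \<Longrightarrow> \<exists>\<delta>>0. \<forall>y\<in>ball x \<delta>. \<forall>z\<in>ball x \<delta>. u z - u y \<le> K * N (z - y)"
  shows "AE x in lebesgue. x \<in> V \<longrightarrow> (\<forall>w. g x \<bullet> w \<le> K * N w)"
proof -
  interpret N: norm_fun N by (rule N)
  have neg: "negligible {x \<in> V. K * N w < g x \<bullet> w}" for w
    unfolding locally_negligible_alt[of "{x \<in> V. K * N w < g x \<bullet> w}"]
  proof
    fix x assume "x \<in> {x \<in> V. K * N w < g x \<bullet> w}"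
    then have xV: "x \<in> V" and xS: "K * N w < g x \<bullet> w" by auto
    obtain a' b' where Q: "x \<in> box a' b'" "cbox a' b' \<subseteq> V" using open_contains_cbox[OF V(1) xV] by metis
    obtain a b where ab: "x \<in> box a b" "cbox a b \<subseteq> box a' b'" using open_contains_cbox[OF open_box Q(1)] by metis
    have Q\<Omega>: "cbox a' b' \<subseteq> \<Omega>" using Q V by blast
    have abQ: "cbox a b \<subseteq> cbox a' b'" using ab(2) box_subset_cbox by blast
    have int: "(\<lambda>x. g x \<bullet> w - K * N w) integrable_on cbox a b"
    proof (rule set_lebesgue_integral_eq_integral(1)[OF set_integral_diff(1)[OF set_integrable_inner]])
      show "set_integrable lebesgue (cbox a b) g" by (rule weak_gradientD(1)[OF weak compact_cbox]) (use abQ Q\<Omega> in blast)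
      show "set_integrable lebesgue (cbox a b) (\<lambda>x. K * N w)" by (rule set_integrable_compact) auto
    qed
    have inc: "u (y + t *\<^sub>R w) - u y \<le> t * (K * N w)" if "t \<ge> 0" "y \<in> cbox a' b'" "y + t *\<^sub>R w \<in> cbox a' b'" for y t
    proof -
      have "closed_segment y (y + t *\<^sub>R w) \<subseteq> V"
        using closed_segment_subset[OF that(2,3) convex_box(1)] Q(2) by blast
      then have "u (y + t *\<^sub>R w) - u y \<le> K * N ((y + t *\<^sub>R w) - y)" by (intro N.segment_increment lip) blast
      then show ?thesis using that(1) by (simp add: N.scale mult_ac)
    qed
    have "negligible {x \<in> cbox a b. 0 < g x \<bullet> w - K * N w}"
    proof (rule AE_le_of_box_integrals[OF int])
      fix c d assume "cbox c d \<subseteq> cbox a b"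
      then have "cbox c d \<subseteq> box a' b'" using ab(2) by blast
      from weak_directional_bound_converse[OF weak Q\<Omega> continuous_on_subset[OF cu Q(2)] inc this]
      show "integral (cbox c d) (\<lambda>x. g x \<bullet> w - K * N w) \<le> 0" .
    qed
    then have "negligible ({x \<in> V. K * N w < g x \<bullet> w} \<inter> box a b)"
      by (rule negligible_subset) (use box_subset_cbox in auto)
    moreover have "openin (top_of_set {x \<in> V. K * N w < g x \<bullet> w}) ({x \<in> V. K * N w < g x \<bullet> w} \<inter> box a b)"
      by (rule openin_open_Int[OF open_box])
    ultimately show "\<exists>U. openin (top_of_set {x \<in> V. K * N w < g x \<bullet> w}) U \<and> x \<in> U \<and> negligible U"
      using xV xS ab(1) by blast
  qed
  obtain D :: "(real ^ 'n) set" where D: "countable D" "\<And>X. open X \<Longrightarrow> X \<noteq> {} \<Longrightarrow> \<exists>d\<in>D. d \<in> X"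
    using countable_dense_exists by blast
  have "AE x in lebesgue. \<not> (x \<in> V \<and> K * N w < g x \<bullet> w)" for w
    using neg[of w] by (intro AE_I'[of "{x \<in> V. K * N w < g x \<bullet> w}"]) (auto simp: negligible_iff_null_sets)
  then have "AE x in lebesgue. \<forall>w\<in>D. \<not> (x \<in> V \<and> K * N w < g x \<bullet> w)" by (subst AE_ball_countable[OF D(1)]) blast
  then show ?thesis
  proof eventually_elim
    fix x assume x: "\<forall>w\<in>D. \<not> (x \<in> V \<and> K * N w < g x \<bullet> w)"
    show "x \<in> V \<longrightarrow> (\<forall>w. g x \<bullet> w \<le> K * N w)"
    proof (intro impI allI, rule ccontr)
      fix w assume xV: "x \<in> V" and w: "\<not> g x \<bullet> w \<le> K * N w"
      have o: "open {w. K * N w < g x \<bullet> w}" by (intro open_Collect_less continuous_intros)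
      have "{w. K * N w < g x \<bullet> w} \<noteq> {}" using w[unfolded not_le] by blast
      then obtain d where "d \<in> D" "d \<in> {w. K * N w < g x \<bullet> w}" using D(2)[OF o] by blast
      then show False using x xV by blast
    qed
  qed
qed

section \<open>Classical derivatives are weak ones\<close>

text \<open>
  Gluing over the open cover by \<open>V\<close> and the complement of \<open>K\<close>.
\<close>

lemma continuous_on_zero_extension:
  fixes h :: "'a::t2_space \<Rightarrow> real"
  assumes "open V" "compact K" "K \<subseteq> V" "continuous_on V h" "\<And>x. x \<in> V \<Longrightarrow> x \<notin> K \<Longrightarrow> h x = 0"
  shows "continuous_on UNIV (\<lambda>x. if x \<in> V then h x else 0)"
proof -
  let ?f = "\<lambda>x. if x \<in> V then h x else 0"
  have "open (- K)" using assms(2) by (intro open_Compl compact_imp_closed)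
  moreover have "continuous_on V ?f" using assms(4) by (rule continuous_on_eq) simp
  moreover have "continuous_on (- K) ?f" by (rule continuous_on_eq[OF continuous_on_const[of _ 0]]) (use assms(5) in auto)
  ultimately have "continuous_on (V \<union> - K) ?f" using assms(1) by (intro continuous_on_open_Un)
  moreover have "V \<union> - K = UNIV" using assms(3) by blast
  ultimately show ?thesis by simp
qed

lemma set_integral_zero_extension:
  fixes h :: "'a::euclidean_space \<Rightarrow> real"
  assumes "open V" "compact K" "K \<subseteq> V" "continuous_on V h" "\<And>x. x \<in> V \<Longrightarrow> x \<notin> K \<Longrightarrow> h x = 0" "K \<subseteq> cbox a b"
  shows "(LINT x:V|lebesgue. h x) = integral (cbox a b) (\<lambda>x. if x \<in> V then h x else 0)"
proof -
  have "(LINT x:V|lebesgue. h x) = (LINT x:UNIV|lebesgue. if x \<in> V then h x else 0)"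
    unfolding set_lebesgue_integral_def by (rule arg_cong[where f = "integral\<^sup>L lebesgue"]) (auto simp: indicator_def fun_eq_iff)
  also have "\<dots> = integral (cbox a b) (\<lambda>x. if x \<in> V then h x else 0)"
  proof (rule set_integral_eq_HK)
    show "(if x \<in> V then h x else 0) = 0" if "x \<notin> cbox a b" for x using assms(5)[of x] assms(6) that by auto
    show "continuous_on (cbox a b) (\<lambda>x. if x \<in> V then h x else 0)"
      by (rule continuous_on_subset[OF continuous_on_zero_extension[OF assms(1-5)]]) auto
  qed simp
  finally show ?thesis .
qed

text \<open>
  The integral of a compactly supported function does not change under translation.
\<close>

lemma integral_partial_derivative_zero:
  fixes F G :: "real ^ 'n::finite \<Rightarrow> real"
  assumes der: "\<And>z t. ((\<lambda>t. F (z + t *\<^sub>R axis i 1)) has_real_derivative G (z + t *\<^sub>R axis i 1)) (at t within {-1..1})"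
    and cF: "continuous_on UNIV F" and cG: "continuous_on UNIV G"
    and zero: "\<And>x. x \<notin> cbox (- a) a \<Longrightarrow> F x = 0"
  shows "integral (cbox (- a - 1) (a + 1)) G = 0"
proof -
  let ?Q = "cbox (- a - 1) (a + 1)" and ?e = "axis i 1 :: real ^ 'n"
  have const: "integral ?Q (\<lambda>z. F (z + t *\<^sub>R ?e)) = integral (cbox (- a) a) F" if t: "t \<in> {-1<..<1}" for t
  proof -
    have sub: "cbox (- a) a \<subseteq> cbox (- a - 1 + t *\<^sub>R ?e) (a + 1 + t *\<^sub>R ?e)"
    proof
      fix z assume z: "z \<in> cbox (- a) a"
      have "(- a - 1 + t *\<^sub>R ?e) $ j \<le> z $ j \<and> z $ j \<le> (a + 1 + t *\<^sub>R ?e) $ j" for j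
      proof -
        have "- (a $ j) \<le> z $ j" "z $ j \<le> a $ j" using z by (auto simp: mem_box_cart)
        then show ?thesis using t by (cases "j = i") (auto simp: axis_def)
      qed
      then show "z \<in> cbox (- a - 1 + t *\<^sub>R ?e) (a + 1 + t *\<^sub>R ?e)" by (auto simp: mem_box_cart)
    qed
    have "(\<lambda>z. F (z + t *\<^sub>R ?e)) = F \<circ> (+) (t *\<^sub>R ?e)" by (auto simp: add.commute)
    then have "integral ?Q (\<lambda>z. F (z + t *\<^sub>R ?e)) = integral (cbox (- a - 1 + t *\<^sub>R ?e) (a + 1 + t *\<^sub>R ?e)) F"
      by (simp only: integral_shift_cbox_plus)
    also have "\<dots> = integral (cbox (- a) a) F"
    proof -
      have "(\<lambda>z. if z \<in> cbox (- a) a then F z else 0) = F" using zero by auto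
      then show ?thesis
        using Henstock_Kurzweil_Integration.integral_restrict_Int[of "cbox (- a - 1 + t *\<^sub>R ?e) (a + 1 + t *\<^sub>R ?e)" "cbox (- a) a" F] sub
        by (simp add: Int_absorb2)
    qed
    finally show ?thesis .
  qed
  have leib: "((\<lambda>t. integral ?Q (\<lambda>z. F (z + t *\<^sub>R ?e))) has_real_derivative integral ?Q (\<lambda>z. G (z + 0 *\<^sub>R ?e))) (at 0 within {-1..1})"
  proof (rule leibniz_rule_field_derivative[of "{-1..1}" "- a - 1" "a + 1" "\<lambda>t z. F (z + t *\<^sub>R ?e)" "\<lambda>t z. G (z + t *\<^sub>R ?e)"])
    show "((\<lambda>t. F (z + t *\<^sub>R ?e)) has_field_derivative G (z + t *\<^sub>R ?e)) (at t within {-1..1})" for t z by (rule der)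
    show "(\<lambda>z. F (z + t *\<^sub>R ?e)) integrable_on ?Q" for t
      by (intro integrable_continuous continuous_on_compose2[OF cF] continuous_intros) auto
    have "continuous_on ({-1..1} \<times> ?Q) (\<lambda>p. G (snd p + fst p *\<^sub>R ?e))"
      by (intro continuous_on_compose2[OF cG] continuous_intros) auto
    then show "continuous_on ({-1..1} \<times> ?Q) (\<lambda>(t, z). G (z + t *\<^sub>R ?e))" by (simp add: split_beta)
  qed auto
  have "at (0::real) within {-1..1} = at 0" by (rule at_within_interior) (simp add: interior_atLeastAtMost_real)
  with leib have "((\<lambda>t. integral ?Q (\<lambda>z. F (z + t *\<^sub>R ?e))) has_real_derivative integral ?Q G) (at 0)" by simp
  then have "((\<lambda>t. integral (cbox (- a) a) F) has_real_derivative integral ?Q G) (at (0::real))"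
    by (rule has_field_derivative_transform_within_open[of _ _ _ "{-1<..<1}"]) (use const in auto)
  then show ?thesis using DERIV_unique[OF _ DERIV_const] by blast
qed

lemma test_functionD:
  fixes \<phi> :: "real ^ 'n::finite \<Rightarrow> real"
  assumes "test_function V \<phi>"
  shows "(\<phi> has_derivative (\<lambda>h. grad \<phi> x \<bullet> h)) (at x)" "continuous_on S \<phi>" "continuous_on S (partial_deriv i \<phi>)"
    "compact (closure {x. \<phi> x \<noteq> 0})" "closure {x. \<phi> x \<noteq> 0} \<subseteq> V"
    "x \<notin> closure {x. \<phi> x \<noteq> 0} \<Longrightarrow> \<phi> x = 0 \<and> partial_deriv i \<phi> x = 0"
proof -
  have C: "C_k_on k \<phi> UNIV" for k using assms by (simp add: test_function_def)
  show "(\<phi> has_derivative (\<lambda>h. grad \<phi> x \<bullet> h)) (at x)" using C[of "Suc 0"] by (intro grad_has_derivative) simp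
  show "continuous_on S \<phi>" using C[of 0] continuous_on_subset[of UNIV \<phi> S] by simp
  show "continuous_on S (partial_deriv i \<phi>)" using C[of "Suc 0"] continuous_on_subset[of UNIV "partial_deriv i \<phi>" S] by simp
  show "compact (closure {x. \<phi> x \<noteq> 0})" "closure {x. \<phi> x \<noteq> 0} \<subseteq> V"
    using assms by (auto simp: test_function_def compactly_inside_def)
  assume x: "x \<notin> closure {x. \<phi> x \<noteq> 0}"
  have z: "\<phi> y = 0" if "y \<in> - closure {x. \<phi> x \<noteq> 0}" for y using that closure_subset[of "{x. \<phi> x \<noteq> 0}"] by auto
  have "((\<lambda>x. 0) has_derivative (\<lambda>h. 0 \<bullet> h)) (at x)" by simp
  then have "(\<phi> has_derivative (\<lambda>h. 0 \<bullet> h)) (at x)"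
  proof (rule has_derivative_transform_within_open[of _ _ _ _ "- closure {x. \<phi> x \<noteq> 0}"])
    show "x \<in> - closure {x. \<phi> x \<noteq> 0}" unfolding Compl_iff by (rule x)
    show "0 = \<phi> y" if "y \<in> - closure {x. \<phi> x \<noteq> 0}" for y using z[OF that] by (rule sym)
  qed (rule open_Compl[OF closed_closure])
  then have "partial_deriv i \<phi> x = 0 $ i" by (rule partial_deriv_eqI)
  then show "\<phi> x = 0 \<and> partial_deriv i \<phi> x = 0" using z[OF iffD2[OF Compl_iff x]] by (simp only: zero_index)
qed

text \<open>
  Integration by parts: the product with a test function, extended by zero, is continuously
  differentiable on the whole space and has compact support.
\<close>

lemma classical_weak_gradient:
  fixes v :: "real ^ 'n::finite \<Rightarrow> real"
  assumes V: "open V" and der: "\<And>x. x \<in> V \<Longrightarrow> (v has_derivative (\<lambda>h. D x \<bullet> h)) (at x)" and cD: "continuous_on V D"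
  shows "is_weak_gradient V v D"
  unfolding is_weak_gradient_def
proof (intro conjI allI impI)
  have cv: "continuous_on V v" using der has_derivative_continuous by (blast intro: continuous_at_imp_continuous_on)
  show "locally_integrable_on v V" "locally_integrable_on D V" unfolding locally_integrable_on_def
    using set_integrable_compact continuous_on_subset[OF cv] continuous_on_subset[OF cD] by blast+
  fix \<phi> i assume test: "test_function V \<phi>"
  define K where "K = closure {x. \<phi> x \<noteq> 0}"
  note T = test_functionD[OF test, folded K_def]
  let ?h1 = "\<lambda>x. v x * partial_deriv i \<phi> x" and ?h2 = "\<lambda>x. D x $ i * \<phi> x" and ?h0 = "\<lambda>x. v x * \<phi> x"
  have c: "continuous_on V ?h1" "continuous_on V ?h2" "continuous_on V ?h0"
    by (intro continuous_intros cv cD T(2,3))+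
  have z: "?h1 x = 0" "?h2 x = 0" "?h0 x = 0" if "x \<notin> K" for x using T(6)[OF that] by auto
  let ?E = "\<lambda>h x. if x \<in> V then h x else 0"
  note cE = continuous_on_zero_extension[OF V T(4,5)]
  obtain a where a: "K \<subseteq> cbox (- a) a" using bounded_subset_cbox_symmetric[OF compact_imp_bounded[OF T(4)]] by blast
  let ?Q = "cbox (- a - 1) (a + 1)"
  have "cbox (- a) a \<subseteq> ?Q"
  proof
    fix z assume "z \<in> cbox (- a) a"
    then have "- (a $ j) \<le> z $ j \<and> z $ j \<le> a $ j" for j by (auto simp: mem_box_cart)
    then have "- (a $ j) - 1 \<le> z $ j \<and> z $ j \<le> a $ j + 1" for j using add_increasing2[of 1 "z $ j" "a $ j"] by (smt (verit))
    then show "z \<in> ?Q" by (auto simp: mem_box_cart)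
  qed
  then have KQ: "K \<subseteq> ?Q" using a by blast
  define G where "G x = ?E ?h1 x + ?E ?h2 x" for x
  have cG: "continuous_on UNIV G" unfolding G_def using cE[OF c(1) z(1)] cE[OF c(2) z(2)] by (intro continuous_on_add)
  have dF: "(?E ?h0 has_derivative (\<lambda>h. (if x \<in> V then v x *\<^sub>R grad \<phi> x + \<phi> x *\<^sub>R D x else 0) \<bullet> h)) (at x)" for x
  proof (cases "x \<in> V")
    case True
    have "(?h0 has_derivative (\<lambda>h. v x * (grad \<phi> x \<bullet> h) + (D x \<bullet> h) * \<phi> x)) (at x)"
      by (rule has_derivative_mult[OF der[OF True] T(1)])
    moreover have "(\<lambda>h. v x * (grad \<phi> x \<bullet> h) + (D x \<bullet> h) * \<phi> x) = (\<lambda>h. (v x *\<^sub>R grad \<phi> x + \<phi> x *\<^sub>R D x) \<bullet> h)"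
      by (simp add: inner_add_left mult.commute)
    ultimately have "(?h0 has_derivative (\<lambda>h. (v x *\<^sub>R grad \<phi> x + \<phi> x *\<^sub>R D x) \<bullet> h)) (at x)" by simp
    then have "(?E ?h0 has_derivative (\<lambda>h. (v x *\<^sub>R grad \<phi> x + \<phi> x *\<^sub>R D x) \<bullet> h)) (at x)"
      by (rule has_derivative_transform_within_open[OF _ V True]) simp
    then show ?thesis using True by simp
  next
    case False
    have "((\<lambda>x. 0) has_derivative (\<lambda>h. 0 \<bullet> h)) (at x)" by simp
    then have "(?E ?h0 has_derivative (\<lambda>h. 0 \<bullet> h)) (at x)"
      by (rule has_derivative_transform_within_open[of _ _ _ _ "- K"]) (use False T(5) z(3) open_Compl[OF compact_imp_closed[OF T(4)]] in auto)
    then show ?thesis using False by simp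
  qed
  have Gi: "(if x \<in> V then v x *\<^sub>R grad \<phi> x + \<phi> x *\<^sub>R D x else 0) \<bullet> axis i 1 = G x" for x
    by (simp add: G_def inner_axis grad_def mult.commute)
  have "integral ?Q G = 0"
  proof (rule integral_partial_derivative_zero[where F = "?E ?h0" and i = i])
    fix z t
    have "((\<lambda>t. ?E ?h0 (z + t *\<^sub>R axis i 1)) has_derivative
        (\<lambda>h. (if z + t *\<^sub>R axis i 1 \<in> V then v (z + t *\<^sub>R axis i 1) *\<^sub>R grad \<phi> (z + t *\<^sub>R axis i 1) + \<phi> (z + t *\<^sub>R axis i 1) *\<^sub>R D (z + t *\<^sub>R axis i 1) else 0) \<bullet> (h *\<^sub>R axis i 1)))
        (at t within {-1..1})"
    proof (rule has_derivative_compose[of "\<lambda>t. z + t *\<^sub>R axis i 1" "\<lambda>h. h *\<^sub>R axis i 1", OF _ dF])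
      show "((\<lambda>t. z + t *\<^sub>R axis i 1) has_derivative (\<lambda>h. h *\<^sub>R axis i 1)) (at t within {-1..1})" by (auto intro!: derivative_eq_intros)
    qed
    then show "((\<lambda>t. ?E ?h0 (z + t *\<^sub>R axis i 1)) has_real_derivative G (z + t *\<^sub>R axis i 1)) (at t within {-1..1})"
      unfolding inner_scaleR_right Gi by (rule has_derivative_imp_has_field_derivative) simp
  next
    show "continuous_on UNIV (?E ?h0)" by (rule cE[OF c(3) z(3)])
    show "continuous_on UNIV G" by (rule cG)
    show "?E ?h0 x = 0" if "x \<notin> cbox (- a) a" for x using z(3)[of x] a that by auto
  qed
  moreover have "integral ?Q G = integral ?Q (?E ?h1) + integral ?Q (?E ?h2)" unfolding G_def
    by (intro Henstock_Kurzweil_Integration.integral_add integrable_continuous continuous_on_subset[OF cE[OF c(1) z(1)]] continuous_on_subset[OF cE[OF c(2) z(2)]]) auto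
  ultimately have "integral ?Q (?E ?h1) = - integral ?Q (?E ?h2)" by linarith
  then show "(LINT x:V|lebesgue. ?h1 x) = - (LINT x:V|lebesgue. ?h2 x)"
    using set_integral_zero_extension[OF V T(4,5) c(1) z(1) KQ] set_integral_zero_extension[OF V T(4,5) c(2) z(2) KQ] by simp
qed

section \<open>Essential suprema\<close>

lemma ess_sup_on_le:
  assumes "S \<in> sets lebesgue" "f \<in> borel_measurable (lebesgue_on S)" "AE x in lebesgue. x \<in> S \<longrightarrow> f x \<le> c"
  shows "ess_sup_on S f \<le> ereal c"
  unfolding ess_sup_on_def
proof (rule esssup_I)
  show "(\<lambda>x. ereal (f x)) \<in> borel_measurable (lebesgue_on S)" using assms(2) by simp
  show "AE x in lebesgue_on S. ereal (f x) \<le> ereal c" using assms by (simp add: AE_restrict_space_iff)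
qed

lemma ess_sup_on_leD:
  assumes "S \<in> sets lebesgue" "ess_sup_on S f \<le> ereal c"
  shows "AE x in lebesgue. x \<in> S \<longrightarrow> f x \<le> c"
proof -
  have "AE x in lebesgue_on S. ereal (f x) \<le> ess_sup_on S f" unfolding ess_sup_on_def by (rule esssup_AE)
  then have "AE x in lebesgue_on S. f x \<le> c" by eventually_elim (metis assms(2) ereal_less_eq(3) order_trans)
  then show ?thesis using assms(1) by (simp add: AE_restrict_space_iff)
qed

lemma continuous_Linf_loc:
  fixes f :: "'a::euclidean_space \<Rightarrow> 'b::euclidean_space"
  assumes "open V" "continuous_on V f"
  shows "Linf_loc V f"
  unfolding Linf_loc_def
proof (intro conjI allI impI)
  show "f \<in> borel_measurable (lebesgue_on V)"
    by (rule continuous_imp_measurable_on_sets_lebesgue) (use assms in auto)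
  fix K assume K: "compact K \<and> K \<subseteq> V"
  have cK: "continuous_on K f" using continuous_on_subset assms(2) K by blast
  have Ks: "K \<in> sets lebesgue" using K by (simp add: lmeasurable_compact fmeasurableD)
  obtain B where B: "\<And>x. x \<in> K \<Longrightarrow> norm (f x) \<le> B"
    using compact_imp_bounded[OF compact_continuous_image[OF cK]] K by (auto simp: bounded_iff)
  have "ess_sup_on K (\<lambda>x. norm (f x)) \<le> ereal B"
  proof (rule ess_sup_on_le[OF Ks])
    show "(\<lambda>x. norm (f x)) \<in> borel_measurable (lebesgue_on K)"
      by (rule continuous_imp_measurable_on_sets_lebesgue[OF continuous_on_norm[OF cK] Ks])
  qed (use B in simp)
  then show "Linf_norm K f < \<infinity>" unfolding Linf_norm_def using le_less_trans[of _ "ereal B" \<infinity>] by simp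
qed

lemma weak_gradient_is_weak_gradient:
  assumes "W1inf_loc \<Omega> u"
  shows "is_weak_gradient \<Omega> u (weak_gradient \<Omega> u)"
proof -
  obtain g where "is_weak_gradient \<Omega> u g" using assms by (auto simp: W1inf_loc_def)
  then show ?thesis unfolding weak_gradient_def by (rule someI[of "is_weak_gradient \<Omega> u"])
qed

section \<open>Absolute minimizers enjoy comparison with cones and planes\<close>

text \<open>
  Duality, in the form that links gradient bounds to Lipschitz bounds.
\<close>

lemma (in strict_norm) H_le_iff: "H p \<le> K \<longleftrightarrow> (\<forall>w. p \<bullet> w \<le> K * L w)"
proof
  assume "H p \<le> K"
  then have "H p * L w \<le> K * L w" for w by (intro mult_right_mono) auto
  then show "\<forall>w. p \<bullet> w \<le> K * L w" using inner_le order_trans by blast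
next
  assume a: "\<forall>w. p \<bullet> w \<le> K * L w"
  obtain v where "L v = 1" "p \<bullet> v = H p" using primal_attained by blast
  then show "H p \<le> K" using a[rule_format, of v] by simp
qed

lemma (in strict_norm) H_measurable:
  assumes "g \<in> borel_measurable M"
  shows "(\<lambda>x. H (g x)) \<in> borel_measurable M"
  using measurable_compose[OF assms borel_measurable_continuous_onI[OF H.continuous_on]] .

lemma weak_gradient_measurable:
  assumes "is_weak_gradient \<Omega> u g" "open V" "V \<subseteq> \<Omega>"
  shows "g \<in> borel_measurable (lebesgue_on V)"
proof (rule locally_integrable_measurable[OF assms(2)])
  show "locally_integrable_on g V" using weak_gradientD(1)[OF assms(1)] assms(3) unfolding locally_integrable_on_def by blast
qed

lemma ess_sup_gradient_le:
  fixes H :: "real ^ 'n::finite \<Rightarrow> real"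
  assumes sn: "strict_norm H" and weak: "is_weak_gradient \<Omega> u g" and V: "open V" "V \<subseteq> \<Omega>" and cu: "continuous_on V u"
    and lip: "\<And>x. x \<in> V \<Longrightarrow> \<exists>\<delta>>0. \<forall>y\<in>ball x \<delta>. \<forall>z\<in>ball x \<delta>. u z - u y \<le> K * strict_norm.L H (z - y)"
  shows "ess_sup_on V (\<lambda>x. H (g x)) \<le> ereal K"
proof -
  interpret strict_norm H by (rule sn)
  have nf: "norm_fun L" by unfold_locales
  have "AE x in lebesgue. x \<in> V \<longrightarrow> H (g x) \<le> K"
    using Lipschitz_imp_weak_bound[OF weak V cu nf lip] by (simp add: H_le_iff)
  then show ?thesis
    by (intro ess_sup_on_le H_measurable weak_gradient_measurable[OF weak V]) (use V(1) in auto)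
qed

lemma ess_sup_gradient_leD:
  fixes H :: "real ^ 'n::finite \<Rightarrow> real"
  assumes sn: "strict_norm H" and weak: "is_weak_gradient \<Omega> u g" and V: "open V" "V \<subseteq> \<Omega>" and cu: "continuous_on V u"
    and le: "ess_sup_on V (\<lambda>x. H (g x)) \<le> ereal K" and x: "x \<in> V"
  shows "\<exists>\<delta>>0. ball x \<delta> \<subseteq> V \<and> (\<forall>y\<in>ball x \<delta>. \<forall>z\<in>ball x \<delta>. u z - u y \<le> K * strict_norm.L H (z - y))"
proof -
  interpret strict_norm H by (rule sn)
  have "AE x in lebesgue. x \<in> V \<longrightarrow> H (g x) \<le> K" by (rule ess_sup_on_leD[OF _ le]) (use V(1) in simp)
  then have "AE x in lebesgue. x \<in> V \<longrightarrow> (\<forall>w. g x \<bullet> w \<le> K * L w)" by (simp add: H_le_iff)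
  from weak_bound_imp_Lipschitz[OF weak V cu this x] show ?thesis .
qed

lemma (in norm_fun) gradient_bound_imp_Lipschitz:
  assumes V: "open V" and der: "\<And>x. x \<in> V \<Longrightarrow> (v has_derivative (\<lambda>h. D x \<bullet> h)) (at x)"
    and D: "\<And>x w. x \<in> V \<Longrightarrow> D x \<bullet> w \<le> K * N w" and x: "x \<in> V"
  shows "\<exists>\<delta>>0. \<forall>y\<in>ball x \<delta>. \<forall>z\<in>ball x \<delta>. v z - v y \<le> K * N (z - y)"
proof -
  obtain \<delta> where \<delta>: "\<delta> > 0" "ball x \<delta> \<subseteq> V" using V x open_contains_ball by blast
  have "v z - v y \<le> K * N (z - y)" if yz: "y \<in> ball x \<delta>" "z \<in> ball x \<delta>" for y z
  proof -
    let ?p = "\<lambda>t. y + t *\<^sub>R (z - y)"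
    have inV: "?p t \<in> V" if t: "t \<in> {0..1}" for t
    proof -
      have "(1 - t) *\<^sub>R y + t *\<^sub>R z \<in> ball x \<delta>" using convexD[OF convex_ball yz, of "1 - t" t] t by simp
      moreover have "(1 - t) *\<^sub>R y + t *\<^sub>R z = ?p t" by (simp add: algebra_simps)
      ultimately show ?thesis using \<delta>(2) by auto
    qed
    have "\<exists>t\<in>{0<..<1}. v (?p 1) - v (?p 0) = D (?p t) \<bullet> ((1 - 0) *\<^sub>R (z - y))"
    proof (rule mvt_simple[OF zero_less_one])
      fix t :: real assume t: "0 \<le> t" "t \<le> 1"
      show "((\<lambda>t. v (?p t)) has_derivative (\<lambda>h. D (?p t) \<bullet> (h *\<^sub>R (z - y)))) (at t within {0..1})"
      proof (rule has_derivative_compose[of "?p" "\<lambda>h. h *\<^sub>R (z - y)", OF _ der])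
        show "(?p has_derivative (\<lambda>h. h *\<^sub>R (z - y))) (at t within {0..1})" by (auto intro!: derivative_eq_intros)
        show "?p t \<in> V" using t by (intro inV) simp
      qed
    qed
    then obtain t where t: "t \<in> {0<..<1}" "v z - v y = D (?p t) \<bullet> (z - y)" by auto
    have "t \<in> {0..1}" using t(1) by simp
    then show ?thesis unfolding t(2) by (intro D inV)
  qed
  then show ?thesis using \<delta>(1) by blast
qed

text \<open>
  Minimality bounds the essential supremum for \<open>u\<close> by that for the competitor
  \<open>v\<close>, and both are Lipschitz constants.
\<close>

lemma AM_Lipschitz_of_competitor:
  fixes H :: "real ^ 'n::finite \<Rightarrow> real"
  assumes sn: "strict_norm H" and u: "u \<in> AM H \<Omega>" and V: "open V" "V \<Subset> \<Omega>"
    and der: "\<And>x. x \<in> V \<Longrightarrow> (v has_derivative (\<lambda>h. D x \<bullet> h)) (at x)" and cD: "continuous_on V D"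
    and K: "\<And>x. x \<in> V \<Longrightarrow> H (D x) \<le> K" and cv: "continuous_on (closure V) v"
    and fr: "\<And>x. x \<in> frontier V \<Longrightarrow> v x = u x" and x: "x \<in> V"
  shows "\<exists>\<delta>>0. \<forall>y\<in>ball x \<delta>. \<forall>z\<in>ball x \<delta>. u z - u y \<le> K * strict_norm.L H (z - y)"
proof -
  interpret strict_norm H by (rule sn)
  have VO: "V \<subseteq> \<Omega>" using V(2) closure_subset by (auto simp: compactly_inside_def)
  have W: "W1inf_loc \<Omega> u" "continuous_on \<Omega> u"
    and min: "W1inf_loc V v \<Longrightarrow> ess_sup_on V (\<lambda>x. H (weak_gradient \<Omega> u x)) \<le> ess_sup_on V (\<lambda>x. H (weak_gradient V v x))"
    using u V cv fr by (auto simp: AM_def)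
  have cvV: "continuous_on V v" by (rule continuous_on_subset[OF cv closure_subset])
  have "is_weak_gradient V v D" by (rule classical_weak_gradient[OF V(1) _ cD]) (rule der)
  then have Wv: "W1inf_loc V v"
    unfolding W1inf_loc_def using continuous_Linf_loc[OF V(1) cvV] continuous_Linf_loc[OF V(1) cD] by (intro conjI exI[of _ D])
  have "ess_sup_on V (\<lambda>x. H (weak_gradient V v x)) \<le> ereal K"
  proof (rule ess_sup_gradient_le[OF sn weak_gradient_is_weak_gradient[OF Wv] V(1) subset_refl cvV])
    fix x assume x: "x \<in> V"
    have KL: "D y \<bullet> w \<le> K * L w" if "y \<in> V" for y w
      using inner_le[of "D y" w] mult_right_mono[OF K[OF that] L.nonneg[of w]] by linarith
    show "\<exists>\<delta>>0. \<forall>y\<in>ball x \<delta>. \<forall>z\<in>ball x \<delta>. v z - v y \<le> K * L (z - y)"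
      by (rule L.gradient_bound_imp_Lipschitz[OF V(1) der KL x])
  qed
  then have "ess_sup_on V (\<lambda>x. H (weak_gradient \<Omega> u x)) \<le> ereal K" using min[OF Wv] by (rule order_trans[rotated])
  from ess_sup_gradient_leD[OF sn weak_gradient_is_weak_gradient[OF W(1)] V(1) VO continuous_on_subset[OF W(2) VO] this x]
  show ?thesis by blast
qed

lemma (in norm_fun) half_open_segment_increment:
  assumes cu: "continuous_on (closure V) u" and lip: "\<And>x. x \<in> V \<Longrightarrow> \<exists>\<delta>>0. \<forall>y\<in>ball x \<delta>. \<forall>z\<in>ball x \<delta>. u z - u y \<le> K * N (z - y)"
    and t: "t > 0" "\<And>s. 0 \<le> s \<Longrightarrow> s < t \<Longrightarrow> x + s *\<^sub>R d \<in> V"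
  shows "\<bar>u (x + t *\<^sub>R d) - u x\<bar> \<le> K * (t * N d)"
proof -
  let ?p = "\<lambda>s. x + s *\<^sub>R d"
  have cp: "continuous_on UNIV ?p" by (intro continuous_intros)
  have clos: "?p s \<in> closure V" if s: "s \<in> {0..t}" for s
  proof -
    have "?p ` closure {0..<t} \<subseteq> closure V"
    proof (rule image_closure_subset)
      show "continuous_on (closure {0..<t}) ?p" by (intro continuous_intros)
      show "?p ` {0..<t} \<subseteq> closure V" using t(2) closure_subset[of V] by auto
    qed simp
    moreover have "closure {0..<t} = {0..t}" using t(1) by simp
    ultimately show ?thesis using s by blast
  qed
  have cs: "continuous_on {0..t} (\<lambda>s. u (?p s))" by (rule continuous_on_compose2[OF cu continuous_on_subset[OF cp]]) (use clos in auto)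
  have le: "\<bar>u (?p s) - u x\<bar> \<le> K * (s * N d)" if s: "s \<in> {0..<t}" for s
  proof -
    have seg: "closed_segment x (?p s) \<subseteq> V"
    proof
      fix w assume "w \<in> closed_segment x (?p s)"
      then obtain r where r: "0 \<le> r" "r \<le> 1" "w = (1 - r) *\<^sub>R x + r *\<^sub>R ?p s" by (auto simp: closed_segment_def)
      have "w = ?p (r * s)" by (simp add: r(3) algebra_simps)
      moreover have "r * s \<le> 1 * s" using r s by (intro mult_right_mono) auto
      ultimately show "w \<in> V" using t(2)[of "r * s"] r s by auto
    qed
    have "u (?p s) - u x \<le> K * N (?p s - x)" by (rule segment_increment) (use seg lip in blast)
    moreover have "u x - u (?p s) \<le> K * N (x - ?p s)" by (rule segment_increment) (use seg lip closed_segment_commute in blast)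
    moreover have "N (?p s - x) = s * N d" "N (x - ?p s) = s * N d" using s by (simp_all add: scale)
    ultimately show ?thesis by (simp add: abs_le_iff)
  qed
  have "\<bar>u (?p t) - u x\<bar> - K * (t * N d) \<le> 0"
  proof (rule continuous_le_on_closure[of "{0..<t}" "\<lambda>s. \<bar>u (?p s) - u x\<bar> - K * (s * N d)"])
    have "closure {0..<t} = {0..t}" using t(1) by simp
    then show "continuous_on (closure {0..<t}) (\<lambda>s. \<bar>u (?p s) - u x\<bar> - K * (s * N d))" "t \<in> closure {0..<t}"
      using t(1) by (auto intro!: continuous_intros cs)
  qed (use le in force)
  then show ?thesis by simp
qed

text \<open>
  For the cone, the segment through \<open>x\<close> runs along the ray from the vertex: since the
  vertex is not in \<open>V\<close>, the ray meets the boundary on both sides of \<open>x\<close>. For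
  the affine function, it runs in a direction in which \<open>p\<close> attains its norm. At both ends
  \<open>u\<close> equals the competitor, whose increment between them is the largest that the Lipschitz
  bound allows, so \<open>u\<close> has to follow it in between.
\<close>

lemma AM_comparison:
  fixes H :: "real ^ 'n::finite \<Rightarrow> real"
  assumes sn: "strict_norm H" and \<Omega>: "open \<Omega>" and u: "u \<in> AM H \<Omega>"
  shows "comparison H \<Omega> u"
proof -
  interpret strict_norm H by (rule sn)
  have cu: "continuous_on \<Omega> u" using u by (simp add: AM_def)
  show ?thesis
  proof unfold_locales
    show "open \<Omega>" "continuous_on \<Omega> u" by fact+
    fix V :: "(real ^ 'n) set" and x and c :: real
    have bdd: "bounded V" and cuV: "continuous_on (closure V) u" if "V \<Subset> \<Omega>"
      using that bounded_subset[OF compact_imp_bounded closure_subset[of V]] continuous_on_subset[OF cu]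
      by (auto simp: compactly_inside_def)
    { fix z b assume V: "open V" "V \<Subset> \<Omega>" "z \<notin> V" "x \<in> V"
        and fr: "\<And>x. x \<in> frontier V \<Longrightarrow> u x = c + b * L (x - z)"
      let ?v = "\<lambda>y. c + b * L (y - z)"
      have xz: "x - z \<noteq> 0" using V by auto
      have lip: "\<exists>\<delta>>0. \<forall>y\<in>ball y0 \<delta>. \<forall>z\<in>ball y0 \<delta>. u z - u y \<le> \<bar>b\<bar> * L (z - y)" if y0: "y0 \<in> V" for y0
      proof (rule AM_Lipschitz_of_competitor[OF sn u V(1,2), where v = ?v and D = "\<lambda>y. b *\<^sub>R J (y - z)"])
        fix y assume "y \<in> V"
        then have yz: "y - z \<noteq> 0" using V(3) by auto
        have "((\<lambda>y. L (y - z)) has_derivative (\<lambda>h. J (y - z) \<bullet> h)) (at y)"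
          by (rule has_derivative_compose[of "\<lambda>y. y - z" "\<lambda>h. h", OF _ L_has_derivative[OF yz]]) (auto intro!: derivative_eq_intros)
        from has_derivative_add[OF has_derivative_const[of c] has_derivative_mult_right[OF this, of b]]
        show "(?v has_derivative (\<lambda>h. (b *\<^sub>R J (y - z)) \<bullet> h)) (at y)" by simp
        show "H (b *\<^sub>R J (y - z)) \<le> \<bar>b\<bar>" using H_J[OF yz] by (simp add: H.scale)
      next
        have "continuous_on V (\<lambda>y. J (y - z))"
          by (rule continuous_on_compose2[OF continuous_on_J]) (use V(3) in \<open>auto intro!: continuous_intros\<close>)
        then show "continuous_on V (\<lambda>y. b *\<^sub>R J (y - z))" by (intro continuous_intros)
        show "continuous_on (closure V) ?v" by (intro continuous_intros)
      qed (use fr y0 in auto)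
      have int: "x \<in> interior V" using V by (simp add: interior_open)
      obtain t2 where t2: "t2 > 0" "x + t2 *\<^sub>R (x - z) \<in> frontier V" "\<And>s. 0 \<le> s \<Longrightarrow> s < t2 \<Longrightarrow> x + s *\<^sub>R (x - z) \<in> interior V"
        using ray_to_frontier[OF bdd[OF V(2)] int xz] by blast
      have zx: "z - x \<noteq> 0" using xz by auto
      obtain t1 where t1: "t1 > 0" "x + t1 *\<^sub>R (z - x) \<in> frontier V" "\<And>s. 0 \<le> s \<Longrightarrow> s < t1 \<Longrightarrow> x + s *\<^sub>R (z - x) \<in> interior V"
        using ray_to_frontier[OF bdd[OF V(2)] int zx] by blast
      have t1': "t1 \<le> 1" using t1(3)[of 1] V(3) interior_subset[of V] by force
      have "\<bar>u (x + t2 *\<^sub>R (x - z)) - u x\<bar> \<le> \<bar>b\<bar> * (t2 * L (x - z))"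
        by (rule L.half_open_segment_increment[OF cuV[OF V(2)] lip t2(1)]) (use t2(3) interior_subset in auto)
      moreover have "\<bar>u (x + t1 *\<^sub>R (z - x)) - u x\<bar> \<le> \<bar>b\<bar> * (t1 * L (z - x))"
        by (rule L.half_open_segment_increment[OF cuV[OF V(2)] lip t1(1)]) (use t1(3) interior_subset in auto)
      moreover have "u (x + t2 *\<^sub>R (x - z)) = c + b * ((1 + t2) * L (x - z))"
      proof -
        have e: "x + t2 *\<^sub>R (x - z) - z = (1 + t2) *\<^sub>R (x - z)" by (simp add: algebra_simps)
        have "L (x + t2 *\<^sub>R (x - z) - z) = (1 + t2) * L (x - z)" unfolding e L.scale using t2(1) by simp
        then show ?thesis unfolding fr[OF t2(2)] by (simp only:)
      qed
      moreover have "u (x + t1 *\<^sub>R (z - x)) = c + b * ((1 - t1) * L (x - z))"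
      proof -
        have e: "x + t1 *\<^sub>R (z - x) - z = (1 - t1) *\<^sub>R (x - z)" by (simp add: algebra_simps)
        have "L (x + t1 *\<^sub>R (z - x) - z) = (1 - t1) * L (x - z)" unfolding e L.scale using t1' by simp
        then show ?thesis unfolding fr[OF t1(2)] by (simp only:)
      qed
      ultimately have "\<bar>c + b * L (x - z) + b * (t2 * L (x - z)) - u x\<bar> \<le> \<bar>b\<bar> * (t2 * L (x - z))"
        "\<bar>c + b * L (x - z) - b * (t1 * L (x - z)) - u x\<bar> \<le> \<bar>b\<bar> * (t1 * L (x - z))"
        by (simp_all add: algebra_simps L.diff_comm[of z x])
      then show "u x = c + b * L (x - z)" by (cases "b \<ge> 0") (simp_all add: abs_le_iff) }
    { fix p assume V: "open V" "V \<Subset> \<Omega>" "x \<in> V"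
        and fr: "\<And>x. x \<in> frontier V \<Longrightarrow> u x = c + p \<bullet> x"
      let ?v = "\<lambda>y. c + p \<bullet> y"
      have lip: "\<exists>\<delta>>0. \<forall>y\<in>ball y0 \<delta>. \<forall>z\<in>ball y0 \<delta>. u z - u y \<le> H p * L (z - y)" if y0: "y0 \<in> V" for y0
      proof (rule AM_Lipschitz_of_competitor[OF sn u V(1,2), where v = ?v and D = "\<lambda>y. p"])
        show "(?v has_derivative (\<lambda>h. p \<bullet> h)) (at y)" for y by (auto intro!: derivative_eq_intros)
        show "continuous_on (closure V) ?v" by (intro continuous_intros)
      qed (use fr y0 in auto)
      obtain d where d: "L d = 1" "p \<bullet> d = H p" using primal_attained by blast
      have d0: "d \<noteq> 0" "- d \<noteq> 0" using d(1) by auto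
      have int: "x \<in> interior V" using V by (simp add: interior_open)
      obtain t2 where t2: "t2 > 0" "x + t2 *\<^sub>R d \<in> frontier V" "\<And>s. 0 \<le> s \<Longrightarrow> s < t2 \<Longrightarrow> x + s *\<^sub>R d \<in> interior V"
        using ray_to_frontier[OF bdd[OF V(2)] int d0(1)] by blast
      obtain t1 where t1: "t1 > 0" "x + t1 *\<^sub>R (- d) \<in> frontier V" "\<And>s. 0 \<le> s \<Longrightarrow> s < t1 \<Longrightarrow> x + s *\<^sub>R (- d) \<in> interior V"
        using ray_to_frontier[OF bdd[OF V(2)] int d0(2)] by blast
      have "\<bar>u (x + t2 *\<^sub>R d) - u x\<bar> \<le> H p * (t2 * L d)"
        by (rule L.half_open_segment_increment[OF cuV[OF V(2)] lip t2(1)]) (use t2(3) interior_subset in auto)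
      then have 2: "\<bar>c + p \<bullet> x + t2 * H p - u x\<bar> \<le> H p * t2" using fr[OF t2(2)] d by (simp add: inner_add_right)
      have "\<bar>u (x + t1 *\<^sub>R (- d)) - u x\<bar> \<le> H p * (t1 * L (- d))"
        by (rule L.half_open_segment_increment[OF cuV[OF V(2)] lip t1(1)]) (use t1(3) interior_subset in auto)
      then have 1: "\<bar>c + p \<bullet> x - t1 * H p - u x\<bar> \<le> H p * t1" using fr[OF t1(2)] d by (simp add: inner_diff_right)
      show "u x = c + p \<bullet> x" using 1 2 by (simp add: abs_le_iff mult.commute) }
  qed
qed

section \<open>The supremum norm of the gradient near a point\<close>

text \<open>
  Both inequalities translate between a bound on the essential supremum and a local Lipschitz constant.
\<close>

lemma gradient_norm_limit:
  fixes H :: "real ^ 'n::finite \<Rightarrow> real"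
  assumes cm: "comparison H \<Omega> u" and weak: "is_weak_gradient \<Omega> u g" and x: "x \<in> \<Omega>"
  shows "((\<lambda>r. Linf_norm (ball x r) (\<lambda>y. H (g y))) \<longlongrightarrow> ereal (lslope (strict_norm.L H) \<Omega> u x)) (at_right 0)"
proof -
  interpret comparison H \<Omega> u by (rule cm)
  have sn: "strict_norm H" by unfold_locales
  have eq: "Linf_norm A (\<lambda>y. H (g y)) = ess_sup_on A (\<lambda>y. H (g y))" for A by (simp add: Linf_norm_def)
  obtain R where R: "R > 0" "ball x R \<subseteq> \<Omega>" using open_\<Omega> x open_contains_ball by blast
  show ?thesis unfolding eq
  proof (rule order_tendstoI)
    fix a assume a: "a < ereal (S x)"
    have "a < ess_sup_on (ball x r) (\<lambda>y. H (g y))" if r: "r \<in> {0<..<R}" for r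
    proof (rule ccontr)
      assume neg: "\<not> ?thesis"
      obtain K where K: "a < ereal K" "ereal K < ereal (S x)" using ereal_dense2[OF a] by blast
      have le: "ess_sup_on (ball x r) (\<lambda>y. H (g y)) \<le> ereal K" using neg K(1) by (metis le_less_trans not_less order_less_imp_le)
      have sub: "ball x r \<subseteq> \<Omega>" using r R(2) by force
      have "x \<in> ball x r" using r by simp
      from ess_sup_gradient_leD[OF sn weak open_ball sub continuous_on_subset[OF cont sub] le this]
      obtain \<delta> where \<delta>: "\<delta> > 0" "ball x \<delta> \<subseteq> ball x r" "\<forall>y\<in>ball x \<delta>. \<forall>z\<in>ball x \<delta>. u z - u y \<le> K * L (z - y)" by blast
      have "S x \<le> K" by (rule slope_le[OF \<delta>(1)]) (use \<delta> sub in auto)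
      then show False using K(2) by simp
    qed
    then show "\<forall>\<^sub>F r in at_right 0. a < ess_sup_on (ball x r) (\<lambda>y. H (g y))" by (rule eventually_at_rightI[OF _ R(1)])
  next
    fix a assume a: "ereal (S x) < a"
    obtain K where K: "ereal (S x) < ereal K" "ereal K < a" using ereal_dense2[OF a] by blast
    have "K - S x > 0" using K(1) by simp
    then obtain \<delta> where \<delta>: "\<delta> > 0" "ball x \<delta> \<subseteq> \<Omega>" "\<forall>y\<in>ball x \<delta>. \<forall>z\<in>ball x \<delta>. u z - u y \<le> (S x + (K - S x)) * L (z - y)"
      using slope_Lipschitz[OF x] by blast
    have "ess_sup_on (ball x r) (\<lambda>y. H (g y)) < a" if r: "r \<in> {0<..<\<delta>}" for r
    proof -
      have sub: "ball x r \<subseteq> \<Omega>" "ball x r \<subseteq> ball x \<delta>" using r \<delta>(2) by force+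
      have "ess_sup_on (ball x r) (\<lambda>y. H (g y)) \<le> ereal K"
      proof (rule ess_sup_gradient_le[OF sn weak open_ball sub(1) continuous_on_subset[OF cont sub(1)]])
        fix y0 assume "y0 \<in> ball x r"
        then obtain \<rho> where \<rho>: "\<rho> > 0" "ball y0 \<rho> \<subseteq> ball x r" using open_ball open_contains_ball by meson
        then have "ball y0 \<rho> \<subseteq> ball x \<delta>" using sub(2) by blast
        then show "\<exists>\<delta>>0. \<forall>y\<in>ball y0 \<delta>. \<forall>z\<in>ball y0 \<delta>. u z - u y \<le> K * L (z - y)"
          using \<delta>(3) \<rho>(1) by (intro exI[of _ \<rho>]) auto
      qed
      then show ?thesis using K(2) by (rule le_less_trans)
    qed
    then show "\<forall>\<^sub>F r in at_right 0. ess_sup_on (ball x r) (\<lambda>y. H (g y)) < a" by (rule eventually_at_rightI[OF _ \<delta>(1)])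
  qed
qed

section \<open>The theorem\<close>

theorem corollary1p3:
  fixes H :: "real ^ 'n \<Rightarrow> real"
  assumes "CARD('n) \<ge> 2"
    and "strictly_convex_norm H"
  shows "(\<forall>\<Omega> u. domain_set \<Omega> \<and> u \<in> AM H \<Omega> \<longrightarrow>
            linear_approximation_property \<Omega> u \<and>
            (\<forall>x\<in>\<Omega>. \<forall>e\<in>blow_up_slopes u x.
               ((\<lambda>r. Linf_norm (ball x r) (\<lambda>y. H (weak_gradient \<Omega> u y)))
                  \<longlongrightarrow> ereal (H e)) (at_right 0)))
       \<and> (CARD('n) = 2 \<longrightarrow>
            (\<forall>\<Omega> u. domain_set \<Omega> \<and> u \<in> AM H \<Omega> \<longrightarrow> C_k_on 1 u \<Omega>) \<and>
            (\<forall>u. u \<in> AM H UNIV \<and> (\<exists>C>0. \<forall>x. \<bar>u x\<bar> \<le> C * (1 + norm x)) \<longrightarrow>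
               (\<exists>a p. \<forall>x. u x = a + p \<bullet> x)))"
proof -
  have sn: "strict_norm H" using assms(2) by unfold_locales
  have cm: "comparison H \<Omega> u" if "open \<Omega>" "u \<in> AM H \<Omega>" for \<Omega> u
    using that by (rule AM_comparison[OF sn])
  have lap: "linear_approximation_property \<Omega> u \<and> (\<forall>x\<in>\<Omega>. \<forall>e\<in>blow_up_slopes u x.
      ((\<lambda>r. Linf_norm (ball x r) (\<lambda>y. H (weak_gradient \<Omega> u y))) \<longlongrightarrow> ereal (H e)) (at_right 0))"
    if dom: "domain_set \<Omega>" and u: "u \<in> AM H \<Omega>" for \<Omega> u
  proof (intro conjI ballI)
    have o: "open \<Omega>" using dom by (simp add: domain_set_def)
    show "linear_approximation_property \<Omega> u" by (rule comparison.has_lap[OF cm[OF o u]])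
    fix x e assume x: "x \<in> \<Omega>" and e: "e \<in> blow_up_slopes u x"
    have "W1inf_loc \<Omega> u" using u by (simp add: AM_def)
    from gradient_norm_limit[OF cm[OF o u] weak_gradient_is_weak_gradient[OF this] x]
    show "((\<lambda>r. Linf_norm (ball x r) (\<lambda>y. H (weak_gradient \<Omega> u y))) \<longlongrightarrow> ereal (H e)) (at_right 0)"
      unfolding comparison.blow_up_slope_norm[OF cm[OF o u] x e] .
  qed
  have C1: "C_k_on 1 u \<Omega>" if two: "CARD('n) = 2" and dom: "domain_set \<Omega>" and u: "u \<in> AM H \<Omega>" for \<Omega> u
  proof -
    have o: "open \<Omega>" using dom by (simp add: domain_set_def)
    show ?thesis by (rule planar_C1[OF cm[OF o u] two])
  qed
  have lin: "\<exists>a p. \<forall>x. u x = a + p \<bullet> x"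
    if two: "CARD('n) = 2" and u: "u \<in> AM H UNIV" and C: "C > 0" "\<And>x. \<bar>u x\<bar> \<le> C * (1 + norm x)" for u C
  proof -
    have "DIM(real ^ 'n) = 2" using two by simp
    from planar_Liouville[OF cm[OF open_UNIV u] this C] show ?thesis .
  qed
  show ?thesis using lap C1 lin by blast
qed

end
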